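(* Let $M$ be a smooth (purely even) manifold and $r\ge 0$ an integer. Let $J_{(r)}$ be the space of infinite jets of sections of the trivial bundle $\mathbb R^r\times M\to\mathbb R^r$, let $\Omega^*_{(r)}$ be the algebra of differential forms on $J_{(r)}$, and let $C^k\Omega^*_{(r)}$ be the $k$-th power of its Cartan ideal. Let $p_r^*:\Omega^*_{(r)}\hookrightarrow\Omega^*_{(r+1)}$ be the embedding induced by the natural projection $p_r:\mathbb R^{r+1}\times M\to\mathbb R^r\times M$. Then: 1. Under the projection $p_r$, the $k$-th power of the Cartan ideal in $\Omega^*_{(r)}$ maps to the $(k-1)$-th power of the Cartan ideal in $\Omega^*_{(r+1)}$: $$p_r^*: C^k\Omega^*_{(r)}\longrightarrow C^{k-1}\Omega^*_{(r+1)}.$$ 2. The map in part 1 induces a map of the zeroth terms of the corresponding spectral sequences, $$E^{p,q}_{(r)0}\longrightarrow E^{p-1,q+1}_{(r+1)0},\qquad E^{p,q}_{(r)0}=C^p\Omega^{p+q}_{(r)}/C^{p+1}\Omega^{p+q}_{(r)}.$$ Thus it defines a map of bicomplexes $\Omega^{**}_{(r)}\to\Omega^{**}_{(r+1)}$ of bidegree $(-1,1)$: $$\kappa_r:\Omega^{p,q}_{(r)}\longrightarrow\Omega^{p-1,q+1}_{(r+1)}.$$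
   Context: $\mathbb R^r$ has fixed standard coordinates $t^1,\dots,t^r$, and $x^a$ are local coordinates on $M$. $J_{(r)}$ is the inverse limit of the finite-order jet bundles of sections of $\mathbb R^r\times M\to\mathbb R^r$. It has local coordinates $t^i$, $x^a_\sigma$, where $\sigma=i_1\dots i_k$ runs over all symmetric multi-indices with entries in $\{1,\dots,r\}$, including the empty one ($x^a_\emptyset=x^a$). All functions and coefficients of forms are smooth and of finite order, i.e. depend on finitely many coordinates. Forms are multiplied by the wedge product, with the wedge sign omitted. The Cartan one-forms on $J_{(r)}$ are $\Gamma^a_{(r)\sigma}=dx^a_\sigma-\sum_{i=1}^r dt^i\,x^a_{i\sigma}$. The Cartan ideal $C\Omega^*_{(r)}\subset\Omega^*_{(r)}$ is the ideal generated by all the $\Gamma^a_{(r)\sigma}$; $C^k\Omega^*_{(r)}$ is its $k$-th power, with $C^k\Omega^*_{(r)}=\Omega^*_{(r)}$ for $k\le 0$, and $C^k\Omega^n_{(r)}$ is its part in form-degree $n$. The filtration of the de Rham complex $(\Omega^*_{(r)},d)$ by the $C^k\Omega^*_{(r)}$ gives a spectral sequence with zeroth term $E^{p,q}_{(r)0}=C^p\Omega^{p+q}_{(r)}/C^{p+1}\Omega^{p+q}_{(r)}$. Every form on $J_{(r)}$ can be written in terms of $t^i$, $x^a_\sigma$, $dt^i$, $\Gamma^a_{(r)\sigma}$. $\Omega^{p,q}_{(r)}$ denotes the space of forms homogeneous of degree $p$ in the $\Gamma^a_{(r)\sigma}$ and of degree $q$ in the $dt^i$ (zero if $p<0$ or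 $q<0$). The exterior differential splits as $d=D+\delta$, where, for forms written in these variables, the horizontal differential is $$D=dt^i\Bigl(\frac{\partial}{\partial t^i}+x^a_{i\sigma}\frac{\partial}{\partial x^a_\sigma}+\Gamma^a_{(r)i\sigma}\frac{\partial}{\partial \Gamma^a_{(r)\sigma}}\Bigr):\Omega^{p,q}_{(r)}\to\Omega^{p,q+1}_{(r)}$$ and the vertical differential is $\delta=\Gamma^a_{(r)\sigma}\,\partial/\partial x^a_\sigma:\Omega^{p,q}_{(r)}\to\Omega^{p+1,q}_{(r)}$; they satisfy $D^2=\delta^2=D\delta+\delta D=0$, and $\Omega^{**}_{(r)}$ with $D$ and $\delta$ is the bicomplex on $J_{(r)}$. One has $C^p\Omega^{p+q}_{(r)}=\Omega^{p,q}_{(r)}\oplus\Omega^{p+1,q-1}_{(r)}\oplus\cdots$, which gives the identification $E^{p,q}_{(r)0}\cong\Omega^{p,q}_{(r)}$, the differential of the zeroth term being $D$. The projection $p_r:\mathbb R^{r+1}\times M\to\mathbb R^r\times M$ forgets $t^{r+1}$. It induces a projection $J_{(r+1)}\to J_{(r)}$ that forgets $t^{r+1}$ and all coordinates $x^a_\sigma$ whose multi-index $\sigma$ contains the index $r+1$; $p_r^*$ is pullback of forms along this projection.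
   Formalization: "Map of bicomplexes" is stated as: κ_r commutes strictly with D, and with δ only on D-closed forms up to a D-exact form; strict commutation with δ fails, e.g. for f(x) on M: κf = 0 but κδf = dt^{r+1} x^a_{r+1} ∂f/∂x^a ≠ 0. *)

theory Defs
  imports
    "HOL-Analysis.Analysis"
    "HOL-Library.Multiset_Order"
    "HOL-Library.Function_Algebras"
begin

section \<open>Smooth functions of (possibly infinitely many) real coordinates\<close>

definition pd :: "'i \<Rightarrow> (('i \<Rightarrow> real) \<Rightarrow> real) \<Rightarrow> ('i \<Rightarrow> real) \<Rightarrow> real" where
  "pd i f x = deriv (\<lambda>s. f (x(i := s))) (x i)"

text \<open>
  Points are functions \<^typ>\<open>'i \<Rightarrow> real\<close> that vanish outside the set \<open>S\<close> of coordinates in use,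
  and \<open>W\<close> is meant to be open among those points.  Smoothness means that all iterated partial
  derivatives exist and are continuous on \<open>W\<close>.
\<close>

definition smooth_on :: "'i set \<Rightarrow> ('i \<Rightarrow> real) set \<Rightarrow> (('i \<Rightarrow> real) \<Rightarrow> real) \<Rightarrow> bool" where
  "smooth_on S W f \<longleftrightarrow>
     (\<forall>js. set js \<subseteq> S \<longrightarrow>
        continuous_on W (foldr pd js f) \<and>
        (\<forall>i\<in>S. \<forall>x\<in>W. (\<lambda>s. foldr pd js f (x(i := s))) differentiable (at (x i))))"

section \<open>Smooth manifolds\<close>

type_synonym 'a chart = "'a set \<times> ('a \<Rightarrow> nat \<Rightarrow> real)"

record 'a mfd =
  mtop :: "'a topology"
  mdim :: nat
  matlas :: "'a chart set"

definition smooth_manifold :: "'a mfd \<Rightarrow> bool" where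
  "smooth_manifold M \<longleftrightarrow>
     Hausdorff_space (mtop M) \<and> second_countable (mtop M) \<and>
     (\<Union>(U, \<phi>)\<in>matlas M. U) = topspace (mtop M) \<and>
     (\<forall>(U, \<phi>)\<in>matlas M. openin (mtop M) U \<and>
        (\<exists>V. openin (Euclidean_space (mdim M)) V \<and>
             homeomorphic_map (subtopology (mtop M) U)
               (subtopology (Euclidean_space (mdim M)) V) \<phi>)) \<and>
     (\<forall>(U, \<phi>)\<in>matlas M. \<forall>(U', \<phi>')\<in>matlas M. \<forall>a<mdim M.
        smooth_on {..<mdim M} (\<phi> ` (U \<inter> U')) (\<lambda>y. \<phi>' (inv_into U \<phi> y) a))"

section \<open>Jets of sections of the trivial bundle with fibre \<open>M\<close> over the \<open>r\<close>-space\<close>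

text \<open>
  The coordinates are indexed from 0, so that \<open>t\<^sup>1, \<dots>, t\<^sup>r\<close> are \<open>Tc 0, \<dots>, Tc (r - 1)\<close>.  Symmetric
  multi-indices are multisets.
\<close>

datatype jcoord = Tc nat | Xc nat "nat multiset"

text \<open>
  The linear order serves only to write a monomial in anticommuting variables as
  an ordered product; any other order would do.
\<close>

instantiation jcoord :: linorder
begin

fun less_eq_jcoord :: "jcoord \<Rightarrow> jcoord \<Rightarrow> bool" where
  "Tc i \<le> Tc j \<longleftrightarrow> i \<le> j"
| "Tc i \<le> Xc b \<tau> \<longleftrightarrow> True"
| "Xc a \<sigma> \<le> Tc j \<longleftrightarrow> False"
| "Xc a \<sigma> \<le> Xc b \<tau> \<longleftrightarrow> a < b \<or> (a = b \<and> \<sigma> \<le> \<tau>)"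

definition less_jcoord :: "jcoord \<Rightarrow> jcoord \<Rightarrow> bool" where
  "u < v \<longleftrightarrow> u \<le> v \<and> \<not> v \<le> (u :: jcoord)"

instance
proof
  fix u v w :: jcoord
  show "u < v \<longleftrightarrow> u \<le> v \<and> \<not> v \<le> u" by (rule less_jcoord_def)
  show "u \<le> u" by (cases u) auto
  show "u \<le> v \<Longrightarrow> v \<le> w \<Longrightarrow> u \<le> w"
    by (cases u; cases v; cases w) auto
  show "u \<le> v \<Longrightarrow> v \<le> u \<Longrightarrow> u = v"
    by (cases u; cases v) auto
  show "u \<le> v \<or> v \<le> u"
    by (cases u; cases v) auto
qed

end

definition tidx :: "nat \<Rightarrow> jcoord set" where
  "tidx r = {Tc i | i. i < r}"

definition xidx :: "'a mfd \<Rightarrow> nat \<Rightarrow> jcoord set" where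
  "xidx M r = {Xc a \<sigma> | a \<sigma>. a < mdim M \<and> set_mset \<sigma> \<subseteq> {..<r}}"

definition jidx :: "'a mfd \<Rightarrow> nat \<Rightarrow> jcoord set" where
  "jidx M r = tidx r \<union> xidx M r"

definition jidx_le :: "'a mfd \<Rightarrow> nat \<Rightarrow> nat \<Rightarrow> jcoord set" where
  "jidx_le M r k = tidx r \<union> {Xc a \<sigma> | a \<sigma>. Xc a \<sigma> \<in> xidx M r \<and> size \<sigma> \<le> k}"

definition mpd :: "nat multiset \<Rightarrow> ((nat \<Rightarrow> real) \<Rightarrow> real) \<Rightarrow> (nat \<Rightarrow> real) \<Rightarrow> real" where
  "mpd \<sigma> f = foldr pd (sorted_list_of_multiset \<sigma>) f"

text \<open>
  A local section at \<open>t\<close> is given by its \<open>M\<close>-component \<open>s\<close>, a smooth map to \<open>M\<close> defined near \<open>t\<close>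
  (the values of \<open>s\<close> elsewhere are irrelevant).
\<close>

type_synonym 'a lsec = "(nat \<Rightarrow> real) \<times> ((nat \<Rightarrow> real) \<Rightarrow> 'a)"

definition local_sections :: "'a mfd \<Rightarrow> nat \<Rightarrow> 'a lsec set" where
  "local_sections M r =
     {(t, s). \<exists>N. openin (Euclidean_space r) N \<and> t \<in> N \<and>
        continuous_map (subtopology (Euclidean_space r) N) (mtop M) s \<and>
        (\<forall>(U, \<phi>)\<in>matlas M. \<forall>a<mdim M.
           smooth_on {..<r} {u\<in>N. s u \<in> U} (\<lambda>u. \<phi> (s u) a))}"

definition jet_rel :: "'a mfd \<Rightarrow> nat \<Rightarrow> nat \<Rightarrow> ('a lsec \<times> 'a lsec) set" where
  "jet_rel M r k =
     {((t, s), (t', s')). (t, s) \<in> local_sections M r \<and> (t', s') \<in> local_sections M r \<and>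
        t = t' \<and> s t = s' t \<and>
        (\<forall>(U, \<phi>)\<in>matlas M. s t \<in> U \<longrightarrow>
           (\<forall>a<mdim M. \<forall>\<sigma>. set_mset \<sigma> \<subseteq> {..<r} \<longrightarrow> size \<sigma> \<le> k \<longrightarrow>
              mpd \<sigma> (\<lambda>u. \<phi> (s u) a) t = mpd \<sigma> (\<lambda>u. \<phi> (s' u) a) t))}"

definition finite_jets :: "'a mfd \<Rightarrow> nat \<Rightarrow> nat \<Rightarrow> 'a lsec set set" where
  "finite_jets M r k = local_sections M r // jet_rel M r k"

text \<open>
  The inverse limit of the finite-order jet spaces.  A jet of order \<open>k + 1\<close> lies over a jet of
  order \<open>k\<close> iff it is contained in it as an equivalence class.
\<close>

type_synonym 'a jet = "nat \<Rightarrow> 'a lsec set"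

definition jets :: "'a mfd \<Rightarrow> nat \<Rightarrow> 'a jet set" where
  "jets M r = {z. \<forall>k. z k \<in> finite_jets M r k \<and> z (Suc k) \<subseteq> z k}"

definition jet_rep :: "'a jet \<Rightarrow> nat \<Rightarrow> 'a lsec" where
  "jet_rep z k = (SOME p. p \<in> z k)"

definition jet_dom :: "'a mfd \<Rightarrow> nat \<Rightarrow> 'a chart \<Rightarrow> 'a jet set" where
  "jet_dom M r c = {z\<in>jets M r. case jet_rep z 0 of (t, s) \<Rightarrow> s t \<in> fst c}"

text \<open>The coordinates \<open>t\<^sup>i\<close>, \<open>x\<^sup>a\<^sub>\<sigma>\<close> induced on \<^const>\<open>jet_dom\<close> by a chart of \<open>M\<close>.\<close>

definition jet_coords :: "'a mfd \<Rightarrow> nat \<Rightarrow> 'a chart \<Rightarrow> 'a jet \<Rightarrow> jcoord \<Rightarrow> real" where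
  "jet_coords M r c z j =
     (if j \<in> jidx M r then
        (case j of
           Tc i \<Rightarrow> fst (jet_rep z 0) i
         | Xc a \<sigma> \<Rightarrow> (case jet_rep z (size \<sigma>) of (t, s) \<Rightarrow> mpd \<sigma> (\<lambda>u. snd c (s u) a) t))
      else 0)"

definition jet_img :: "'a mfd \<Rightarrow> nat \<Rightarrow> 'a chart \<Rightarrow> (jcoord \<Rightarrow> real) set" where
  "jet_img M r c = jet_coords M r c ` jet_dom M r c"

definition jet_trans ::
    "'a mfd \<Rightarrow> nat \<Rightarrow> 'a chart \<Rightarrow> 'a chart \<Rightarrow> (jcoord \<Rightarrow> real) \<Rightarrow> jcoord \<Rightarrow> real" where
  "jet_trans M r c c' y = jet_coords M r c' (inv_into (jet_dom M r c) (jet_coords M r c) y)"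

section \<open>Anticommuting variables\<close>

text \<open>
  An element of the Grassmann algebra on generators \<open>'g\<close> is given by its coefficients:
  \<open>\<alpha> {g\<^sub>1 < \<dots> < g\<^sub>n}\<close> is the coefficient of \<open>g\<^sub>1 \<cdots> g\<^sub>n\<close>.
\<close>

type_synonym 'g grass = "'g set \<Rightarrow> real"

definition gone :: "'g grass" where
  "gone I = (if I = {} then 1 else 0)"

definition gen :: "'g \<Rightarrow> 'g grass" where
  "gen g I = (if I = {g} then 1 else 0)"

definition wedge :: "'g::linorder grass \<Rightarrow> 'g grass \<Rightarrow> 'g grass" where
  "wedge \<alpha> \<beta> I =
     (\<Sum>K\<in>Pow I. (- 1) ^ card {(g, h). g \<in> K \<and> h \<in> I - K \<and> h < g} * \<alpha> K * \<beta> (I - K))"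

definition grass_deriv :: "'g::linorder \<Rightarrow> 'g grass \<Rightarrow> 'g grass" where
  "grass_deriv g \<alpha> I = (if g \<in> I then 0 else (- 1) ^ card {h\<in>I. h < g} * \<alpha> (insert g I))"

text \<open>Substitution of elements \<open>\<theta> g\<close> of degree 1 for the generators \<open>g\<close>.\<close>

definition gsubst :: "('g::linorder \<Rightarrow> 'h::linorder grass) \<Rightarrow> 'g grass \<Rightarrow> 'h grass" where
  "gsubst \<theta> \<alpha> I =
     (\<Sum>K | \<alpha> K \<noteq> 0. \<alpha> K * foldr wedge (map \<theta> (sorted_list_of_set K)) gone I)"

section \<open>Differential forms in one coordinate system\<close>

text \<open>
  Apart from the operators written in the variables \<open>\<Gamma>\<close> below, \<open>\<omega> y\<close> is an element of the
  Grassmann algebra whose generator \<open>j\<close> stands for the differential of the coordinate \<open>j\<close>.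
\<close>

type_synonym lform = "(jcoord \<Rightarrow> real) \<Rightarrow> jcoord grass"

definition restrict_form :: "(jcoord \<Rightarrow> real) set \<Rightarrow> lform \<Rightarrow> lform" where
  "restrict_form W \<omega> y = (if y \<in> W then \<omega> y else 0)"

definition fwedge :: "lform \<Rightarrow> lform \<Rightarrow> lform" where
  "fwedge \<alpha> \<beta> y = wedge (\<alpha> y) (\<beta> y)"

definition dfun :: "jcoord set \<Rightarrow> ((jcoord \<Rightarrow> real) \<Rightarrow> real) \<Rightarrow> lform" where
  "dfun S f y I = (if is_singleton I \<and> I \<subseteq> S then pd (the_elem I) f y else 0)"

text \<open>Pullback along a map \<open>F\<close> given in coordinates; \<open>S\<close> are the coordinates on its domain.\<close>

definition pullback ::
    "jcoord set \<Rightarrow> ((jcoord \<Rightarrow> real) \<Rightarrow> jcoord \<Rightarrow> real) \<Rightarrow> lform \<Rightarrow> lform" where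
  "pullback S F \<omega> y = gsubst (\<lambda>j. dfun S (\<lambda>y. F y j) y) (\<omega> (F y))"

text \<open>
  The operator \<open>\<Sum>j. g\<^sub>j \<partial>/\<partial>y\<^sup>j\<close> (\<open>j\<close> in \<open>S\<close>), where \<open>g\<^sub>j\<close> is the generator \<open>j\<close>; only \<open>j\<close> in \<open>I\<close>
  contribute to the coefficient at \<open>I\<close>.
\<close>

definition gen_diff :: "jcoord set \<Rightarrow> lform \<Rightarrow> lform" where
  "gen_diff S \<omega> y I = (\<Sum>j\<in>I \<inter> S. wedge (gen j) (\<lambda>K. pd j (\<lambda>y. \<omega> y K) y) I)"

definition lforms_le :: "'a mfd \<Rightarrow> nat \<Rightarrow> 'a chart \<Rightarrow> nat \<Rightarrow> lform set" where
  "lforms_le M r c k =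
     {\<omega>. (\<forall>y I. \<omega> y I \<noteq> 0 \<longrightarrow> y \<in> jet_img M r c \<and> I \<subseteq> jidx_le M r k) \<and>
         (\<forall>I. smooth_on (jidx M r) (jet_img M r c) (\<lambda>y. \<omega> y I)) \<and>
         (\<forall>I. \<forall>y\<in>jet_img M r c. \<forall>y'\<in>jet_img M r c.
            (\<forall>j\<in>jidx_le M r k. y j = y' j) \<longrightarrow> \<omega> y I = \<omega> y' I)}"

definition lforms :: "'a mfd \<Rightarrow> nat \<Rightarrow> 'a chart \<Rightarrow> lform set" where
  "lforms M r c = (\<Union>k. lforms_le M r c k)"

subsection \<open>The Cartan ideal and its powers\<close>

fun raise :: "nat \<Rightarrow> jcoord \<Rightarrow> jcoord" where
  "raise i (Xc a \<sigma>) = Xc a (add_mset i \<sigma>)"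
| "raise i (Tc j) = Tc j"

definition cartan_form :: "'a mfd \<Rightarrow> nat \<Rightarrow> 'a chart \<Rightarrow> jcoord \<Rightarrow> lform" where
  "cartan_form M r c j =
     restrict_form (jet_img M r c)
       (\<lambda>y I. gen j I - (\<Sum>i<r. y (raise i j) * gen (Tc i) I))"

definition cartan_ideal :: "'a mfd \<Rightarrow> nat \<Rightarrow> 'a chart \<Rightarrow> lform set" where
  "cartan_ideal M r c =
     {\<Sum>l<n. fwedge (fwedge (\<alpha> l) (cartan_form M r c (j l))) (\<beta> l) | (n::nat) \<alpha> j \<beta>.
        \<forall>l<n. \<alpha> l \<in> lforms M r c \<and> j l \<in> xidx M r \<and> \<beta> l \<in> lforms M r c}"

definition ideal_prod :: "lform set \<Rightarrow> lform set \<Rightarrow> lform set" where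
  "ideal_prod A B =
     {\<Sum>l<n. fwedge (\<alpha> l) (\<beta> l) | (n::nat) \<alpha> \<beta>. \<forall>l<n. \<alpha> l \<in> A \<and> \<beta> l \<in> B}"

primrec cartan_power :: "'a mfd \<Rightarrow> nat \<Rightarrow> 'a chart \<Rightarrow> nat \<Rightarrow> lform set" where
  "cartan_power M r c 0 = lforms M r c"
| "cartan_power M r c (Suc k) = ideal_prod (cartan_power M r c k) (cartan_ideal M r c)"

subsection \<open>Forms written in the variables \<open>t, x, dt, \<Gamma>\<close>\<close>

text \<open>
  In the result of \<open>to_cartan\<close> the generator \<open>Xc a \<sigma>\<close> stands for the Cartan form
  \<open>\<Gamma>\<^sup>a\<^sub>\<sigma>\<close> instead of \<open>dx\<^sup>a\<^sub>\<sigma>\<close>; \<open>from_cartan\<close> goes back.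
\<close>

definition to_cartan :: "nat \<Rightarrow> lform \<Rightarrow> lform" where
  "to_cartan r \<omega> y =
     gsubst (\<lambda>j. case j of Tc i \<Rightarrow> gen (Tc i)
        | Xc a \<sigma> \<Rightarrow> (\<lambda>I. gen (Xc a \<sigma>) I + (\<Sum>i<r. y (Xc a (add_mset i \<sigma>)) * gen (Tc i) I))) (\<omega> y)"

definition from_cartan :: "nat \<Rightarrow> lform \<Rightarrow> lform" where
  "from_cartan r \<omega> y =
     gsubst (\<lambda>j. case j of Tc i \<Rightarrow> gen (Tc i)
        | Xc a \<sigma> \<Rightarrow> (\<lambda>I. gen (Xc a \<sigma>) I - (\<Sum>i<r. y (Xc a (add_mset i \<sigma>)) * gen (Tc i) I))) (\<omega> y)"

text \<open>
  In the next two operators the sums over all \<open>x\<^sup>a\<^sub>\<sigma>\<close> are restricted to the nonzero terms, of which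
  there are finitely many.
\<close>

definition total_deriv ::
    "'a mfd \<Rightarrow> nat \<Rightarrow> nat \<Rightarrow> ((jcoord \<Rightarrow> real) \<Rightarrow> real) \<Rightarrow> (jcoord \<Rightarrow> real) \<Rightarrow> real" where
  "total_deriv M r i f y =
     pd (Tc i) f y + (\<Sum>j | j \<in> xidx M r \<and> pd j f y \<noteq> 0. y (raise i j) * pd j f y)"

definition cartan_shift :: "'a mfd \<Rightarrow> nat \<Rightarrow> nat \<Rightarrow> jcoord grass \<Rightarrow> jcoord grass" where
  "cartan_shift M r i \<alpha> I =
     (\<Sum>j | j \<in> xidx M r \<and> grass_deriv j \<alpha> \<noteq> 0. wedge (gen (raise i j)) (grass_deriv j \<alpha>) I)"

text \<open>\<open>dt\<^sup>i (\<partial>/\<partial>t\<^sup>i + x\<^sup>a\<^sub>i\<^sub>\<sigma> \<partial>/\<partial>x\<^sup>a\<^sub>\<sigma> + \<Gamma>\<^sup>a\<^sub>i\<^sub>\<sigma> \<partial>/\<partial>\<Gamma>\<^sup>a\<^sub>\<sigma>)\<close>, in the variables \<open>t, x, dt, \<Gamma>\<close>.\<close>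

definition horizontal_op :: "'a mfd \<Rightarrow> nat \<Rightarrow> lform \<Rightarrow> lform" where
  "horizontal_op M r \<eta> y I =
     (\<Sum>i<r. wedge (gen (Tc i))
        (\<lambda>K. total_deriv M r i (\<lambda>y. \<eta> y K) y + cartan_shift M r i (\<eta> y) K) I)"

section \<open>Differential forms on the jet space\<close>

text \<open>
  A form is the family of its expressions in the charts, which are related by pullback along the
  coordinate changes of the jet space.  The bound \<open>k\<close> on the order is common to all charts.
\<close>

type_synonym 'a form = "'a chart \<Rightarrow> lform"

definition forms :: "'a mfd \<Rightarrow> nat \<Rightarrow> 'a form set" where
  "forms M r =
     {\<omega>. (\<exists>k. \<forall>c\<in>matlas M. \<omega> c \<in> lforms_le M r c k) \<and>
         (\<forall>c. c \<notin> matlas M \<longrightarrow> \<omega> c = 0) \<and>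
         (\<forall>c\<in>matlas M. \<forall>c'\<in>matlas M.
            \<forall>y \<in> jet_coords M r c ` (jet_dom M r c \<inter> jet_dom M r c').
              \<omega> c y = pullback (jidx M r) (jet_trans M r c c') (\<omega> c') y)}"

definition forms_deg :: "'a mfd \<Rightarrow> nat \<Rightarrow> int \<Rightarrow> 'a form set" where
  "forms_deg M r n = {\<omega>\<in>forms M r. \<forall>c y I. \<omega> c y I \<noteq> 0 \<longrightarrow> int (card I) = n}"

definition lincomb :: "real \<Rightarrow> 'a form \<Rightarrow> real \<Rightarrow> 'a form \<Rightarrow> 'a form" where
  "lincomb u \<omega> v \<eta> c y I = u * \<omega> c y I + v * \<eta> c y I"

text \<open>Turns an operator on coordinate expressions into an operator on forms.\<close>

definition chartwise :: "'a mfd \<Rightarrow> nat \<Rightarrow> ('a chart \<Rightarrow> lform) \<Rightarrow> 'a form" where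
  "chartwise M r \<omega> c = (if c \<in> matlas M then restrict_form (jet_img M r c) (\<omega> c) else 0)"

definition ext_deriv :: "'a mfd \<Rightarrow> nat \<Rightarrow> 'a form \<Rightarrow> 'a form" where
  "ext_deriv M r \<omega> = chartwise M r (\<lambda>c. gen_diff (jidx M r) (\<omega> c))"

definition bihom :: "'a mfd \<Rightarrow> nat \<Rightarrow> int \<Rightarrow> int \<Rightarrow> 'a form set" where
  "bihom M r p q =
     {\<omega>\<in>forms M r. \<forall>c\<in>matlas M. \<forall>y I. to_cartan r (\<omega> c) y I \<noteq> 0 \<longrightarrow>
        int (card (I \<inter> xidx M r)) = p \<and> int (card (I \<inter> tidx r)) = q}"

definition hor_diff :: "'a mfd \<Rightarrow> nat \<Rightarrow> 'a form \<Rightarrow> 'a form" where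
  "hor_diff M r \<omega> =
     chartwise M r (\<lambda>c. from_cartan r (horizontal_op M r (to_cartan r (\<omega> c))))"

text \<open>\<open>\<delta> = \<Gamma>\<^sup>a\<^sub>\<sigma> \<partial>/\<partial>x\<^sup>a\<^sub>\<sigma>\<close> in the variables \<open>t, x, dt, \<Gamma>\<close>.\<close>

definition vert_diff :: "'a mfd \<Rightarrow> nat \<Rightarrow> 'a form \<Rightarrow> 'a form" where
  "vert_diff M r \<omega> =
     chartwise M r (\<lambda>c. from_cartan r (gen_diff (xidx M r) (to_cartan r (\<omega> c))))"

text \<open>
  The forms \<open>\<Gamma>\<^sup>a\<^sub>\<sigma>\<close> exist in charts only, so membership in a power of the Cartan ideal is
  tested in each chart.
\<close>

definition cartan_filt :: "'a mfd \<Rightarrow> nat \<Rightarrow> int \<Rightarrow> 'a form set" where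
  "cartan_filt M r k = {\<omega>\<in>forms M r. \<forall>c\<in>matlas M. \<omega> c \<in> cartan_power M r c (nat k)}"

definition cartan_filt_deg :: "'a mfd \<Rightarrow> nat \<Rightarrow> int \<Rightarrow> int \<Rightarrow> 'a form set" where
  "cartan_filt_deg M r k n = cartan_filt M r k \<inter> forms_deg M r n"

section \<open>The zeroth term of the spectral sequence\<close>

definition E0_rel :: "'a mfd \<Rightarrow> nat \<Rightarrow> int \<Rightarrow> int \<Rightarrow> ('a form \<times> 'a form) set" where
  "E0_rel M r p q =
     {(\<omega>, \<eta>). \<omega> \<in> cartan_filt_deg M r p (p + q) \<and> \<eta> \<in> cartan_filt_deg M r p (p + q) \<and>
        \<omega> - \<eta> \<in> cartan_filt_deg M r (p + 1) (p + q)}"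

definition E0 :: "'a mfd \<Rightarrow> nat \<Rightarrow> int \<Rightarrow> int \<Rightarrow> 'a form set set" where
  "E0 M r p q = cartan_filt_deg M r p (p + q) // E0_rel M r p q"

definition E0_class :: "'a mfd \<Rightarrow> nat \<Rightarrow> int \<Rightarrow> int \<Rightarrow> 'a form \<Rightarrow> 'a form set" where
  "E0_class M r p q \<omega> = E0_rel M r p q `` {\<omega>}"

text \<open>
  As usual for maps out of a quotient, the union is over the (equal) images of all representatives.
\<close>

definition E0_diff :: "'a mfd \<Rightarrow> nat \<Rightarrow> int \<Rightarrow> int \<Rightarrow> 'a form set \<Rightarrow> 'a form set" where
  "E0_diff M r p q Z = (\<Union>\<omega>\<in>Z. E0_class M r p (q + 1) (ext_deriv M r \<omega>))"

section \<open>The maps induced by forgetting the last independent variable\<close>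

text \<open>
  The projection from the jet space over \<open>r + 1\<close> variables to the one over \<open>r\<close> variables, which
  has the same expression in every chart.
\<close>

definition jet_proj :: "'a mfd \<Rightarrow> nat \<Rightarrow> (jcoord \<Rightarrow> real) \<Rightarrow> jcoord \<Rightarrow> real" where
  "jet_proj M r y j = (if j \<in> jidx M r then y j else 0)"

definition proj_pullback :: "'a mfd \<Rightarrow> nat \<Rightarrow> 'a form \<Rightarrow> 'a form" where
  "proj_pullback M r \<omega> =
     chartwise M (r + 1) (\<lambda>c. pullback (jidx M (r + 1)) (jet_proj M r) (\<omega> c))"

definition E0_map :: "'a mfd \<Rightarrow> nat \<Rightarrow> int \<Rightarrow> int \<Rightarrow> 'a form set \<Rightarrow> 'a form set" where
  "E0_map M r p q Z = (\<Union>\<omega>\<in>Z. E0_class M (r + 1) (p - 1) (q + 1) (proj_pullback M r \<omega>))"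

text \<open>
  \<^const>\<open>E0_map\<close>, transported along the identifications of \<^const>\<open>bihom\<close> with \<^const>\<open>E0\<close> by
  \<^const>\<open>E0_class\<close>.
\<close>

definition kappa :: "'a mfd \<Rightarrow> nat \<Rightarrow> int \<Rightarrow> int \<Rightarrow> 'a form \<Rightarrow> 'a form" where
  "kappa M r p q \<omega> =
     inv_into (bihom M (r + 1) (p - 1) (q + 1)) (E0_class M (r + 1) (p - 1) (q + 1))
       (E0_map M r p q (E0_class M r p q \<omega>))"

end

theory Submission
  imports Defs
begin

text \<open>
  In the variables \<open>t, x, dt, \<Gamma>\<close> the pullback along the projection only replaces \<open>\<Gamma>\<^sub>\<sigma>\<close> by
  \<open>\<Gamma>\<^sub>\<sigma> + x\<^sub>r\<^sub>\<sigma> dt\<^sup>r\<close> (indices starting at 0), and a monomial can pick up \<open>dt\<^sup>r\<close> at most once.  Hence the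
  pullback \<open>p\<^sup>*\<close> lowers the power of the Cartan ideal by at most one, and \<open>p\<^sup>* = \<iota> + \<kappa>\<close> on bihomogeneous
  forms, where \<open>\<iota>\<close> preserves the bidegree and \<open>\<kappa>\<close> has bidegree \<open>(-1, 1)\<close>.  Comparing bidegrees in
  \<open>p\<^sup>* d = d p\<^sup>*\<close>, \<open>d = D + \<delta>\<close>, gives \<open>\<kappa> D = D \<kappa>\<close> and
  \<open>\<kappa> \<delta> - \<delta> \<kappa> = D \<iota> - \<iota> D\<close>.  Bihomogeneous components are globally
  defined because the coordinate changes of the jet space, being prolonged from the manifold, map Cartan forms
  to combinations of Cartan forms; this in turn holds because every point is, up to any finite order,
  the jet of a section.
\<close>

section \<open>Calculus in coordinates\<close>

text \<open>The jet space is infinite-dimensional and given through charts. Functions have finite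
  order, so the chain rule and the symmetry of second derivatives are only needed for finitely many
  coordinates at a time. Forms are families of chart expressions and Cartan forms exist in charts
  only, so constructions must be shown compatible with coordinate changes.

  The ideal is made tractable by one description: written in \<open>dt\<close> and \<Gamma>, the
  k-th power consists of the forms all of whose terms contain at least k factors \<Gamma>.
  Filtration, form degree and bidegree then become conditions on the index sets of nonzero
  coefficients.

  With the filtration index shifted by one, \<open>p^*\<close> is a filtered map. In the graded
  quotient only \<kappa> survives, since \<iota> lies one filtration step deeper. As \<iota> need
  not commute with D, \<kappa> commutes with D exactly but with \<delta> only up to
  \<open>D \<iota>\<close> and \<open>\<iota> D\<close>; on D-closed forms the latter vanishes and
  the defect is D-exact.\<close>

definition coord_space :: "'i set \<Rightarrow> ('i \<Rightarrow> real) set" where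
  "coord_space S = {x. \<forall>j. j \<notin> S \<longrightarrow> x j = 0}"

definition open_in :: "'i set \<Rightarrow> ('i \<Rightarrow> real) set \<Rightarrow> bool" where
  "open_in S W \<longleftrightarrow> openin (top_of_set (coord_space S)) W"

lemma coord_space_upd: "x \<in> coord_space S \<Longrightarrow> i \<in> S \<Longrightarrow> x(i := s) \<in> coord_space S"
  by (auto simp: coord_space_def)

lemma open_in_subset: "open_in S W \<Longrightarrow> W \<subseteq> coord_space S"
  unfolding open_in_def by (rule openin_imp_subset)

lemma open_in_Int: "open_in S W \<Longrightarrow> open_in S W' \<Longrightarrow> open_in S (W \<inter> W')"
  unfolding open_in_def by (rule openin_Int)

text \<open>A basic open set of the product topology constrains only finitely many coordinates.
  Those outside \<open>S\<close> can be left out of \<open>F\<close>, because both points vanish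
  there.\<close>

lemma open_in_box:
  assumes "open_in S W" "x \<in> W"
  shows "\<exists>F e. finite F \<and> F \<subseteq> S \<and> e > 0 \<and>
    (\<forall>y\<in>coord_space S. (\<forall>j\<in>F. \<bar>y j - x j\<bar> < e) \<longrightarrow> y \<in> W)"
proof -
  obtain T where T: "open T" "W = coord_space S \<inter> T"
    using assms(1) unfolding open_in_def openin_open by auto
  have "openin (product_topology (\<lambda>i::'a. euclidean :: real topology) UNIV) T"
    using T(1) by (simp add: euclidean_product_topology)
  then obtain X where X: "x \<in> PiE UNIV X" "\<forall>i. open (X i)" "finite {i. X i \<noteq> UNIV}" "PiE UNIV X \<subseteq> T"
    using product_topology_open_contains_basis[of "\<lambda>i::'a. euclidean :: real topology" UNIV T x] assms(2) T(2)
    by auto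
  let ?F = "{i. X i \<noteq> UNIV} \<inter> S"
  have "\<forall>i. \<exists>e>0. \<forall>s. \<bar>s - x i\<bar> < e \<longrightarrow> s \<in> X i"
    using X(1,2) by (auto simp: open_dist dist_real_def PiE_iff)
  then obtain e where e: "\<And>i. e i > 0" "\<And>i s. \<bar>s - x i\<bar> < e i \<Longrightarrow> s \<in> X i" by metis
  \<comment> \<open>The 1 keeps the minimum positive when no coordinate is constrained.\<close>
  define d where "d = Min (insert 1 (e ` ?F))"
  have fin: "finite ?F" using X(3) by auto
  have d: "d > 0" using fin e(1) by (auto simp: d_def)
  have dle: "d \<le> e i" if "i \<in> ?F" for i using that fin by (auto simp: d_def)
  have "y \<in> W" if y: "y \<in> coord_space S" "\<forall>j\<in>?F. \<bar>y j - x j\<bar> < d" for y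
  proof -
    have "y i \<in> X i" for i
    proof (cases "i \<in> S")
      case True
      show ?thesis
      proof (cases "X i = UNIV")
        case False
        then show ?thesis using True y(2) dle[of i] e(2)[of "y i" i] by force
      qed simp
    next
      case False
      then have "y i = x i" using y(1) assms T(2) by (auto simp: coord_space_def)
      then show ?thesis using X(1) by auto
    qed
    then show ?thesis using X(4) T(2) y(1) by auto
  qed
  then show ?thesis using fin d by blast
qed

lemma open_inI:
  assumes "W \<subseteq> coord_space S"
    and "\<And>x. x \<in> W \<Longrightarrow> \<exists>F e. finite F \<and> e > 0 \<and>
      (\<forall>y\<in>coord_space S. (\<forall>j\<in>F. \<bar>y j - x j\<bar> < e) \<longrightarrow> y \<in> W)"
  shows "open_in S W"
proof -
  have "\<exists>T. openin (top_of_set (coord_space S)) T \<and> x \<in> T \<and> T \<subseteq> W" if x: "x \<in> W" for x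
  proof -
    obtain F e where F: "finite F" "e > 0" "\<forall>y\<in>coord_space S. (\<forall>j\<in>F. \<bar>y j - x j\<bar> < e) \<longrightarrow> y \<in> W"
      using assms(2)[OF x] by auto
    let ?T = "coord_space S \<inter> (\<Inter>j\<in>F. {y. \<bar>y j - x j\<bar> < e})"
    have "open (\<Inter>j\<in>F. {y. \<bar>y j - x j\<bar> < e})"
      using F(1) by (intro open_INT ballI open_Collect_less continuous_intros) auto
    then have "openin (top_of_set (coord_space S)) ?T" by auto
    then show ?thesis using F x assms(1) by (intro exI[of _ ?T]) auto
  qed
  then show ?thesis unfolding open_in_def by (subst openin_subopen) blast
qed

text \<open>By \<open>open_in_box\<close> membership in \<open>V\<close> is decided near
  \<open>y0\<close> by finitely many coordinates, so convergence in each coordinate is enough. The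
  filter is general because \<open>at\<close>, \<open>nhds\<close> and \<open>at x within W\<close>
  all occur.\<close>

lemma open_in_tendsto:
  assumes "open_in S V" "y0 \<in> V" "\<forall>\<^sub>F s in F. Y s \<in> coord_space S"
    and "\<And>j. j \<in> S \<Longrightarrow> ((\<lambda>s. Y s j) \<longlongrightarrow> y0 j) F"
  shows "\<forall>\<^sub>F s in F. Y s \<in> V"
proof -
  obtain A e where A: "finite A" "A \<subseteq> S" "e > 0"
    "\<forall>y\<in>coord_space S. (\<forall>j\<in>A. \<bar>y j - y0 j\<bar> < e) \<longrightarrow> y \<in> V"
    using open_in_box[OF assms(1,2)] by blast
  have "\<forall>\<^sub>F s in F. \<forall>j\<in>A. \<bar>Y s j - y0 j\<bar> < e"
    using A(1,2,3) tendstoD[OF assms(4), of _ e]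
    by (auto simp: eventually_ball_finite_distrib dist_real_def)
  with assms(3) show ?thesis by eventually_elim (use A(4) in auto)
qed

lemma open_in_preimage:
  assumes "open_in S W" "continuous_on W g" "open T"
  shows "open_in S {x\<in>W. g x \<in> T}"
proof -
  have "openin (top_of_set W) (W \<inter> g -` T)"
    using assms(2,3) continuous_openin_preimage_gen by blast
  moreover have "W \<inter> g -` T = {x\<in>W. g x \<in> T}" by auto
  ultimately show ?thesis using assms(1) unfolding open_in_def by (metis openin_trans)
qed

lemma continuous_on_tendsto:
  fixes g :: "('i \<Rightarrow> real) \<Rightarrow> real"
  assumes "open_in S V" "continuous_on V g" "y0 \<in> V" "\<forall>\<^sub>F s in F. Y s \<in> coord_space S"
    and "\<And>j. j \<in> S \<Longrightarrow> ((\<lambda>s. Y s j) \<longlongrightarrow> y0 j) F"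
  shows "((\<lambda>s. g (Y s)) \<longlongrightarrow> g y0) F"
proof (rule topological_tendstoI)
  fix T :: "real set" assume T: "open T" "g y0 \<in> T"
  have "\<forall>\<^sub>F s in F. Y s \<in> {x\<in>V. g x \<in> T}"
    using T assms by (intro open_in_tendsto[OF open_in_preimage[OF assms(1,2) T(1)]]) auto
  then show "\<forall>\<^sub>F s in F. g (Y s) \<in> T" by (rule eventually_mono) auto
qed

lemma open_in_line:
  assumes "open_in S W" "x \<in> W" "i \<in> S"
  shows "\<forall>\<^sub>F s in nhds (x i). x(i := s) \<in> W"
  using assms(1,2)
proof (rule open_in_tendsto)
  show "\<forall>\<^sub>F s in nhds (x i). x(i := s) \<in> coord_space S"
    using assms open_in_subset coord_space_upd by fastforce
  show "((\<lambda>s. (x(i := s)) j) \<longlongrightarrow> x j) (nhds (x i))" for j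
    by (cases "j = i") (auto simp: filterlim_ident)
qed

subsection \<open>Partial derivatives\<close>

text \<open>\<open>pd\<close> is a \<open>deriv\<close> and has an unspecified value where the
  derivative fails to exist; \<open>pdiff\<close> records existence separately, as
  \<open>smooth_on\<close> demands it.\<close>

definition pdiff :: "'i \<Rightarrow> (('i \<Rightarrow> real) \<Rightarrow> real) \<Rightarrow> ('i \<Rightarrow> real) \<Rightarrow> bool" where
  "pdiff i f x \<longleftrightarrow> (\<lambda>s. f (x(i := s))) differentiable (at (x i))"

lemma pdiff_DERIV:
  "pdiff i f x \<Longrightarrow> ((\<lambda>s. f (x(i := s))) has_real_derivative pd i f x) (at (x i))"
  unfolding pdiff_def pd_def by (simp add: DERIV_deriv_iff_real_differentiable)

lemma pd_eqI: "((\<lambda>s. f (x(i := s))) has_real_derivative d) (at (x i)) \<Longrightarrow> pd i f x = d"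
  unfolding pd_def by (rule DERIV_imp_deriv)

lemma pdiffI: "((\<lambda>s. f (x(i := s))) has_real_derivative d) (at (x i)) \<Longrightarrow> pdiff i f x"
  unfolding pdiff_def real_differentiable_def by blast

lemma pd_cong:
  assumes "open_in S W" "x \<in> W" "i \<in> S" "\<And>y. y \<in> W \<Longrightarrow> f y = g y"
  shows "pd i f x = pd i g x"
  unfolding pd_def by (rule deriv_cong_ev[OF eventually_mono[OF open_in_line[OF assms(1-3)]]])
    (use assms(4) in auto)

lemma pdiff_cong:
  assumes "open_in S W" "x \<in> W" "i \<in> S" "\<And>y. y \<in> W \<Longrightarrow> f y = g y" "pdiff i f x"
  shows "pdiff i g x"
proof -
  have "\<forall>\<^sub>F s in nhds (x i). f (x(i := s)) = g (x(i := s))"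
    by (rule eventually_mono[OF open_in_line[OF assms(1-3)]]) (use assms(4) in auto)
  then have "((\<lambda>s. g (x(i := s))) has_real_derivative pd i f x) (at (x i))"
    using pdiff_DERIV[OF assms(5)] by (subst DERIV_cong_ev[OF refl _ refl, symmetric]) auto
  then show ?thesis by (rule pdiffI)
qed

lemma pd_const [simp]: "pd i (\<lambda>x. c) x = 0"
  by (rule pd_eqI) simp

lemma pd_coord: "pd i (\<lambda>x. x j) x = (if i = j then 1 else 0)"
  by (rule pd_eqI) (cases "i = j"; auto)

lemma pdiff_const [simp]: "pdiff i (\<lambda>x. c) x"
  by (simp add: pdiff_def)

lemma pdiff_coord [simp]: "pdiff i (\<lambda>x. x j) x"
  by (rule pdiffI[of _ _ _ "if i = j then 1 else 0"]) (cases "i = j"; auto)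

lemma
  assumes "pdiff i f x" "pdiff i g x"
  shows pd_add: "pd i (\<lambda>x. f x + g x) x = pd i f x + pd i g x"
    and pdiff_add: "pdiff i (\<lambda>x. f x + g x) x"
    and pd_mult: "pd i (\<lambda>x. f x * g x) x = pd i f x * g x + f x * pd i g x"
    and pdiff_mult: "pdiff i (\<lambda>x. f x * g x) x"
proof -
  note D = assms[THEN pdiff_DERIV]
  note D1 = DERIV_add[OF D]
  have D2: "((\<lambda>s. f (x(i := s)) * g (x(i := s))) has_real_derivative
      pd i f x * g x + f x * pd i g x) (at (x i))"
    using DERIV_mult[OF D] by (simp add: algebra_simps)
  show "pd i (\<lambda>x. f x + g x) x = pd i f x + pd i g x" "pdiff i (\<lambda>x. f x + g x) x"
    "pd i (\<lambda>x. f x * g x) x = pd i f x * g x + f x * pd i g x" "pdiff i (\<lambda>x. f x * g x) x"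
    using pd_eqI[OF D1] pdiffI[OF D1] pd_eqI[OF D2] pdiffI[OF D2]
    by auto
qed

lemma pd_cmult: "pdiff i f x \<Longrightarrow> pd i (\<lambda>x. c * f x) x = c * pd i f x"
  using pd_mult[of i "\<lambda>_. c" x f] by simp

lemma pd_sum:
  assumes "\<And>k. k \<in> K \<Longrightarrow> pdiff i (f k) x"
  shows "pd i (\<lambda>x. \<Sum>k\<in>K. f k x) x = (\<Sum>k\<in>K. pd i (f k) x)"
  by (intro pd_eqI DERIV_sum pdiff_DERIV assms)

text \<open>The endpoints may come in either order or coincide, so the lemma applies along a path
  that is not monotone; the price is that \<xi> is located only by its distance from
  \<open>c\<close>.\<close>

lemma mvt_between:
  fixes \<phi> \<phi>' :: "real \<Rightarrow> real"
  assumes "\<And>\<tau>. \<bar>\<tau> - c\<bar> \<le> \<bar>b - c\<bar> \<Longrightarrow> (\<phi> has_real_derivative \<phi>' \<tau>) (at \<tau>)"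
  shows "\<exists>\<xi>. \<bar>\<xi> - c\<bar> \<le> \<bar>b - c\<bar> \<and> \<phi> b - \<phi> c = (b - c) * \<phi>' \<xi>"
proof (cases b c rule: linorder_cases)
  case less
  then obtain z where "b < z" "z < c" "\<phi> c - \<phi> b = (c - b) * \<phi>' z"
    using MVT2[of b c \<phi> \<phi>'] assms by force
  then show ?thesis by (intro exI[of _ z]) (auto simp: algebra_simps)
next
  case equal
  then show ?thesis by auto
next
  case greater
  then obtain z where "c < z" "z < b" "\<phi> b - \<phi> c = (b - c) * \<phi>' z"
    using MVT2[of c b \<phi> \<phi>'] assms by force
  then show ?thesis by (intro exI[of _ z]) auto
qed

lemma pdiff_DERIV_upd:
  "pdiff i f (x(i := \<tau>)) \<Longrightarrow> ((\<lambda>s. f (x(i := s))) has_real_derivative pd i f (x(i := \<tau>))) (at \<tau>)"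
  using pdiff_DERIV[of i f "x(i := \<tau>)"] by simp

text \<open>The coordinates in \<open>A\<close> are moved one at a time, each step being controlled by the mean value theorem.\<close>

lemma chain_rule_upd:
  assumes "open_in S V" "y0 \<in> V" "finite A" "A \<subseteq> S"
    and "\<And>j. j \<in> A \<Longrightarrow> ((\<lambda>s. \<gamma> s j) has_real_derivative \<gamma>' j) (at s0)"
    and "\<And>j. j \<in> A \<Longrightarrow> \<gamma> s0 j = y0 j"
    and "\<And>j y. j \<in> A \<Longrightarrow> y \<in> V \<Longrightarrow> pdiff j f y"
    and "\<And>j. j \<in> A \<Longrightarrow> continuous_on V (pd j f)"
  shows "((\<lambda>s. f (\<lambda>j. if j \<in> A then \<gamma> s j else y0 j)) has_real_derivative
    (\<Sum>j\<in>A. pd j f y0 * \<gamma>' j)) (at s0)"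
  using assms(3-8)
proof (induction A)
  case empty
  then show ?case by simp
next
  case (insert a A)
  define u where "u s = (\<lambda>j. if j \<in> A then \<gamma> s j else y0 j)" for s
  have y0: "y0 \<in> coord_space S" using assms open_in_subset by blast
  have ins: "(\<lambda>j. if j \<in> insert a A then \<gamma> s j else y0 j) = (u s)(a := \<gamma> s a)" for s
    by (auto simp: u_def)
  have ua: "(u s)(a := y0 a) = u s" for s using insert.hyps by (auto simp: u_def)
  have u0: "u s0 = y0" using insert.prems(3) by (auto simp: u_def)
  have IH: "((\<lambda>s. f (u s)) has_real_derivative (\<Sum>j\<in>A. pd j f y0 * \<gamma>' j)) (at s0)"
    unfolding u_def by (rule insert.IH) (use insert.prems in auto)
  have lim: "((\<lambda>s. \<gamma> s j) \<longlongrightarrow> y0 j) (at s0)" if "j \<in> insert a A" for j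
    using DERIV_isCont[OF insert.prems(2)[OF that]] insert.prems(3)[OF that] by (simp add: isCont_def)
  have usp: "(u s)(a := \<tau>) \<in> coord_space S" for s \<tau>
    using insert.prems(1) y0 by (auto simp: u_def coord_space_def)
  obtain F e where Fe: "finite F" "F \<subseteq> S" "e > 0"
    "\<forall>y\<in>coord_space S. (\<forall>j\<in>F. \<bar>y j - y0 j\<bar> < e) \<longrightarrow> y \<in> V"
    using open_in_box[OF assms(1,2)] by blast
  have "\<forall>\<^sub>F s in at s0. \<forall>j\<in>insert a A. \<bar>\<gamma> s j - y0 j\<bar> < e"
    using insert.hyps(1) tendstoD[OF lim Fe(3)]
    by (auto simp: eventually_ball_finite_distrib dist_real_def eventually_conj_iff)
  then have "\<forall>\<^sub>F s in at s0. \<exists>\<xi>. \<bar>\<xi> - y0 a\<bar> \<le> \<bar>\<gamma> s a - y0 a\<bar> \<and>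
      f ((u s)(a := \<gamma> s a)) - f ((u s)(a := y0 a)) = (\<gamma> s a - y0 a) * pd a f ((u s)(a := \<xi>))"
  proof eventually_elim
    case (elim s)
    \<comment> \<open>\<open>V\<close> need not be convex; within the box the whole segment in
      direction \<open>a\<close> stays in \<open>V\<close>.\<close>
    have "(u s)(a := \<tau>) \<in> V" if "\<bar>\<tau> - y0 a\<bar> \<le> \<bar>\<gamma> s a - y0 a\<bar>" for \<tau>
      using elim that Fe(3) by (intro Fe(4)[rule_format] usp) (auto simp: u_def)
    then show ?case
      by (intro mvt_between pdiff_DERIV_upd insert.prems(4)[OF insertI1])
  qed
  then obtain \<xi> where \<xi>: "\<forall>\<^sub>F s in at s0. \<bar>\<xi> s - y0 a\<bar> \<le> \<bar>\<gamma> s a - y0 a\<bar> \<and>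
      f ((u s)(a := \<gamma> s a)) - f ((u s)(a := y0 a)) = (\<gamma> s a - y0 a) * pd a f ((u s)(a := \<xi> s))"
    unfolding eventually_ex by blast
  \<comment> \<open>The intermediate points have no regularity in \<open>s\<close>; they converge
    because their distance from \<open>y0 a\<close> is bounded by that of
    \<open>\<gamma> s a\<close>.\<close>
  have \<xi>lim: "(\<xi> \<longlongrightarrow> y0 a) (at s0)"
  proof (rule LIM_zero_cancel, rule tendsto_0_le[where K = 1])
    show "((\<lambda>s. \<gamma> s a - y0 a) \<longlongrightarrow> 0) (at s0)" using lim[of a] by (simp add: LIM_zero)
    show "\<forall>\<^sub>F s in at s0. norm (\<xi> s - y0 a) \<le> norm (\<gamma> s a - y0 a) * 1"
      using \<xi> by eventually_elim auto
  qed
  have h: "((\<lambda>s. pd a f ((u s)(a := \<xi> s))) \<longlongrightarrow> pd a f y0) (at s0)"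
  proof (rule continuous_on_tendsto[OF assms(1) _ assms(2)])
    show "continuous_on V (pd a f)" using insert.prems by auto
    show "((\<lambda>s. ((u s)(a := \<xi> s)) j) \<longlongrightarrow> y0 j) (at s0)" for j
      using \<xi>lim lim[of j] by (cases "j = a"; cases "j \<in> A") (auto simp: u_def)
  qed (rule always_eventually, rule allI, rule usp)
  have q: "((\<lambda>s. (\<gamma> s a - y0 a) / (s - s0)) \<longlongrightarrow> \<gamma>' a) (at s0)"
    using insert.prems(2)[of a] insert.prems(3)[of a] by (simp add: has_field_derivative_iff)
  \<comment> \<open>The difference quotient is split into the step in direction \<open>a\<close> and
    the increment due to the coordinates in \<open>A\<close>, moved before.\<close>
  have "((\<lambda>s. (\<gamma> s a - y0 a) / (s - s0) * pd a f ((u s)(a := \<xi> s)) + (f (u s) - f (u s0)) / (s - s0))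
      \<longlongrightarrow> \<gamma>' a * pd a f y0 + (\<Sum>j\<in>A. pd j f y0 * \<gamma>' j)) (at s0)"
    using IH by (intro tendsto_add tendsto_mult q h) (simp add: has_field_derivative_iff)
  moreover have "\<forall>\<^sub>F s in at s0. (\<gamma> s a - y0 a) / (s - s0) * pd a f ((u s)(a := \<xi> s)) + (f (u s) - f (u s0)) / (s - s0)
      = (f ((u s)(a := \<gamma> s a)) - f ((u s0)(a := \<gamma> s0 a))) / (s - s0)"
    using \<xi> by eventually_elim (use insert.prems(3)[of a] ua in \<open>auto simp: add_divide_distrib[symmetric]\<close>)
  ultimately have "((\<lambda>s. (f ((u s)(a := \<gamma> s a)) - f ((u s0)(a := \<gamma> s0 a))) / (s - s0))
      \<longlongrightarrow> \<gamma>' a * pd a f y0 + (\<Sum>j\<in>A. pd j f y0 * \<gamma>' j)) (at s0)"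
    using tendsto_cong by fastforce
  then show ?case
    unfolding ins has_field_derivative_iff using insert.hyps by (simp add: mult.commute)
qed

text \<open>As \<open>f\<close> depends only on the coordinates in \<open>A\<close>, freezing the
  others at their values in \<open>\<gamma> s0\<close> does not change it near \<open>s0\<close>,
  and \<open>chain_rule_upd\<close> applies. Of the other coordinates of \<gamma> it is only asked
  that the path stay in \<open>V\<close>.\<close>

lemma chain_rule:
  assumes V: "open_in S V" and "\<gamma> s0 \<in> V" "\<forall>\<^sub>F s in nhds s0. \<gamma> s \<in> V" and A: "finite A" "A \<subseteq> S"
    and dep: "\<And>y y'. y \<in> V \<Longrightarrow> y' \<in> V \<Longrightarrow> (\<And>j. j \<in> A \<Longrightarrow> y j = y' j) \<Longrightarrow> f y = f y'"
    and \<gamma>: "\<And>j. j \<in> A \<Longrightarrow> ((\<lambda>s. \<gamma> s j) has_real_derivative \<gamma>' j) (at s0)"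
    and f: "\<And>j y. j \<in> A \<Longrightarrow> y \<in> V \<Longrightarrow> pdiff j f y" "\<And>j. j \<in> A \<Longrightarrow> continuous_on V (pd j f)"
  shows "((\<lambda>s. f (\<gamma> s)) has_real_derivative (\<Sum>j\<in>A. pd j f (\<gamma> s0) * \<gamma>' j)) (at s0)"
proof -
  let ?u = "\<lambda>s j. if j \<in> A then \<gamma> s j else \<gamma> s0 j"
  have "\<forall>\<^sub>F s in nhds s0. ?u s \<in> V"
  proof (rule open_in_tendsto[OF V assms(2)])
    have "?u s \<in> coord_space S" for s
      using A(2) open_in_subset[OF V] assms(2) by (auto simp: coord_space_def)
    then show "\<forall>\<^sub>F s in nhds s0. ?u s \<in> coord_space S" by simp
    fix j
    show "((\<lambda>s. ?u s j) \<longlongrightarrow> \<gamma> s0 j) (nhds s0)"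
      using DERIV_isCont[OF \<gamma>, of j] tendsto_at_iff_tendsto_nhds[of "\<lambda>s. \<gamma> s j" s0]
      by (cases "j \<in> A") (auto simp: isCont_def)
  qed
  with assms(3) have ev: "\<forall>\<^sub>F s in nhds s0. f (?u s) = f (\<gamma> s)"
    by eventually_elim (rule dep; auto)
  have "((\<lambda>s. f (?u s)) has_real_derivative (\<Sum>j\<in>A. pd j f (\<gamma> s0) * \<gamma>' j)) (at s0)"
    by (rule chain_rule_upd[OF V assms(2) A]) (use \<gamma> f in auto)
  then show ?thesis using DERIV_cong_ev[OF refl ev refl] by blast
qed

subsection \<open>Smooth functions\<close>

lemma smooth_on_continuous: "smooth_on S W f \<Longrightarrow> continuous_on W f"
  unfolding smooth_on_def by (drule spec[of _ "[]"]) simp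

lemma smooth_on_pdiff: "smooth_on S W f \<Longrightarrow> i \<in> S \<Longrightarrow> x \<in> W \<Longrightarrow> pdiff i f x"
  unfolding smooth_on_def pdiff_def by (drule spec[of _ "[]"]) simp

lemma smooth_on_pd: "smooth_on S W f \<Longrightarrow> i \<in> S \<Longrightarrow> smooth_on S W (pd i f)"
  unfolding smooth_on_def
proof (intro allI impI)
  fix js assume *: "\<forall>js. set js \<subseteq> S \<longrightarrow> continuous_on W (foldr pd js f) \<and>
      (\<forall>i\<in>S. \<forall>x\<in>W. (\<lambda>s. foldr pd js f (x(i := s))) differentiable at (x i))" "i \<in> S" "set js \<subseteq> S"
  then show "continuous_on W (foldr pd js (pd i f)) \<and>
      (\<forall>ia\<in>S. \<forall>x\<in>W. (\<lambda>s. foldr pd js (pd i f) (x(ia := s))) differentiable at (x ia))"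
    using *(1)[rule_format, of "js @ [i]"] by simp
qed

lemma foldr_pd_cong:
  assumes "open_in S W" "set js \<subseteq> S" "\<And>y. y \<in> W \<Longrightarrow> f y = g y" "x \<in> W"
  shows "foldr pd js f x = foldr pd js g x"
  using assms(2,4)
proof (induction js arbitrary: x)
  case (Cons j js)
  then show ?case using pd_cong[OF assms(1), of x j "foldr pd js f" "foldr pd js g"] by auto
qed (use assms in auto)

text \<open>Every iterated derivative agrees on \<open>W\<close> with a member of \<open>C\<close>,
  because \<open>W\<close> is open and equality on \<open>W\<close> therefore passes to partial
  derivatives. To prove smoothness it is enough to exhibit one class closed under
  differentiation.\<close>

lemma smooth_on_coinduct:
  assumes W: "open_in S W" and "f \<in> C"
    and cont: "\<And>f. f \<in> C \<Longrightarrow> continuous_on W f"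
    and diff: "\<And>f i x. f \<in> C \<Longrightarrow> i \<in> S \<Longrightarrow> x \<in> W \<Longrightarrow> pdiff i f x"
    and pd: "\<And>f i. f \<in> C \<Longrightarrow> i \<in> S \<Longrightarrow> \<exists>g\<in>C. \<forall>x\<in>W. pd i f x = g x"
  shows "smooth_on S W f"
proof -
  have ex: "\<exists>g\<in>C. \<forall>x\<in>W. foldr pd js f x = g x" if "set js \<subseteq> S" for js
    using that
  proof (induction js)
    case Nil
    then show ?case using assms(2) by auto
  next
    case (Cons j js)
    then obtain g where g: "g \<in> C" "\<forall>x\<in>W. foldr pd js f x = g x" by auto
    obtain h where h: "h \<in> C" "\<forall>x\<in>W. pd j g x = h x" using pd[OF g(1), of j] Cons.prems by auto
    then show ?case using Cons.prems g pd_cong[OF W, of _ j "foldr pd js f" g] by auto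
  qed
  show ?thesis unfolding smooth_on_def
  proof (intro allI impI conjI ballI)
    fix js assume js: "set js \<subseteq> S"
    then obtain g where g: "g \<in> C" "\<forall>x\<in>W. foldr pd js f x = g x" using ex by blast
    show "continuous_on W (foldr pd js f)" using cont[OF g(1)] g(2) continuous_on_cong by metis
    fix i x assume "i \<in> S" "x \<in> W"
    then show "(\<lambda>s. foldr pd js f (x(i := s))) differentiable at (x i)"
      using pdiff_cong[OF W, of x i g "foldr pd js f"] diff[OF g(1)] g(2) by (auto simp: pdiff_def)
  qed
qed

lemma smooth_on_cong:
  assumes "open_in S W" "smooth_on S W f" "\<And>x. x \<in> W \<Longrightarrow> g x = f x"
  shows "smooth_on S W g"
proof (rule smooth_on_coinduct[OF assms(1)])
  show "g \<in> {g. \<exists>f. smooth_on S W f \<and> (\<forall>x\<in>W. g x = f x)}" using assms by auto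
next
  fix g assume "g \<in> {g. \<exists>f. smooth_on S W f \<and> (\<forall>x\<in>W. g x = f x)}"
  then show "continuous_on W g" using smooth_on_continuous continuous_on_cong by blast
next
  fix g i x assume "g \<in> {g. \<exists>f. smooth_on S W f \<and> (\<forall>x\<in>W. g x = f x)}" "i \<in> S" "x \<in> W"
  then obtain f where "smooth_on S W f" "\<forall>x\<in>W. g x = f x" by auto
  then show "pdiff i g x"
    using pdiff_cong[OF assms(1), of x i f g] smooth_on_pdiff \<open>i \<in> S\<close> \<open>x \<in> W\<close> by force
next
  fix g i assume "g \<in> {g. \<exists>f. smooth_on S W f \<and> (\<forall>x\<in>W. g x = f x)}" "i \<in> S"
  then obtain f where "smooth_on S W f" "\<forall>x\<in>W. g x = f x" by auto
  then show "\<exists>h\<in>{g. \<exists>f. smooth_on S W f \<and> (\<forall>x\<in>W. g x = f x)}. \<forall>x\<in>W. pd i g x = h x"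
    using pd_cong[OF assms(1), of _ i g f] smooth_on_pd[of S W f i] \<open>i \<in> S\<close>
    by (intro bexI[of _ "pd i f"]) auto
qed

lemma smooth_on_subset:
  assumes "smooth_on S W f" "W' \<subseteq> W"
  shows "smooth_on S W' f"
  using assms unfolding smooth_on_def by (meson continuous_on_subset subsetD)

text \<open>The derivative of a product or of a composite is a sum of products, so the class given
  to \<open>smooth_on_coinduct\<close> has to be closed under sums and products: it is the algebra
  generated by \<open>B\<close>.\<close>

inductive_set falg :: "('x \<Rightarrow> real) set \<Rightarrow> ('x \<Rightarrow> real) set" for B where
  falg_base: "f \<in> B \<Longrightarrow> f \<in> falg B"
| falg_0: "(\<lambda>x. 0) \<in> falg B"
| falg_add: "f \<in> falg B \<Longrightarrow> g \<in> falg B \<Longrightarrow> (\<lambda>x. f x + g x) \<in> falg B"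
| falg_mult: "f \<in> falg B \<Longrightarrow> g \<in> falg B \<Longrightarrow> (\<lambda>x. f x * g x) \<in> falg B"

lemma falg_sum: "finite K \<Longrightarrow> (\<And>k. k \<in> K \<Longrightarrow> f k \<in> falg B) \<Longrightarrow> (\<lambda>x. \<Sum>k\<in>K. f k x) \<in> falg B"
  by (induction K rule: finite_induct) (auto intro: falg.intros)

text \<open>By the Leibniz rule it suffices that the derivatives of the generators lie in the
  algebra.\<close>

lemma smooth_on_falg:
  assumes W: "open_in S W" and "f \<in> falg B"
    and cont: "\<And>f. f \<in> B \<Longrightarrow> continuous_on W f"
    and diff: "\<And>f i x. f \<in> B \<Longrightarrow> i \<in> S \<Longrightarrow> x \<in> W \<Longrightarrow> pdiff i f x"
    and pd: "\<And>f i. f \<in> B \<Longrightarrow> i \<in> S \<Longrightarrow> \<exists>g\<in>falg B. \<forall>x\<in>W. pd i f x = g x"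
  shows "smooth_on S W f"
proof (rule smooth_on_coinduct[OF W assms(2)])
  show "continuous_on W f" if "f \<in> falg B" for f
    using that by induction (auto intro: cont continuous_intros)
  show diff': "pdiff i f x" if "f \<in> falg B" "i \<in> S" "x \<in> W" for f i x
    using that by induction (auto intro: diff pdiff_add pdiff_mult)
  show "\<exists>g\<in>falg B. \<forall>x\<in>W. pd i f x = g x" if "f \<in> falg B" "i \<in> S" for f i
    using that
  proof induction
    case (falg_base f)
    then show ?case using pd by auto
  next
    case falg_0
    show ?case by (rule bexI[OF _ falg.falg_0]) simp
  next
    case (falg_add f g)
    then obtain f' g' where "f' \<in> falg B" "\<forall>x\<in>W. pd i f x = f' x" "g' \<in> falg B" "\<forall>x\<in>W. pd i g x = g' x"
      by auto
    then show ?case using pd_add[OF diff' diff'] falg_add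
      by (intro bexI[of _ "\<lambda>x. f' x + g' x"]) (auto intro: falg.intros)
  next
    case (falg_mult f g)
    then obtain f' g' where "f' \<in> falg B" "\<forall>x\<in>W. pd i f x = f' x" "g' \<in> falg B" "\<forall>x\<in>W. pd i g x = g' x"
      by auto
    then show ?case using pd_mult[OF diff' diff'] falg_mult
      by (intro bexI[of _ "\<lambda>x. f' x * g x + f x * g' x"]) (auto intro!: falg.falg_add falg.falg_mult)
  qed
qed

lemma
  assumes "open_in S W" "smooth_on S W f" "smooth_on S W g"
  shows smooth_on_add: "smooth_on S W (\<lambda>x. f x + g x)"
    and smooth_on_mult: "smooth_on S W (\<lambda>x. f x * g x)"
proof -
  let ?B = "Collect (smooth_on S W)"
  have "smooth_on S W h" if "h \<in> falg ?B" for h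
    using assms(1) that
  proof (rule smooth_on_falg)
    fix f i assume "f \<in> ?B" "i \<in> S"
    then show "\<exists>g\<in>falg ?B. \<forall>x\<in>W. pd i f x = g x"
      by (intro bexI[of _ "pd i f"]) (auto intro: falg.intros smooth_on_pd)
  qed (auto intro: smooth_on_continuous smooth_on_pdiff)
  then show "smooth_on S W (\<lambda>x. f x + g x)" "smooth_on S W (\<lambda>x. f x * g x)"
    using assms by (auto intro: falg.intros)
qed

lemma smooth_on_const: "open_in S W \<Longrightarrow> smooth_on S W (\<lambda>x. c)"
  by (rule smooth_on_coinduct[of S W _ "{f. \<exists>c. f = (\<lambda>x. c)}"]) auto

lemma smooth_on_coord:
  assumes "open_in S W"
  shows "smooth_on S W (\<lambda>x. x j)"
proof (rule smooth_on_coinduct[of S W _ "insert (\<lambda>x. x j) {f. \<exists>c. f = (\<lambda>x. c)}"])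
  fix f i assume "f \<in> insert (\<lambda>x. x j) {f. \<exists>c. f = (\<lambda>x::'a\<Rightarrow>real. c)}"
  then have "\<exists>c. pd i f = (\<lambda>x. c)"
  proof
    assume "f = (\<lambda>x. x j)"
    then have "pd i f = (\<lambda>x. if i = j then 1 else 0)" using pd_coord[of i j] by blast
    then show ?thesis by blast
  next
    assume "f \<in> {f. \<exists>c. f = (\<lambda>x. c)}"
    then obtain c where "f = (\<lambda>x. c)" by blast
    then have "pd i f = (\<lambda>x. 0)" using pd_const[of i c] by blast
    then show ?thesis by blast
  qed
  then show "\<exists>g\<in>insert (\<lambda>x. x j) {f. \<exists>c. f = (\<lambda>x. c)}. \<forall>x\<in>W. pd i f x = g x"
    by (intro bexI[of _ "pd i f"]) auto
qed (use assms in \<open>auto intro: continuous_on_subset[OF continuous_on_product_coordinates]\<close>)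

lemma smooth_on_cmult:
  "open_in S W \<Longrightarrow> smooth_on S W f \<Longrightarrow> smooth_on S W (\<lambda>x. c * f x)"
  by (intro smooth_on_mult smooth_on_const)

lemma smooth_on_sum:
  assumes "open_in S W" "\<And>k. k \<in> K \<Longrightarrow> smooth_on S W (f k)"
  shows "smooth_on S W (\<lambda>x. \<Sum>k\<in>K. f k x)"
  using assms(2)
  by (induction K rule: infinite_finite_induct)
    (auto intro: smooth_on_add[OF assms(1)] smooth_on_const[OF assms(1)])

section \<open>Dependence on finitely many coordinates, and composition\<close>

lemma pd_dep_zero:
  assumes "open_in S V" "y \<in> V" "i \<in> S" "i \<notin> A"
    and "\<And>y y'. y \<in> V \<Longrightarrow> y' \<in> V \<Longrightarrow> (\<And>j. j \<in> A \<Longrightarrow> y j = y' j) \<Longrightarrow> f y = f y'"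
  shows "pd i f y = 0"
proof -
  have "\<forall>\<^sub>F s in nhds (y i). f (y(i := s)) = f y"
    using open_in_line[OF assms(1-3)] by eventually_elim (rule assms(5); use assms in auto)
  then show ?thesis unfolding pd_def using deriv_cong_ev[of _ "\<lambda>s. f y"] by fastforce
qed

text \<open>If \<open>i\<close> is in \<open>A\<close>, the two functions of the moved coordinate
  agree near the common value of \<open>y i\<close> and \<open>y' i\<close>; otherwise both
  derivatives are zero. Hence differentiation does not raise the order of a function.\<close>

lemma pd_dep:
  assumes "open_in S V" "i \<in> S"
    and dep: "\<And>y y'. y \<in> V \<Longrightarrow> y' \<in> V \<Longrightarrow> (\<And>j. j \<in> A \<Longrightarrow> y j = y' j) \<Longrightarrow> f y = f y'"
    and y: "y \<in> V" "y' \<in> V" "\<And>j. j \<in> A \<Longrightarrow> y j = y' j"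
  shows "pd i f y = pd i f y'"
proof (cases "i \<in> A")
  case True
  have "\<forall>\<^sub>F s in nhds (y i). f (y(i := s)) = f (y'(i := s))"
    using open_in_line[OF assms(1) y(1) assms(2)] open_in_line[OF assms(1) y(2) assms(2)]
    unfolding y(3)[OF True]
    by eventually_elim (rule dep; use y(3) in auto)
  then show ?thesis unfolding pd_def y(3)[OF True, symmetric] by (rule deriv_cong_ev) simp
next
  case False
  then have "pd i f y = 0" if "y \<in> V" for y
    by (rule pd_dep_zero[OF assms(1) that assms(2)]) (rule dep)
  then show ?thesis using y by simp
qed

text \<open>The chain rule writes the derivative of a composite as a sum of products of composites
  and smooth functions, so \<open>smooth_on_falg\<close> applies to the algebra generated by both
  kinds. Smoothness of \<open>F\<close> is asked only for the coordinates in the finite set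
  \<open>A\<close>, as \<open>f\<close> sees no others.\<close>

lemma
  assumes W: "open_in S W" and V: "open_in S' V" and F: "\<And>x. x \<in> W \<Longrightarrow> F x \<in> V"
    and A: "finite A" "A \<subseteq> S'" and FA: "\<And>j. j \<in> A \<Longrightarrow> smooth_on S W (\<lambda>x. F x j)"
    and dep: "\<And>y y'. y \<in> V \<Longrightarrow> y' \<in> V \<Longrightarrow> (\<And>j. j \<in> A \<Longrightarrow> y j = y' j) \<Longrightarrow> f y = f y'"
    and f: "smooth_on S' V f"
  shows pd_compose: "i \<in> S \<Longrightarrow> x \<in> W \<Longrightarrow>
      pd i (\<lambda>x. f (F x)) x = (\<Sum>j\<in>A. pd j f (F x) * pd i (\<lambda>x. F x j) x)"
    and smooth_on_compose: "smooth_on S W (\<lambda>x. f (F x))"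
proof -
  let ?dep = "\<lambda>f::_\<Rightarrow>real. \<forall>y\<in>V. \<forall>y'\<in>V. (\<forall>j\<in>A. y j = y' j) \<longrightarrow> f y = f y'"
  let ?C = "{f. smooth_on S' V f \<and> ?dep f}"
  have D: "((\<lambda>s. f (F (x(i := s)))) has_real_derivative
      (\<Sum>j\<in>A. pd j f (F x) * pd i (\<lambda>x. F x j) x)) (at (x i))" if "i \<in> S" "x \<in> W" "f \<in> ?C" for i x f
  proof -
    have ev: "\<forall>\<^sub>F s in nhds (x i). F (x(i := s)) \<in> V"
      using open_in_line[OF W that(2,1)] by eventually_elim (rule F)
    have "((\<lambda>s. f (F (x(i := s)))) has_real_derivative
        (\<Sum>j\<in>A. pd j f (F (x(i := x i))) * pd i (\<lambda>x. F x j) x)) (at (x i))"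
    proof (rule chain_rule[OF V _ ev A])
      show "f y = f y'" if "y \<in> V" "y' \<in> V" "\<And>j. j \<in> A \<Longrightarrow> y j = y' j" for y y'
        using \<open>f \<in> ?C\<close> that by blast
      fix j assume j: "j \<in> A"
      show "((\<lambda>s. F (x(i := s)) j) has_real_derivative pd i (\<lambda>x. F x j) x) (at (x i))"
        using pdiff_DERIV[OF smooth_on_pdiff[OF FA[OF j] that(1,2)]] .
      show "pdiff j f y" if "y \<in> V" for y
        using \<open>f \<in> ?C\<close> that j A(2) by (auto intro: smooth_on_pdiff)
      show "continuous_on V (pd j f)"
        using \<open>f \<in> ?C\<close> j A(2) by (auto intro!: smooth_on_continuous smooth_on_pd)
    qed (simp add: F that(2))
    then show ?thesis by simp
  qed
  have fC: "f \<in> ?C" using f by (intro CollectI conjI ballI impI) (blast, blast intro: dep)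
  show "pd i (\<lambda>x. f (F x)) x = (\<Sum>j\<in>A. pd j f (F x) * pd i (\<lambda>x. F x j) x)"
    if "i \<in> S" "x \<in> W" by (rule pd_eqI[OF D[OF that fC]])
  define B where "B = Collect (smooth_on S W) \<union> {\<lambda>x. f (F x) | f. f \<in> ?C}"
  have FS: "continuous_on W (\<lambda>x. g (F x))" if "g \<in> ?C" for g
    unfolding continuous_on_def
  proof
    fix x assume x: "x \<in> W"
    \<comment> \<open>\<open>F\<close> may be discontinuous in the coordinates outside
      \<open>A\<close>; they are frozen at their values at \<open>x\<close>, which leaves
      \<open>g\<close> unchanged.\<close>
    let ?Y = "\<lambda>x' j. if j \<in> A then F x' j else F x j"
    have sp: "?Y x' \<in> coord_space S'" for x'
      using A(2) F[OF x] open_in_subset[OF V] by (auto simp: coord_space_def)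
    have lim: "((\<lambda>x'. ?Y x' j) \<longlongrightarrow> F x j) (at x within W)" for j
      using smooth_on_continuous[OF FA, of j] x by (cases "j \<in> A") (auto simp: continuous_on_def)
    have "continuous_on V g" using that by (blast intro: smooth_on_continuous)
    then have "((\<lambda>x'. g (?Y x')) \<longlongrightarrow> g (F x)) (at x within W)"
      by (rule continuous_on_tendsto[OF V _ F[OF x]]) (simp_all only: sp lim eventually_True)
    moreover have ev: "\<forall>\<^sub>F x' in at x within W. ?Y x' \<in> V"
      by (rule open_in_tendsto[OF V F[OF x]]) (simp_all only: sp lim eventually_True)
    have "\<forall>\<^sub>F x' in at x within W. x' \<in> W" by (auto simp: eventually_at_topological)
    with ev have "\<forall>\<^sub>F x' in at x within W. g (?Y x') = g (F x')"
    proof eventually_elim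
      case (elim x')
      have "\<And>y y'. y \<in> V \<Longrightarrow> y' \<in> V \<Longrightarrow> (\<And>j. j \<in> A \<Longrightarrow> y j = y' j) \<Longrightarrow> g y = g y'"
        using that by blast
      from this[OF elim(1) F[OF elim(2)]] show ?case by simp
    qed
    ultimately show "((\<lambda>x. g (F x)) \<longlongrightarrow> g (F x)) (at x within W)"
      using tendsto_cong by fastforce
  qed
  show "smooth_on S W (\<lambda>x. f (F x))"
  proof (rule smooth_on_falg[OF W, of _ B])
    show "(\<lambda>x. f (F x)) \<in> falg B" using fC by (auto simp: B_def intro!: falg_base)
    show "continuous_on W h" if "h \<in> B" for h
      using that FS smooth_on_continuous by (auto simp: B_def)
    show "pdiff i h x" if "h \<in> B" "i \<in> S" "x \<in> W" for h i x
    proof (cases "smooth_on S W h")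
      case True
      then show ?thesis using that(2,3) by (rule smooth_on_pdiff)
    next
      case False
      then obtain g where g: "g \<in> ?C" "h = (\<lambda>x. g (F x))" using \<open>h \<in> B\<close> unfolding B_def by blast
      show ?thesis unfolding g(2) by (rule pdiffI[OF D[OF that(2,3) g(1)]])
    qed
    show "\<exists>g\<in>falg B. \<forall>x\<in>W. pd i h x = g x" if h: "h \<in> B" "i \<in> S" for h i
    proof (cases "smooth_on S W h")
      case True
      then have "pd i h \<in> falg B" using h by (intro falg_base) (simp add: B_def smooth_on_pd)
      then show ?thesis by blast
    next
      case False
      then obtain g where g: "g \<in> ?C" "h = (\<lambda>x. g (F x))" using h unfolding B_def by blast
      have "pd j g \<in> ?C" if "j \<in> A" for j
        using g(1) A that smooth_on_pd[of S' V g j] pd_dep[OF V, of j A g] by blast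
      moreover have "smooth_on S W (pd i (\<lambda>x. F x j))" if "j \<in> A" for j
        using FA[OF that] h(2) by (rule smooth_on_pd)
      ultimately have "(\<lambda>x. \<Sum>j\<in>A. pd j g (F x) * pd i (\<lambda>x. F x j) x) \<in> falg B"
        unfolding B_def by (intro falg_sum[OF A(1)] falg_mult falg_base) blast+
      then show ?thesis unfolding g(2) by (rule rev_bexI) (intro ballI pd_eqI[OF D[OF h(2) _ g(1)]])
    qed
  qed
qed

section \<open>Symmetry of second partial derivatives\<close>

lemma second_difference:
  assumes W: "open_in S W" and f: "smooth_on S W f" and ij: "i \<in> S" "j \<in> S" "i \<noteq> j"
    and box: "\<And>a b. \<bar>a - x i\<bar> \<le> h \<Longrightarrow> \<bar>b - x j\<bar> \<le> h \<Longrightarrow> x(i := a, j := b) \<in> W" and "h > 0"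
  shows "\<exists>a b. \<bar>a - x i\<bar> \<le> h \<and> \<bar>b - x j\<bar> \<le> h \<and>
    f (x(i := x i + h, j := x j + h)) - f (x(i := x i + h, j := x j))
      - f (x(i := x i, j := x j + h)) + f (x(i := x i, j := x j))
      = h * h * pd j (pd i f) (x(i := a, j := b))"
proof -
  define \<phi> where "\<phi> a = f (x(i := a, j := x j + h)) - f (x(i := a, j := x j))" for a
  have D: "((\<lambda>s. f (x(i := s, j := b))) has_real_derivative pd i f (x(i := a, j := b))) (at a)"
    if "\<bar>a - x i\<bar> \<le> h" "\<bar>b - x j\<bar> \<le> h" for a b
    using pdiff_DERIV_upd[of i f "x(j := b)" a] smooth_on_pdiff[OF f ij(1) box[OF that]] ij(3)
    by (simp add: fun_upd_twist)
  \<comment> \<open>The mean value theorem in direction \<open>i\<close> is applied to the increment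
    \<phi> in direction \<open>j\<close>; a second use of it, in direction \<open>j\<close>, then
    produces the mixed derivative.\<close>
  have "\<exists>\<xi>. \<bar>\<xi> - x i\<bar> \<le> \<bar>(x i + h) - x i\<bar> \<and> \<phi> (x i + h) - \<phi> (x i) = (x i + h - x i) *
      (pd i f (x(i := \<xi>, j := x j + h)) - pd i f (x(i := \<xi>, j := x j)))"
    unfolding \<phi>_def
  proof (rule mvt_between)
    fix \<tau> assume "\<bar>\<tau> - x i\<bar> \<le> \<bar>(x i + h) - x i\<bar>"
    then have "\<bar>\<tau> - x i\<bar> \<le> h" "\<bar>x j + h - x j\<bar> \<le> h" "\<bar>x j - x j\<bar> \<le> h" using \<open>h > 0\<close> by auto
    then show "((\<lambda>a. f (x(i := a, j := x j + h)) - f (x(i := a, j := x j))) has_real_derivative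
        pd i f (x(i := \<tau>, j := x j + h)) - pd i f (x(i := \<tau>, j := x j))) (at \<tau>)"
      by (intro DERIV_diff D)
  qed
  then obtain \<xi> where \<xi>: "\<bar>\<xi> - x i\<bar> \<le> h" "\<phi> (x i + h) - \<phi> (x i) = h *
      (pd i f (x(i := \<xi>, j := x j + h)) - pd i f (x(i := \<xi>, j := x j)))"
    using \<open>h > 0\<close> by auto
  have "\<exists>\<eta>. \<bar>\<eta> - x j\<bar> \<le> \<bar>(x j + h) - x j\<bar> \<and>
      pd i f (x(i := \<xi>, j := x j + h)) - pd i f (x(i := \<xi>, j := x j)) =
      (x j + h - x j) * pd j (pd i f) (x(i := \<xi>, j := \<eta>))"
    by (rule mvt_between, rule pdiff_DERIV_upd, rule smooth_on_pdiff[OF smooth_on_pd[OF f ij(1)] ij(2)],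
        rule box) (use \<xi>(1) \<open>h > 0\<close> in auto)
  then obtain \<eta> where \<eta>: "\<bar>\<eta> - x j\<bar> \<le> h"
    "pd i f (x(i := \<xi>, j := x j + h)) - pd i f (x(i := \<xi>, j := x j)) = h * pd j (pd i f) (x(i := \<xi>, j := \<eta>))"
    using \<open>h > 0\<close> by auto
  have "\<phi> (x i + h) - \<phi> (x i) = h * h * pd j (pd i f) (x(i := \<xi>, j := \<eta>))"
    unfolding \<xi>(2) \<eta>(2) by simp
  then show ?thesis unfolding \<phi>_def
    by (intro exI[of _ \<xi>] exI[of _ \<eta>] conjI \<xi>(1) \<eta>(1)) linarith
qed

text \<open>The second difference over a square at \<open>x\<close> is symmetric in \<open>i\<close>
  and \<open>j\<close>. By \<open>second_difference\<close> it is \<open>h * h\<close> times either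
  mixed derivative at some point of the square, and on a small square both are within
  \<open>e/2\<close> of their values at \<open>x\<close>.\<close>

lemma pd_commute:
  assumes W: "open_in S W" and f: "smooth_on S W f" and ij: "i \<in> S" "j \<in> S" and x: "x \<in> W"
  shows "pd i (pd j f) x = pd j (pd i f) x"
proof (cases "i = j")
  case False
  have "\<bar>pd i (pd j f) x - pd j (pd i f) x\<bar> \<le> e" if "e > 0" for e
  proof -
    let ?W = "{y\<in>{y\<in>W. pd i (pd j f) y \<in> {pd i (pd j f) x - e/2 <..< pd i (pd j f) x + e/2}}.
      pd j (pd i f) y \<in> {pd j (pd i f) x - e/2 <..< pd j (pd i f) x + e/2}}"
    have c: "continuous_on W (pd i (pd j f))" "continuous_on W (pd j (pd i f))"
      using f ij by (auto intro!: smooth_on_continuous smooth_on_pd)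
    have "open_in S ?W"
      by (intro open_in_preimage W c continuous_on_subset[OF c(2)]) auto
    moreover have "x \<in> ?W" using x that by auto
    ultimately obtain F d where F: "d > 0" "\<forall>y\<in>coord_space S. (\<forall>j\<in>F. \<bar>y j - x j\<bar> < d) \<longrightarrow> y \<in> ?W"
      using open_in_box by (metis (no_types, lifting))
    \<comment> \<open>Half of \<open>d\<close>, so that the closed square of radius \<open>h\<close>
      lies in the open box of radius \<open>d\<close>.\<close>
    define h where "h = d / 2"
    have xs: "x \<in> coord_space S" using x open_in_subset[OF W] by auto
    have box: "x(i := a, j := b) \<in> ?W" if "\<bar>a - x i\<bar> \<le> h" "\<bar>b - x j\<bar> \<le> h" for a b
    proof (rule F(2)[rule_format])
      show "x(i := a, j := b) \<in> coord_space S" by (intro coord_space_upd xs ij)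
      show "\<bar>(x(i := a, j := b)) k - x k\<bar> < d" for k using that F(1) by (auto simp: h_def)
    qed
    have boxW: "x(i := a, j := b) \<in> W" if "\<bar>a - x i\<bar> \<le> h" "\<bar>b - x j\<bar> \<le> h" for a b
      using box[OF that] by auto
    have boxW': "x(j := a, i := b) \<in> W" if "\<bar>a - x j\<bar> \<le> h" "\<bar>b - x i\<bar> \<le> h" for a b
      using boxW[OF that(2,1)] False by (simp add: fun_upd_twist)
    have h: "h > 0" using F(1) by (simp add: h_def)
    obtain a b where ab: "\<bar>a - x i\<bar> \<le> h" "\<bar>b - x j\<bar> \<le> h"
      "f (x(i := x i + h, j := x j + h)) - f (x(i := x i + h, j := x j))
      - f (x(i := x i, j := x j + h)) + f (x(i := x i, j := x j)) = h * h * pd j (pd i f) (x(i := a, j := b))"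
      using second_difference[OF W f ij(1,2) False boxW h] by blast
    obtain b' a' where ab': "\<bar>a' - x i\<bar> \<le> h" "\<bar>b' - x j\<bar> \<le> h"
      "f (x(j := x j + h, i := x i + h)) - f (x(j := x j + h, i := x i))
      - f (x(j := x j, i := x i + h)) + f (x(j := x j, i := x i)) = h * h * pd i (pd j f) (x(j := b', i := a'))"
      using second_difference[OF W f ij(2,1) _ boxW' h] False by blast
    have tw: "x(j := b', i := a') = x(i := a', j := b')" for a' b' using False by (simp add: fun_upd_twist)
    have "h * h * pd j (pd i f) (x(i := a, j := b)) = h * h * pd i (pd j f) (x(i := a', j := b'))"
      using ab(3) ab'(3) unfolding tw by argo
    then have "pd j (pd i f) (x(i := a, j := b)) = pd i (pd j f) (x(i := a', j := b'))" using h by simp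
    then show ?thesis using box[OF ab(1,2)] box[OF ab'(1,2)] by auto
  qed
  then have "\<bar>pd i (pd j f) x - pd j (pd i f) x\<bar> \<le> 0" by (rule field_le_epsilon) simp
  then show ?thesis by simp
qed simp

section \<open>The Grassmann algebra\<close>

text \<open>\<open>grass\<close> contains arbitrary functions on sets. The elements singled out here
  form the actual Grassmann algebra: the sum over the support in \<open>gsubst\<close> is finite,
  and nothing sits at infinite index sets, where \<open>wedge\<close> always vanishes.\<close>

definition fin_supp :: "'g grass \<Rightarrow> bool" where
  "fin_supp \<alpha> \<longleftrightarrow> finite {K. \<alpha> K \<noteq> 0} \<and> (\<forall>K. \<alpha> K \<noteq> 0 \<longrightarrow> finite K)"

definition deg1 :: "'g grass \<Rightarrow> bool" where
  "deg1 \<theta> \<longleftrightarrow> (\<forall>I. \<theta> I \<noteq> 0 \<longrightarrow> is_singleton I)"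

definition gmono :: "'g set \<Rightarrow> 'g grass" where
  "gmono K I = (if I = K then 1 else 0)"

definition gprod :: "('g \<Rightarrow> 'h::linorder grass) \<Rightarrow> 'g list \<Rightarrow> 'h grass" where
  "gprod \<theta> l = foldr wedge (map \<theta> l) gone"

definition inversions :: "'g::linorder set \<Rightarrow> 'g set \<Rightarrow> nat" where
  "inversions A B = card {(g, h). g \<in> A \<and> h \<in> B \<and> h < g}"

section \<open>The wedge product and its signs\<close>

lemma wedge_inversions:
  "wedge \<alpha> \<beta> I = (\<Sum>K\<in>Pow I. (- 1) ^ inversions K (I - K) * \<alpha> K * \<beta> (I - K))"
  by (simp add: wedge_def inversions_def)

lemma inversions_Un_left:
  assumes "finite A" "finite A'" "finite B" "A \<inter> A' = {}"
  shows "inversions (A \<union> A') B = inversions A B + inversions A' B"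
proof -
  have "{(g, h). g \<in> A \<union> A' \<and> h \<in> B \<and> h < g} =
      {(g, h). g \<in> A \<and> h \<in> B \<and> h < g} \<union> {(g, h). g \<in> A' \<and> h \<in> B \<and> h < g}" by auto
  moreover have "finite {(g, h). g \<in> A \<and> h \<in> B \<and> h < g}" "finite {(g, h). g \<in> A' \<and> h \<in> B \<and> h < g}"
    by (rule finite_subset[of _ "A \<times> B"] finite_subset[of _ "A' \<times> B"]; use assms in auto)+
  ultimately show ?thesis unfolding inversions_def using assms(4)
    by (simp only:) (rule card_Un_disjoint; auto)
qed

lemma inversions_Un_right:
  assumes "finite A" "finite B" "finite B'" "B \<inter> B' = {}"
  shows "inversions A (B \<union> B') = inversions A B + inversions A B'"
proof -
  have "{(g, h). g \<in> A \<and> h \<in> B \<union> B' \<and> h < g} =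
      {(g, h). g \<in> A \<and> h \<in> B \<and> h < g} \<union> {(g, h). g \<in> A \<and> h \<in> B' \<and> h < g}" by auto
  moreover have "finite {(g, h). g \<in> A \<and> h \<in> B \<and> h < g}" "finite {(g, h). g \<in> A \<and> h \<in> B' \<and> h < g}"
    by (rule finite_subset[of _ "A \<times> B"] finite_subset[of _ "A \<times> B'"]; use assms in auto)+
  ultimately show ?thesis unfolding inversions_def using assms(4)
    by (simp only:) (rule card_Un_disjoint; auto)
qed

lemma wedge_infinite: "infinite I \<Longrightarrow> wedge \<alpha> \<beta> I = 0"
  by (simp add: wedge_inversions finite_Pow_iff)

lemma wedge_nonzeroD:
  assumes "wedge \<alpha> \<beta> I \<noteq> 0"
  shows "finite I \<and> (\<exists>K\<subseteq>I. \<alpha> K \<noteq> 0 \<and> \<beta> (I - K) \<noteq> 0)"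
proof -
  have "finite I" using assms wedge_infinite by blast
  moreover have "\<exists>K\<in>Pow I. (- 1) ^ inversions K (I - K) * \<alpha> K * \<beta> (I - K) \<noteq> 0"
    using assms unfolding wedge_inversions by (meson sum.neutral)
  ultimately show ?thesis by auto
qed

text \<open>Both sides are sums over the ways to divide \<open>I\<close> into three ordered parts,
  and in both the sign counts the inversions between each pair of parts.\<close>

lemma wedge_assoc: "wedge (wedge \<alpha> \<beta>) \<gamma> = wedge \<alpha> (wedge \<beta> \<gamma>)"
proof
  fix I
  show "wedge (wedge \<alpha> \<beta>) \<gamma> I = wedge \<alpha> (wedge \<beta> \<gamma>) I"
  proof (cases "finite I")
    case True
    let ?s = "\<lambda>A B. (- 1 :: real) ^ inversions A B"
    have "wedge (wedge \<alpha> \<beta>) \<gamma> I = (\<Sum>K\<in>Pow I. \<Sum>L\<in>Pow K.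
        ?s K (I - K) * (?s L (K - L) * \<alpha> L * \<beta> (K - L)) * \<gamma> (I - K))"
      unfolding wedge_inversions by (simp add: sum_distrib_left sum_distrib_right)
    also have "\<dots> = (\<Sum>(K, L)\<in>Sigma (Pow I) Pow.
        ?s K (I - K) * (?s L (K - L) * \<alpha> L * \<beta> (K - L)) * \<gamma> (I - K))"
      using True by (subst sum.Sigma) (auto intro: finite_subset)
    also have "\<dots> = (\<Sum>(L, N)\<in>Sigma (Pow I) (\<lambda>L. Pow (I - L)).
        ?s L (I - L) * \<alpha> L * (?s N (I - L - N) * \<beta> N * \<gamma> (I - L - N)))"
    \<comment> \<open>The pair \<open>(K, L)\<close> stands for the three parts \<open>L\<close>,
      \<open>K - L\<close> and \<open>I - K\<close>.\<close>
    proof (rule sum.reindex_bij_witness[of _ "\<lambda>(L, N). (L \<union> N, L)" "\<lambda>(K, L). (L, K - L)"], goal_cases)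
      case (5 x)
      then obtain K L where x: "x = (K, L)" "L \<subseteq> K" "K \<subseteq> I" by auto
      have fin: "finite K" "finite L" using x True by (auto intro: finite_subset)
      have "inversions (L \<union> (K - L)) (I - K) = inversions L (I - K) + inversions (K - L) (I - K)"
        by (rule inversions_Un_left) (use fin True in auto)
      moreover have "inversions L ((K - L) \<union> (I - K)) = inversions L (K - L) + inversions L (I - K)"
        by (rule inversions_Un_right) (use x fin True in auto)
      moreover have "L \<union> (K - L) = K" "(K - L) \<union> (I - K) = I - L" "I - L - (K - L) = I - K"
        using x by auto
      ultimately show ?case unfolding x(1) by (simp add: power_add)
    qed auto
    also have "\<dots> = wedge \<alpha> (wedge \<beta> \<gamma>) I"
      unfolding wedge_inversions using True
      by (subst sum.Sigma[symmetric]) (auto simp: sum_distrib_left mult.assoc intro: finite_subset)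
    finally show ?thesis .
  qed (simp add: wedge_infinite)
qed

lemma wedge_add_left: "wedge (\<lambda>I. \<alpha> I + \<beta> I) \<gamma> = (\<lambda>I. wedge \<alpha> \<gamma> I + wedge \<beta> \<gamma> I)"
  by (auto simp: wedge_inversions sum.distrib[symmetric] algebra_simps intro!: ext sum.cong)

lemma wedge_add_right: "wedge \<gamma> (\<lambda>I. \<alpha> I + \<beta> I) = (\<lambda>I. wedge \<gamma> \<alpha> I + wedge \<gamma> \<beta> I)"
  by (auto simp: wedge_inversions sum.distrib[symmetric] algebra_simps intro!: ext sum.cong)

lemma wedge_cmult_left: "wedge (\<lambda>I. c * \<alpha> I) \<gamma> = (\<lambda>I. c * wedge \<alpha> \<gamma> I)"
  by (auto simp: wedge_inversions sum_distrib_left algebra_simps intro!: ext sum.cong)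

lemma wedge_cmult_right: "wedge \<gamma> (\<lambda>I. c * \<alpha> I) = (\<lambda>I. c * wedge \<gamma> \<alpha> I)"
  by (auto simp: wedge_inversions sum_distrib_left algebra_simps intro!: ext sum.cong)

lemma wedge_zero_left [simp]: "wedge (\<lambda>I. 0) \<gamma> = (\<lambda>I. 0)"
  by (auto simp: wedge_inversions)

lemma wedge_zero_right [simp]: "wedge \<gamma> (\<lambda>I. 0) = (\<lambda>I. 0)"
  by (auto simp: wedge_inversions)

lemma wedge_sum_left: "wedge (\<lambda>I. \<Sum>k\<in>A. \<alpha> k I) \<gamma> = (\<lambda>I. \<Sum>k\<in>A. wedge (\<alpha> k) \<gamma> I)"
  by (induction A rule: infinite_finite_induct) (auto simp: wedge_add_left)

lemma wedge_sum_right: "wedge \<gamma> (\<lambda>I. \<Sum>k\<in>A. \<alpha> k I) = (\<lambda>I. \<Sum>k\<in>A. wedge \<gamma> (\<alpha> k) I)"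
  by (induction A rule: infinite_finite_induct) (auto simp: wedge_add_right)

lemma wedge_gen:
  "wedge (gen j) \<alpha> I =
    (if finite I \<and> j \<in> I then (- 1) ^ card {h\<in>I. h < j} * \<alpha> (I - {j}) else 0)"
proof (cases "finite I")
  case True
  have "wedge (gen j) \<alpha> I =
      (\<Sum>K\<in>Pow I. if K = {j} then (- 1) ^ inversions {j} (I - {j}) * \<alpha> (I - {j}) else 0)"
    unfolding wedge_inversions gen_def by (rule sum.cong) auto
  moreover have "{(g, h). g \<in> {j} \<and> h \<in> I - {j} \<and> h < g} = Pair j ` {h\<in>I. h < j}" by auto
  then have "inversions {j} (I - {j}) = card {h\<in>I. h < j}"
    unfolding inversions_def by (simp add: card_image inj_on_def)
  ultimately show ?thesis using True by (simp add: sum.delta finite_Pow_iff)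
qed (simp add: wedge_infinite)

text \<open>A generator outside \<open>I\<close> cannot occur in a term at \<open>I\<close>. So a
  finite sum suffices although \<theta> may have infinite support, and any finite set containing
  \<open>I\<close> may serve as \<open>B\<close>.\<close>

lemma wedge_deg1:
  assumes "deg1 \<theta>" "finite B" "I \<subseteq> B"
  shows "wedge \<theta> \<alpha> I = (\<Sum>j\<in>B. \<theta> {j} * wedge (gen j) \<alpha> I)"
proof -
  have I: "finite I" using assms finite_subset by blast
  have "wedge \<theta> \<alpha> I = (\<Sum>K\<in>(\<lambda>j. {j}) ` I. (- 1) ^ inversions K (I - K) * \<theta> K * \<alpha> (I - K))"
    unfolding wedge_inversions
  proof (rule sum.mono_neutral_right)
    show "\<forall>K\<in>Pow I - (\<lambda>j. {j}) ` I. (- 1) ^ inversions K (I - K) * \<theta> K * \<alpha> (I - K) = 0"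
      using assms(1) by (fastforce simp: deg1_def is_singleton_def)
  qed (use I in auto)
  also have "\<dots> = (\<Sum>j\<in>I. (- 1) ^ inversions {j} (I - {j}) * \<theta> {j} * \<alpha> (I - {j}))"
    by (subst sum.reindex) (auto simp: inj_on_def)
  also have "\<dots> = (\<Sum>j\<in>I. \<theta> {j} * wedge (gen j) \<alpha> I)"
  proof (rule sum.cong[OF refl])
    fix j assume j: "j \<in> I"
    have "{(g, h). g \<in> {j} \<and> h \<in> I - {j} \<and> h < g} = Pair j ` {h\<in>I. h < j}" by auto
    then have "inversions {j} (I - {j}) = card {h\<in>I. h < j}"
      unfolding inversions_def by (simp add: card_image inj_on_def)
    then show "(- 1) ^ inversions {j} (I - {j}) * \<theta> {j} * \<alpha> (I - {j}) = \<theta> {j} * wedge (gen j) \<alpha> I"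
      using I j by (simp add: wedge_gen)
  qed
  also have "\<dots> = (\<Sum>j\<in>B. \<theta> {j} * wedge (gen j) \<alpha> I)"
    by (rule sum.mono_neutral_left) (use assms in \<open>auto simp: wedge_gen\<close>)
  finally show ?thesis .
qed

lemma card_less_remove:
  fixes i j :: "'g::linorder"
  assumes "finite I" "i \<in> I" "i < j"
  shows "card {h\<in>I. h < j} = Suc (card {h\<in>I - {i}. h < j})"
proof -
  have "{h\<in>I. h < j} = insert i {h\<in>I - {i}. h < j}" using assms by auto
  then show ?thesis using assms by simp
qed

lemma card_less_remove':
  fixes i j :: "'g::linorder"
  shows "\<not> i < j \<Longrightarrow> card {h\<in>I - {i}. h < j} = card {h\<in>I. h < j}"
  by (rule arg_cong[of _ _ card]) auto

text \<open>Taking out the smaller generator lowers by one the number of generators below the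
  larger, while taking out the larger does not affect the count for the smaller. The two orders
  therefore differ by exactly one sign.\<close>

lemma wedge_gen_anticommute:
  fixes i j :: "'g::linorder"
  shows "wedge (gen i) (wedge (gen j) \<alpha>) I = - wedge (gen j) (wedge (gen i) \<alpha>) I"
proof -
  have *: "wedge (gen i) (wedge (gen j) \<alpha>) I = - wedge (gen j) (wedge (gen i) \<alpha>) I" if "i < j" for i j :: 'g
  proof (cases "finite I \<and> i \<in> I \<and> j \<in> I")
    case True
    then have "card {h\<in>I. h < j} = Suc (card {h\<in>I - {i}. h < j})"
      "card {h\<in>I - {j}. h < i} = card {h\<in>I. h < i}"
      using card_less_remove[of I i j] card_less_remove'[of j i I] that by auto
    moreover have "I - {i} - {j} = I - {j} - {i}" by auto
    ultimately show ?thesis using True that by (simp add: wedge_gen)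
  qed (auto simp: wedge_gen)
  show ?thesis
  proof (cases i j rule: linorder_cases)
    case equal
    then show ?thesis by (simp add: wedge_gen)
  qed (use *[of i j] *[of j i] in simp_all)
qed

lemma wedge_deg1_anticommute:
  assumes "deg1 \<theta>" "deg1 \<eta>"
  shows "wedge \<theta> (wedge \<eta> \<alpha>) = (\<lambda>I. - wedge \<eta> (wedge \<theta> \<alpha>) I)"
proof
  fix I
  show "wedge \<theta> (wedge \<eta> \<alpha>) I = - wedge \<eta> (wedge \<theta> \<alpha>) I"
  proof (cases "finite I")
    case True
    have expand: "wedge \<theta> (wedge \<eta> \<alpha>) I =
        (\<Sum>a\<in>I. \<Sum>b\<in>I. \<theta> {a} * \<eta> {b} * wedge (gen a) (wedge (gen b) \<alpha>) I)"
      if "deg1 \<theta>" "deg1 \<eta>" for \<theta> \<eta>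
    proof -
      have "wedge (gen a) (wedge \<eta> \<alpha>) I = (\<Sum>b\<in>I. \<eta> {b} * wedge (gen a) (wedge (gen b) \<alpha>) I)" for a
        using True unfolding wedge_gen[of a]
        by (subst wedge_deg1[OF that(2) True]) (auto simp: sum_distrib_left algebra_simps)
      then show ?thesis
        using wedge_deg1[OF that(1) True order_refl, of "wedge \<eta> \<alpha>"]
        by (simp add: sum_distrib_left mult.assoc)
    qed
    have "wedge \<theta> (wedge \<eta> \<alpha>) I = (\<Sum>b\<in>I. \<Sum>a\<in>I. \<theta> {a} * \<eta> {b} * wedge (gen a) (wedge (gen b) \<alpha>) I)"
      unfolding expand[OF assms] by (rule sum.swap)
    also have "\<dots> = - wedge \<eta> (wedge \<theta> \<alpha>) I"
      unfolding expand[OF assms(2,1)] sum_negf[symmetric]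
      by (intro sum.cong refl, subst wedge_gen_anticommute) simp
    finally show ?thesis .
  qed (simp add: wedge_infinite)
qed

lemma wedge_deg1_self: "deg1 \<theta> \<Longrightarrow> wedge \<theta> (wedge \<theta> \<alpha>) = (\<lambda>I. 0)"
  using wedge_deg1_anticommute[of \<theta> \<theta> \<alpha>] by (auto simp: fun_eq_iff)

lemma wedge_gone: "(\<And>I. \<alpha> I \<noteq> 0 \<Longrightarrow> finite I) \<Longrightarrow> wedge gone \<alpha> = \<alpha>"
proof
  fix I assume *: "\<And>I. \<alpha> I \<noteq> 0 \<Longrightarrow> finite I"
  show "wedge gone \<alpha> I = \<alpha> I"
  proof (cases "finite I")
    case True
    have "wedge gone \<alpha> I = (\<Sum>K\<in>Pow I. if K = {} then \<alpha> I else 0)"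
      unfolding wedge_inversions gone_def by (rule sum.cong) (auto simp: inversions_def)
    then show ?thesis using True by (simp add: sum.delta finite_Pow_iff)
  qed (use * wedge_infinite in metis)
qed

lemma wedge_gone_right: "(\<And>I. \<alpha> I \<noteq> 0 \<Longrightarrow> finite I) \<Longrightarrow> wedge \<alpha> gone = \<alpha>"
proof
  fix I assume *: "\<And>I. \<alpha> I \<noteq> 0 \<Longrightarrow> finite I"
  show "wedge \<alpha> gone I = \<alpha> I"
  proof (cases "finite I")
    case True
    have "inversions I {} = 0" by (simp add: inversions_def)
    then have "wedge \<alpha> gone I = (\<Sum>K\<in>Pow I. if K = I then \<alpha> I else 0)"
      unfolding wedge_inversions gone_def by (intro sum.cong) auto
    then show ?thesis using True by (simp add: sum.delta finite_Pow_iff)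
  qed (use * wedge_infinite in metis)
qed

lemma deg1_gen [simp]: "deg1 (gen j)"
  by (simp add: deg1_def gen_def)

lemma deg1_add: "deg1 \<alpha> \<Longrightarrow> deg1 \<beta> \<Longrightarrow> deg1 (\<lambda>I. \<alpha> I + \<beta> I)"
  unfolding deg1_def by force

lemma deg1_cmult: "deg1 \<alpha> \<Longrightarrow> deg1 (\<lambda>I. c * \<alpha> I)"
  unfolding deg1_def by force

lemma deg1_diff: "deg1 \<alpha> \<Longrightarrow> deg1 \<beta> \<Longrightarrow> deg1 (\<lambda>I. \<alpha> I - \<beta> I)"
  unfolding deg1_def by force

lemma deg1_sum: "(\<And>k. k \<in> A \<Longrightarrow> deg1 (\<alpha> k)) \<Longrightarrow> deg1 (\<lambda>I. \<Sum>k\<in>A. \<alpha> k I)"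
  unfolding deg1_def by (metis (mono_tags, lifting) sum.neutral)

subsection \<open>Elements of finite support\<close>

lemma fin_supp_gone [simp]: "fin_supp gone" and fin_supp_gen [simp]: "fin_supp (gen j)"
  and fin_supp_zero [simp]: "fin_supp (\<lambda>I. 0)"
  by (auto simp: fin_supp_def gone_def gen_def)

lemma fin_supp_subset:
  "finite B \<Longrightarrow> (\<And>K. \<alpha> K \<noteq> 0 \<Longrightarrow> K \<in> B \<and> finite K) \<Longrightarrow> fin_supp \<alpha>"
  unfolding fin_supp_def using finite_subset[of "{K. \<alpha> K \<noteq> 0}" B] by blast

lemma fin_supp_finite: "fin_supp \<alpha> \<Longrightarrow> \<alpha> I \<noteq> 0 \<Longrightarrow> finite I"
  by (simp add: fin_supp_def)

lemma fin_supp_add: "fin_supp \<alpha> \<Longrightarrow> fin_supp \<beta> \<Longrightarrow> fin_supp (\<lambda>I. \<alpha> I + \<beta> I)"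
  by (rule fin_supp_subset[of "{K. \<alpha> K \<noteq> 0} \<union> {K. \<beta> K \<noteq> 0}"]) (auto simp: fin_supp_def, force)

lemma fin_supp_diff: "fin_supp \<alpha> \<Longrightarrow> fin_supp \<beta> \<Longrightarrow> fin_supp (\<lambda>I. \<alpha> I - \<beta> I)"
  by (rule fin_supp_subset[of "{K. \<alpha> K \<noteq> 0} \<union> {K. \<beta> K \<noteq> 0}"]) (auto simp: fin_supp_def, force)

lemma fin_supp_cmult: "fin_supp \<alpha> \<Longrightarrow> fin_supp (\<lambda>I. c * \<alpha> I)"
  by (rule fin_supp_subset[of "{K. \<alpha> K \<noteq> 0}"]) (auto simp: fin_supp_def)

lemma fin_supp_sum:
  "(\<And>k. k \<in> A \<Longrightarrow> fin_supp (\<alpha> k)) \<Longrightarrow> fin_supp (\<lambda>I. \<Sum>k\<in>A. \<alpha> k I)"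
  by (induction A rule: infinite_finite_induct) (auto intro: fin_supp_add)

lemma fin_supp_wedge:
  assumes "fin_supp \<alpha>" "fin_supp \<beta>"
  shows "fin_supp (wedge \<alpha> \<beta>)"
proof (rule fin_supp_subset)
  show "finite ((\<lambda>(K, L). K \<union> L) ` ({K. \<alpha> K \<noteq> 0} \<times> {K. \<beta> K \<noteq> 0}))"
    using assms by (auto simp: fin_supp_def)
  fix I assume "wedge \<alpha> \<beta> I \<noteq> 0"
  then obtain K where K: "finite I" "K \<subseteq> I" "\<alpha> K \<noteq> 0" "\<beta> (I - K) \<noteq> 0" using wedge_nonzeroD by blast
  then have "I = K \<union> (I - K)" by auto
  then show "I \<in> (\<lambda>(K, L). K \<union> L) ` ({K. \<alpha> K \<noteq> 0} \<times> {K. \<beta> K \<noteq> 0}) \<and> finite I"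
    using K by (auto simp: image_iff)
qed

lemma grass_expand:
  "finite B \<Longrightarrow> {K. \<alpha> K \<noteq> 0} \<subseteq> B \<Longrightarrow> \<alpha> = (\<lambda>I. \<Sum>K\<in>B. \<alpha> K * gmono K I)"
proof
  fix I assume B: "finite B" "{K. \<alpha> K \<noteq> 0} \<subseteq> B"
  have "(\<Sum>K\<in>B. \<alpha> K * gmono K I) = (\<Sum>K\<in>B. if K = I then \<alpha> I else 0)"
    by (rule sum.cong) (auto simp: gmono_def)
  then show "\<alpha> I = (\<Sum>K\<in>B. \<alpha> K * gmono K I)" using B by (auto simp: sum.delta)
qed

lemma gmono_insert:
  assumes "finite A" "\<And>a. a \<in> A \<Longrightarrow> b < a"
  shows "gmono (insert b A) = wedge (gen b) (gmono A)"
proof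
  fix I
  have b: "b \<notin> A" using assms(2) by auto
  show "gmono (insert b A) I = wedge (gen b) (gmono A) I"
  proof (cases "I = insert b A")
    case True
    have e: "{h\<in>insert b A. h < b} = {}" using assms(2) by force
    have e': "insert b A - {b} = A" using b by auto
    show ?thesis unfolding True wedge_gen gmono_def e e' using assms(1) by simp
  next
    case False
    then have "\<not> (b \<in> I \<and> I - {b} = A)" by auto
    then show ?thesis unfolding wedge_gen gmono_def using False by auto
  qed
qed

lemma fin_supp_gmono: "finite K \<Longrightarrow> fin_supp (gmono K)"
  by (auto simp: fin_supp_def gmono_def)

text \<open>A monomial is built up by multiplying with its smallest generator last, which costs no
  sign (\<open>gmono_insert\<close>). Identities for \<open>gsubst\<close> thereby reduce to
  multiplication by one generator.\<close>

lemma fin_supp_induct [consumes 1, case_names gone gen add cmult]: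
  fixes \<alpha> :: "'g::linorder grass"
  assumes "fin_supp \<alpha>"
    and one: "P gone"
    and gen: "\<And>j \<alpha>. fin_supp \<alpha> \<Longrightarrow> P \<alpha> \<Longrightarrow> P (wedge (gen j) \<alpha>)"
    and add: "\<And>\<alpha> \<beta>. fin_supp \<alpha> \<Longrightarrow> fin_supp \<beta> \<Longrightarrow> P \<alpha> \<Longrightarrow> P \<beta> \<Longrightarrow> P (\<lambda>I. \<alpha> I + \<beta> I)"
    and cmult: "\<And>c \<alpha>. fin_supp \<alpha> \<Longrightarrow> P \<alpha> \<Longrightarrow> P (\<lambda>I. c * \<alpha> I)"
  shows "P \<alpha>"
proof -
  have mono: "P (gmono K)" if "finite K" for K
    using that
  proof (induction K rule: finite_linorder_min_induct)
    case empty
    have "gmono {} = (gone :: 'g grass)" by (auto simp: gmono_def gone_def)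
    then show ?case using one by simp
  next
    case (insert b A)
    then show ?case using gen[OF fin_supp_gmono] gmono_insert by metis
  qed
  have sum: "P (\<lambda>I. \<Sum>K\<in>B. \<alpha> K * gmono K I)" if "finite B" "\<And>K. K \<in> B \<Longrightarrow> finite K" for B
    using that
  proof (induction B rule: finite_induct)
    case empty
    show ?case using cmult[OF fin_supp_gone one, of 0] by simp
  next
    case (insert K B)
    then have "P (\<lambda>I. \<alpha> K * gmono K I + (\<Sum>K\<in>B. \<alpha> K * gmono K I))"
      by (intro add cmult mono fin_supp_cmult fin_supp_gmono fin_supp_sum) auto
    then show ?case using insert.hyps by simp
  qed
  have "P (\<lambda>I. \<Sum>K\<in>{K. \<alpha> K \<noteq> 0}. \<alpha> K * gmono K I)"
    using assms(1) by (intro sum) (auto simp: fin_supp_def)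
  then show ?thesis
    using grass_expand[of "{K. \<alpha> K \<noteq> 0}" \<alpha>] assms(1) by (simp add: fin_supp_def)
qed

subsection \<open>Substitution\<close>

lemma gprod_Nil [simp]: "gprod \<theta> [] = gone"
  and gprod_Cons [simp]: "gprod \<theta> (g # l) = wedge (\<theta> g) (gprod \<theta> l)"
  by (simp_all add: gprod_def)

lemma gsubst_gprod: "gsubst \<theta> \<alpha> I = (\<Sum>K | \<alpha> K \<noteq> 0. \<alpha> K * gprod \<theta> (sorted_list_of_set K) I)"
  by (simp add: gsubst_def gprod_def)

lemma gsubst_sum:
  "finite B \<Longrightarrow> {K. \<alpha> K \<noteq> 0} \<subseteq> B \<Longrightarrow>
    gsubst \<theta> \<alpha> = (\<lambda>I. \<Sum>K\<in>B. \<alpha> K * gprod \<theta> (sorted_list_of_set K) I)"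
  unfolding gsubst_gprod by (intro ext sum.mono_neutral_left) auto

text \<open>Images of generators anticommute, so a new factor moves to its place in the sorted
  product with one sign per factor passed; a repeated factor gives zero.\<close>

lemma wedge_gprod:
  assumes \<theta>: "\<And>g. deg1 (\<theta> g)" and "sorted l" "distinct l"
  shows "wedge (\<theta> j) (gprod \<theta> l) =
    (\<lambda>I. if j \<in> set l then 0 else (- 1) ^ card {h\<in>set l. h < j} * gprod \<theta> (insort j l) I)"
  using assms(2,3)
proof (induction l)
  case (Cons x l)
  have x: "x \<notin> set l" "\<And>h. h \<in> set l \<Longrightarrow> x < h" using Cons.prems by (auto simp: order_le_less)
  consider "j < x" | "j = x" | "x < j" by fastforce
  then show ?case
  proof cases
    case 1
    then have e: "{h\<in>set (x # l). h < j} = {}" and j: "j \<notin> set (x # l)" using x by force+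
    have "insort j (x # l) = j # x # l" using 1 by (simp add: order_less_imp_le)
    then show ?thesis unfolding e using j by (simp only: gprod_Cons card.empty power_0 if_False mult_1)
  next
    case 2
    then show ?thesis using wedge_deg1_self[OF \<theta>] by simp
  next
    case 3
    have c: "card {h\<in>set (x # l). h < j} = Suc (card {h\<in>set l. h < j})"
      using 3 x(1) card_less_remove[of "set (x # l)" x j] by simp
    have IH: "wedge (\<theta> j) (gprod \<theta> l) =
        (\<lambda>I. if j \<in> set l then 0 else (- 1) ^ card {h\<in>set l. h < j} * gprod \<theta> (insort j l) I)"
      using Cons by simp
    have anti: "wedge (\<theta> j) (gprod \<theta> (x # l)) = (\<lambda>I. - wedge (\<theta> x) (wedge (\<theta> j) (gprod \<theta> l)) I)"
      unfolding gprod_Cons by (rule wedge_deg1_anticommute[OF \<theta> \<theta>])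
    show ?thesis
    proof (cases "j \<in> set l")
      case True
      then show ?thesis unfolding anti IH by simp
    next
      case False
      then have e: "j \<notin> set (x # l)" "insort j (x # l) = x # insort j l" using 3 by auto
      show ?thesis unfolding anti unfolding IH c e(2) if_not_P[OF False] if_not_P[OF e(1)] wedge_cmult_right gprod_Cons
        by simp
    qed
  qed
qed simp

text \<open>\<open>gsubst\<close> is defined through sorted monomials, and this is the step that
  makes it multiplicative: both sides acquire the same sign when \<open>j\<close> is sorted in, and
  both lose the monomials that contain \<open>j\<close> already.\<close>

lemma gsubst_wedge_gen:
  fixes \<theta> :: "'g::linorder \<Rightarrow> 'h::linorder grass"
  assumes \<theta>: "\<And>g. deg1 (\<theta> g)" and "fin_supp \<alpha>"
  shows "gsubst \<theta> (wedge (gen j) \<alpha>) = wedge (\<theta> j) (gsubst \<theta> \<alpha>)"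
proof
  fix I
  let ?B = "{K. \<alpha> K \<noteq> 0}" and ?C = "{K. \<alpha> K \<noteq> 0 \<and> j \<notin> K}"
  have B: "finite ?B" "finite ?C" "\<And>K. K \<in> ?B \<Longrightarrow> finite K"
    using assms(2) by (auto simp: fin_supp_def intro: finite_subset[of _ ?B])
  have "{K. wedge (gen j) \<alpha> K \<noteq> 0} \<subseteq> insert j ` ?C"
  proof
    fix K assume "K \<in> {K. wedge (gen j) \<alpha> K \<noteq> 0}"
    then have "j \<in> K" "\<alpha> (K - {j}) \<noteq> 0" by (auto simp: wedge_gen split: if_splits)
    then show "K \<in> insert j ` ?C" by (intro image_eqI[of _ _ "K - {j}"]) auto
  qed
  then have "gsubst \<theta> (wedge (gen j) \<alpha>) I =
      (\<Sum>K\<in>insert j ` ?C. wedge (gen j) \<alpha> K * gprod \<theta> (sorted_list_of_set K) I)"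
    using B by (subst gsubst_sum) auto
  also have "\<dots> = (\<Sum>K\<in>?C. wedge (gen j) \<alpha> (insert j K) * gprod \<theta> (sorted_list_of_set (insert j K)) I)"
    by (subst sum.reindex) (auto simp: inj_on_def)
  also have "\<dots> = (\<Sum>K\<in>?C. \<alpha> K * wedge (\<theta> j) (gprod \<theta> (sorted_list_of_set K)) I)"
  proof (rule sum.cong[OF refl])
    fix K assume K: "K \<in> ?C"
    then have fin: "finite K" and j: "insert j K - {j} = K" "j \<notin> K" using B by auto
    have "{h \<in> insert j K. h < j} = {h\<in>K. h < j}" by auto
    then show "wedge (gen j) \<alpha> (insert j K) * gprod \<theta> (sorted_list_of_set (insert j K)) I =
        \<alpha> K * wedge (\<theta> j) (gprod \<theta> (sorted_list_of_set K)) I"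
      using fin j wedge_gprod[where \<theta> = \<theta>, OF \<theta>, of "sorted_list_of_set K" j] by (simp add: wedge_gen)
  qed
  also have "\<dots> = (\<Sum>K\<in>?B. \<alpha> K * wedge (\<theta> j) (gprod \<theta> (sorted_list_of_set K)) I)"
  proof (rule sum.mono_neutral_left)
    show "\<forall>K\<in>?B - ?C. \<alpha> K * wedge (\<theta> j) (gprod \<theta> (sorted_list_of_set K)) I = 0"
      using B wedge_gprod[where \<theta> = \<theta>, OF \<theta>, of _ j] by auto
  qed (use B in auto)
  also have "\<dots> = wedge (\<theta> j) (gsubst \<theta> \<alpha>) I"
    using gsubst_sum[OF B(1) order_refl, of \<theta>]
    by (simp add: wedge_sum_right wedge_cmult_right)
  finally show "gsubst \<theta> (wedge (gen j) \<alpha>) I = wedge (\<theta> j) (gsubst \<theta> \<alpha>) I" .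
qed

lemma gsubst_gone: "gsubst \<theta> gone = gone"
  by (subst gsubst_sum[of "{{}}"]) (auto simp: gone_def)

lemma gsubst_zero [simp]: "gsubst \<theta> (\<lambda>I. 0) = (\<lambda>I. 0)"
  by (auto simp: gsubst_gprod)

lemma gsubst_add:
  assumes "fin_supp \<alpha>" "fin_supp \<beta>"
  shows "gsubst \<theta> (\<lambda>I. \<alpha> I + \<beta> I) = (\<lambda>I. gsubst \<theta> \<alpha> I + gsubst \<theta> \<beta> I)"
proof -
  let ?B = "{K. \<alpha> K \<noteq> 0} \<union> {K. \<beta> K \<noteq> 0}"
  have B: "finite ?B" using assms by (auto simp: fin_supp_def)
  have sub: "{K. \<alpha> K \<noteq> 0} \<subseteq> ?B" "{K. \<beta> K \<noteq> 0} \<subseteq> ?B" "{K. \<alpha> K + \<beta> K \<noteq> 0} \<subseteq> ?B" by auto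
  show ?thesis
    by (simp add: gsubst_sum[OF B sub(1)] gsubst_sum[OF B sub(2)] gsubst_sum[OF B sub(3)]
        sum.distrib algebra_simps del: Un_iff)
qed

lemma gsubst_cmult:
  assumes "fin_supp \<alpha>"
  shows "gsubst \<theta> (\<lambda>I. c * \<alpha> I) = (\<lambda>I. c * gsubst \<theta> \<alpha> I)"
proof -
  have B: "finite {K. \<alpha> K \<noteq> 0}" using assms by (auto simp: fin_supp_def)
  have "{K. c * \<alpha> K \<noteq> 0} \<subseteq> {K. \<alpha> K \<noteq> 0}" by auto
  then show ?thesis unfolding gsubst_sum[OF B \<open>_ \<subseteq> _\<close>] gsubst_sum[OF B order_refl]
    by (simp add: sum_distrib_left mult.assoc)
qed

lemma gsubst_minus: "fin_supp \<alpha> \<Longrightarrow> gsubst \<theta> (\<lambda>I. - \<alpha> I) = (\<lambda>I. - gsubst \<theta> \<alpha> I)"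
  using gsubst_cmult[of \<alpha> \<theta> "-1"] by simp

lemma gsubst_diff:
  assumes "fin_supp \<alpha>" "fin_supp \<beta>"
  shows "gsubst \<theta> (\<lambda>I. \<alpha> I - \<beta> I) = (\<lambda>I. gsubst \<theta> \<alpha> I - gsubst \<theta> \<beta> I)"
  using gsubst_add[OF assms(1) fin_supp_cmult[OF assms(2), of "-1"], of \<theta>]
    gsubst_cmult[OF assms(2), of \<theta> "-1"] by simp

lemma gsubst_setsum:
  assumes "\<And>k. k \<in> A \<Longrightarrow> fin_supp (\<alpha> k)"
  shows "gsubst \<theta> (\<lambda>I. \<Sum>k\<in>A. \<alpha> k I) = (\<lambda>I. \<Sum>k\<in>A. gsubst \<theta> (\<alpha> k) I)"
  using assms
  by (induction A rule: infinite_finite_induct) (simp_all add: gsubst_add fin_supp_sum)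

lemma gsubst_cong:
  assumes "fin_supp \<alpha>" "\<And>g K. \<alpha> K \<noteq> 0 \<Longrightarrow> g \<in> K \<Longrightarrow> \<theta> g = \<theta>' g"
  shows "gsubst \<theta> \<alpha> = gsubst \<theta>' \<alpha>"
proof -
  have "gprod \<theta> (sorted_list_of_set K) = gprod \<theta>' (sorted_list_of_set K)" if "\<alpha> K \<noteq> 0" for K
    using assms that unfolding gprod_def
    by (metis (no_types, lifting) fin_supp_finite list.map_cong0 set_sorted_list_of_set)
  then show ?thesis unfolding gsubst_gprod by (auto intro!: sum.cong)
qed

lemma gsubst_gen:
  assumes "\<And>I. \<theta> j I \<noteq> 0 \<Longrightarrow> finite I"
  shows "gsubst \<theta> (gen j) = \<theta> j"
proof -
  have "gsubst \<theta> (gen j) = wedge (\<theta> j) gone"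
    by (subst gsubst_sum[of "{{j}}"]) (auto simp: gen_def)
  also have "\<dots> = \<theta> j" by (rule wedge_gone_right) (use assms in auto)
  finally show ?thesis .
qed

lemma deg1_finite: "deg1 \<theta> \<Longrightarrow> \<theta> I \<noteq> 0 \<Longrightarrow> finite I"
  unfolding deg1_def is_singleton_def by auto

lemma fin_supp_gprod: "(\<And>g. g \<in> set l \<Longrightarrow> fin_supp (\<theta> g)) \<Longrightarrow> fin_supp (gprod \<theta> l)"
  by (induction l) (auto intro: fin_supp_wedge)

lemma fin_supp_gsubst:
  assumes "fin_supp \<alpha>" "\<And>K g. \<alpha> K \<noteq> 0 \<Longrightarrow> g \<in> K \<Longrightarrow> fin_supp (\<theta> g)"
  shows "fin_supp (gsubst \<theta> \<alpha>)"
proof -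
  have "gsubst \<theta> \<alpha> = (\<lambda>I. \<Sum>K\<in>{K. \<alpha> K \<noteq> 0}. \<alpha> K * gprod \<theta> (sorted_list_of_set K) I)"
    by (rule gsubst_sum) (use assms in \<open>auto simp: fin_supp_def\<close>)
  then show ?thesis using assms
    by (auto intro!: fin_supp_sum fin_supp_cmult fin_supp_gprod dest: fin_supp_finite)
qed

lemma gsubst_wedge:
  assumes \<theta>: "\<And>g. deg1 (\<theta> g)" and "fin_supp \<alpha>" "fin_supp \<beta>"
    and fs: "\<And>g. fin_supp (\<theta> g)"
  shows "gsubst \<theta> (wedge \<alpha> \<beta>) = wedge (gsubst \<theta> \<alpha>) (gsubst \<theta> \<beta>)"
  using assms(2)
proof (induction rule: fin_supp_induct)
  case gone
  have "fin_supp (gsubst \<theta> \<beta>)" using assms by (intro fin_supp_gsubst) auto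
  then show ?case using assms by (simp add: wedge_gone gsubst_gone fin_supp_finite)
next
  case (gen j \<alpha>)
  then show ?case using assms
    by (simp add: wedge_assoc gsubst_wedge_gen[OF \<theta>] fin_supp_wedge)
next
  case (add \<alpha> \<alpha>')
  then show ?case using assms by (simp add: wedge_add_left gsubst_add fin_supp_wedge)
next
  case (cmult c \<alpha>)
  then show ?case using assms by (simp add: wedge_cmult_left gsubst_cmult fin_supp_wedge)
qed

lemma deg1_wedge_gen_expand:
  assumes "deg1 \<alpha>" "fin_supp \<alpha>"
  shows "\<exists>B. finite B \<and> \<alpha> = (\<lambda>I. \<Sum>j\<in>B. \<alpha> {j} * gen j I)"
proof -
  let ?B = "{j. \<alpha> {j} \<noteq> 0}"
  have "finite ((\<lambda>j. {j}) -` {K. \<alpha> K \<noteq> 0})"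
    by (rule finite_vimageI) (use assms in \<open>auto simp: fin_supp_def\<close>)
  then have B: "finite ?B" by (simp add: vimage_def)
  have "{K. \<alpha> K \<noteq> 0} \<subseteq> (\<lambda>j. {j}) ` ?B"
    using assms(1) by (auto simp: deg1_def is_singleton_def)
  then have "\<alpha> = (\<lambda>I. \<Sum>K\<in>(\<lambda>j. {j}) ` ?B. \<alpha> K * gmono K I)"
    using B by (intro grass_expand) auto
  also have "\<dots> = (\<lambda>I. \<Sum>j\<in>?B. \<alpha> {j} * gen j I)"
    by (subst sum.reindex) (auto simp: inj_on_def gmono_def gen_def)
  finally show ?thesis using B by blast
qed

lemma deg1_gsubst:
  assumes "\<And>g. deg1 (\<theta> g)" "deg1 \<alpha>" "fin_supp \<alpha>"
  shows "deg1 (gsubst \<theta> \<alpha>)"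
proof -
  obtain B where B: "finite B" "\<alpha> = (\<lambda>I. \<Sum>j\<in>B. \<alpha> {j} * gen j I)"
    using deg1_wedge_gen_expand[OF assms(2,3)] by auto
  have "gsubst \<theta> \<alpha> = (\<lambda>I. \<Sum>j\<in>B. \<alpha> {j} * \<theta> j I)"
    by (subst B(2), subst gsubst_setsum)
      (auto intro: fin_supp_cmult simp: gsubst_cmult gsubst_gen deg1_finite[OF assms(1)])
  then show ?thesis using assms(1) by (auto intro!: deg1_sum deg1_cmult)
qed

lemma gsubst_gsubst:
  assumes \<theta>: "\<And>g. deg1 (\<theta> g)" and \<eta>: "\<And>g. deg1 (\<eta> g)" "\<And>g. fin_supp (\<eta> g)"
    and "fin_supp \<alpha>"
  shows "gsubst \<theta> (gsubst \<eta> \<alpha>) = gsubst (\<lambda>g. gsubst \<theta> (\<eta> g)) \<alpha>"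
proof -
  have fs: "fin_supp (gsubst \<eta> \<alpha>)" if "fin_supp \<alpha>" for \<alpha> using that \<eta> by (intro fin_supp_gsubst) auto
  have d: "deg1 (gsubst \<theta> (\<eta> g))" for g by (intro deg1_gsubst \<theta> \<eta>)
  \<comment> \<open>\<open>\<eta> j\<close> is a finite combination of generators, so
    \<open>gsubst_wedge_gen\<close> extends to it by linearity.\<close>
  have lin: "gsubst \<theta> (wedge (\<eta> j) \<beta>) = wedge (gsubst \<theta> (\<eta> j)) (gsubst \<theta> \<beta>)" if "fin_supp \<beta>" for j \<beta>
  proof -
    obtain B where B: "finite B" "\<eta> j = (\<lambda>I. \<Sum>i\<in>B. \<eta> j {i} * gen i I)"
      using deg1_wedge_gen_expand[OF \<eta>(1) \<eta>(2)] by blast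
    show ?thesis using that
      by (subst (1 2) B(2)) (simp add: gsubst_setsum gsubst_cmult fin_supp_cmult fin_supp_wedge
          wedge_sum_left wedge_cmult_left gsubst_wedge_gen[OF \<theta>] gsubst_gen deg1_finite[OF \<theta>])
  qed
  show ?thesis using assms(4)
  proof (induction rule: fin_supp_induct)
    case (gen j \<alpha>)
    then show ?case by (simp add: gsubst_wedge_gen[OF \<eta>(1)] gsubst_wedge_gen[OF d] lin fs)
  qed (simp_all add: gsubst_gone gsubst_add gsubst_cmult fs)
qed

lemma gsubst_gen_id: "fin_supp \<alpha> \<Longrightarrow> gsubst gen \<alpha> = \<alpha>"
  by (induction rule: fin_supp_induct)
    (simp_all add: gsubst_gone gsubst_add gsubst_cmult gsubst_wedge_gen)

lemma gsubst_id:
  "fin_supp \<alpha> \<Longrightarrow> (\<And>g K. \<alpha> K \<noteq> 0 \<Longrightarrow> g \<in> K \<Longrightarrow> \<theta> g = gen g) \<Longrightarrow> gsubst \<theta> \<alpha> = \<alpha>"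
  using gsubst_cong[of \<alpha> \<theta> gen] gsubst_gen_id by metis

text \<open>Each factor contributes exactly one generator to \<open>I\<close>, and its membership in
  \<open>X\<close> is decided by that of the factor in \<open>Y\<close>. Counting degrees in this
  way replaces any explicit formula for the product.\<close>

lemma gprod_nonzeroD:
  assumes "\<And>g. g \<in> set l \<Longrightarrow> deg1 (\<theta> g)" "gprod \<theta> l I \<noteq> 0"
    and "\<And>g h. g \<in> set l \<Longrightarrow> \<theta> g {h} \<noteq> 0 \<Longrightarrow> h \<in> X \<longleftrightarrow> g \<in> Y"
  shows "finite I \<and> card (I \<inter> X) = length (filter (\<lambda>g. g \<in> Y) l) \<and>
    I \<subseteq> (\<Union>g\<in>set l. {h. \<theta> g {h} \<noteq> 0})"
  using assms
proof (induction l arbitrary: I)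
  case Nil
  then show ?case by (simp add: gone_def split: if_splits)
next
  case (Cons g l)
  obtain K where K: "finite I" "K \<subseteq> I" "\<theta> g K \<noteq> 0" "gprod \<theta> l (I - K) \<noteq> 0"
    using Cons.prems(2) wedge_nonzeroD[of "\<theta> g" "gprod \<theta> l" I] by auto
  then obtain h where h: "K = {h}" using Cons.prems(1)[of g] unfolding deg1_def is_singleton_def by auto
  have IH: "card ((I - {h}) \<inter> X) = length (filter (\<lambda>g. g \<in> Y) l)"
    "I - {h} \<subseteq> (\<Union>g\<in>set l. {h. \<theta> g {h} \<noteq> 0})"
    using Cons.IH[of "I - {h}"] K h Cons.prems by auto
  have hX: "h \<in> X \<longleftrightarrow> g \<in> Y" using Cons.prems(3)[of g h] K h by auto
  have "card (I \<inter> X) = (if h \<in> X then 1 else 0) + card ((I - {h}) \<inter> X)"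
  proof (cases "h \<in> X")
    case True
    then have "I \<inter> X = insert h ((I - {h}) \<inter> X)" using K h by auto
    then show ?thesis using True K(1) by (subst \<open>I \<inter> X = _\<close>, subst card_insert_disjoint) auto
  next
    case False
    then have "I \<inter> X = (I - {h}) \<inter> X" by auto
    then show ?thesis using False by simp
  qed
  then have "card (I \<inter> X) = length (filter (\<lambda>g. g \<in> Y) (g # l))" using IH(1) hX by simp
  moreover have "I \<subseteq> (\<Union>g\<in>set (g # l). {h. \<theta> g {h} \<noteq> 0})" using IH(2) K h by auto
  ultimately show ?case using K(1) by blast
qed

text \<open>\<open>X\<close> and \<open>Y\<close> are quantified inside, so that one and the same
  \<open>K\<close> accounts for the degree in \<open>dt\<close> and for the degree in
  \<Gamma>.\<close>

lemma gsubst_nonzeroD: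
  assumes "fin_supp \<alpha>" "\<And>g. deg1 (\<theta> g)" "gsubst \<theta> \<alpha> I \<noteq> 0"
  shows "\<exists>K. \<alpha> K \<noteq> 0 \<and> finite K \<and> finite I \<and> card I = card K \<and> I \<subseteq> (\<Union>g\<in>K. {h. \<theta> g {h} \<noteq> 0}) \<and>
    (\<forall>X Y. (\<forall>g h. g \<in> K \<longrightarrow> \<theta> g {h} \<noteq> 0 \<longrightarrow> (h \<in> X \<longleftrightarrow> g \<in> Y)) \<longrightarrow> card (I \<inter> X) = card (K \<inter> Y))"
proof -
  obtain K where K: "\<alpha> K \<noteq> 0" "gprod \<theta> (sorted_list_of_set K) I \<noteq> 0"
    using assms(3) unfolding gsubst_gprod by (force dest: sum.not_neutral_contains_not_neutral)
  have fin: "finite K" using assms(1) K(1) fin_supp_finite by blast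
  have "card (I \<inter> X) = card (K \<inter> Y)" "finite I" "I \<subseteq> (\<Union>g\<in>K. {h. \<theta> g {h} \<noteq> 0})"
    if "\<And>g h. g \<in> K \<Longrightarrow> \<theta> g {h} \<noteq> 0 \<Longrightarrow> (h \<in> X \<longleftrightarrow> g \<in> Y)" for X Y
  proof -
    have "length (filter (\<lambda>g. g \<in> Y) (sorted_list_of_set K)) =
        card (set (filter (\<lambda>g. g \<in> Y) (sorted_list_of_set K)))"
      by (rule distinct_card[symmetric]) simp
    also have "set (filter (\<lambda>g. g \<in> Y) (sorted_list_of_set K)) = K \<inter> Y" using fin by auto
    finally show "card (I \<inter> X) = card (K \<inter> Y)" "finite I" "I \<subseteq> (\<Union>g\<in>K. {h. \<theta> g {h} \<noteq> 0})"
      using gprod_nonzeroD[of "sorted_list_of_set K" \<theta> I X Y] assms(2) K(2) that fin by auto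
  qed
  from this[of UNIV UNIV] this show ?thesis using K(1) fin by (intro exI[of _ K]) auto
qed

text \<open>\<open>grass_deriv i\<close> is an odd derivation: removing \<open>i\<close> and
  multiplying by \<open>j\<close> are independent up to one sign, except when the two generators
  coincide.\<close>

lemma grass_deriv_wedge_gen:
  fixes \<alpha> :: "'g::linorder grass"
  assumes "fin_supp \<alpha>"
  shows "grass_deriv i (wedge (gen j) \<alpha>) =
    (\<lambda>I. (if i = j then \<alpha> I else 0) - wedge (gen j) (grass_deriv i \<alpha>) I)"
proof
  fix I
  show "grass_deriv i (wedge (gen j) \<alpha>) I =
    (if i = j then \<alpha> I else 0) - wedge (gen j) (grass_deriv i \<alpha>) I"
  proof (cases "finite I")
    case False
    then show ?thesis using assms by (auto simp: grass_deriv_def wedge_infinite dest: fin_supp_finite)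
  next
    case fin: True
    have lt: "{h \<in> insert j I. h < j} = {h\<in>I. h < j}" "{h \<in> I - {j}. h < j} = {h\<in>I. h < j}" by auto
    show ?thesis
    proof (cases "i = j")
      case True
      have sq: "(- 1) ^ n * ((- 1) ^ n * a) = (a :: real)" for n a
        by (simp add: mult.assoc[symmetric] power_mult_distrib[symmetric])
      show ?thesis unfolding True
      proof (cases "j \<in> I")
        case True
        then show "grass_deriv j (wedge (gen j) \<alpha>) I =
            (if j = j then \<alpha> I else 0) - wedge (gen j) (grass_deriv j \<alpha>) I"
          using fin unfolding grass_deriv_def wedge_gen lt by (simp add: insert_absorb sq)
      next
        case False
        then show "grass_deriv j (wedge (gen j) \<alpha>) I =
            (if j = j then \<alpha> I else 0) - wedge (gen j) (grass_deriv j \<alpha>) I"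
          using fin unfolding grass_deriv_def wedge_gen lt by (simp add: sq)
      qed
    next
      case neq: False
      show ?thesis
      proof (cases "i \<notin> I \<and> j \<in> I")
        case True
        have e: "insert i I - {j} = insert i (I - {j})" using neq by auto
        have j: "j \<in> insert i I" using True by auto
        \<comment> \<open>Exactly one of \<open>i\<close> and \<open>j\<close> lies below the other,
          so exactly one of the two counts changes, and by one.\<close>
        have "(- 1 :: real) ^ (card {h\<in>I. h < i} + card {h\<in>insert i I. h < j}) =
            - ((- 1) ^ (card {h\<in>I. h < j} + card {h\<in>I - {j}. h < i}))"
        proof (cases "i < j")
          case True
          have "card {h\<in>insert i I. h < j} = Suc (card {h\<in>I. h < j})"
            using card_less_remove[of "insert i I" i j] True fin \<open>i \<notin> I \<and> j \<in> I\<close> by simp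
          moreover have "card {h\<in>I - {j}. h < i} = card {h\<in>I. h < i}"
            using True card_less_remove'[of j i I] by simp
          ultimately show ?thesis by (simp add: power_add)
        next
          case False
          then have "j < i" using neq by simp
          then have "card {h\<in>I. h < i} = Suc (card {h\<in>I - {j}. h < i})"
            using card_less_remove[of I j i] fin True by simp
          moreover have "{h\<in>insert i I. h < j} = {h\<in>I. h < j}" using False by auto
          ultimately show ?thesis by (simp add: power_add)
        qed
        then show ?thesis using True fin neq
          by (simp add: grass_deriv_def wedge_gen e power_add mult.assoc[symmetric])
      qed (use neq in \<open>auto simp: grass_deriv_def wedge_gen\<close>)
    qed
  qed
qed

section \<open>Functions of finite order\<close>

text \<open>The condition on coefficients from \<open>lforms_le\<close>, with an arbitrary set
  \<open>W\<close> for the chart image, because overlaps of charts are needed as well.\<close>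

definition order_fun :: "'a mfd \<Rightarrow> nat \<Rightarrow> (jcoord \<Rightarrow> real) set \<Rightarrow> nat \<Rightarrow> ((jcoord \<Rightarrow> real) \<Rightarrow> real) set" where
  "order_fun M r W k = {f. smooth_on (jidx M r) W f \<and>
     (\<forall>y\<in>W. \<forall>y'\<in>W. (\<forall>j\<in>jidx_le M r k. y j = y' j) \<longrightarrow> f y = f y')}"

lemma order_funI:
  "smooth_on (jidx M r) W f \<Longrightarrow>
   (\<And>y y'. y \<in> W \<Longrightarrow> y' \<in> W \<Longrightarrow> (\<And>j. j \<in> jidx_le M r k \<Longrightarrow> y j = y' j) \<Longrightarrow> f y = f y') \<Longrightarrow>
   f \<in> order_fun M r W k"
  unfolding order_fun_def by blast

lemma order_fun_smooth: "f \<in> order_fun M r W k \<Longrightarrow> smooth_on (jidx M r) W f"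
  by (simp add: order_fun_def)

lemma order_fun_dep:
  "f \<in> order_fun M r W k \<Longrightarrow> y \<in> W \<Longrightarrow> y' \<in> W \<Longrightarrow> (\<And>j. j \<in> jidx_le M r k \<Longrightarrow> y j = y' j) \<Longrightarrow> f y = f y'"
  unfolding order_fun_def by blast

lemma finite_msets_le: "finite {\<sigma>. set_mset \<sigma> \<subseteq> {..<r::nat} \<and> size \<sigma> \<le> k}"
proof (rule finite_subset)
  show "finite (mset ` {xs. set xs \<subseteq> {..<r} \<and> length xs \<le> k})"
    by (intro finite_imageI finite_lists_length_le) simp
  show "{\<sigma>. set_mset \<sigma> \<subseteq> {..<r} \<and> size \<sigma> \<le> k} \<subseteq> mset ` {xs. set xs \<subseteq> {..<r} \<and> length xs \<le> k}"
  proof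
    fix \<sigma> assume "\<sigma> \<in> {\<sigma>. set_mset \<sigma> \<subseteq> {..<r} \<and> size \<sigma> \<le> k}"
    moreover obtain xs where "mset xs = \<sigma>" using ex_mset by blast
    ultimately show "\<sigma> \<in> mset ` {xs. set xs \<subseteq> {..<r} \<and> length xs \<le> k}"
      by (intro image_eqI[of _ _ xs]) auto
  qed
qed

lemma finite_jidx_le: "finite (jidx_le M r k)"
proof (rule finite_subset)
  show "finite (Tc ` {..<r} \<union> (\<lambda>(a, \<sigma>). Xc a \<sigma>) ` ({..<mdim M} \<times> {\<sigma>. set_mset \<sigma> \<subseteq> {..<r} \<and> size \<sigma> \<le> k}))"
    by (intro finite_UnI finite_imageI finite_cartesian_product finite_msets_le) auto
  show "jidx_le M r k \<subseteq> Tc ` {..<r} \<union> (\<lambda>(a, \<sigma>). Xc a \<sigma>) ` ({..<mdim M} \<times> {\<sigma>. set_mset \<sigma> \<subseteq> {..<r} \<and> size \<sigma> \<le> k})"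
    by (auto simp: jidx_le_def tidx_def xidx_def)
qed

lemma jidx_le_subset: "jidx_le M r k \<subseteq> jidx M r"
  by (auto simp: jidx_le_def jidx_def)

lemma jidx_le_mono: "k \<le> k' \<Longrightarrow> jidx_le M r k \<subseteq> jidx_le M r k'"
  by (auto simp: jidx_le_def)

lemma Tc_jidx [simp]: "Tc i \<in> jidx M r \<longleftrightarrow> i < r" "Tc i \<in> jidx_le M r k \<longleftrightarrow> i < r"
    "Tc i \<in> tidx r \<longleftrightarrow> i < r" "Tc i \<notin> xidx M r"
  by (auto simp: jidx_def jidx_le_def tidx_def xidx_def)

lemma Xc_jidx [simp]:
    "Xc a \<sigma> \<in> jidx M r \<longleftrightarrow> a < mdim M \<and> set_mset \<sigma> \<subseteq> {..<r}"
    "Xc a \<sigma> \<in> jidx_le M r k \<longleftrightarrow> a < mdim M \<and> set_mset \<sigma> \<subseteq> {..<r} \<and> size \<sigma> \<le> k"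
    "Xc a \<sigma> \<in> xidx M r \<longleftrightarrow> a < mdim M \<and> set_mset \<sigma> \<subseteq> {..<r}" "Xc a \<sigma> \<notin> tidx r"
  by (auto simp: jidx_def jidx_le_def tidx_def xidx_def)

lemma tidx_xidx_disjoint: "tidx r \<inter> xidx M r = {}"
  by (auto simp: tidx_def xidx_def)

lemma jidx_finite_order: "j \<in> jidx M r \<Longrightarrow> \<exists>k. j \<in> jidx_le M r k"
  by (cases j) auto

lemma order_fun_mono: "k \<le> k' \<Longrightarrow> f \<in> order_fun M r W k \<Longrightarrow> f \<in> order_fun M r W k'"
  by (rule order_funI[OF order_fun_smooth], assumption, rule order_fun_dep, assumption)
    (use jidx_le_mono[of k k' M r] in auto)

lemma order_fun_cong:
  assumes "open_in (jidx M r) W" "f \<in> order_fun M r W k" "\<And>y. y \<in> W \<Longrightarrow> g y = f y"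
  shows "g \<in> order_fun M r W k"
proof (rule order_funI)
  show "smooth_on (jidx M r) W g"
    by (rule smooth_on_cong[OF assms(1) order_fun_smooth[OF assms(2)] assms(3)])
  show "g y = g y'" if "y \<in> W" "y' \<in> W" "\<And>j. j \<in> jidx_le M r k \<Longrightarrow> y j = y' j" for y y'
    using order_fun_dep[OF assms(2) that] assms(3) that by simp
qed

lemma order_fun_const: "open_in (jidx M r) W \<Longrightarrow> (\<lambda>y. c) \<in> order_fun M r W k"
  by (simp add: order_fun_def smooth_on_const)

lemma order_fun_coord: "open_in (jidx M r) W \<Longrightarrow> j \<in> jidx_le M r k \<Longrightarrow> (\<lambda>y. y j) \<in> order_fun M r W k"
  by (simp add: order_fun_def smooth_on_coord)

lemma
  assumes "open_in (jidx M r) W" "f \<in> order_fun M r W k" "g \<in> order_fun M r W k"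
  shows order_fun_add: "(\<lambda>y. f y + g y) \<in> order_fun M r W k"
    and order_fun_mult: "(\<lambda>y. f y * g y) \<in> order_fun M r W k"
proof -
  note sm = assms(1) order_fun_smooth[OF assms(2)] order_fun_smooth[OF assms(3)]
  have *: "(\<lambda>y. h (f y) (g y)) \<in> order_fun M r W k" if "smooth_on (jidx M r) W (\<lambda>y. h (f y) (g y))"
    for h :: "real \<Rightarrow> real \<Rightarrow> real"
  proof (rule order_funI[OF that])
    fix y y' assume a: "y \<in> W" "y' \<in> W" "\<And>j. j \<in> jidx_le M r k \<Longrightarrow> y j = y' j"
    have "f y = f y'" by (rule order_fun_dep[OF assms(2) a])
    moreover have "g y = g y'" by (rule order_fun_dep[OF assms(3) a])
    ultimately show "h (f y) (g y) = h (f y') (g y')" by simp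
  qed
  show "(\<lambda>y. f y + g y) \<in> order_fun M r W k" by (rule *[OF smooth_on_add[OF sm]])
  show "(\<lambda>y. f y * g y) \<in> order_fun M r W k" by (rule *[OF smooth_on_mult[OF sm]])
qed

lemma order_fun_sum:
  assumes "open_in (jidx M r) W" "\<And>a. a \<in> A \<Longrightarrow> f a \<in> order_fun M r W k"
  shows "(\<lambda>y. \<Sum>a\<in>A. f a y) \<in> order_fun M r W k"
  using assms(2) by (induction A rule: infinite_finite_induct)
    (simp_all add: order_fun_const order_fun_add assms(1))

lemma order_fun_pdiff: "f \<in> order_fun M r W k \<Longrightarrow> j \<in> jidx M r \<Longrightarrow> y \<in> W \<Longrightarrow> pdiff j f y"
  by (rule smooth_on_pdiff[OF order_fun_smooth])

lemma order_fun_pd: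
  assumes "open_in (jidx M r) W" "f \<in> order_fun M r W k" "j \<in> jidx M r"
  shows "pd j f \<in> order_fun M r W k"
  by (rule order_funI[OF smooth_on_pd[OF order_fun_smooth[OF assms(2)] assms(3)]],
      rule pd_dep[OF assms(1,3), where A = "jidx_le M r k"], rule order_fun_dep[OF assms(2)])

lemma order_fun_pd_zero:
  assumes "open_in (jidx M r) W" "f \<in> order_fun M r W k" "y \<in> W" "j \<in> jidx M r" "j \<notin> jidx_le M r k"
  shows "pd j f y = 0"
  by (rule pd_dep_zero[OF assms(1,3-5)]) (rule order_fun_dep[OF assms(2)])

text \<open>In \<open>total_deriv\<close> the set of summands varies with the point. A fixed finite
  set is needed to treat the result as a function of \<open>y\<close>, for instance to see that it
  is smooth.\<close>

lemma total_deriv_eq: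
  assumes "open_in (jidx M r) W" "f \<in> order_fun M r W k" "y \<in> W" "i < r"
  shows "total_deriv M r i f y =
    pd (Tc i) f y + (\<Sum>j\<in>jidx_le M r k \<inter> xidx M r. y (raise i j) * pd j f y)"
proof -
  have "{j \<in> xidx M r. pd j f y \<noteq> 0} \<subseteq> jidx_le M r k \<inter> xidx M r"
    using order_fun_pd_zero[OF assms(1-3)] by (auto simp: jidx_def)
  then have "(\<Sum>j | j \<in> xidx M r \<and> pd j f y \<noteq> 0. y (raise i j) * pd j f y) =
      (\<Sum>j\<in>jidx_le M r k \<inter> xidx M r. y (raise i j) * pd j f y)"
    by (intro sum.mono_neutral_left) (auto simp: finite_jidx_le)
  then show ?thesis by (simp add: total_deriv_def)
qed

lemma raise_jidx_le: "i < r \<Longrightarrow> j \<in> jidx_le M r k \<Longrightarrow> raise i j \<in> jidx_le M r (Suc k)"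
  by (cases j) auto

lemma raise_xidx: "i < r \<Longrightarrow> j \<in> xidx M r \<Longrightarrow> raise i j \<in> xidx M r"
  by (cases j) auto

text \<open>The factors \<open>y (raise i j)\<close> are what raises the order by one; the partial
  derivatives keep it.\<close>

lemma order_fun_total_deriv:
  assumes W: "open_in (jidx M r) W" and f: "f \<in> order_fun M r W k" and i: "i < r"
  shows "total_deriv M r i f \<in> order_fun M r W (Suc k)"
proof (rule order_fun_cong[OF W _ total_deriv_eq[OF W f _ i]])
  have pd: "pd j f \<in> order_fun M r W (Suc k)" if "j \<in> jidx M r" for j
    using order_fun_mono[OF _ order_fun_pd[OF W f that], of "Suc k"] by simp
  show "(\<lambda>y. pd (Tc i) f y + (\<Sum>j\<in>jidx_le M r k \<inter> xidx M r. y (raise i j) * pd j f y))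
      \<in> order_fun M r W (Suc k)"
    using i by (intro order_fun_add[OF W] order_fun_sum[OF W] order_fun_mult[OF W] order_fun_coord[OF W]
        raise_jidx_le pd) (auto simp: jidx_def)
qed

lemma total_deriv_cong:
  assumes W: "open_in (jidx M r) W" and "y \<in> W" "i < r" "\<And>y. y \<in> W \<Longrightarrow> f y = g y"
  shows "total_deriv M r i f y = total_deriv M r i g y"
proof -
  have "pd j f y = pd j g y" if "j \<in> jidx M r" for j using pd_cong[OF W assms(2) that assms(4)] .
  then have *: "pd (Tc i) f y = pd (Tc i) g y" "\<And>j. j \<in> xidx M r \<Longrightarrow> pd j f y = pd j g y"
    using assms(3) by (auto simp: jidx_def tidx_def)
  then have "{j \<in> xidx M r. pd j f y \<noteq> 0} = {j \<in> xidx M r. pd j g y \<noteq> 0}" by auto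
  then show ?thesis unfolding total_deriv_def using * by (auto intro: sum.cong)
qed

lemma
  assumes W: "open_in (jidx M r) W" and V: "open_in (jidx M' r') V"
    and F: "\<And>x. x \<in> W \<Longrightarrow> F x \<in> V"
    and FA: "\<And>j. j \<in> jidx_le M' r' k \<Longrightarrow> (\<lambda>x. F x j) \<in> order_fun M r W m"
    and f: "f \<in> order_fun M' r' V k"
  shows order_fun_compose: "(\<lambda>x. f (F x)) \<in> order_fun M r W m"
    and order_fun_pd_compose: "i \<in> jidx M r \<Longrightarrow> x \<in> W \<Longrightarrow>
      pd i (\<lambda>x. f (F x)) x = (\<Sum>j\<in>jidx_le M' r' k. pd j f (F x) * pd i (\<lambda>x. F x j) x)"
proof -
  note rules = W V F finite_jidx_le jidx_le_subset order_fun_smooth[OF FA] order_fun_dep[OF f] order_fun_smooth[OF f]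
  show "(\<lambda>x. f (F x)) \<in> order_fun M r W m"
  proof (rule order_funI)
    show "smooth_on (jidx M r) W (\<lambda>x. f (F x))"
      by (rule smooth_on_compose[where A = "jidx_le M' r' k", OF rules])
    show "f (F y) = f (F y')" if "y \<in> W" "y' \<in> W" "\<And>j. j \<in> jidx_le M r m \<Longrightarrow> y j = y' j" for y y'
      by (rule order_fun_dep[OF f F[OF that(1)] F[OF that(2)]]) (rule order_fun_dep[OF FA that])
  qed
  show "pd i (\<lambda>x. f (F x)) x = (\<Sum>j\<in>jidx_le M' r' k. pd j f (F x) * pd i (\<lambda>x. F x j) x)"
    if "i \<in> jidx M r" "x \<in> W"
    by (rule pd_compose[where A = "jidx_le M' r' k", OF rules that])
qed

section \<open>Jets of sections in local coordinates\<close>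

lemma Euclidean_space_coord: "Euclidean_space r = top_of_set (coord_space {..<r})"
proof -
  have "{x. \<forall>i\<ge>r. x i = (0 :: real)} = coord_space {..<r}" by (auto simp: coord_space_def)
  then show ?thesis by (simp add: Euclidean_space_def euclidean_product_topology)
qed

lemma openin_Euclidean: "openin (Euclidean_space r) N \<longleftrightarrow> open_in {..<r} N"
  by (simp add: Euclidean_space_coord open_in_def)

lemma chart_homeo:
  assumes "smooth_manifold M" "c \<in> matlas M"
  shows "openin (mtop M) (fst c)"
    and "homeomorphic_map (subtopology (mtop M) (fst c))
      (subtopology (Euclidean_space (mdim M)) (snd c ` fst c)) (snd c)"
    and "open_in {..<mdim M} (snd c ` fst c)"
proof -
  obtain U \<phi> where c: "c = (U, \<phi>)" by (cases c)
  have *: "\<forall>c\<in>matlas M. case c of (U, \<phi>) \<Rightarrow> openin (mtop M) U \<and>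
      (\<exists>V. openin (Euclidean_space (mdim M)) V \<and>
        homeomorphic_map (subtopology (mtop M) U) (subtopology (Euclidean_space (mdim M)) V) \<phi>)"
    using assms(1) unfolding smooth_manifold_def by blast
  obtain V where V: "openin (mtop M) U" "openin (Euclidean_space (mdim M)) V"
    "homeomorphic_map (subtopology (mtop M) U) (subtopology (Euclidean_space (mdim M)) V) \<phi>"
    using bspec[OF * assms(2)] c by auto
  have "\<phi> ` topspace (subtopology (mtop M) U) = topspace (subtopology (Euclidean_space (mdim M)) V)"
    using V(3) by (rule homeomorphic_imp_surjective_map)
  then have "\<phi> ` U = V"
    using openin_subset[OF V(1)] openin_subset[OF V(2)] by (simp add: Int_absorb1)
  then show "openin (mtop M) (fst c)" "open_in {..<mdim M} (snd c ` fst c)"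
    "homeomorphic_map (subtopology (mtop M) (fst c))
      (subtopology (Euclidean_space (mdim M)) (snd c ` fst c)) (snd c)"
    using V c by (auto simp: openin_Euclidean)
qed

lemma chart_inj:
  assumes "smooth_manifold M" "c \<in> matlas M"
  shows "inj_on (snd c) (fst c)"
  using homeomorphic_imp_injective_map[OF chart_homeo(2)[OF assms]] openin_subset[OF chart_homeo(1)[OF assms]]
  by (simp add: Int_absorb1)

lemma chart_overlap_open:
  assumes "smooth_manifold M" "c \<in> matlas M" "c' \<in> matlas M"
  shows "open_in {..<mdim M} (snd c ` (fst c \<inter> fst c'))"
proof -
  have o: "openin (subtopology (mtop M) (fst c)) (fst c \<inter> fst c')"
    using chart_homeo(1)[OF assms(1,3)] by (auto simp: openin_subtopology)
  then have "openin (subtopology (Euclidean_space (mdim M)) (snd c ` fst c)) (snd c ` (fst c \<inter> fst c'))"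
    using homeomorphic_imp_open_map[OF chart_homeo(2)[OF assms(1,2)]] by (simp add: open_map_def)
  then have "openin (Euclidean_space (mdim M)) (snd c ` (fst c \<inter> fst c'))"
    using chart_homeo(3)[OF assms(1,2)] openin_trans_full openin_Euclidean by blast
  then show ?thesis by (simp add: openin_Euclidean)
qed

lemma chart_inverse_continuous:
  assumes "smooth_manifold M" "c \<in> matlas M"
  shows "continuous_map (subtopology (Euclidean_space (mdim M)) (snd c ` fst c)) (mtop M)
    (inv_into (fst c) (snd c))"
proof -
  let ?X = "subtopology (mtop M) (fst c)"
  let ?Y = "subtopology (Euclidean_space (mdim M)) (snd c ` fst c)"
  have tX: "topspace ?X = fst c"
    using openin_subset[OF chart_homeo(1)[OF assms]] by (simp add: Int_absorb1)
  obtain g where g: "homeomorphic_maps ?X ?Y (snd c) g"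
    using chart_homeo(2)[OF assms] unfolding homeomorphic_map_maps by blast
  have tY: "topspace ?Y = snd c ` fst c"
    using homeomorphic_imp_surjective_map[OF chart_homeo(2)[OF assms]] tX by simp
  have "continuous_map ?Y (mtop M) g"
    using g by (simp add: homeomorphic_maps_def continuous_map_in_subtopology)
  moreover have "g y = inv_into (fst c) (snd c) y" if y: "y \<in> topspace ?Y" for y
  proof -
    obtain x where "x \<in> fst c" "y = snd c x" using y unfolding tY by auto
    then show ?thesis using g tX chart_inj[OF assms] by (simp add: homeomorphic_maps_def)
  qed
  ultimately show ?thesis by (rule continuous_map_eq)
qed

lemma chart_trans_smooth:
  assumes "smooth_manifold M" "c \<in> matlas M" "c' \<in> matlas M" "a < mdim M"
  shows "smooth_on {..<mdim M} (snd c ` (fst c \<inter> fst c')) (\<lambda>y. snd c' (inv_into (fst c) (snd c) y) a)"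
proof -
  have *: "\<forall>c\<in>matlas M. case c of (U, \<phi>) \<Rightarrow> \<forall>c'\<in>matlas M. case c' of (U', \<phi>') \<Rightarrow> \<forall>a<mdim M.
      smooth_on {..<mdim M} (\<phi> ` (U \<inter> U')) (\<lambda>y. \<phi>' (inv_into U \<phi> y) a)"
    using assms(1) unfolding smooth_manifold_def by blast
  show ?thesis using bspec[OF * assms(2)] assms(3,4) by (auto simp: case_prod_unfold)
qed

lemma chart_coord_space:
  assumes "smooth_manifold M" "c \<in> matlas M" "x \<in> fst c"
  shows "snd c x \<in> coord_space {..<mdim M}"
  using open_in_subset[OF chart_homeo(3)[OF assms(1,2)]] assms(3) by auto

subsection \<open>Iterated partial derivatives\<close>

text \<open>\<open>mpd\<close> differentiates in sorted order. A new index is inserted somewhere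
  inside the list and is brought to the outside by \<open>pd_commute\<close>.\<close>

lemma foldr_pd_insort:
  assumes W: "open_in S W" and f: "smooth_on S W f" and "set l \<subseteq> S" "i \<in> S" "x \<in> W"
  shows "foldr pd (insort i l) f x = pd i (foldr pd l f) x"
  using assms(3,5)
proof (induction l arbitrary: x)
  case (Cons j l)
  have sm: "smooth_on S W (foldr pd l f)"
    using Cons.prems(1) f by (induction l) (auto intro: smooth_on_pd)
  show ?case
  proof (cases "i \<le> j")
    case False
    have "foldr pd (insort i (j # l)) f x = pd j (foldr pd (insort i l) f) x" using False by simp
    also have "\<dots> = pd j (pd i (foldr pd l f)) x"
      by (rule pd_cong[OF W]) (use Cons in auto)
    also have "\<dots> = pd i (pd j (foldr pd l f)) x"
      by (rule pd_commute[OF W sm]) (use Cons.prems assms(4) in auto)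
    finally show ?thesis by simp
  qed simp
qed simp

lemma mpd_add_mset:
  assumes "open_in {..<r} W" "smooth_on {..<r} W f" "set_mset \<sigma> \<subseteq> {..<r}" "i < r" "x \<in> W"
  shows "mpd (add_mset i \<sigma>) f x = pd i (mpd \<sigma> f) x"
proof -
  have "sorted_list_of_multiset (add_mset i \<sigma>) = insort i (sorted_list_of_multiset \<sigma>)" by simp
  then show ?thesis unfolding mpd_def
    using foldr_pd_insort[OF assms(1,2), of "sorted_list_of_multiset \<sigma>" i x] assms(3-5) by simp
qed

lemma smooth_on_foldr_pd: "smooth_on S W f \<Longrightarrow> set l \<subseteq> S \<Longrightarrow> smooth_on S W (foldr pd l f)"
  by (induction l) (auto intro: smooth_on_pd)

lemma smooth_on_mpd: "smooth_on {..<r} W f \<Longrightarrow> set_mset \<sigma> \<subseteq> {..<r} \<Longrightarrow> smooth_on {..<r} W (mpd \<sigma> f)"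
  unfolding mpd_def by (rule smooth_on_foldr_pd) auto

lemma mpd_cong:
  assumes "open_in {..<r} W" "set_mset \<sigma> \<subseteq> {..<r}" "x \<in> W" "\<And>y. y \<in> W \<Longrightarrow> f y = g y"
  shows "mpd \<sigma> f x = mpd \<sigma> g x"
  unfolding mpd_def by (rule foldr_pd_cong[OF assms(1)]) (use assms in auto)

subsection \<open>Polynomials with prescribed derivatives\<close>

text \<open>Normalised by factorials, so that \<open>pd i\<close> just removes one \<open>i\<close>
  from \<tau>, or gives 0 if there is none.\<close>

definition taylor_mono :: "nat \<Rightarrow> (nat \<Rightarrow> real) \<Rightarrow> nat multiset \<Rightarrow> (nat \<Rightarrow> real) \<Rightarrow> real" where
  "taylor_mono r t \<tau> u = (\<Prod>i<r. (u i - t i) ^ count \<tau> i / fact (count \<tau> i))"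

lemma taylor_mono_DERIV:
  assumes "i < r"
  shows "((\<lambda>s. taylor_mono r t \<tau> (u(i := s))) has_real_derivative
    (if i \<in># \<tau> then taylor_mono r t (\<tau> - {#i#}) u else 0)) (at (u i))"
proof -
  let ?P = "\<Prod>l\<in>{..<r} - {i}. (u l - t l) ^ count \<tau> l / fact (count \<tau> l)"
  have split: "taylor_mono r t \<tau>' (u(i := s)) = (s - t i) ^ count \<tau>' i / fact (count \<tau>' i) *
      (\<Prod>l\<in>{..<r} - {i}. (u l - t l) ^ count \<tau>' l / fact (count \<tau>' l))" for s \<tau>'
    unfolding taylor_mono_def using assms by (subst prod.remove[of _ i]) auto
  have P: "(\<Prod>l\<in>{..<r} - {i}. (u l - t l) ^ count (\<tau> - {#i#}) l / fact (count (\<tau> - {#i#}) l)) = ?P"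
    by (rule prod.cong) auto
  show ?thesis
  proof (cases "i \<in># \<tau>")
    case True
    then obtain m where m: "count \<tau> i = Suc m" by (metis count_greater_zero_iff gr0_implies_Suc)
    have "taylor_mono r t (\<tau> - {#i#}) u = (u i - t i) ^ m / fact m * ?P"
      using split[of "\<tau> - {#i#}" "u i"] P m by simp
    moreover have "((\<lambda>s. (s - t i) ^ Suc m / fact (Suc m) * ?P) has_real_derivative
        real (Suc m) * (u i - t i) ^ m / fact (Suc m) * ?P) (at (u i))"
    proof (intro DERIV_cmult_right DERIV_cdivide)
      have "((\<lambda>s. s - t i) has_real_derivative 1) (at (u i))" by (auto intro!: derivative_eq_intros)
      from DERIV_power[OF this, of "Suc m"]
      show "((\<lambda>s. (s - t i) ^ Suc m) has_real_derivative real (Suc m) * (u i - t i) ^ m) (at (u i))"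
        by (simp del: power_Suc)
    qed
    moreover have "real (Suc m) * (u i - t i) ^ m / fact (Suc m) = (u i - t i) ^ m / fact m"
      by (simp add: fact_Suc del: of_nat_Suc)
    ultimately show ?thesis unfolding split m using True by simp
  next
    case False
    then have "count \<tau> i = 0" by (simp add: not_in_iff)
    then show ?thesis unfolding split using False by simp
  qed
qed

lemma pd_taylor_mono:
  "i < r \<Longrightarrow> pd i (taylor_mono r t \<tau>) = (if i \<in># \<tau> then taylor_mono r t (\<tau> - {#i#}) else (\<lambda>u. 0))"
  by (rule ext, subst pd_eqI[OF taylor_mono_DERIV]) auto

lemma pdiff_taylor_mono: "i < r \<Longrightarrow> pdiff i (taylor_mono r t \<tau>) u"
  using pdiffI[OF taylor_mono_DERIV] .

lemma foldr_pd_taylor_mono: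
  "set l \<subseteq> {..<r} \<Longrightarrow> foldr pd l (taylor_mono r t \<tau>) =
    (if mset l \<subseteq># \<tau> then taylor_mono r t (\<tau> - mset l) else (\<lambda>u. 0))"
proof (induction l)
  case (Cons i l)
  show ?case
  proof (cases "mset l \<subseteq># \<tau>")
    case True
    have "i \<in># \<tau> - mset l \<longleftrightarrow> mset (i # l) \<subseteq># \<tau>"
      using subset_mset.le_diff_conv2[OF True, of "{#i#}"] by simp
    then show ?thesis using Cons True by (simp add: pd_taylor_mono)
  next
    case False
    then have "\<not> mset (i # l) \<subseteq># \<tau>"
      by (metis mset.simps(2) mset_subset_eq_insertD subset_mset.less_imp_le)
    moreover have "pd i (\<lambda>u. 0) = (\<lambda>u. 0)" by (rule ext) simp
    ultimately show ?thesis using Cons False by simp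
  qed
qed simp

lemma taylor_mono_center:
  assumes "set_mset \<tau> \<subseteq> {..<r}"
  shows "taylor_mono r t \<tau> t = (if \<tau> = {#} then 1 else 0)"
proof (cases "\<tau> = {#}")
  case False
  then obtain i where "i \<in># \<tau>" by blast
  then have "i < r" "count \<tau> i > 0" using assms by auto
  then show ?thesis unfolding taylor_mono_def using False by (auto intro!: prod_zero bexI[of _ i])
qed (simp add: taylor_mono_def)

lemma smooth_on_taylor_mono:
  "open_in {..<r} W \<Longrightarrow> smooth_on {..<r} W (taylor_mono r t \<tau>)"
proof (rule smooth_on_coinduct)
  let ?C = "insert (\<lambda>u. 0) (range (taylor_mono r t))"
  show "taylor_mono r t \<tau> \<in> ?C" by auto
  show "continuous_on W f" if "f \<in> ?C" for f
    using that unfolding taylor_mono_def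
    by (auto intro!: continuous_intros continuous_on_subset[OF continuous_on_product_coordinates])
  show "pdiff i f x" if "f \<in> ?C" "i \<in> {..<r}" for f i x
    using that pdiff_taylor_mono by auto
  show "\<exists>g\<in>?C. \<forall>x\<in>W. pd i f x = g x" if "f \<in> ?C" "i \<in> {..<r}" for f i
  proof -
    have "pd i f \<in> ?C"
      using that pd_taylor_mono[of i r t] by (auto simp: fun_eq_iff[of "pd i (\<lambda>u. 0)"])
    then show ?thesis by blast
  qed
qed

lemma foldr_pd_sum_taylor_mono:
  assumes "set l \<subseteq> {..<r}"
  shows "foldr pd l (\<lambda>u. \<Sum>\<tau>\<in>B. y \<tau> * taylor_mono r t \<tau> u) =
    (\<lambda>u. \<Sum>\<tau>\<in>B. y \<tau> * foldr pd l (taylor_mono r t \<tau>) u)"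
  using assms
proof (induction l)
  case (Cons i l)
  have d: "pdiff i (foldr pd l (taylor_mono r t \<tau>)) u" for \<tau> u
    using Cons.prems foldr_pd_taylor_mono[of l r t \<tau>] pdiff_taylor_mono[of i r] by auto
  show ?case
  proof
    fix u
    have "foldr pd (i # l) (\<lambda>u. \<Sum>\<tau>\<in>B. y \<tau> * taylor_mono r t \<tau> u) u =
        pd i (\<lambda>u. \<Sum>\<tau>\<in>B. y \<tau> * foldr pd l (taylor_mono r t \<tau>) u) u"
      using Cons by simp
    also have "\<dots> = (\<Sum>\<tau>\<in>B. pd i (\<lambda>u. y \<tau> * foldr pd l (taylor_mono r t \<tau>) u) u)"
      by (rule pd_sum) (intro pdiff_mult pdiff_const d)
    also have "\<dots> = (\<Sum>\<tau>\<in>B. y \<tau> * foldr pd (i # l) (taylor_mono r t \<tau>) u)"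
      by (simp add: pd_cmult[OF d])
    finally show "foldr pd (i # l) (\<lambda>u. \<Sum>\<tau>\<in>B. y \<tau> * taylor_mono r t \<tau> u) u =
        (\<Sum>\<tau>\<in>B. y \<tau> * foldr pd (i # l) (taylor_mono r t \<tau>) u)" .
  qed
qed simp

text \<open>This is the Taylor polynomial with the prescribed coefficients. After differentiation by
  \<sigma>, terms whose \<tau> does not contain \<sigma> are gone, and those with larger \<tau>
  vanish at the centre. The bound \<open>k\<close> makes the sum finite.\<close>

lemma taylor_polynomial:
  fixes y :: "nat multiset \<Rightarrow> real"
  shows "\<exists>P. (\<forall>W. open_in {..<r} W \<longrightarrow> smooth_on {..<r} W P) \<and>
    (\<forall>\<sigma>. set_mset \<sigma> \<subseteq> {..<r} \<longrightarrow> size \<sigma> \<le> k \<longrightarrow> mpd \<sigma> P t = y \<sigma>)"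
proof -
  let ?B = "{\<sigma>. set_mset \<sigma> \<subseteq> {..<r} \<and> size \<sigma> \<le> k}"
  let ?P = "\<lambda>u. \<Sum>\<tau>\<in>?B. y \<tau> * taylor_mono r t \<tau> u"
  have "mpd \<sigma> ?P t = y \<sigma>" if \<sigma>: "\<sigma> \<in> ?B" for \<sigma>
  proof -
    have "mpd \<sigma> ?P t = (\<Sum>\<tau>\<in>?B. y \<tau> * (if \<sigma> \<subseteq># \<tau> then taylor_mono r t (\<tau> - \<sigma>) else (\<lambda>u. 0)) t)"
      unfolding mpd_def using \<sigma>
      by (subst foldr_pd_sum_taylor_mono, simp, subst foldr_pd_taylor_mono)
        (simp_all only: mset_sorted_list_of_multiset set_sorted_list_of_multiset mem_Collect_eq)
    also have "\<dots> = (\<Sum>\<tau>\<in>?B. if \<tau> = \<sigma> then y \<sigma> else 0)"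
    proof (rule sum.cong[OF refl])
      fix \<tau> assume "\<tau> \<in> ?B"
      then have "taylor_mono r t (\<tau> - \<sigma>) t = (if \<tau> - \<sigma> = {#} then 1 else 0)"
        by (intro taylor_mono_center) (auto dest: in_diffD)
      moreover have "\<sigma> \<subseteq># \<tau> \<Longrightarrow> \<tau> - \<sigma> = {#} \<longleftrightarrow> \<tau> = \<sigma>"
        by (metis Diff_eq_empty_iff_mset subset_mset.antisym subset_mset.order_refl)
      ultimately show "y \<tau> * (if \<sigma> \<subseteq># \<tau> then taylor_mono r t (\<tau> - \<sigma>) else (\<lambda>u. 0)) t = (if \<tau> = \<sigma> then y \<sigma> else 0)"
        by auto
    qed
    also have "\<dots> = y \<sigma>" using \<sigma> finite_msets_le[of r k] by (simp add: sum.delta)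
    finally show ?thesis .
  qed
  moreover have "smooth_on {..<r} W ?P" if "open_in {..<r} W" for W
    by (intro smooth_on_sum[OF that] smooth_on_cmult[OF that] smooth_on_taylor_mono that)
  ultimately show ?thesis by (intro exI[of _ ?P]) auto
qed

subsection \<open>Coordinates of the jet of a local section\<close>

lemma coord_space_eqI:
  assumes "x \<in> coord_space S" "y \<in> coord_space S" "\<And>j. j \<in> S \<Longrightarrow> x j = y j"
  shows "x = y"
proof
  show "x j = y j" for j using assms by (cases "j \<in> S") (auto simp: coord_space_def)
qed

text \<open>\<open>jet_coords\<close> takes each coordinate from a representative chosen for its
  order. Here all of them come from one section, so that they can be differentiated while the base
  point moves.\<close>

definition sec_coords :: "'a mfd \<Rightarrow> nat \<Rightarrow> 'a chart \<Rightarrow> 'a lsec \<Rightarrow> jcoord \<Rightarrow> real" where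
  "sec_coords M r c p j = (if j \<in> jidx M r then
     (case j of Tc i \<Rightarrow> fst p i | Xc a \<sigma> \<Rightarrow> mpd \<sigma> (\<lambda>u. snd c (snd p u) a) (fst p)) else 0)"

definition sec_dom :: "'a mfd \<Rightarrow> nat \<Rightarrow> 'a chart \<Rightarrow> 'a lsec set" where
  "sec_dom M r c = {p \<in> local_sections M r. snd p (fst p) \<in> fst c}"

definition jet_base :: "'a mfd \<Rightarrow> (jcoord \<Rightarrow> real) \<Rightarrow> nat \<Rightarrow> real" where
  "jet_base M y a = (if a < mdim M then y (Xc a {#}) else 0)"

text \<open>An open set of base points with no condition on the derivatives. By
  \<open>jet_img_eq\<close> the chart images of the jet space are of this shape.\<close>

definition jet_over :: "'a mfd \<Rightarrow> nat \<Rightarrow> (nat \<Rightarrow> real) set \<Rightarrow> (jcoord \<Rightarrow> real) set" where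
  "jet_over M r V = {y \<in> coord_space (jidx M r). jet_base M y \<in> V}"

lemma open_in_jet_over:
  assumes "open_in {..<mdim M} V"
  shows "open_in (jidx M r) (jet_over M r V)"
proof (rule open_inI)
  show "jet_over M r V \<subseteq> coord_space (jidx M r)" by (auto simp: jet_over_def)
  fix x assume x: "x \<in> jet_over M r V"
  then obtain F e where F: "finite F" "F \<subseteq> {..<mdim M}" "e > 0"
    "\<forall>v\<in>coord_space {..<mdim M}. (\<forall>a\<in>F. \<bar>v a - jet_base M x a\<bar> < e) \<longrightarrow> v \<in> V"
    using open_in_box[OF assms, of "jet_base M x"] unfolding jet_over_def by auto
  show "\<exists>F e. finite F \<and> 0 < e \<and> (\<forall>y\<in>coord_space (jidx M r). (\<forall>j\<in>F. \<bar>y j - x j\<bar> < e) \<longrightarrow> y \<in> jet_over M r V)"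
  proof (intro exI conjI ballI impI)
    show "finite ((\<lambda>a. Xc a {#}) ` F)" "0 < e" using F by auto
    fix y assume y: "y \<in> coord_space (jidx M r)" "\<forall>j\<in>(\<lambda>a. Xc a {#}) ` F. \<bar>y j - x j\<bar> < e"
    have "jet_base M y \<in> V"
    proof (rule F(4)[rule_format])
      show "\<bar>jet_base M y a - jet_base M x a\<bar> < e" if "a \<in> F" for a
        using y(2) that F(2) by (auto simp: jet_base_def)
    qed (simp add: jet_base_def coord_space_def)
    then show "y \<in> jet_over M r V" using y(1) by (simp add: jet_over_def)
  qed
qed

text \<open>The neighbourhood on which the section is given is shrunk to the preimage of the chart
  domain. The same \<open>s\<close> is then a local section at every \<open>u\<close> in it, which
  allows identities between jet coordinates to be differentiated.\<close>

lemma sec_domE: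
  assumes sm: "smooth_manifold M" and c: "c \<in> matlas M" and p: "(t, s) \<in> sec_dom M r c"
  obtains N where "open_in {..<r} N" "t \<in> N"
    "\<And>u. u \<in> N \<Longrightarrow> s u \<in> fst c" "\<And>u. u \<in> N \<Longrightarrow> (u, s) \<in> sec_dom M r c"
    "\<And>a. a < mdim M \<Longrightarrow> smooth_on {..<r} N (\<lambda>u. snd c (s u) a)"
proof -
  obtain N where N: "openin (Euclidean_space r) N" "t \<in> N"
    "continuous_map (subtopology (Euclidean_space r) N) (mtop M) s"
    "\<forall>(U, \<phi>)\<in>matlas M. \<forall>a<mdim M. smooth_on {..<r} {u\<in>N. s u \<in> U} (\<lambda>u. \<phi> (s u) a)"
    using p unfolding sec_dom_def local_sections_def by auto
  let ?N = "{u\<in>N. s u \<in> fst c}"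
  have "openin (subtopology (Euclidean_space r) N) {u \<in> topspace (subtopology (Euclidean_space r) N). s u \<in> fst c}"
    using openin_continuous_map_preimage[OF N(3) chart_homeo(1)[OF sm c]] .
  moreover have "topspace (subtopology (Euclidean_space r) N) = N"
    using openin_subset[OF N(1)] by (simp add: Int_absorb1)
  ultimately have o: "open_in {..<r} ?N"
    using N(1) openin_trans_full unfolding openin_Euclidean[symmetric] by fastforce
  show ?thesis
  proof (rule that[OF o])
    show "t \<in> ?N" using N(2) p by (simp add: sec_dom_def)
    show "(u, s) \<in> sec_dom M r c" if "u \<in> ?N" for u
      using that N unfolding sec_dom_def local_sections_def by auto
    show "smooth_on {..<r} ?N (\<lambda>u. snd c (s u) a)" if "a < mdim M" for a
      using bspec[OF N(4) c] that by (simp add: case_prod_unfold)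
  qed auto
qed

lemma sec_dom_Int: "p \<in> sec_dom M r c \<Longrightarrow> snd p (fst p) \<in> fst c' \<Longrightarrow> p \<in> sec_dom M r c'"
  by (simp add: sec_dom_def)

lemma sec_base_coord: "p \<in> local_sections M r \<Longrightarrow> fst p \<in> coord_space {..<r}"
  using open_in_subset by (fastforce simp: local_sections_def openin_Euclidean)

lemma sec_coords_coord_space: "sec_coords M r c p \<in> coord_space (jidx M r)"
  by (auto simp: coord_space_def sec_coords_def)

lemma sec_coords_Tc: "i < r \<Longrightarrow> sec_coords M r c p (Tc i) = fst p i"
  by (simp add: sec_coords_def)

lemma sec_coords_Xc: "a < mdim M \<Longrightarrow> set_mset \<sigma> \<subseteq> {..<r} \<Longrightarrow>
    sec_coords M r c p (Xc a \<sigma>) = mpd \<sigma> (\<lambda>u. snd c (snd p u) a) (fst p)"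
  by (simp add: sec_coords_def)

lemma mpd_empty [simp]: "mpd {#} f = f"
  by (simp add: mpd_def)

lemma jet_base_sec_coords:
  assumes "smooth_manifold M" "c \<in> matlas M" "p \<in> sec_dom M r c"
  shows "jet_base M (sec_coords M r c p) = snd c (snd p (fst p))"
proof
  fix a
  have "snd c (snd p (fst p)) \<in> coord_space {..<mdim M}"
    using chart_coord_space[OF assms(1,2)] assms(3) by (simp add: sec_dom_def)
  then show "jet_base M (sec_coords M r c p) a = snd c (snd p (fst p)) a"
    by (auto simp: jet_base_def sec_coords_Xc coord_space_def)
qed

text \<open>By the chain rule: along the jet of a section \<open>Tc i\<close> moves with speed 1,
  the other \<open>Tc\<close> stay fixed, and \<open>Xc a \<sigma>\<close> moves with speed
  \<open>Xc a (add_mset i \<sigma>)\<close>.\<close>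

lemma pd_along_section:
  assumes sm: "smooth_manifold M" and c: "c \<in> matlas M"
    and N: "open_in {..<r} N" "\<And>u. u \<in> N \<Longrightarrow> s u \<in> fst c"
      "\<And>a. a < mdim M \<Longrightarrow> smooth_on {..<r} N (\<lambda>u. snd c (s u) a)"
    and W: "open_in (jidx M r) W" "\<And>u. u \<in> N \<Longrightarrow> sec_coords M r c (u, s) \<in> W"
    and f: "f \<in> order_fun M r W k"
    and i: "i < r" and u: "u \<in> N"
  shows "pd i (\<lambda>u. f (sec_coords M r c (u, s))) u = total_deriv M r i f (sec_coords M r c (u, s))"
proof -
  let ?J = "\<lambda>u. sec_coords M r c (u, s)"
  have JX: "(\<lambda>u. ?J u (Xc a \<sigma>)) = mpd \<sigma> (\<lambda>u. snd c (s u) a)" if "Xc a \<sigma> \<in> jidx M r" for a \<sigma>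
    using that by (auto simp: sec_coords_Xc)
  have JT: "(\<lambda>u. ?J u (Tc l)) = (\<lambda>u. u l)" if "l < r" for l
    using that by (auto simp: sec_coords_Tc)
  have JA: "smooth_on {..<r} N (\<lambda>u. ?J u j)" if j: "j \<in> jidx_le M r k" for j
  proof (cases j)
    case (Tc l)
    then show ?thesis using j JT[of l] smooth_on_coord[OF N(1), of l] by simp
  next
    case (Xc a \<sigma>)
    then show ?thesis using j JX[of a \<sigma>] smooth_on_mpd[OF N(3), of a \<sigma>] by simp
  qed
  note rules = N(1) W finite_jidx_le jidx_le_subset JA order_fun_dep[OF f] order_fun_smooth[OF f]
  have "pd i (\<lambda>u. f (?J u)) u = (\<Sum>j\<in>jidx_le M r k. pd j f (?J u) * pd i (\<lambda>u. ?J u j) u)"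
    by (rule pd_compose[where A = "jidx_le M r k", OF rules]) (use i u in auto)
  also have "jidx_le M r k = tidx r \<union> (jidx_le M r k \<inter> xidx M r)"
    by (auto simp: jidx_le_def)
  also have "(\<Sum>j\<in>tidx r \<union> (jidx_le M r k \<inter> xidx M r). pd j f (?J u) * pd i (\<lambda>u. ?J u j) u) =
      (\<Sum>j\<in>tidx r. pd j f (?J u) * pd i (\<lambda>u. ?J u j) u) +
      (\<Sum>j\<in>jidx_le M r k \<inter> xidx M r. pd j f (?J u) * pd i (\<lambda>u. ?J u j) u)"
    using finite_jidx_le[of M r k] tidx_xidx_disjoint[of r M]
    by (intro sum.union_disjoint) (auto simp: jidx_le_def)
  also have "(\<Sum>j\<in>tidx r. pd j f (?J u) * pd i (\<lambda>u. ?J u j) u) = (\<Sum>j\<in>tidx r. if j = Tc i then pd (Tc i) f (?J u) else 0)"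
  proof (rule sum.cong[OF refl])
    fix j assume "j \<in> tidx r"
    then obtain l where l: "j = Tc l" "l < r" by (auto simp: tidx_def)
    then show "pd j f (?J u) * pd i (\<lambda>u. ?J u j) u = (if j = Tc i then pd (Tc i) f (?J u) else 0)"
      by (simp add: JT pd_coord)
  qed
  also have "\<dots> = pd (Tc i) f (?J u)"
  proof -
    have "finite (tidx r)" by (simp add: tidx_def)
    then show ?thesis using i by (simp add: sum.delta')
  qed
  also have "(\<Sum>j\<in>jidx_le M r k \<inter> xidx M r. pd j f (?J u) * pd i (\<lambda>u. ?J u j) u) =
      (\<Sum>j\<in>jidx_le M r k \<inter> xidx M r. ?J u (raise i j) * pd j f (?J u))"
  proof (rule sum.cong[OF refl])
    fix j assume j: "j \<in> jidx_le M r k \<inter> xidx M r"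
    then obtain a \<sigma> where a: "j = Xc a \<sigma>" "a < mdim M" "set_mset \<sigma> \<subseteq> {..<r}" by (cases j) auto
    then have "pd i (\<lambda>u. ?J u j) u = ?J u (raise i j)"
      using JX[of a \<sigma>] i u mpd_add_mset[OF N(1) N(3)[OF a(2)] a(3) i u] by (simp add: sec_coords_Xc)
    then show "pd j f (?J u) * pd i (\<lambda>u. ?J u j) u = ?J u (raise i j) * pd j f (?J u)" by simp
  qed
  also have "pd (Tc i) f (?J u) + \<dots> = total_deriv M r i f (?J u)"
    by (rule total_deriv_eq[OF W(1) f W(2)[OF u] i, symmetric])
  finally show "pd i (\<lambda>u. f (?J u)) u = total_deriv M r i f (?J u)" .
qed

subsection \<open>Prolongation of the coordinate changes of the manifold\<close>

text \<open>The total derivatives are applied in the order of a list. That inserting an index in its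
  sorted place amounts to one more total derivative is obtained only in
  \<open>prolong_contact\<close>, by way of sections.\<close>

definition prolong :: "'a mfd \<Rightarrow> nat \<Rightarrow> 'a chart \<Rightarrow> 'a chart \<Rightarrow> nat \<Rightarrow> nat list \<Rightarrow> (jcoord \<Rightarrow> real) \<Rightarrow> real" where
  "prolong M r c c' a l = foldr (total_deriv M r) l
     (\<lambda>y. snd c' (inv_into (fst c) (snd c) (jet_base M y)) a)"

definition overlap :: "'a mfd \<Rightarrow> nat \<Rightarrow> 'a chart \<Rightarrow> 'a chart \<Rightarrow> (jcoord \<Rightarrow> real) set" where
  "overlap M r c c' = jet_over M r (snd c ` (fst c \<inter> fst c'))"

lemma open_in_overlap:
  "smooth_manifold M \<Longrightarrow> c \<in> matlas M \<Longrightarrow> c' \<in> matlas M \<Longrightarrow> open_in (jidx M r) (overlap M r c c')"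
  unfolding overlap_def by (intro open_in_jet_over chart_overlap_open)

lemma prolong_order_fun:
  assumes "smooth_manifold M" "c \<in> matlas M" "c' \<in> matlas M" "a < mdim M" "set l \<subseteq> {..<r}"
  shows "prolong M r c c' a l \<in> order_fun M r (overlap M r c c') (length l)"
  using assms(5)
proof (induction l)
  case Nil
  let ?V = "snd c ` (fst c \<inter> fst c')"
  note W = open_in_overlap[OF assms(1-3)]
  have V: "open_in {..<mdim M} ?V" by (rule chart_overlap_open[OF assms(1-3)])
  note \<psi> = chart_trans_smooth[OF assms(1-4)]
  have "smooth_on (jidx M r) (overlap M r c c') (\<lambda>y. snd c' (inv_into (fst c) (snd c) (jet_base M y)) a)"
  proof (rule smooth_on_compose[where A = "{..<mdim M}" and F = "jet_base M", OF W V _ _ _ _ _ \<psi>])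
    show "jet_base M y \<in> ?V" if "y \<in> overlap M r c c'" for y using that by (simp add: overlap_def jet_over_def)
    show "smooth_on (jidx M r) (overlap M r c c') (\<lambda>x. jet_base M x b)" if "b \<in> {..<mdim M}" for b
      using that smooth_on_coord[OF W, where j = "Xc b {#}"] by (simp add: jet_base_def)
    fix y y' :: "nat \<Rightarrow> real" assume y: "y \<in> ?V" "y' \<in> ?V" "\<And>j. j \<in> {..<mdim M} \<Longrightarrow> y j = y' j"
    then have "y \<in> coord_space {..<mdim M}" "y' \<in> coord_space {..<mdim M}"
      using open_in_subset[OF V] by auto
    then have "y = y'" using y(3) by (rule coord_space_eqI)
    then show "snd c' (inv_into (fst c) (snd c) y) a = snd c' (inv_into (fst c) (snd c) y') a" by simp
  qed auto
  then have "(\<lambda>y. snd c' (inv_into (fst c) (snd c) (jet_base M y)) a) \<in> order_fun M r (overlap M r c c') 0"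
  proof (rule order_funI)
    fix y y' :: "jcoord \<Rightarrow> real" assume y: "\<And>j. j \<in> jidx_le M r 0 \<Longrightarrow> y j = y' j"
    have "jet_base M y = jet_base M y'"
    proof
      show "jet_base M y b = jet_base M y' b" for b
        using y[of "Xc b {#}"] by (simp add: jet_base_def)
    qed
    then show "snd c' (inv_into (fst c) (snd c) (jet_base M y)) a = snd c' (inv_into (fst c) (snd c) (jet_base M y')) a"
      by simp
  qed
  then show ?case by (simp add: prolong_def)
next
  case (Cons i l)
  then show ?case
    using order_fun_total_deriv[OF open_in_overlap[OF assms(1-3)], of "prolong M r c c' a l" r "length l" i]
    by (simp add: prolong_def)
qed

lemma sec_coords_overlap:
  assumes "smooth_manifold M" "c \<in> matlas M" "p \<in> sec_dom M r c" "p \<in> sec_dom M r c'"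
  shows "sec_coords M r c p \<in> overlap M r c c'"
  using jet_base_sec_coords[OF assms(1-3)] assms(3,4) sec_coords_coord_space[of M r c p]
  by (auto simp: overlap_def jet_over_def sec_dom_def)

text \<open>The induction works because the identity holds on the whole of \<open>N\<close> and not
  just at one point: it is differentiated once more by \<open>pd_along_section\<close>.\<close>

lemma prolong_sec_coords_list:
  assumes sm: "smooth_manifold M" and c: "c \<in> matlas M" "c' \<in> matlas M" and a: "a < mdim M"
    and N: "open_in {..<r} N" "\<And>u. u \<in> N \<Longrightarrow> (u, s) \<in> sec_dom M r c \<and> (u, s) \<in> sec_dom M r c'"
      "\<And>a. a < mdim M \<Longrightarrow> smooth_on {..<r} N (\<lambda>u. snd c (s u) a)"
    and "set l \<subseteq> {..<r}" "u \<in> N"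
  shows "foldr pd l (\<lambda>u. snd c' (s u) a) u = prolong M r c c' a l (sec_coords M r c (u, s))"
  using assms(8,9)
proof (induction l arbitrary: u)
  case Nil
  have "s u \<in> fst c" using N(2)[OF Nil(2)] by (simp add: sec_dom_def)
  then show ?case using jet_base_sec_coords[OF sm c(1), of "(u, s)"] N(2)[OF Nil(2)] chart_inj[OF sm c(1)]
    by (simp add: prolong_def)
next
  case (Cons i l)
  have NS: "\<And>u. u \<in> N \<Longrightarrow> s u \<in> fst c" using N(2) by (simp add: sec_dom_def)
  have NW: "\<And>u. u \<in> N \<Longrightarrow> sec_coords M r c (u, s) \<in> overlap M r c c'"
    using N(2) sec_coords_overlap[OF sm c(1)] by blast
  have "foldr pd (i # l) (\<lambda>u. snd c' (s u) a) u = pd i (\<lambda>u. prolong M r c c' a l (sec_coords M r c (u, s))) u"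
    unfolding foldr.simps comp_def by (rule pd_cong[OF N(1)]) (use Cons in auto)
  also have "\<dots> = total_deriv M r i (prolong M r c c' a l) (sec_coords M r c (u, s))"
    by (rule pd_along_section[OF sm c(1) N(1) NS N(3) open_in_overlap[OF sm c] NW
        prolong_order_fun[OF sm c a]]) (use Cons.prems in auto)
  finally show ?case by (simp add: prolong_def)
qed

lemma prolong_sec_coords:
  assumes sm: "smooth_manifold M" and c: "c \<in> matlas M" "c' \<in> matlas M" and a: "a < mdim M"
    and p: "p \<in> sec_dom M r c" "p \<in> sec_dom M r c'" and \<sigma>: "set_mset \<sigma> \<subseteq> {..<r}"
  shows "sec_coords M r c' p (Xc a \<sigma>) =
    prolong M r c c' a (sorted_list_of_multiset \<sigma>) (sec_coords M r c p)"
proof -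
  obtain t s where ts: "p = (t, s)" by (cases p)
  obtain N where N: "open_in {..<r} N" "t \<in> N" "\<And>u. u \<in> N \<Longrightarrow> (u, s) \<in> sec_dom M r c"
      "\<And>a. a < mdim M \<Longrightarrow> smooth_on {..<r} N (\<lambda>u. snd c (s u) a)"
    using sec_domE[OF sm c(1) p(1)[unfolded ts]] by metis
  obtain N' where N': "open_in {..<r} N'" "t \<in> N'" "\<And>u. u \<in> N' \<Longrightarrow> (u, s) \<in> sec_dom M r c'"
    using sec_domE[OF sm c(2) p(2)[unfolded ts]] by metis
  have "foldr pd (sorted_list_of_multiset \<sigma>) (\<lambda>u. snd c' (s u) a) t =
      prolong M r c c' a (sorted_list_of_multiset \<sigma>) (sec_coords M r c (t, s))"
    by (rule prolong_sec_coords_list[OF sm c a, of r "N \<inter> N'"])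
      (use N N' \<sigma> in \<open>auto intro: open_in_Int smooth_on_subset\<close>)
  then show ?thesis using a \<sigma> by (simp add: ts sec_coords_Xc mpd_def)
qed

text \<open>In the chart, take polynomials with the prescribed derivatives at the base point and
  follow them by the inverse of the chart, on the open set where they stay in its image. Only
  derivatives up to order \<open>k\<close> are matched, so no convergence question arises.\<close>

lemma section_through:
  assumes sm: "smooth_manifold M" and c: "c \<in> matlas M" and y: "y \<in> jet_over M r (snd c ` fst c)"
  shows "\<exists>p\<in>sec_dom M r c. \<forall>j\<in>jidx_le M r k. sec_coords M r c p j = y j"
proof -
  let ?n = "mdim M"
  let ?V = "snd c ` fst c"
  let ?E = "coord_space {..<r} :: (nat \<Rightarrow> real) set"
  define t where "t i = (if i < r then y (Tc i) else 0)" for i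
  have oE: "open_in {..<r} ?E" by (simp add: open_in_def)
  have t: "t \<in> ?E" by (simp add: t_def coord_space_def)
  have "\<forall>a. \<exists>P. (\<forall>W. open_in {..<r} W \<longrightarrow> smooth_on {..<r} W P) \<and>
    (\<forall>\<sigma>. set_mset \<sigma> \<subseteq> {..<r} \<longrightarrow> size \<sigma> \<le> k \<longrightarrow> mpd \<sigma> P t = y (Xc a \<sigma>))"
    by (intro allI taylor_polynomial)
  then obtain Q where Q: "\<And>a W. open_in {..<r} W \<Longrightarrow> smooth_on {..<r} W (Q a)"
    "\<And>a \<sigma>. set_mset \<sigma> \<subseteq> {..<r} \<Longrightarrow> size \<sigma> \<le> k \<Longrightarrow> mpd \<sigma> (Q a) t = y (Xc a \<sigma>)"
    by metis
  define P where "P u a = (if a < ?n then Q a u else 0)" for u a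
  have PE: "P u \<in> coord_space {..<?n}" for u by (simp add: P_def coord_space_def)
  have Pa: "(\<lambda>u. P u a) = Q a" if "a < ?n" for a using that by (simp add: P_def)
  have Pcont: "continuous_on ?E P"
  proof (rule continuous_on_coordinatewise_then_product)
    show "continuous_on ?E (\<lambda>u. P u a)" for a
      using smooth_on_continuous[OF Q(1)[OF oE, of a]] by (cases "a < ?n") (simp_all add: P_def)
  qed
  obtain T where T: "open T" "?V = coord_space {..<?n} \<inter> T"
    using chart_homeo(3)[OF sm c] unfolding open_in_def openin_open by blast
  define N where "N = {u\<in>?E. P u \<in> ?V}"
  have N_eq: "N = {u\<in>?E. P u \<in> T}" using PE T by (auto simp: N_def)
  have N: "open_in {..<r} N"
  proof -
    have "openin (top_of_set ?E) (?E \<inter> P -` T)"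
      using continuous_openin_preimage_gen[OF Pcont T(1)] .
    moreover have "?E \<inter> P -` T = N" by (auto simp: N_eq)
    ultimately show ?thesis by (simp add: open_in_def)
  qed
  have Pt: "P t = jet_base M y"
    using Q(2)[of "{#}"] by (auto simp: P_def jet_base_def)
  have tN: "t \<in> N" using t Pt y by (simp add: N_def jet_over_def)
  define s where "s = inv_into (fst c) (snd c) \<circ> P"
  have sU: "s u \<in> fst c" "snd c (s u) = P u" if "u \<in> N" for u
    using that by (auto simp: N_def s_def inv_into_into f_inv_into_f)
  have "continuous_map (subtopology (Euclidean_space r) N) (mtop M) s"
    unfolding s_def
  proof (rule continuous_map_compose[OF _ chart_inverse_continuous[OF sm c]])
    have "continuous_on N P" by (rule continuous_on_subset[OF Pcont]) (auto simp: N_def)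
    moreover have "subtopology (Euclidean_space r) N = top_of_set N"
      unfolding Euclidean_space_coord subtopology_subtopology by (rule arg_cong) (auto simp: N_def)
    moreover have "subtopology (Euclidean_space ?n) ?V = top_of_set ?V"
      unfolding Euclidean_space_coord subtopology_subtopology T(2) by (rule arg_cong) auto
    ultimately show "continuous_map (subtopology (Euclidean_space r) N) (subtopology (Euclidean_space ?n) ?V) P"
      by (auto simp: N_def)
  qed
  \<comment> \<open>A local section must be smooth in every chart of the atlas; in \<open>c'\<close>
    this one is the coordinate change from \<open>c\<close> composed with the polynomials.\<close>
  moreover have "smooth_on {..<r} {u\<in>N. s u \<in> fst c'} (\<lambda>u. snd c' (s u) a)" if c': "c' \<in> matlas M" "a < ?n" for c' a
  proof -
    let ?V' = "snd c ` (fst c \<inter> fst c')"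
    have V': "open_in {..<?n} ?V'" by (rule chart_overlap_open[OF sm c c'(1)])
    have eq: "{u\<in>N. s u \<in> fst c'} = {u\<in>N. P u \<in> ?V'}"
    proof -
      have "s u \<in> fst c' \<longleftrightarrow> P u \<in> ?V'" if "u \<in> N" for u
        using inj_on_image_mem_iff[OF chart_inj[OF sm c] sU(1)[OF that], of "fst c \<inter> fst c'"] sU[OF that] by simp
      then show ?thesis by auto
    qed
    obtain T' where T': "open T'" "?V' = coord_space {..<?n} \<inter> T'"
      using V' unfolding open_in_def openin_open by blast
    have oN': "open_in {..<r} {u\<in>N. P u \<in> ?V'}"
    proof -
      have "openin (top_of_set ?E) (?E \<inter> P -` (T \<inter> T'))"
        using continuous_openin_preimage_gen[OF Pcont open_Int[OF T(1) T'(1)]] .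
      moreover have "?E \<inter> P -` (T \<inter> T') = {u\<in>N. P u \<in> ?V'}" using PE by (auto simp: N_eq T'(2))
      ultimately show ?thesis by (simp add: open_in_def)
    qed
    have "smooth_on {..<r} {u\<in>N. P u \<in> ?V'} (\<lambda>u. snd c' (inv_into (fst c) (snd c) (P u)) a)"
    proof (rule smooth_on_compose[where A = "{..<?n}" and F = P,
          OF oN' V' _ _ _ _ _ chart_trans_smooth[OF sm c c']])
      show "smooth_on {..<r} {u\<in>N. P u \<in> ?V'} (\<lambda>u. P u j)" if "j \<in> {..<?n}" for j
        using that Pa[of j] Q(1)[OF oN', of j] by simp
      fix v v' assume v: "v \<in> ?V'" "v' \<in> ?V'" "\<And>j. j \<in> {..<?n} \<Longrightarrow> v j = v' j"
      then have "v \<in> coord_space {..<?n}" "v' \<in> coord_space {..<?n}" using open_in_subset[OF V'] by auto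
      then have "v = v'" using v(3) by (rule coord_space_eqI)
      then show "snd c' (inv_into (fst c) (snd c) v) a = snd c' (inv_into (fst c) (snd c) v') a" by simp
    qed auto
    then show ?thesis unfolding eq by (simp add: s_def)
  qed
  ultimately have "(t, s) \<in> local_sections M r"
    unfolding local_sections_def using N tN by (auto simp: openin_Euclidean case_prod_unfold)
  then have dom: "(t, s) \<in> sec_dom M r c" using sU(1)[OF tN] by (simp add: sec_dom_def)
  moreover have "sec_coords M r c (t, s) j = y j" if j: "j \<in> jidx_le M r k" for j
  proof (cases j)
    case (Tc i)
    then show ?thesis using j by (simp add: sec_coords_Tc t_def)
  next
    case (Xc a \<sigma>)
    then have "mpd \<sigma> (\<lambda>u. snd c (s u) a) t = mpd \<sigma> (\<lambda>u. P u a) t"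
      using j by (intro mpd_cong[OF N _ tN]) (auto simp: sU(2))
    then show ?thesis using Xc j Pa[of a] Q(2)[of \<sigma> a] by (simp add: sec_coords_Xc)
  qed
  ultimately show ?thesis by blast
qed

text \<open>
  Differentiating the coordinates of an arbitrary section gives the identity at every point, since
  every point is, up to any finite order, the jet of a section.
\<close>

lemma prolong_contact:
  assumes sm: "smooth_manifold M" and c: "c \<in> matlas M" "c' \<in> matlas M" and a: "a < mdim M"
    and \<sigma>: "set_mset \<sigma> \<subseteq> {..<r}" and i: "i < r" and y: "y \<in> overlap M r c c'"
  shows "total_deriv M r i (prolong M r c c' a (sorted_list_of_multiset \<sigma>)) y =
    prolong M r c c' a (sorted_list_of_multiset (add_mset i \<sigma>)) y"
proof -
  \<comment> \<open>The order of the right-hand side. The left-hand side has this order as well, so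
    a section that matches \<open>y\<close> up to it suffices.\<close>
  let ?k = "Suc (size \<sigma>)"
  have "y \<in> jet_over M r (snd c ` fst c)" using y by (auto simp: overlap_def jet_over_def)
  from section_through[OF sm c(1) this, of ?k] obtain p where
    p: "p \<in> sec_dom M r c" "\<And>j. j \<in> jidx_le M r ?k \<Longrightarrow> sec_coords M r c p j = y j" by blast
  obtain t s where ts: "p = (t, s)" by (cases p)
  have "jet_base M (sec_coords M r c p) = jet_base M y"
    using p(2) by (auto simp: jet_base_def)
  then have "snd c (s t) \<in> snd c ` (fst c \<inter> fst c')"
    using jet_base_sec_coords[OF sm c(1) p(1)] y ts by (simp add: overlap_def jet_over_def)
  then have "s t \<in> fst c'"
    using p(1) ts chart_inj[OF sm c(1)] by (auto simp: sec_dom_def inj_on_def)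
  then have p': "p \<in> sec_dom M r c'" using p(1) ts by (auto intro: sec_dom_Int)
  obtain N where N: "open_in {..<r} N" "t \<in> N" "\<And>u. u \<in> N \<Longrightarrow> (u, s) \<in> sec_dom M r c"
      "\<And>a. a < mdim M \<Longrightarrow> smooth_on {..<r} N (\<lambda>u. snd c (s u) a)" "\<And>u. u \<in> N \<Longrightarrow> s u \<in> fst c"
    using sec_domE[OF sm c(1) p(1)[unfolded ts]] by metis
  obtain N' where N': "open_in {..<r} N'" "t \<in> N'" "\<And>u. u \<in> N' \<Longrightarrow> (u, s) \<in> sec_dom M r c'"
      "\<And>a. a < mdim M \<Longrightarrow> smooth_on {..<r} N' (\<lambda>u. snd c' (s u) a)"
    using sec_domE[OF sm c(2) p'[unfolded ts]] by metis
  have NN: "open_in {..<r} (N \<inter> N')" "t \<in> N \<inter> N'" using N N' open_in_Int by auto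
  let ?W = "overlap M r c c'" and ?J = "\<lambda>u. sec_coords M r c (u, s)"
  let ?T = "prolong M r c c' a (sorted_list_of_multiset \<sigma>)"
    and ?T' = "prolong M r c c' a (sorted_list_of_multiset (add_mset i \<sigma>))"
  note W = open_in_overlap[OF sm c, of r]
  have JW: "?J u \<in> ?W" if "u \<in> N \<inter> N'" for u
    using that N(3) N'(3) sec_coords_overlap[OF sm c(1)] by blast
  have T: "?T \<in> order_fun M r ?W (size \<sigma>)" "?T' \<in> order_fun M r ?W ?k"
    using prolong_order_fun[OF sm c a, of "sorted_list_of_multiset \<sigma>" r]
      prolong_order_fun[OF sm c a, of "sorted_list_of_multiset (add_mset i \<sigma>)" r] \<sigma> i
      mset_sorted_list_of_multiset[of \<sigma>] mset_sorted_list_of_multiset[of "add_mset i \<sigma>"]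
    by (simp_all add: size_mset[symmetric] del: size_mset sorted_list_of_multiset_insert)
  have mp: "mpd \<tau> (\<lambda>u. snd c' (s u) a) u = prolong M r c c' a (sorted_list_of_multiset \<tau>) (?J u)"
    if "u \<in> N \<inter> N'" "set_mset \<tau> \<subseteq> {..<r}" for u \<tau>
    using prolong_sec_coords[OF sm c a, of "(u, s)" r \<tau>] that N(3) N'(3) a by (simp add: sec_coords_Xc)
  have "?T' (?J t) = mpd (add_mset i \<sigma>) (\<lambda>u. snd c' (s u) a) t"
    using mp[OF NN(2), of "add_mset i \<sigma>"] \<sigma> i by simp
  also have "\<dots> = pd i (mpd \<sigma> (\<lambda>u. snd c' (s u) a)) t"
    by (rule mpd_add_mset[OF N'(1) N'(4)[OF a] \<sigma> i N'(2)])
  also have "\<dots> = pd i (\<lambda>u. ?T (?J u)) t"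
    by (rule pd_cong[OF NN(1,2)]) (use i mp \<sigma> in auto)
  also have "\<dots> = total_deriv M r i ?T (?J t)"
    by (rule pd_along_section[OF sm c(1) NN(1) _ _ W JW T(1) i NN(2)])
      (use N in \<open>auto intro: smooth_on_subset\<close>)
  finally have eq: "?T' (?J t) = total_deriv M r i ?T (?J t)" .
  have "?T' y = ?T' (?J t)"
    by (rule order_fun_dep[OF T(2) y JW[OF NN(2)]]) (use p(2) ts in auto)
  moreover have "total_deriv M r i ?T y = total_deriv M r i ?T (?J t)"
    by (rule order_fun_dep[OF order_fun_total_deriv[OF W T(1) i] y JW[OF NN(2)]]) (use p(2) ts in auto)
  ultimately show ?thesis using eq by simp
qed

subsection \<open>The jet space\<close>

lemma jet_rel_iff:
  "(p, q) \<in> jet_rel M r k \<longleftrightarrow> p \<in> local_sections M r \<and> q \<in> local_sections M r \<and>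
     fst p = fst q \<and> snd p (fst p) = snd q (fst p) \<and>
     (\<forall>c\<in>matlas M. snd p (fst p) \<in> fst c \<longrightarrow>
       (\<forall>a<mdim M. \<forall>\<sigma>. set_mset \<sigma> \<subseteq> {..<r} \<longrightarrow> size \<sigma> \<le> k \<longrightarrow>
          mpd \<sigma> (\<lambda>u. snd c (snd p u) a) (fst p) = mpd \<sigma> (\<lambda>u. snd c (snd q u) a) (fst p)))"
  by (cases p; cases q) (auto simp: jet_rel_def case_prod_unfold)

lemma jet_rel_refl: "p \<in> local_sections M r \<Longrightarrow> (p, p) \<in> jet_rel M r k"
  by (simp add: jet_rel_iff)

lemma jet_rel_sym: "(p, q) \<in> jet_rel M r k \<Longrightarrow> (q, p) \<in> jet_rel M r k"
  by (cases p; cases q) (auto simp: jet_rel_iff)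

lemma jet_rel_trans: "(p, q) \<in> jet_rel M r k \<Longrightarrow> (q, q') \<in> jet_rel M r k \<Longrightarrow> (p, q') \<in> jet_rel M r k"
  by (cases p; cases q; cases q') (auto simp: jet_rel_iff)

lemma jet_rel_mono: "k \<le> k' \<Longrightarrow> (p, q) \<in> jet_rel M r k' \<Longrightarrow> (p, q) \<in> jet_rel M r k"
  unfolding jet_rel_iff by (meson order_trans)

lemma jet_rel_coords:
  assumes "(p, q) \<in> jet_rel M r k" "c \<in> matlas M" "p \<in> sec_dom M r c"
  shows "q \<in> sec_dom M r c" and "j \<in> jidx_le M r k \<Longrightarrow> sec_coords M r c p j = sec_coords M r c q j"
proof -
  show "q \<in> sec_dom M r c" using assms by (cases p; cases q) (auto simp: jet_rel_iff sec_dom_def)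
  show "sec_coords M r c p j = sec_coords M r c q j" if "j \<in> jidx_le M r k"
    using assms that by (cases j) (auto simp: jet_rel_iff sec_dom_def sec_coords_Tc sec_coords_Xc)
qed

text \<open>\<open>jet_rel\<close> compares sections in all charts. One chart is enough, since by
  \<open>prolong_sec_coords\<close> the derivatives in another chart are functions, of no higher
  order, of the coordinates in the first.\<close>

lemma jet_rel_chart:
  assumes sm: "smooth_manifold M" and c: "c \<in> matlas M" and p: "p \<in> sec_dom M r c" "q \<in> sec_dom M r c"
    and eq: "\<And>j. j \<in> jidx_le M r k \<Longrightarrow> sec_coords M r c p j = sec_coords M r c q j"
  shows "(p, q) \<in> jet_rel M r k"
proof -
  have l: "p \<in> local_sections M r" "q \<in> local_sections M r" using p by (auto simp: sec_dom_def)
  have t: "fst p = fst q"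
    by (rule coord_space_eqI[OF sec_base_coord[OF l(1)] sec_base_coord[OF l(2)]])
      (use eq[of "Tc _"] in \<open>simp add: sec_coords_Tc\<close>)
  have "jet_base M (sec_coords M r c p) = jet_base M (sec_coords M r c q)"
    using eq[of "Xc _ {#}"] by (auto simp: jet_base_def)
  then have "snd c (snd p (fst p)) = snd c (snd q (fst q))"
    using jet_base_sec_coords[OF sm c p(1)] jet_base_sec_coords[OF sm c p(2)] by simp
  then have s: "snd p (fst p) = snd q (fst p)"
    using chart_inj[OF sm c] p t by (auto simp: sec_dom_def inj_on_def)
  have "mpd \<sigma> (\<lambda>u. snd c' (snd p u) a) (fst p) = mpd \<sigma> (\<lambda>u. snd c' (snd q u) a) (fst p)"
    if c': "c' \<in> matlas M" "snd p (fst p) \<in> fst c'" and a: "a < mdim M" and \<sigma>: "set_mset \<sigma> \<subseteq> {..<r}" "size \<sigma> \<le> k"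
    for c' a \<sigma>
  proof -
    have p': "p \<in> sec_dom M r c'" "q \<in> sec_dom M r c'" using c' p s t by (auto simp: sec_dom_def)
    let ?l = "sorted_list_of_multiset \<sigma>"
    have len: "length ?l = size \<sigma>" by (metis mset_sorted_list_of_multiset size_mset)
    have T: "prolong M r c c' a ?l \<in> order_fun M r (overlap M r c c') (size \<sigma>)"
      using prolong_order_fun[OF sm c c'(1) a, of ?l r] \<sigma> len by simp
    have "prolong M r c c' a ?l (sec_coords M r c p) = prolong M r c c' a ?l (sec_coords M r c q)"
    proof (rule order_fun_dep[OF T])
      show "sec_coords M r c p \<in> overlap M r c c'" "sec_coords M r c q \<in> overlap M r c c'"
        using sec_coords_overlap[OF sm c] p p' by auto
      show "sec_coords M r c p j = sec_coords M r c q j" if "j \<in> jidx_le M r (size \<sigma>)" for j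
        using that jidx_le_mono[OF \<sigma>(2), of M r] by (intro eq) auto
    qed
    then show ?thesis
      using prolong_sec_coords[OF sm c c'(1) a p(1) p'(1) \<sigma>(1)] prolong_sec_coords[OF sm c c'(1) a p(2) p'(2) \<sigma>(1)]
        a \<sigma> t by (simp add: sec_coords_Xc)
  qed
  then show ?thesis unfolding jet_rel_iff using l t s by blast
qed

lemma jetsD:
  assumes "z \<in> jets M r"
  shows "\<And>p. p \<in> z k \<Longrightarrow> p \<in> local_sections M r"
    and "\<And>p q. p \<in> z k \<Longrightarrow> q \<in> z k \<Longrightarrow> (p, q) \<in> jet_rel M r k"
    and "\<And>p. p \<in> z k \<Longrightarrow> z k = jet_rel M r k `` {p}"
    and "jet_rep z k \<in> z k"
    and "\<And>k'. k \<le> k' \<Longrightarrow> z k' \<subseteq> z k"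
proof -
  have "z k \<in> finite_jets M r k" using assms by (simp add: jets_def)
  then obtain p0 where p0: "z k = jet_rel M r k `` {p0}" "p0 \<in> local_sections M r"
    unfolding finite_jets_def by (rule quotientE)
  show "\<And>p. p \<in> z k \<Longrightarrow> p \<in> local_sections M r" using p0 by (auto simp: jet_rel_iff)
  show *: "(p, q) \<in> jet_rel M r k" if "p \<in> z k" "q \<in> z k" for p q
    using that unfolding p0(1) by (auto intro: jet_rel_trans jet_rel_sym)
  show "z k = jet_rel M r k `` {p}" if "p \<in> z k" for p
    using that * unfolding p0(1) by (blast intro: jet_rel_trans)
  have "p0 \<in> z k" using p0(1) jet_rel_refl[OF p0(2)] by simp
  then show "jet_rep z k \<in> z k" unfolding jet_rep_def by (rule someI)
  have "\<And>k. z (Suc k) \<subseteq> z k" using assms by (simp add: jets_def)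
  then show "z k' \<subseteq> z k" if "k \<le> k'" for k' using that by (rule lift_Suc_antimono_le)
qed

text \<open>\<open>jet_dom\<close> looks at one representative of order zero. All the others, of
  whatever order, are related to it to order zero because the classes of a jet are nested.\<close>

lemma jet_dom_iff:
  assumes "c \<in> matlas M"
  shows "z \<in> jet_dom M r c \<longleftrightarrow> z \<in> jets M r \<and> (\<forall>k. z k \<subseteq> sec_dom M r c)"
proof
  assume z: "z \<in> jet_dom M r c"
  then have j: "z \<in> jets M r" by (simp add: jet_dom_def)
  have rep: "jet_rep z 0 \<in> sec_dom M r c"
    using z jetsD(1)[OF j jetsD(4)[OF j]] by (auto simp: jet_dom_def sec_dom_def case_prod_unfold)
  have "p \<in> sec_dom M r c" if "p \<in> z k" for p k
  proof -
    have "z k \<subseteq> z 0" by (rule jetsD(5)[OF j]) simp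
    then have "p \<in> z 0" using that by auto
    from jetsD(2)[OF j jetsD(4)[OF j] this] show ?thesis by (rule jet_rel_coords(1)[OF _ assms rep])
  qed
  then show "z \<in> jets M r \<and> (\<forall>k. z k \<subseteq> sec_dom M r c)" using j by blast
next
  assume z: "z \<in> jets M r \<and> (\<forall>k. z k \<subseteq> sec_dom M r c)"
  then have "jet_rep z 0 \<in> z 0" "z 0 \<subseteq> sec_dom M r c" using jetsD(4) by blast+
  then have "jet_rep z 0 \<in> sec_dom M r c" by blast
  then show "z \<in> jet_dom M r c" using z by (auto simp: jet_dom_def sec_dom_def case_prod_unfold)
qed

text \<open>Each coordinate is defined by a representative of its own order \<open>l\<close>. As
  \<open>z k\<close> is contained in \<open>z l\<close>, a representative of any order at least
  \<open>l\<close> gives the same value.\<close>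

lemma jet_coords_eq:
  assumes c: "c \<in> matlas M" and z: "z \<in> jet_dom M r c" and p: "p \<in> z k" and j: "j \<in> jidx_le M r k"
  shows "jet_coords M r c z j = sec_coords M r c p j"
proof -
  have zj: "z \<in> jets M r" "\<And>k. z k \<subseteq> sec_dom M r c" using z jet_dom_iff[OF c] by auto
  have ji: "j \<in> jidx M r" using j jidx_le_subset by blast
  obtain l where l: "l \<le> k" "j \<in> jidx_le M r l"
    "jet_coords M r c z j = sec_coords M r c (jet_rep z l) j"
  proof (cases j)
    case (Tc i)
    then show thesis using that[of 0] j ji by (simp add: jet_coords_def sec_coords_def)
  next
    case (Xc a \<sigma>)
    then show thesis using that[of "size \<sigma>"] j ji
      by (simp add: jet_coords_def sec_coords_def case_prod_unfold)
  qed
  have "p \<in> z l" using jetsD(5)[OF zj(1) l(1)] p by blast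
  then have "(jet_rep z l, p) \<in> jet_rel M r l" using jetsD(2,4)[OF zj(1)] by blast
  from jet_rel_coords(2)[OF this c _ l(2)] show ?thesis
    using l(3) zj jetsD(4) by (metis subsetD)
qed

lemma jet_coords_coord_space: "jet_coords M r c z \<in> coord_space (jidx M r)"
  by (simp add: coord_space_def jet_coords_def)

lemma jet_coords_inj:
  assumes sm: "smooth_manifold M" and c: "c \<in> matlas M"
  shows "inj_on (jet_coords M r c) (jet_dom M r c)"
proof (rule inj_onI, rule ext)
  fix z w k assume z: "z \<in> jet_dom M r c" and w: "w \<in> jet_dom M r c"
    and eq: "jet_coords M r c z = jet_coords M r c w"
  have j: "z \<in> jets M r" "w \<in> jets M r" "z k \<subseteq> sec_dom M r c" "w k \<subseteq> sec_dom M r c"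
    using z w jet_dom_iff[OF c] by auto
  let ?p = "jet_rep z k" and ?q = "jet_rep w k"
  have pq: "?p \<in> z k" "?q \<in> w k" using jetsD(4)[OF j(1)] jetsD(4)[OF j(2)] by auto
  have "(?p, ?q) \<in> jet_rel M r k"
    using jet_coords_eq[OF c z pq(1)] jet_coords_eq[OF c w pq(2)] eq pq j
    by (intro jet_rel_chart[OF sm c]) auto
  then have "jet_rel M r k `` {?p} = jet_rel M r k `` {?q}"
    by (auto intro: jet_rel_trans jet_rel_sym)
  then show "z k = w k" using jetsD(3)[OF j(1) pq(1)] jetsD(3)[OF j(2) pq(2)] by simp
qed

text \<open>For surjectivity no section with the prescribed infinite jet has to be found. For each
  \<open>k\<close> a section is chosen that matches \<open>y\<close> to order \<open>k\<close>; the
  classes are nested, since sections \<open>k\<close> and \<open>k + 1\<close> agree to order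
  \<open>k\<close>, and so define a point of the inverse limit.\<close>

lemma jet_img_eq:
  assumes sm: "smooth_manifold M" and c: "c \<in> matlas M"
  shows "jet_img M r c = jet_over M r (snd c ` fst c)"
proof
  show "jet_img M r c \<subseteq> jet_over M r (snd c ` fst c)"
  proof
    fix y assume "y \<in> jet_img M r c"
    then obtain z where z: "z \<in> jet_dom M r c" "y = jet_coords M r c z" by (auto simp: jet_img_def)
    then have j: "z \<in> jets M r" "z 0 \<subseteq> sec_dom M r c" using jet_dom_iff[OF c] by auto
    have p: "jet_rep z 0 \<in> z 0" "jet_rep z 0 \<in> sec_dom M r c" using jetsD(4)[OF j(1)] j(2) by auto
    have "jet_base M y = jet_base M (sec_coords M r c (jet_rep z 0))"
      unfolding z(2) by (auto simp: jet_base_def jet_coords_eq[OF c z(1) p(1)])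
    then show "y \<in> jet_over M r (snd c ` fst c)"
      using jet_base_sec_coords[OF sm c p(2)] p(2) jet_coords_coord_space[of M r c z] z(2)
      by (simp add: jet_over_def sec_dom_def)
  qed
  show "jet_over M r (snd c ` fst c) \<subseteq> jet_img M r c"
  proof
    fix y assume y: "y \<in> jet_over M r (snd c ` fst c)"
    obtain p where p: "\<And>k. p k \<in> sec_dom M r c" "\<And>k j. j \<in> jidx_le M r k \<Longrightarrow> sec_coords M r c (p k) j = y j"
      using section_through[OF sm c y] by metis
    define z where "z k = jet_rel M r k `` {p k}" for k
    have pl: "p k \<in> local_sections M r" for k using p(1) by (simp add: sec_dom_def)
    have pz: "p k \<in> z k" for k using jet_rel_refl[OF pl] by (simp add: z_def)
    have "z (Suc k) \<subseteq> z k" for k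
    proof -
      have "(p k, p (Suc k)) \<in> jet_rel M r k"
        using p jidx_le_mono[of k "Suc k" M r] by (intro jet_rel_chart[OF sm c]) auto
      moreover have "(p (Suc k), q) \<in> jet_rel M r k" if "q \<in> z (Suc k)" for q
        using that unfolding z_def by (intro jet_rel_mono[of k "Suc k"]) auto
      ultimately show ?thesis by (auto simp: z_def[of k] intro: jet_rel_trans)
    qed
    then have j: "z \<in> jets M r" using pl by (auto simp: jets_def finite_jets_def quotient_def z_def)
    have "z k \<subseteq> sec_dom M r c" for k
      using jet_rel_coords(1)[OF _ c p(1)] by (auto simp: z_def)
    then have zd: "z \<in> jet_dom M r c" using j jet_dom_iff[OF c] by auto
    have "jet_coords M r c z = y"
    proof (rule coord_space_eqI[OF jet_coords_coord_space])
      show "y \<in> coord_space (jidx M r)" using y by (simp add: jet_over_def)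
      fix j assume "j \<in> jidx M r"
      then obtain k where "j \<in> jidx_le M r k" using jidx_finite_order by blast
      then show "jet_coords M r c z j = y j" using jet_coords_eq[OF c zd pz] p(2) by simp
    qed
    then show "y \<in> jet_img M r c" using zd by (auto simp: jet_img_def)
  qed
qed

lemma jet_dom_Int_image:
  assumes sm: "smooth_manifold M" and c: "c \<in> matlas M" "c' \<in> matlas M"
  shows "jet_coords M r c ` (jet_dom M r c \<inter> jet_dom M r c') = overlap M r c c'"
proof -
  have base: "jet_base M (jet_coords M r c z) = snd c (snd (jet_rep z 0) (fst (jet_rep z 0)))"
    if z: "z \<in> jet_dom M r c" for z
  proof -
    have j: "z \<in> jets M r" "z 0 \<subseteq> sec_dom M r c" using z jet_dom_iff[OF c(1)] by auto
    have p: "jet_rep z 0 \<in> z 0" "jet_rep z 0 \<in> sec_dom M r c" using jetsD(4)[OF j(1)] j(2) by auto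
    have "jet_base M (jet_coords M r c z) = jet_base M (sec_coords M r c (jet_rep z 0))"
      by (auto simp: jet_base_def jet_coords_eq[OF c(1) z(1) p(1)])
    then show ?thesis using jet_base_sec_coords[OF sm c(1) p(2)] by simp
  qed
  have in_c: "snd (jet_rep z 0) (fst (jet_rep z 0)) \<in> fst c" if "z \<in> jet_dom M r c" for z c
    using that by (auto simp: jet_dom_def case_prod_unfold)
  show ?thesis
  proof
    show "jet_coords M r c ` (jet_dom M r c \<inter> jet_dom M r c') \<subseteq> overlap M r c c'"
    proof
      fix y assume "y \<in> jet_coords M r c ` (jet_dom M r c \<inter> jet_dom M r c')"
      then obtain z where z: "z \<in> jet_dom M r c" "z \<in> jet_dom M r c'" "y = jet_coords M r c z" by auto
      then show "y \<in> overlap M r c c'"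
        using base[OF z(1)] in_c[OF z(1)] in_c[OF z(2)] jet_coords_coord_space[of M r c z]
        by (simp add: overlap_def jet_over_def)
    qed
    show "overlap M r c c' \<subseteq> jet_coords M r c ` (jet_dom M r c \<inter> jet_dom M r c')"
    proof
      fix y assume y: "y \<in> overlap M r c c'"
      then have "y \<in> jet_img M r c" unfolding jet_img_eq[OF sm c(1)] by (auto simp: overlap_def jet_over_def)
      then obtain z where z: "z \<in> jet_dom M r c" "y = jet_coords M r c z" by (auto simp: jet_img_def)
      have "snd c (snd (jet_rep z 0) (fst (jet_rep z 0))) \<in> snd c ` (fst c \<inter> fst c')"
        using base[OF z(1)] y z(2) by (simp add: overlap_def jet_over_def)
      then have "snd (jet_rep z 0) (fst (jet_rep z 0)) \<in> fst c'"
        using in_c[OF z(1)] chart_inj[OF sm c(1)] by (auto simp: inj_on_def)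
      then have "z \<in> jet_dom M r c'" using z(1) by (auto simp: jet_dom_def case_prod_unfold)
      then show "y \<in> jet_coords M r c ` (jet_dom M r c \<inter> jet_dom M r c')" using z by auto
    qed
  qed
qed

lemma open_in_jet_img:
  "smooth_manifold M \<Longrightarrow> c \<in> matlas M \<Longrightarrow> open_in (jidx M r) (jet_img M r c)"
  using jet_img_eq open_in_jet_over[OF chart_homeo(3)] by metis

lemma overlap_subset_jet_img:
  "smooth_manifold M \<Longrightarrow> c \<in> matlas M \<Longrightarrow> overlap M r c c' \<subseteq> jet_img M r c"
  using jet_img_eq by (fastforce simp: overlap_def jet_over_def)

text \<open>A representative of the jet is a section seen in both charts, and the derivatives of its
  expression in \<open>c'\<close> are given by \<open>prolong_sec_coords\<close>. The coordinate
  change, defined by choices, thus becomes an explicit function of finite order.\<close>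

lemma jet_trans_eq:
  assumes sm: "smooth_manifold M" and c: "c \<in> matlas M" "c' \<in> matlas M" and y: "y \<in> overlap M r c c'"
  shows "jet_trans M r c c' y \<in> overlap M r c' c"
    and "i < r \<Longrightarrow> jet_trans M r c c' y (Tc i) = y (Tc i)"
    and "Xc a \<sigma> \<in> xidx M r \<Longrightarrow>
      jet_trans M r c c' y (Xc a \<sigma>) = prolong M r c c' a (sorted_list_of_multiset \<sigma>) y"
    and "j \<notin> jidx M r \<Longrightarrow> jet_trans M r c c' y j = 0"
proof -
  obtain z where z: "z \<in> jet_dom M r c" "z \<in> jet_dom M r c'" "y = jet_coords M r c z"
    using y unfolding jet_dom_Int_image[OF sm c, symmetric] by auto
  have T: "jet_trans M r c c' y = jet_coords M r c' z"
    unfolding jet_trans_def z(3) using jet_coords_inj[OF sm c(1)] z(1) by simp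
  show "jet_trans M r c c' y \<in> overlap M r c' c"
    unfolding T jet_dom_Int_image[OF sm c(2,1), symmetric] using z by auto
  show "jet_trans M r c c' y (Tc i) = y (Tc i)" if "i < r"
    unfolding T using that by (simp add: z(3) jet_coords_def)
  show "jet_trans M r c c' y j = 0" if "j \<notin> jidx M r"
    unfolding T using that by (simp add: jet_coords_def)
  assume X: "Xc a \<sigma> \<in> xidx M r"
  let ?k = "size \<sigma>" and ?l = "sorted_list_of_multiset \<sigma>"
  let ?p = "jet_rep z ?k"
  have zj: "z \<in> jets M r" "z ?k \<subseteq> sec_dom M r c" "z ?k \<subseteq> sec_dom M r c'"
    using z jet_dom_iff[OF c(1)] jet_dom_iff[OF c(2)] by auto
  have p: "?p \<in> z ?k" "?p \<in> sec_dom M r c" "?p \<in> sec_dom M r c'" using jetsD(4)[OF zj(1)] zj by auto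
  have len: "length ?l = size \<sigma>" by (metis mset_sorted_list_of_multiset size_mset)
  have P: "prolong M r c c' a ?l \<in> order_fun M r (overlap M r c c') ?k"
    using prolong_order_fun[OF sm c, of a ?l r] X len by simp
  have "jet_trans M r c c' y (Xc a \<sigma>) = sec_coords M r c' ?p (Xc a \<sigma>)"
    unfolding T by (rule jet_coords_eq[OF c(2) z(2) p(1)]) (use X in auto)
  also have "\<dots> = prolong M r c c' a ?l (sec_coords M r c ?p)"
    using X by (intro prolong_sec_coords[OF sm c _ p(2,3)]) auto
  also have "\<dots> = prolong M r c c' a ?l y"
    by (rule order_fun_dep[OF P sec_coords_overlap[OF sm c(1) p(2,3)] y])
      (simp add: z(3) jet_coords_eq[OF c(1) z(1) p(1)])
  finally show "jet_trans M r c c' y (Xc a \<sigma>) = prolong M r c c' a ?l y" .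
qed

text \<open>Coordinate changes preserve the order, so that a single bound on the order of a form can
  hold in all charts.\<close>

lemma jet_trans_order_fun:
  assumes sm: "smooth_manifold M" and c: "c \<in> matlas M" "c' \<in> matlas M" and j: "j \<in> jidx_le M r k"
  shows "(\<lambda>y. jet_trans M r c c' y j) \<in> order_fun M r (overlap M r c c') k"
proof (cases j)
  case (Tc i)
  then show ?thesis using j jet_trans_eq(2)[OF sm c]
    by (intro order_fun_cong[OF open_in_overlap[OF sm c] order_fun_coord[OF open_in_overlap[OF sm c] j]]) auto
next
  case (Xc a \<sigma>)
  let ?l = "sorted_list_of_multiset \<sigma>"
  have "length ?l = size \<sigma>" by (metis mset_sorted_list_of_multiset size_mset)
  then have P: "prolong M r c c' a ?l \<in> order_fun M r (overlap M r c c') k"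
    using prolong_order_fun[OF sm c, of a ?l r] j Xc order_fun_mono by fastforce
  show ?thesis using j Xc
    by (intro order_fun_cong[OF open_in_overlap[OF sm c] P]) (auto simp: jet_trans_eq(3)[OF sm c])
qed

text \<open>Coordinate changes respect the contact structure. In \<open>jet_trans_frame\<close> this
  identity cancels the \<open>dt\<close>-terms of a pulled back Cartan form.\<close>

lemma jet_trans_contact:
  assumes sm: "smooth_manifold M" and c: "c \<in> matlas M" "c' \<in> matlas M" and y: "y \<in> overlap M r c c'"
    and j: "j \<in> xidx M r" and i: "i < r"
  shows "total_deriv M r i (\<lambda>y. jet_trans M r c c' y j) y = jet_trans M r c c' y (raise i j)"
proof -
  obtain a \<sigma> where a: "j = Xc a \<sigma>" "a < mdim M" "set_mset \<sigma> \<subseteq> {..<r}" using j by (cases j) auto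
  have "total_deriv M r i (\<lambda>y. jet_trans M r c c' y j) y =
      total_deriv M r i (prolong M r c c' a (sorted_list_of_multiset \<sigma>)) y"
    using a by (intro total_deriv_cong[OF open_in_overlap[OF sm c] y i]) (auto simp: jet_trans_eq(3)[OF sm c])
  also have "\<dots> = prolong M r c c' a (sorted_list_of_multiset (add_mset i \<sigma>)) y"
    by (rule prolong_contact[OF sm c a(2,3) i y])
  also have "\<dots> = jet_trans M r c c' y (raise i j)"
    using a i jet_trans_eq(3)[OF sm c y, of a "add_mset i \<sigma>"] by simp
  finally show ?thesis .
qed

subsection \<open>The projection forgetting the last independent variable\<close>

lemma jidx_le_Suc: "jidx_le M r k \<subseteq> jidx_le M (r + 1) k"
  by (auto simp: jidx_le_def tidx_def xidx_def subset_iff less_Suc_eq)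

lemma jidx_Suc: "jidx M r \<subseteq> jidx M (r + 1)"
  by (auto simp: jidx_def tidx_def xidx_def subset_iff less_Suc_eq)

lemma xidx_Suc: "xidx M r \<subseteq> xidx M (r + 1)"
  by (auto simp: xidx_def subset_iff less_Suc_eq)

lemma jet_proj_over: "y \<in> jet_over M (r + 1) V \<Longrightarrow> jet_proj M r y \<in> jet_over M r V"
proof -
  have "jet_base M (jet_proj M r y) = jet_base M y" by (auto simp: jet_base_def jet_proj_def)
  then show "y \<in> jet_over M (r + 1) V \<Longrightarrow> jet_proj M r y \<in> jet_over M r V"
    by (simp add: jet_over_def coord_space_def jet_proj_def)
qed

lemma jet_proj_order_fun:
  assumes "open_in (jidx M (r + 1)) W" "j \<in> jidx_le M r k"
  shows "(\<lambda>y. jet_proj M r y j) \<in> order_fun M (r + 1) W k"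
proof -
  have "j \<in> jidx M r" "j \<in> jidx_le M (r + 1) k"
    using assms(2) jidx_le_subset[of M r k] jidx_le_Suc[of M r k] by auto
  then show ?thesis using order_fun_coord[OF assms(1)] by (simp add: jet_proj_def)
qed

lemma pd_jet_proj:
  assumes W: "open_in (jidx M (r + 1)) W" and V: "open_in (jidx M r) V"
    and F: "\<And>y. y \<in> W \<Longrightarrow> jet_proj M r y \<in> V" and f: "f \<in> order_fun M r V k"
    and i: "i \<in> jidx M (r + 1)" and y: "y \<in> W"
  shows "pd i (\<lambda>y. f (jet_proj M r y)) y = (if i \<in> jidx_le M r k then pd i f (jet_proj M r y) else 0)"
proof -
  have "pd i (\<lambda>y. f (jet_proj M r y)) y =
      (\<Sum>j\<in>jidx_le M r k. pd j f (jet_proj M r y) * pd i (\<lambda>y. jet_proj M r y j) y)"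
    by (rule order_fun_pd_compose[OF W V F jet_proj_order_fun[OF W] f i y])
  also have "\<dots> = (\<Sum>j\<in>jidx_le M r k. if j = i then pd i f (jet_proj M r y) else 0)"
  proof (rule sum.cong[OF refl])
    fix j assume "j \<in> jidx_le M r k"
    then have "j \<in> jidx M r" using jidx_le_subset[of M r k] by auto
    then show "pd j f (jet_proj M r y) * pd i (\<lambda>y. jet_proj M r y j) y =
        (if j = i then pd i f (jet_proj M r y) else 0)"
      by (simp add: jet_proj_def pd_coord)
  qed
  also have "\<dots> = (if i \<in> jidx_le M r k then pd i f (jet_proj M r y) else 0)"
    using finite_jidx_le[of M r k] by (simp add: sum.delta)
  finally show ?thesis .
qed

text \<open>A function pulled back from the smaller jet space does not depend on the new
  coordinates, so their terms vanish; and for \<open>i < r\<close> the index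
  \<open>raise i j\<close> stays among the old ones.\<close>

lemma total_deriv_jet_proj:
  assumes W: "open_in (jidx M (r + 1)) W" and V: "open_in (jidx M r) V"
    and F: "\<And>y. y \<in> W \<Longrightarrow> jet_proj M r y \<in> V" and f: "f \<in> order_fun M r V k"
    and i: "i < r" and y: "y \<in> W"
  shows "total_deriv M (r + 1) i (\<lambda>y. f (jet_proj M r y)) y = total_deriv M r i f (jet_proj M r y)"
proof -
  let ?g = "\<lambda>y. f (jet_proj M r y)"
  have g: "?g \<in> order_fun M (r + 1) W k"
    by (rule order_fun_compose[OF W V F jet_proj_order_fun[OF W] f])
  note pd = pd_jet_proj[OF W V F f _ y]
  have "(\<Sum>j\<in>jidx_le M (r + 1) k \<inter> xidx M (r + 1). y (raise i j) * pd j ?g y) =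
      (\<Sum>j\<in>jidx_le M r k \<inter> xidx M r. y (raise i j) * pd j ?g y)"
  proof (rule sum.mono_neutral_right)
    show "jidx_le M r k \<inter> xidx M r \<subseteq> jidx_le M (r + 1) k \<inter> xidx M (r + 1)"
      using jidx_le_Suc[of M r k] xidx_Suc[of M r] by auto
    show "\<forall>j\<in>jidx_le M (r + 1) k \<inter> xidx M (r + 1) - jidx_le M r k \<inter> xidx M r. y (raise i j) * pd j ?g y = 0"
    proof
      fix j assume j: "j \<in> jidx_le M (r + 1) k \<inter> xidx M (r + 1) - jidx_le M r k \<inter> xidx M r"
      then have "j \<notin> jidx_le M r k" "j \<in> jidx M (r + 1)" by (cases j; auto)+
      then show "y (raise i j) * pd j ?g y = 0" using pd[of j] by simp
    qed
  qed (simp add: finite_jidx_le)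
  also have "\<dots> = (\<Sum>j\<in>jidx_le M r k \<inter> xidx M r. jet_proj M r y (raise i j) * pd j f (jet_proj M r y))"
  proof (rule sum.cong[OF refl])
    fix j assume j: "j \<in> jidx_le M r k \<inter> xidx M r"
    then have "raise i j \<in> jidx M r" "j \<in> jidx M (r + 1)"
      using raise_xidx[OF i, of j M] xidx_Suc[of M r] by (auto simp: jidx_def)
    then show "y (raise i j) * pd j ?g y = jet_proj M r y (raise i j) * pd j f (jet_proj M r y)"
      using j pd[of j] by (simp add: jet_proj_def)
  qed
  finally show ?thesis
    using total_deriv_eq[OF W g y, of i] total_deriv_eq[OF V f F[OF y] i] i pd[of "Tc i"] by simp
qed

lemma prolong_jet_proj:
  assumes sm: "smooth_manifold M" and c: "c \<in> matlas M" "c' \<in> matlas M" and a: "a < mdim M"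
    and "set l \<subseteq> {..<r}" and "y \<in> overlap M (r + 1) c c'"
  shows "prolong M (r + 1) c c' a l y = prolong M r c c' a l (jet_proj M r y)"
  using assms(5,6)
proof (induction l arbitrary: y)
  case Nil
  have "jet_base M (jet_proj M r y) = jet_base M y" by (auto simp: jet_base_def jet_proj_def)
  then show ?case by (simp add: prolong_def)
next
  case (Cons i l)
  note W = open_in_overlap[OF sm c, of "r + 1"] and V = open_in_overlap[OF sm c, of r]
  have F: "jet_proj M r y \<in> overlap M r c c'" if "y \<in> overlap M (r + 1) c c'" for y
    using that jet_proj_over by (simp add: overlap_def)
  have "prolong M (r + 1) c c' a (i # l) y = total_deriv M (r + 1) i (prolong M (r + 1) c c' a l) y"
    by (simp add: prolong_def)
  also have "\<dots> = total_deriv M (r + 1) i (\<lambda>y. prolong M r c c' a l (jet_proj M r y)) y"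
    by (rule total_deriv_cong[OF W]) (use Cons in auto)
  also have "\<dots> = total_deriv M r i (prolong M r c c' a l) (jet_proj M r y)"
    by (rule total_deriv_jet_proj[OF W V F prolong_order_fun[OF sm c a]]) (use Cons.prems in auto)
  finally show ?case by (simp add: prolong_def)
qed

text \<open>Prolongation by indices below \<open>r\<close> involves only coordinates of the smaller
  jet space. This is why the pullback along the projection, given chart by chart, fits together to a
  form.\<close>

lemma jet_proj_jet_trans:
  assumes sm: "smooth_manifold M" and c: "c \<in> matlas M" "c' \<in> matlas M"
    and y: "y \<in> overlap M (r + 1) c c'"
  shows "jet_proj M r y \<in> overlap M r c c'"
    and "jet_proj M r (jet_trans M (r + 1) c c' y) = jet_trans M r c c' (jet_proj M r y)"
proof -
  show p: "jet_proj M r y \<in> overlap M r c c'" using y jet_proj_over by (simp add: overlap_def)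
  show "jet_proj M r (jet_trans M (r + 1) c c' y) = jet_trans M r c c' (jet_proj M r y)"
  proof
    fix j
    show "jet_proj M r (jet_trans M (r + 1) c c' y) j = jet_trans M r c c' (jet_proj M r y) j"
    proof (cases "j \<in> jidx M r")
      case False
      then show ?thesis using jet_trans_eq(4)[OF sm c p] by (simp add: jet_proj_def)
    next
      case True
      show ?thesis
      proof (cases j)
        case (Tc i)
        then show ?thesis using True jet_trans_eq(2)[OF sm c p, of i] jet_trans_eq(2)[OF sm c y, of i]
          by (simp add: jet_proj_def)
      next
        case (Xc a \<sigma>)
        then have X: "Xc a \<sigma> \<in> xidx M r" "Xc a \<sigma> \<in> xidx M (r + 1)" using True by auto
        then show ?thesis
          using Xc True jet_trans_eq(3)[OF sm c p X(1)] jet_trans_eq(3)[OF sm c y X(2)]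
            prolong_jet_proj[OF sm c, of a "sorted_list_of_multiset \<sigma>" r y] y
          by (simp add: jet_proj_def)
      qed
    qed
  qed
qed

lemma jet_proj_jet_img:
  "smooth_manifold M \<Longrightarrow> c \<in> matlas M \<Longrightarrow> y \<in> jet_img M (r + 1) c \<Longrightarrow> jet_proj M r y \<in> jet_img M r c"
  by (simp only: jet_img_eq jet_proj_over)

section \<open>Differential forms in one chart\<close>

text \<open>Only values on \<open>W\<close> matter here. The vanishing outside that
  \<open>lforms_le\<close> demands is left out, so that operators can be applied first and cut off
  by \<open>restrict_form\<close> afterwards.\<close>

definition form_on :: "'a mfd \<Rightarrow> nat \<Rightarrow> (jcoord \<Rightarrow> real) set \<Rightarrow> nat \<Rightarrow> lform \<Rightarrow> bool" where
  "form_on M r W k \<omega> \<longleftrightarrow> (\<forall>y\<in>W. \<forall>I. \<omega> y I \<noteq> 0 \<longrightarrow> I \<subseteq> jidx_le M r k) \<and>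
     (\<forall>I. (\<lambda>y. \<omega> y I) \<in> order_fun M r W k)"

lemma form_onI:
  "(\<And>y I. y \<in> W \<Longrightarrow> \<omega> y I \<noteq> 0 \<Longrightarrow> I \<subseteq> jidx_le M r k) \<Longrightarrow>
   (\<And>I. (\<lambda>y. \<omega> y I) \<in> order_fun M r W k) \<Longrightarrow> form_on M r W k \<omega>"
  by (simp add: form_on_def)

lemma form_on_support: "form_on M r W k \<omega> \<Longrightarrow> y \<in> W \<Longrightarrow> \<omega> y I \<noteq> 0 \<Longrightarrow> I \<subseteq> jidx_le M r k"
  by (simp add: form_on_def)

lemma form_on_coeff: "form_on M r W k \<omega> \<Longrightarrow> (\<lambda>y. \<omega> y I) \<in> order_fun M r W k"
  by (simp add: form_on_def)

lemma form_on_fin_supp: "form_on M r W k \<omega> \<Longrightarrow> y \<in> W \<Longrightarrow> fin_supp (\<omega> y)"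
  by (rule fin_supp_subset[of "Pow (jidx_le M r k)"])
    (auto simp: finite_jidx_le dest!: form_on_support intro: finite_subset[OF _ finite_jidx_le])

lemma form_on_mono: "k \<le> k' \<Longrightarrow> form_on M r W k \<omega> \<Longrightarrow> form_on M r W k' \<omega>"
  by (rule form_onI, rule subset_trans[OF form_on_support jidx_le_mono], assumption+)
    (rule order_fun_mono[OF _ form_on_coeff])

lemma form_on_cong:
  assumes "open_in (jidx M r) W" "form_on M r W k \<omega>" "\<And>y. y \<in> W \<Longrightarrow> \<eta> y = \<omega> y"
  shows "form_on M r W k \<eta>"
proof (rule form_onI)
  show "I \<subseteq> jidx_le M r k" if "y \<in> W" "\<eta> y I \<noteq> 0" for y I
    using form_on_support[OF assms(2)] assms(3) that by simp
  show "(\<lambda>y. \<eta> y I) \<in> order_fun M r W k" for I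
    by (rule order_fun_cong[OF assms(1) form_on_coeff[OF assms(2)]]) (use assms(3) in simp)
qed

lemma form_on_const:
  assumes "open_in (jidx M r) W" "\<And>I. \<alpha> I \<noteq> 0 \<Longrightarrow> I \<subseteq> jidx_le M r k"
  shows "form_on M r W k (\<lambda>y. \<alpha>)"
  using assms by (auto intro!: form_onI order_fun_const)

lemma form_on_gen: "open_in (jidx M r) W \<Longrightarrow> j \<in> jidx_le M r k \<Longrightarrow> form_on M r W k (\<lambda>y. gen j)"
  by (rule form_on_const) (auto simp: gen_def split: if_splits)

lemma form_on_gone: "open_in (jidx M r) W \<Longrightarrow> form_on M r W k (\<lambda>y. gone)"
  by (rule form_on_const) (auto simp: gone_def split: if_splits)

lemma form_on_add:
  assumes "open_in (jidx M r) W" "form_on M r W k \<alpha>" "form_on M r W k \<beta>"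
  shows "form_on M r W k (\<lambda>y I. \<alpha> y I + \<beta> y I)"
proof (rule form_onI)
  show "I \<subseteq> jidx_le M r k" if "y \<in> W" "\<alpha> y I + \<beta> y I \<noteq> 0" for y I
    using form_on_support[OF assms(2) that(1), of I] form_on_support[OF assms(3) that(1), of I] that(2)
    by (cases "\<alpha> y I = 0") auto
qed (intro order_fun_add assms form_on_coeff)

lemma form_on_mult:
  assumes "open_in (jidx M r) W" "f \<in> order_fun M r W k" "form_on M r W k \<beta>"
  shows "form_on M r W k (\<lambda>y I. f y * \<beta> y I)"
proof (rule form_onI)
  show "I \<subseteq> jidx_le M r k" if "y \<in> W" "f y * \<beta> y I \<noteq> 0" for y I
    using form_on_support[OF assms(3) that(1)] that(2) by auto
qed (intro order_fun_mult assms form_on_coeff)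

lemma form_on_cmult:
  assumes "open_in (jidx M r) W" "form_on M r W k \<beta>"
  shows "form_on M r W k (\<lambda>y I. u * \<beta> y I)"
  by (rule form_on_mult[OF assms(1) order_fun_const[OF assms(1)] assms(2)])

lemma form_on_diff:
  assumes "open_in (jidx M r) W" "form_on M r W k \<alpha>" "form_on M r W k \<beta>"
  shows "form_on M r W k (\<lambda>y I. \<alpha> y I - \<beta> y I)"
  using form_on_add[OF assms(1,2) form_on_cmult[OF assms(1,3), of "-1"]] by simp

lemma form_on_zero: "open_in (jidx M r) W \<Longrightarrow> form_on M r W k (\<lambda>y I. 0)"
  by (rule form_on_const) auto

lemma form_on_sum:
  assumes "open_in (jidx M r) W" "\<And>a. a \<in> A \<Longrightarrow> form_on M r W k (\<alpha> a)"
  shows "form_on M r W k (\<lambda>y I. \<Sum>a\<in>A. \<alpha> a y I)"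
  using assms(2) by (induction A rule: infinite_finite_induct)
    (simp_all add: form_on_zero form_on_add assms(1))

lemma form_on_wedge:
  assumes W: "open_in (jidx M r) W" and "form_on M r W k \<alpha>" "form_on M r W k \<beta>"
  shows "form_on M r W k (\<lambda>y. wedge (\<alpha> y) (\<beta> y))"
proof (rule form_onI)
  fix y I assume y: "y \<in> W" "wedge (\<alpha> y) (\<beta> y) I \<noteq> 0"
  obtain K where K: "K \<subseteq> I" "\<alpha> y K \<noteq> 0" "\<beta> y (I - K) \<noteq> 0" using wedge_nonzeroD[OF y(2)] by auto
  then have "K \<subseteq> jidx_le M r k" "I - K \<subseteq> jidx_le M r k"
    using form_on_support[OF assms(2) y(1)] form_on_support[OF assms(3) y(1)] by auto
  then show "I \<subseteq> jidx_le M r k" using K(1) by auto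
next
  fix I
  show "(\<lambda>y. wedge (\<alpha> y) (\<beta> y) I) \<in> order_fun M r W k"
    unfolding wedge_inversions
    by (intro order_fun_sum[OF W] order_fun_mult[OF W] order_fun_const[OF W] form_on_coeff assms)
qed

lemma form_on_gprod:
  assumes W: "open_in (jidx M r) W" and "\<And>j. j \<in> set l \<Longrightarrow> form_on M r W m (\<lambda>y. \<theta> y j)"
  shows "form_on M r W m (\<lambda>y. gprod (\<theta> y) l)"
  using assms(2) by (induction l) (simp_all add: form_on_gone[OF W] form_on_wedge[OF W])

text \<open>The support of \<open>\<eta> y\<close> varies with \<open>y\<close>. Summing over all
  subsets of the finite set \<open>A\<close> instead makes each coefficient a fixed polynomial
  expression in functions of finite order.\<close>

lemma form_on_gsubst:
  assumes W: "open_in (jidx M r) W" and A: "finite A"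
    and \<eta>: "\<And>y I. y \<in> W \<Longrightarrow> \<eta> y I \<noteq> 0 \<Longrightarrow> I \<subseteq> A" "\<And>I. (\<lambda>y. \<eta> y I) \<in> order_fun M r W m"
    and \<theta>: "\<And>j. j \<in> A \<Longrightarrow> form_on M r W m (\<lambda>y. \<theta> y j)"
  shows "form_on M r W m (\<lambda>y. gsubst (\<theta> y) (\<eta> y))"
proof (rule form_on_cong[OF W])
  show "form_on M r W m (\<lambda>y I. \<Sum>K\<in>Pow A. \<eta> y K * gprod (\<theta> y) (sorted_list_of_set K) I)"
    by (intro form_on_sum[OF W] form_on_mult[OF W] \<eta>(2) form_on_gprod[OF W] \<theta>)
      (use finite_subset[OF _ A] in auto)
  show "gsubst (\<theta> y) (\<eta> y) = (\<lambda>I. \<Sum>K\<in>Pow A. \<eta> y K * gprod (\<theta> y) (sorted_list_of_set K) I)" if "y \<in> W" for y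
    by (rule gsubst_sum) (use A \<eta>(1)[OF that] in auto)
qed

text \<open>Forms arise from functions by multiplying with generators and adding. The clause
  \<open>cong\<close> is there because the expansion agrees with \<omega> on \<open>W\<close>
  only.\<close>

lemma form_on_induct [consumes 2, case_names base gen add cong]:
  assumes W: "open_in (jidx M r) W" and \<omega>: "form_on M r W k \<omega>"
    and base: "\<And>f. f \<in> order_fun M r W k \<Longrightarrow> P (\<lambda>y I. f y * gone I)"
    and gen: "\<And>j \<alpha>. j \<in> jidx_le M r k \<Longrightarrow> form_on M r W k \<alpha> \<Longrightarrow> P \<alpha> \<Longrightarrow> P (\<lambda>y. wedge (gen j) (\<alpha> y))"
    and add: "\<And>\<alpha> \<beta>. form_on M r W k \<alpha> \<Longrightarrow> form_on M r W k \<beta> \<Longrightarrow> P \<alpha> \<Longrightarrow> P \<beta> \<Longrightarrow> P (\<lambda>y I. \<alpha> y I + \<beta> y I)"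
    and cong: "\<And>\<alpha> \<beta>. (\<And>y. y \<in> W \<Longrightarrow> \<alpha> y = \<beta> y) \<Longrightarrow> P \<alpha> \<Longrightarrow> P \<beta>"
  shows "P \<omega>"
proof -
  have fo: "form_on M r W k (\<lambda>y I. f y * gmono K I)" if "f \<in> order_fun M r W k" "K \<subseteq> jidx_le M r k" for f K
    using that by (intro form_on_mult[OF W] form_on_const[OF W]) (auto simp: gmono_def split: if_splits)
  have mono: "P (\<lambda>y I. f y * gmono K I)" if f: "f \<in> order_fun M r W k" and "finite K" "K \<subseteq> jidx_le M r k" for f K
    using that(2,3)
  proof (induction K rule: finite_linorder_min_induct)
    case empty
    have "gmono {} = (gone :: jcoord grass)" by (auto simp: gmono_def gone_def)
    then show ?case using base[OF f] by simp
  next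
    case (insert b A)
    have "P (\<lambda>y. wedge (gen b) (\<lambda>I. f y * gmono A I))"
      using insert fo[OF f] by (intro gen) auto
    moreover have "gmono (insert b A) = wedge (gen b) (gmono A)" using insert.hyps by (intro gmono_insert) auto
    ultimately show ?case by (simp add: wedge_cmult_right)
  qed
  have sum: "P (\<lambda>y I. \<Sum>K\<in>B. \<omega> y K * gmono K I) \<and> form_on M r W k (\<lambda>y I. \<Sum>K\<in>B. \<omega> y K * gmono K I)"
    if "finite B" "B \<subseteq> Pow (jidx_le M r k)" for B
    using that
  proof (induction B rule: finite_induct)
    case empty
    show ?case using base[OF order_fun_const[OF W, of 0]] form_on_zero[OF W] by simp
  next
    case (insert K B)
    have K: "K \<subseteq> jidx_le M r k" "finite K" using insert.prems finite_subset[OF _ finite_jidx_le[of M r k]] by auto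
    have "P (\<lambda>y I. \<omega> y K * gmono K I + (\<Sum>K\<in>B. \<omega> y K * gmono K I))"
      using insert by (intro add fo mono form_on_coeff[OF \<omega>] K) auto
    moreover have "form_on M r W k (\<lambda>y I. \<omega> y K * gmono K I + (\<Sum>K\<in>B. \<omega> y K * gmono K I))"
      using insert by (intro form_on_add[OF W] fo form_on_coeff[OF \<omega>] K) auto
    ultimately show ?case using insert.hyps by simp
  qed
  have B: "finite (Pow (jidx_le M r k))" by (simp add: finite_jidx_le)
  show ?thesis
  proof (rule cong)
    show "P (\<lambda>y I. \<Sum>K\<in>Pow (jidx_le M r k). \<omega> y K * gmono K I)" using sum[OF B] by simp
    show "(\<lambda>I. \<Sum>K\<in>Pow (jidx_le M r k). \<omega> y K * gmono K I) = \<omega> y" if "y \<in> W" for y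
      by (rule grass_expand[OF B, symmetric]) (use form_on_support[OF \<omega> that] in blast)
  qed
qed

subsection \<open>The exterior differential\<close>

definition coeff_pd :: "jcoord \<Rightarrow> lform \<Rightarrow> lform" where
  "coeff_pd j \<omega> y K = pd j (\<lambda>y. \<omega> y K) y"

lemma coeff_pd_cong:
  assumes "open_in (jidx M r) W" "y \<in> W" "j \<in> jidx M r" "\<And>y. y \<in> W \<Longrightarrow> \<omega> y = \<eta> y"
  shows "coeff_pd j \<omega> y = coeff_pd j \<eta> y"
  unfolding coeff_pd_def by (rule ext, rule pd_cong[OF assms(1-3)]) (simp add: assms(4))

lemma coeff_pd_zero:
  assumes "open_in (jidx M r) W" "form_on M r W k \<omega>" "y \<in> W" "j \<in> jidx M r" "j \<notin> jidx_le M r k"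
  shows "coeff_pd j \<omega> y = (\<lambda>K. 0)"
  unfolding coeff_pd_def by (rule ext, rule order_fun_pd_zero[OF assms(1) form_on_coeff[OF assms(2)] assms(3-5)])

lemma form_on_coeff_pd:
  assumes W: "open_in (jidx M r) W" and \<omega>: "form_on M r W k \<omega>" and j: "j \<in> jidx M r"
  shows "form_on M r W k (coeff_pd j \<omega>)"
proof (rule form_onI)
  show "(\<lambda>y. coeff_pd j \<omega> y I) \<in> order_fun M r W k" for I
    unfolding coeff_pd_def using order_fun_pd[OF W form_on_coeff[OF \<omega>] j] by simp
  fix y I assume y: "y \<in> W" and nz: "coeff_pd j \<omega> y I \<noteq> 0"
  show "I \<subseteq> jidx_le M r k"
  proof (rule ccontr)
    assume "\<not> I \<subseteq> jidx_le M r k"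
    then have "coeff_pd j \<omega> y I = pd j (\<lambda>y. 0) y"
      unfolding coeff_pd_def by (intro pd_cong[OF W y j]) (use form_on_support[OF \<omega>] in blast)
    then show False using nz by simp
  qed
qed

lemma coeff_pd_add:
  assumes "form_on M r W k \<alpha>" "form_on M r W k \<beta>" "y \<in> W" "j \<in> jidx M r"
  shows "coeff_pd j (\<lambda>y I. \<alpha> y I + \<beta> y I) y = (\<lambda>I. coeff_pd j \<alpha> y I + coeff_pd j \<beta> y I)"
  unfolding coeff_pd_def by (rule ext, rule pd_add)
    (rule order_fun_pdiff[OF form_on_coeff[OF assms(1)] assms(4,3)]
      order_fun_pdiff[OF form_on_coeff[OF assms(2)] assms(4,3)])+

lemma coeff_pd_mult:
  assumes "f \<in> order_fun M r W k" "y \<in> W" "j \<in> jidx M r"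
  shows "coeff_pd j (\<lambda>y I. f y * \<alpha> I) y = (\<lambda>I. pd j f y * \<alpha> I)"
proof
  fix I
  show "coeff_pd j (\<lambda>y I. f y * \<alpha> I) y I = pd j f y * \<alpha> I"
    unfolding coeff_pd_def using pd_mult[OF order_fun_pdiff[OF assms(1,3,2)] pdiff_const, of "\<alpha> I"] by simp
qed

lemma coeff_pd_const: "coeff_pd j (\<lambda>y. \<alpha>) y = (\<lambda>K. 0)"
  by (simp add: coeff_pd_def fun_eq_iff)

lemma coeff_pd_wedge:
  assumes \<alpha>: "form_on M r W k \<alpha>" and \<beta>: "form_on M r W k \<beta>" and y: "y \<in> W" and j: "j \<in> jidx M r"
  shows "coeff_pd j (\<lambda>y. wedge (\<alpha> y) (\<beta> y)) y =
    (\<lambda>I. wedge (coeff_pd j \<alpha> y) (\<beta> y) I + wedge (\<alpha> y) (coeff_pd j \<beta> y) I)"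
proof
  fix I
  have d: "pdiff j (\<lambda>y. \<alpha> y K) y" "pdiff j (\<lambda>y. \<beta> y K) y" for K
    by (rule order_fun_pdiff[OF form_on_coeff[OF \<alpha>] j y], rule order_fun_pdiff[OF form_on_coeff[OF \<beta>] j y])
  have d': "pdiff j (\<lambda>y. c * \<alpha> y K) y" for c K by (intro pdiff_mult pdiff_const d)
  have "coeff_pd j (\<lambda>y. wedge (\<alpha> y) (\<beta> y)) y I =
      (\<Sum>K\<in>Pow I. pd j (\<lambda>y. (- 1) ^ inversions K (I - K) * \<alpha> y K * \<beta> y (I - K)) y)"
    unfolding coeff_pd_def wedge_inversions by (rule pd_sum) (intro pdiff_mult pdiff_const d)
  also have "\<dots> = (\<Sum>K\<in>Pow I. (- 1) ^ inversions K (I - K) * coeff_pd j \<alpha> y K * \<beta> y (I - K) +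
      (- 1) ^ inversions K (I - K) * \<alpha> y K * coeff_pd j \<beta> y (I - K))"
    unfolding coeff_pd_def by (simp add: pd_mult[OF d' d(2)] pd_cmult[OF d(1)])
  finally show "coeff_pd j (\<lambda>y. wedge (\<alpha> y) (\<beta> y)) y I =
      wedge (coeff_pd j \<alpha> y) (\<beta> y) I + wedge (\<alpha> y) (coeff_pd j \<beta> y) I"
    unfolding wedge_inversions by (simp add: sum.distrib)
qed

text \<open>As in \<open>total_deriv_eq\<close>, a varying index set is exchanged for a fixed finite
  one: a generator outside \<open>I\<close> contributes nothing at \<open>I\<close>, and a
  coordinate beyond the order has zero derivative.\<close>

lemma gen_diff_eq:
  assumes W: "open_in (jidx M r) W" and \<omega>: "form_on M r W k \<omega>" and y: "y \<in> W" and S: "S \<subseteq> jidx M r"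
  shows "gen_diff S \<omega> y = (\<lambda>I. \<Sum>j\<in>S \<inter> jidx_le M r k. wedge (gen j) (coeff_pd j \<omega> y) I)"
proof
  fix I
  let ?t = "\<lambda>j. wedge (gen j) (coeff_pd j \<omega> y) I"
  show "gen_diff S \<omega> y I = (\<Sum>j\<in>S \<inter> jidx_le M r k. ?t j)"
  proof (cases "finite I")
    case True
    have "gen_diff S \<omega> y I = (\<Sum>j\<in>I \<inter> S. ?t j)"
      by (simp add: gen_diff_def coeff_pd_def[abs_def])
    also have "\<dots> = (\<Sum>j\<in>I \<inter> S \<inter> jidx_le M r k. ?t j)"
    proof (rule sum.mono_neutral_right)
      show "\<forall>j\<in>I \<inter> S - I \<inter> S \<inter> jidx_le M r k. ?t j = 0"
      proof
        fix j assume "j \<in> I \<inter> S - I \<inter> S \<inter> jidx_le M r k"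
        then have "j \<in> jidx M r" "j \<notin> jidx_le M r k" using S by auto
        then show "?t j = 0" by (simp add: coeff_pd_zero[OF W \<omega> y])
      qed
    qed (use True in auto)
    also have "\<dots> = (\<Sum>j\<in>S \<inter> jidx_le M r k. ?t j)"
      using finite_jidx_le[of M r k] by (intro sum.mono_neutral_left) (auto simp: wedge_gen)
    finally show ?thesis .
  qed (simp add: gen_diff_def wedge_infinite)
qed

lemma gen_diff_cong:
  assumes "open_in (jidx M r) W" "y \<in> W" "S \<subseteq> jidx M r" "\<And>y. y \<in> W \<Longrightarrow> \<omega> y = \<eta> y"
  shows "gen_diff S \<omega> y = gen_diff S \<eta> y"
proof
  fix I
  have "coeff_pd j \<omega> y = coeff_pd j \<eta> y" if "j \<in> S" for j
    using that assms(3) by (intro coeff_pd_cong[OF assms(1,2) _ assms(4)]) auto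
  then show "gen_diff S \<omega> y I = gen_diff S \<eta> y I"
    by (simp add: gen_diff_def coeff_pd_def[abs_def])
qed

lemma form_on_gen_diff:
  assumes W: "open_in (jidx M r) W" and \<omega>: "form_on M r W k \<omega>" and S: "S \<subseteq> jidx M r"
  shows "form_on M r W k (gen_diff S \<omega>)"
  by (rule form_on_cong[OF W _ gen_diff_eq[OF W \<omega> _ S]],
      intro form_on_sum[OF W] form_on_wedge[OF W] form_on_gen[OF W] form_on_coeff_pd[OF W \<omega>])
    (use S in auto)

lemma gen_diff_add:
  assumes W: "open_in (jidx M r) W" and \<alpha>: "form_on M r W k \<alpha>" and \<beta>: "form_on M r W k \<beta>"
    and y: "y \<in> W" and S: "S \<subseteq> jidx M r"
  shows "gen_diff S (\<lambda>y I. \<alpha> y I + \<beta> y I) y = (\<lambda>I. gen_diff S \<alpha> y I + gen_diff S \<beta> y I)"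
proof -
  have "coeff_pd j (\<lambda>y I. \<alpha> y I + \<beta> y I) y = (\<lambda>I. coeff_pd j \<alpha> y I + coeff_pd j \<beta> y I)" if "j \<in> S" for j
    using that S by (intro coeff_pd_add[OF \<alpha> \<beta> y]) auto
  then show ?thesis
    unfolding gen_diff_eq[OF W form_on_add[OF W \<alpha> \<beta>] y S] gen_diff_eq[OF W \<alpha> y S] gen_diff_eq[OF W \<beta> y S]
    by (simp add: wedge_add_right sum.distrib)
qed

text \<open>Moving the generator of the differential past \<alpha> gives the minus sign. A left
  factor of degree one is enough, since \<open>form_on_induct\<close> multiplies by one generator at
  a time.\<close>

lemma gen_diff_wedge_deg1:
  assumes W: "open_in (jidx M r) W" and \<alpha>: "form_on M r W k \<alpha>" and \<beta>: "form_on M r W k \<beta>"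
    and y: "y \<in> W" and S: "S \<subseteq> jidx M r" and d: "deg1 (\<alpha> y)"
  shows "gen_diff S (\<lambda>y. wedge (\<alpha> y) (\<beta> y)) y =
    (\<lambda>I. wedge (gen_diff S \<alpha> y) (\<beta> y) I - wedge (\<alpha> y) (gen_diff S \<beta> y) I)"
proof -
  have "wedge (gen j) (coeff_pd j (\<lambda>y. wedge (\<alpha> y) (\<beta> y)) y) =
      (\<lambda>I. wedge (wedge (gen j) (coeff_pd j \<alpha> y)) (\<beta> y) I - wedge (\<alpha> y) (wedge (gen j) (coeff_pd j \<beta> y)) I)"
    if "j \<in> S" for j
  proof -
    have "j \<in> jidx M r" using that S by auto
    then show ?thesis
      by (simp add: coeff_pd_wedge[OF \<alpha> \<beta> y] wedge_add_right wedge_assoc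
          wedge_deg1_anticommute[OF deg1_gen d])
  qed
  then show ?thesis
    unfolding gen_diff_eq[OF W form_on_wedge[OF W \<alpha> \<beta>] y S] gen_diff_eq[OF W \<alpha> y S] gen_diff_eq[OF W \<beta> y S]
    by (simp add: wedge_sum_left wedge_sum_right sum_subtractf)
qed

lemma gen_diff_const:
  assumes "open_in (jidx M r) W" "y \<in> W" "S \<subseteq> jidx M r" "\<And>I. \<alpha> I \<noteq> 0 \<Longrightarrow> I \<subseteq> jidx_le M r k"
  shows "gen_diff S (\<lambda>y. \<alpha>) y = (\<lambda>I. 0)"
proof -
  have "form_on M r W k (\<lambda>y. \<alpha>)" by (rule form_on_const[OF assms(1,4)])
  from gen_diff_eq[OF assms(1) this assms(2,3)] show ?thesis by (simp add: coeff_pd_const)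
qed

lemma gen_diff_wedge_gen:
  assumes W: "open_in (jidx M r) W" and \<beta>: "form_on M r W k \<beta>"
    and y: "y \<in> W" and S: "S \<subseteq> jidx M r" and j: "j \<in> jidx_le M r k"
  shows "gen_diff S (\<lambda>y. wedge (gen j) (\<beta> y)) y = (\<lambda>I. - wedge (gen j) (gen_diff S \<beta> y) I)"
proof -
  have "gen_diff S (\<lambda>y. gen j) y = (\<lambda>I. 0)"
    by (rule gen_diff_const[OF W y S]) (use j in \<open>auto simp: gen_def split: if_splits\<close>)
  then show ?thesis using gen_diff_wedge_deg1[OF W form_on_gen[OF W j] \<beta> y S deg1_gen] by simp
qed

lemma wedge_gen_gone: "wedge (gen j) gone = gen j"
  by (rule wedge_gone_right) (auto simp: gen_def split: if_splits)

lemma wedge_gen_mult_gone: "wedge (gen j) (\<lambda>I. c * gone I) = (\<lambda>I. c * gen j I)"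
  by (simp add: wedge_cmult_right wedge_gen_gone)

lemma wedge_gen_gen_anticommute: "wedge (gen i) (gen j) I = - wedge (gen j) (gen i) I"
  using wedge_gen_anticommute[of i j gone I] unfolding wedge_gen_gone .

text \<open>Symmetric coefficients meet an antisymmetric product. They will be second partial
  derivatives in \<open>gen_diff_dfun\<close> and coordinates with two added indices in
  \<open>gen_diff_from_frame\<close>, whence the index map \<open>h\<close>.\<close>

lemma antisymmetric_sum_zero:
  assumes "\<And>i l. i \<in> A \<Longrightarrow> l \<in> A \<Longrightarrow> c i l = c l i"
  shows "(\<Sum>i\<in>A. \<Sum>l\<in>A. c i l * wedge (gen (h i)) (gen (h l)) I) = (0 :: real)"
proof -
  let ?X = "\<Sum>i\<in>A. \<Sum>l\<in>A. c i l * wedge (gen (h i)) (gen (h l)) I"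
  have "?X = (\<Sum>l\<in>A. \<Sum>i\<in>A. c i l * wedge (gen (h i)) (gen (h l)) I)" by (rule sum.swap)
  also have "\<dots> = (\<Sum>l\<in>A. \<Sum>i\<in>A. - (c l i * wedge (gen (h l)) (gen (h i)) I))"
  proof (intro sum.cong refl)
    fix i l assume "l \<in> A" "i \<in> A"
    then show "c i l * wedge (gen (h i)) (gen (h l)) I = - (c l i * wedge (gen (h l)) (gen (h i)) I)"
      using assms[of i l] wedge_gen_gen_anticommute[of "h i" "h l"] by simp
  qed
  also have "\<dots> = - ?X" by (simp add: sum_negf)
  finally show ?thesis by simp
qed

lemma gen_diff_mult_const:
  assumes W: "open_in (jidx M r) W" and f: "f \<in> order_fun M r W k" and y: "y \<in> W" and S: "S \<subseteq> jidx M r"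
    and \<alpha>: "\<And>I. \<alpha> I \<noteq> 0 \<Longrightarrow> I \<subseteq> jidx_le M r k"
  shows "gen_diff S (\<lambda>y I. f y * \<alpha> I) y = (\<lambda>I. \<Sum>j\<in>S \<inter> jidx_le M r k. pd j f y * wedge (gen j) \<alpha> I)"
proof -
  have fo: "form_on M r W k (\<lambda>y I. f y * \<alpha> I)" by (intro form_on_mult[OF W f] form_on_const[OF W \<alpha>])
  have "coeff_pd j (\<lambda>y I. f y * \<alpha> I) y = (\<lambda>I. pd j f y * \<alpha> I)" if "j \<in> S" for j
    using that S by (intro coeff_pd_mult[OF f y]) auto
  then show ?thesis
    unfolding gen_diff_eq[OF W fo y S] by (simp add: wedge_cmult_right)
qed

lemma gen_diff_fun:
  assumes W: "open_in (jidx M r) W" and f: "f \<in> order_fun M r W k" and y: "y \<in> W" and S: "S \<subseteq> jidx M r"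
  shows "gen_diff S (\<lambda>y I. f y * gone I) y = (\<lambda>I. \<Sum>j\<in>S \<inter> jidx_le M r k. pd j f y * gen j I)"
proof -
  have "gen_diff S (\<lambda>y I. f y * gone I) y = (\<lambda>I. \<Sum>j\<in>S \<inter> jidx_le M r k. pd j f y * wedge (gen j) gone I)"
    by (rule gen_diff_mult_const[OF W f y S]) (auto simp: gone_def split: if_splits)
  then show ?thesis by (simp add: wedge_gen_gone)
qed

section \<open>The differential of a function as a form\<close>

lemma deg1_dfun: "deg1 (dfun S f y)"
  by (auto simp: deg1_def dfun_def split: if_splits)

lemma sum_gen_apply:
  assumes "finite B"
  shows "(\<Sum>j\<in>B. c j * gen j I) = (if is_singleton I \<and> I \<subseteq> B then c (the_elem I) else 0)"
proof (cases "is_singleton I")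
  case True
  then obtain i where i: "I = {i}" by (auto simp: is_singleton_def)
  have "(\<Sum>j\<in>B. c j * gen j I) = (\<Sum>j\<in>B. if j = i then c i else 0)"
    by (rule sum.cong) (auto simp: gen_def i)
  then show ?thesis using assms by (simp add: i sum.delta)
next
  case False
  then have "gen j I = 0" for j by (auto simp: gen_def)
  then show ?thesis using False by simp
qed

lemma dfun_eq:
  assumes W: "open_in (jidx M r) W" and f: "f \<in> order_fun M r W k" and y: "y \<in> W" and S: "S \<subseteq> jidx M r"
  shows "dfun S f y = (\<lambda>I. \<Sum>j\<in>S \<inter> jidx_le M r k. pd j f y * gen j I)"
proof
  fix I
  have fin: "finite (S \<inter> jidx_le M r k)" by (simp add: finite_jidx_le)
  have z: "pd i f y = 0" if "i \<in> S" "i \<notin> jidx_le M r k" for i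
    using that S by (intro order_fun_pd_zero[OF W f y]) auto
  show "dfun S f y I = (\<Sum>j\<in>S \<inter> jidx_le M r k. pd j f y * gen j I)"
  proof (cases "is_singleton I")
    case True
    then obtain i where "I = {i}" by (auto simp: is_singleton_def)
    then show ?thesis unfolding sum_gen_apply[OF fin] dfun_def
      by (cases "i \<in> S"; cases "i \<in> jidx_le M r k") (simp_all add: z)
  qed (simp add: sum_gen_apply[OF fin] dfun_def)
qed

lemma form_on_dfun:
  assumes W: "open_in (jidx M r) W" and f: "f \<in> order_fun M r W k"
  shows "form_on M r W k (dfun (jidx M r) f)"
  by (rule form_on_cong[OF W _ dfun_eq[OF W f _ order_refl]],
      intro form_on_sum[OF W] form_on_mult[OF W] form_on_gen[OF W] order_fun_pd[OF W f]) auto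

lemma gen_diff_dfun:
  assumes W: "open_in (jidx M r) W" and f: "f \<in> order_fun M r W k" and y: "y \<in> W"
  shows "gen_diff (jidx M r) (dfun (jidx M r) f) y = (\<lambda>I. 0)"
proof
  fix I
  let ?B = "jidx M r \<inter> jidx_le M r k"
  let ?X = "\<Sum>i\<in>?B. \<Sum>j\<in>?B. pd i (pd j f) y * wedge (gen i) (gen j) I"
  have "coeff_pd i (dfun (jidx M r) f) y = (\<lambda>I. \<Sum>j\<in>?B. pd i (pd j f) y * gen j I)" if i: "i \<in> jidx M r" for i
  proof -
    have "coeff_pd i (dfun (jidx M r) f) y = coeff_pd i (\<lambda>y I. \<Sum>j\<in>?B. pd j f y * gen j I) y"
      by (rule coeff_pd_cong[OF W y i dfun_eq[OF W f _ order_refl]])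
    also have "\<dots> = (\<lambda>I. \<Sum>j\<in>?B. pd i (pd j f) y * gen j I)"
    proof
      fix I
      have d: "pdiff i (pd j f) y" if "j \<in> ?B" for j
        using that by (intro order_fun_pdiff[OF order_fun_pd[OF W f] i y]) auto
      have "coeff_pd i (\<lambda>y I. \<Sum>j\<in>?B. pd j f y * gen j I) y I = (\<Sum>j\<in>?B. pd i (\<lambda>y. pd j f y * gen j I) y)"
        unfolding coeff_pd_def by (rule pd_sum) (intro pdiff_mult pdiff_const d)
      also have "\<dots> = (\<Sum>j\<in>?B. pd i (pd j f) y * gen j I)"
        by (rule sum.cong[OF refl]) (simp add: pd_mult[OF d pdiff_const])
      finally show "coeff_pd i (\<lambda>y I. \<Sum>j\<in>?B. pd j f y * gen j I) y I = (\<Sum>j\<in>?B. pd i (pd j f) y * gen j I)" .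
    qed
    finally show ?thesis .
  qed
  then have "gen_diff (jidx M r) (dfun (jidx M r) f) y I = ?X"
    unfolding gen_diff_eq[OF W form_on_dfun[OF W f] y order_refl]
    by (simp add: wedge_sum_right wedge_cmult_right)
  also have "?X = 0"
    by (rule antisymmetric_sum_zero[where h = "\<lambda>i. i"])
      (auto intro!: pd_commute[OF W order_fun_smooth[OF f] _ _ y])
  finally show "gen_diff (jidx M r) (dfun (jidx M r) f) y I = 0" .
qed

subsection \<open>Pullback\<close>

context
  fixes M :: "'a mfd" and M' :: "'a mfd" and r r' k m :: nat and W V F
  assumes W: "open_in (jidx M r) W" and V: "open_in (jidx M' r') V"
    and F: "\<And>y. y \<in> W \<Longrightarrow> F y \<in> V"
    and FA: "\<And>j. j \<in> jidx_le M' r' k \<Longrightarrow> (\<lambda>y. F y j) \<in> order_fun M r W m"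
begin

lemma form_on_pullback:
  assumes "form_on M' r' V k \<omega>"
  shows "form_on M r W m (pullback (jidx M r) F \<omega>)"
  unfolding pullback_def
proof (rule form_on_gsubst[OF W finite_jidx_le[of M' r' k]])
  show "I \<subseteq> jidx_le M' r' k" if "y \<in> W" "\<omega> (F y) I \<noteq> 0" for y I
    using form_on_support[OF assms F] that by blast
  show "(\<lambda>y. \<omega> (F y) I) \<in> order_fun M r W m" for I
    by (rule order_fun_compose[OF W V F FA form_on_coeff[OF assms]])
  show "form_on M r W m (\<lambda>y. dfun (jidx M r) (\<lambda>y. F y j) y)" if "j \<in> jidx_le M' r' k" for j
    by (rule form_on_dfun[OF W FA[OF that]])
qed

lemma pullback_add:
  assumes "form_on M' r' V k \<alpha>" "form_on M' r' V k \<beta>" "y \<in> W"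
  shows "pullback S F (\<lambda>y I. \<alpha> y I + \<beta> y I) y = (\<lambda>I. pullback S F \<alpha> y I + pullback S F \<beta> y I)"
  unfolding pullback_def
  by (rule gsubst_add[OF form_on_fin_supp[OF assms(1) F[OF assms(3)]] form_on_fin_supp[OF assms(2) F[OF assms(3)]]])

lemma pullback_wedge_gen:
  assumes "form_on M' r' V k \<alpha>" "y \<in> W"
  shows "pullback S F (\<lambda>y. wedge (gen j) (\<alpha> y)) y = wedge (dfun S (\<lambda>y. F y j) y) (pullback S F \<alpha> y)"
  unfolding pullback_def
  by (rule gsubst_wedge_gen[OF deg1_dfun form_on_fin_supp[OF assms(1) F[OF assms(2)]]])

lemma dfun_compose:
  assumes f: "f \<in> order_fun M' r' V k" and y: "y \<in> W"
  shows "dfun (jidx M r) (\<lambda>y. f (F y)) y =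
    (\<lambda>I. \<Sum>j\<in>jidx_le M' r' k. pd j f (F y) * dfun (jidx M r) (\<lambda>y. F y j) y I)"
proof
  fix I
  show "dfun (jidx M r) (\<lambda>y. f (F y)) y I =
      (\<Sum>j\<in>jidx_le M' r' k. pd j f (F y) * dfun (jidx M r) (\<lambda>y. F y j) y I)"
  proof (cases "is_singleton I \<and> I \<subseteq> jidx M r")
    case True
    then have "the_elem I \<in> jidx M r" by (auto simp: is_singleton_def)
    then show ?thesis using True order_fun_pd_compose[OF W V F FA f _ y] by (simp add: dfun_def)
  next
    case False
    then have "dfun (jidx M r) g y I = 0" for g by (auto simp: dfun_def)
    then show ?thesis by simp
  qed
qed

text \<open>Both sides obey the same graded Leibniz rule, so functions and generators suffice. On
  functions the identity is the chain rule; on a generator it says that the differential of the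
  corresponding component of \<open>F\<close> is closed.\<close>

lemma gen_diff_pullback:
  assumes \<omega>: "form_on M' r' V k \<omega>" and "y \<in> W"
  shows "gen_diff (jidx M r) (pullback (jidx M r) F \<omega>) y = pullback (jidx M r) F (gen_diff (jidx M' r') \<omega>) y"
  using V \<omega> assms(2)
proof (induction arbitrary: y rule: form_on_induct)
  case (base f)
  let ?B = "jidx M' r' \<inter> jidx_le M' r' k"
  have B: "?B = jidx_le M' r' k" using jidx_le_subset[of M' r' k] by auto
  have fs: "fin_supp (\<lambda>I. c * gen j I)" for c and j :: jcoord by (intro fin_supp_cmult) simp
  have "pullback (jidx M r) F (\<lambda>y I. f y * gone I) = (\<lambda>y I. f (F y) * gone I)"
    by (auto simp: pullback_def fun_eq_iff gsubst_cmult gsubst_gone)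
  then have "gen_diff (jidx M r) (pullback (jidx M r) F (\<lambda>y I. f y * gone I)) y = dfun (jidx M r) (\<lambda>y. f (F y)) y"
    using gen_diff_fun[OF W order_fun_compose[OF W V F FA base(1)] base(2) order_refl]
      dfun_eq[OF W order_fun_compose[OF W V F FA base(1)] base(2) order_refl] by simp
  also have "\<dots> = (\<lambda>I. \<Sum>j\<in>jidx_le M' r' k. pd j f (F y) * dfun (jidx M r) (\<lambda>y. F y j) y I)"
    by (rule dfun_compose[OF base])
  also have "\<dots> = pullback (jidx M r) F (gen_diff (jidx M' r') (\<lambda>y I. f y * gone I)) y"
    unfolding pullback_def gen_diff_fun[OF V base(1) F[OF base(2)] order_refl] B
    by (simp add: gsubst_setsum fs gsubst_cmult gsubst_gen deg1_finite[OF deg1_dfun])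
  finally show ?case .
next
  case (gen j \<alpha>)
  let ?S = "jidx M r"
  have dF: "form_on M r W m (dfun ?S (\<lambda>y. F y j))" by (rule form_on_dfun[OF W FA[OF gen(1)]])
  have "gen_diff ?S (pullback ?S F (\<lambda>y. wedge (gen j) (\<alpha> y))) y =
      gen_diff ?S (\<lambda>y. wedge (dfun ?S (\<lambda>y. F y j) y) (pullback ?S F \<alpha> y)) y"
    by (rule gen_diff_cong[OF W gen(4) order_refl]) (rule pullback_wedge_gen[OF gen(2)])
  also have "\<dots> = (\<lambda>I. - wedge (dfun ?S (\<lambda>y. F y j) y) (pullback ?S F (gen_diff (jidx M' r') \<alpha>) y) I)"
    using gen_diff_wedge_deg1[OF W dF form_on_pullback[OF gen(2)] gen(4) order_refl deg1_dfun]
      gen_diff_dfun[OF W FA[OF gen(1)] gen(4)] gen(3)[OF gen(4)] by simp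
  also have "\<dots> = (\<lambda>I. - pullback ?S F (\<lambda>y. wedge (gen j) (gen_diff (jidx M' r') \<alpha> y)) y I)"
    using pullback_wedge_gen[OF form_on_gen_diff[OF V gen(2) order_refl] gen(4)] by simp
  also have "\<dots> = pullback ?S F (gen_diff (jidx M' r') (\<lambda>y. wedge (gen j) (\<alpha> y))) y"
  proof -
    have "gen_diff (jidx M' r') (\<lambda>y. wedge (gen j) (\<alpha> y)) (F y) =
        (\<lambda>I. - wedge (gen j) (gen_diff (jidx M' r') \<alpha> (F y)) I)"
      by (rule gen_diff_wedge_gen[OF V gen(2) F[OF gen(4)] order_refl gen(1)])
    moreover have "fin_supp (wedge (gen j) (gen_diff (jidx M' r') \<alpha> (F y)))"
      by (intro fin_supp_wedge fin_supp_gen form_on_fin_supp[OF form_on_gen_diff[OF V gen(2) order_refl]] F gen(4))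
    ultimately show ?thesis by (simp only: pullback_def gsubst_minus)
  qed
  finally show ?case .
next
  case (add \<alpha> \<beta>)
  let ?S = "jidx M r" and ?S' = "jidx M' r'"
  have "gen_diff ?S (pullback ?S F (\<lambda>y I. \<alpha> y I + \<beta> y I)) y =
      gen_diff ?S (\<lambda>y I. pullback ?S F \<alpha> y I + pullback ?S F \<beta> y I) y"
    by (rule gen_diff_cong[OF W add(5) order_refl]) (rule pullback_add[OF add(1,2)])
  also have "\<dots> = (\<lambda>I. pullback ?S F (gen_diff ?S' \<alpha>) y I + pullback ?S F (gen_diff ?S' \<beta>) y I)"
    using gen_diff_add[OF W form_on_pullback[OF add(1)] form_on_pullback[OF add(2)] add(5) order_refl]
      add(3,4)[OF add(5)] by simp
  also have "\<dots> = pullback ?S F (\<lambda>y I. gen_diff ?S' \<alpha> y I + gen_diff ?S' \<beta> y I) y"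
    using pullback_add[OF form_on_gen_diff[OF V add(1) order_refl] form_on_gen_diff[OF V add(2) order_refl] add(5)]
    by simp
  also have "\<dots> = pullback ?S F (gen_diff ?S' (\<lambda>y I. \<alpha> y I + \<beta> y I)) y"
    unfolding pullback_def using gen_diff_add[OF V add(1,2) F[OF add(5)] order_refl] by simp
  finally show ?case .
next
  case (cong \<alpha> \<beta>)
  have "gen_diff (jidx M r) (pullback (jidx M r) F \<beta>) y = gen_diff (jidx M r) (pullback (jidx M r) F \<alpha>) y"
    by (rule gen_diff_cong[OF W cong(3) order_refl]) (simp add: pullback_def cong(1) F)
  also have "\<dots> = pullback (jidx M r) F (gen_diff (jidx M' r') \<alpha>) y" by (rule cong(2)[OF cong(3)])
  also have "\<dots> = pullback (jidx M r) F (gen_diff (jidx M' r') \<beta>) y"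
    unfolding pullback_def using gen_diff_cong[OF V F[OF cong(3)] order_refl cong(1)] by simp
  finally show ?case .
qed

end

subsection \<open>Cartan frames\<close>

definition to_frame :: "nat \<Rightarrow> (jcoord \<Rightarrow> real) \<Rightarrow> jcoord \<Rightarrow> jcoord grass" where
  "to_frame r y j = (case j of Tc i \<Rightarrow> gen (Tc i)
     | Xc a \<sigma> \<Rightarrow> (\<lambda>I. gen (Xc a \<sigma>) I + (\<Sum>i<r. y (Xc a (add_mset i \<sigma>)) * gen (Tc i) I)))"

definition from_frame :: "nat \<Rightarrow> (jcoord \<Rightarrow> real) \<Rightarrow> jcoord \<Rightarrow> jcoord grass" where
  "from_frame r y j = (case j of Tc i \<Rightarrow> gen (Tc i)
     | Xc a \<sigma> \<Rightarrow> (\<lambda>I. gen (Xc a \<sigma>) I - (\<Sum>i<r. y (Xc a (add_mset i \<sigma>)) * gen (Tc i) I)))"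

lemma to_cartan_frame: "to_cartan r \<omega> y = gsubst (to_frame r y) (\<omega> y)"
  unfolding to_cartan_def to_frame_def ..

lemma from_cartan_frame: "from_cartan r \<omega> y = gsubst (from_frame r y) (\<omega> y)"
  unfolding from_cartan_def from_frame_def ..

lemma frame_Tc [simp]: "to_frame r y (Tc i) = gen (Tc i)" "from_frame r y (Tc i) = gen (Tc i)"
  by (simp_all add: to_frame_def from_frame_def)

lemma frame_Xc:
  "to_frame r y (Xc a \<sigma>) = (\<lambda>I. gen (Xc a \<sigma>) I + (\<Sum>i<r. y (raise i (Xc a \<sigma>)) * gen (Tc i) I))"
  "from_frame r y (Xc a \<sigma>) = (\<lambda>I. gen (Xc a \<sigma>) I - (\<Sum>i<r. y (raise i (Xc a \<sigma>)) * gen (Tc i) I))"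
  by (simp_all add: to_frame_def from_frame_def)

lemma deg1_frame [simp]: "deg1 (to_frame r y j)" "deg1 (from_frame r y j)"
  by (cases j; simp add: frame_Xc deg1_add deg1_diff deg1_sum deg1_cmult)+

lemma fin_supp_frame [simp]: "fin_supp (to_frame r y j)" "fin_supp (from_frame r y j)"
  by (cases j; simp add: frame_Xc fin_supp_add fin_supp_diff fin_supp_sum fin_supp_cmult)+

lemma gsubst_linear:
  assumes "\<And>g. deg1 (\<theta> g)"
  shows "gsubst \<theta> (\<lambda>I. \<Sum>i\<in>A. c i * gen (h i) I) = (\<lambda>I. \<Sum>i\<in>A. c i * \<theta> (h i) I)"
  by (simp add: gsubst_setsum fin_supp_cmult gsubst_cmult gsubst_gen deg1_finite[OF assms])

text \<open>The two substitutions are opposite shears: they add or subtract the same multiples of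
  \<open>dt\<close>, and both fix \<open>dt\<close>.\<close>

lemma to_frame_from_frame: "gsubst (to_frame r y) (from_frame r y j) = gen j"
proof (cases j)
  case (Xc a \<sigma>)
  have "gsubst (to_frame r y) (from_frame r y j) =
      (\<lambda>I. to_frame r y j I - (\<Sum>i<r. y (raise i j) * to_frame r y (Tc i) I))"
    unfolding Xc frame_Xc(2)
    by (simp only: gsubst_diff fin_supp_gen fin_supp_sum fin_supp_cmult gsubst_linear deg1_frame
        gsubst_gen deg1_finite[OF deg1_frame(1)])
  then show ?thesis by (simp add: Xc frame_Xc)
qed (simp add: gsubst_gen deg1_finite[OF deg1_frame(1)])

lemma from_frame_to_frame: "gsubst (from_frame r y) (to_frame r y j) = gen j"
proof (cases j)
  case (Xc a \<sigma>)
  have "gsubst (from_frame r y) (to_frame r y j) =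
      (\<lambda>I. from_frame r y j I + (\<Sum>i<r. y (raise i j) * from_frame r y (Tc i) I))"
    unfolding Xc frame_Xc(1)
    by (simp only: gsubst_add fin_supp_gen fin_supp_sum fin_supp_cmult gsubst_linear deg1_frame
        gsubst_gen deg1_finite[OF deg1_frame(2)])
  then show ?thesis by (simp add: Xc frame_Xc)
qed (simp add: gsubst_gen deg1_finite[OF deg1_frame(2)])

lemma to_cartan_from_cartan: "fin_supp (\<eta> y) \<Longrightarrow> to_cartan r (from_cartan r \<eta>) y = \<eta> y"
  unfolding to_cartan_frame from_cartan_frame
  by (simp add: gsubst_gsubst to_frame_from_frame gsubst_gen_id)

lemma from_cartan_to_cartan: "fin_supp (\<eta> y) \<Longrightarrow> from_cartan r (to_cartan r \<eta>) y = \<eta> y"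
  unfolding to_cartan_frame from_cartan_frame
  by (simp add: gsubst_gsubst from_frame_to_frame gsubst_gen_id)

lemma fin_supp_cartan:
  "fin_supp (\<eta> y) \<Longrightarrow> fin_supp (to_cartan r \<eta> y)" "fin_supp (\<eta> y) \<Longrightarrow> fin_supp (from_cartan r \<eta> y)"
  unfolding to_cartan_frame from_cartan_frame by (simp_all add: fin_supp_gsubst)

text \<open>The coefficients in front of \<open>dt\<close> carry one index more than
  \<open>j\<close>, hence \<open>Suc k\<close>.\<close>

lemma form_on_frame:
  assumes W: "open_in (jidx M r) W" and j: "j \<in> jidx_le M r k"
  shows "form_on M r W (Suc k) (\<lambda>y. to_frame r y j)" "form_on M r W (Suc k) (\<lambda>y. from_frame r y j)"
proof -
  have j': "j \<in> jidx_le M r (Suc k)" using jidx_le_mono[of k "Suc k" M r] j by auto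
  have s: "form_on M r W (Suc k) (\<lambda>y I. \<Sum>i<r. y (raise i j) * gen (Tc i) I)"
    using j by (intro form_on_sum[OF W] form_on_mult[OF W] order_fun_coord[OF W] raise_jidx_le form_on_gen[OF W]) auto
  show "form_on M r W (Suc k) (\<lambda>y. to_frame r y j)"
    using form_on_add[OF W form_on_gen[OF W j'] s] form_on_gen[OF W j'] by (cases j) (simp_all add: frame_Xc)
  show "form_on M r W (Suc k) (\<lambda>y. from_frame r y j)"
    using form_on_diff[OF W form_on_gen[OF W j'] s] form_on_gen[OF W j'] by (cases j) (simp_all add: frame_Xc)
qed

lemma form_on_cartan:
  assumes W: "open_in (jidx M r) W" and \<omega>: "form_on M r W k \<omega>"
  shows "form_on M r W (Suc k) (to_cartan r \<omega>)" "form_on M r W (Suc k) (from_cartan r \<omega>)"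
proof -
  note \<omega>' = form_on_coeff[OF form_on_mono[OF _ \<omega>, of "Suc k"]]
  show "form_on M r W (Suc k) (to_cartan r \<omega>)" "form_on M r W (Suc k) (from_cartan r \<omega>)"
    unfolding to_cartan_frame[abs_def] from_cartan_frame[abs_def]
    by (rule form_on_gsubst[OF W finite_jidx_le[of M r k]];
        simp add: form_on_support[OF \<omega>] \<omega>' form_on_frame[OF W])+
qed

lemma gsubst_card:
  assumes "fin_supp \<alpha>" "\<And>g. deg1 (\<theta> g)" "gsubst \<theta> \<alpha> I \<noteq> 0"
  shows "\<exists>K. \<alpha> K \<noteq> 0 \<and> card K = card I"
  using gsubst_nonzeroD[OF assms] by metis

subsection \<open>The splitting of the exterior differential\<close>

lemma cartan_shift_eq:
  assumes "\<And>K. \<alpha> K \<noteq> 0 \<Longrightarrow> K \<subseteq> A" "finite A"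
  shows "cartan_shift M r i \<alpha> = (\<lambda>I. \<Sum>j\<in>A \<inter> xidx M r. wedge (gen (raise i j)) (grass_deriv j \<alpha>) I)"
proof
  fix I
  have "j \<in> A" if nz: "grass_deriv j \<alpha> \<noteq> 0" for j
  proof -
    obtain K where "grass_deriv j \<alpha> K \<noteq> 0" using nz by (auto simp: fun_eq_iff zero_fun_def)
    then have "\<alpha> (insert j K) \<noteq> 0" by (auto simp: grass_deriv_def split: if_splits)
    then show ?thesis using assms(1) by blast
  qed
  then show "cartan_shift M r i \<alpha> I = (\<Sum>j\<in>A \<inter> xidx M r. wedge (gen (raise i j)) (grass_deriv j \<alpha>) I)"
    unfolding cartan_shift_def using assms(2)
    by (intro sum.mono_neutral_left) (auto simp: zero_fun_def)
qed

text \<open>The factor of \<open>dt^i\<close> in the horizontal differential, with sums over a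
  finite set that does not depend on the point; \<open>k\<close> is any bound on the order of
  \<eta>.\<close>

definition hor_coeff :: "'a mfd \<Rightarrow> nat \<Rightarrow> nat \<Rightarrow> nat \<Rightarrow> lform \<Rightarrow> lform" where
  "hor_coeff M r k i \<eta> y I = coeff_pd (Tc i) \<eta> y I
     + (\<Sum>j\<in>jidx_le M r k \<inter> xidx M r. y (raise i j) * coeff_pd j \<eta> y I)
     + (\<Sum>j\<in>jidx_le M r k \<inter> xidx M r. wedge (gen (raise i j)) (grass_deriv j (\<eta> y)) I)"

lemma horizontal_op_eq:
  assumes W: "open_in (jidx M r) W" and \<eta>: "form_on M r W k \<eta>" and y: "y \<in> W"
  shows "horizontal_op M r \<eta> y = (\<lambda>I. \<Sum>i<r. wedge (gen (Tc i)) (hor_coeff M r k i \<eta> y) I)"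
proof -
  have "(\<lambda>K. total_deriv M r i (\<lambda>y. \<eta> y K) y + cartan_shift M r i (\<eta> y) K) = hor_coeff M r k i \<eta> y"
    if "i < r" for i
  proof -
    have "cartan_shift M r i (\<eta> y) =
        (\<lambda>I. \<Sum>j\<in>jidx_le M r k \<inter> xidx M r. wedge (gen (raise i j)) (grass_deriv j (\<eta> y)) I)"
      by (rule cartan_shift_eq[OF _ finite_jidx_le]) (rule form_on_support[OF \<eta> y])
    then show ?thesis
      unfolding hor_coeff_def[abs_def] total_deriv_eq[OF W form_on_coeff[OF \<eta>] y that] coeff_pd_def[symmetric]
      by simp
  qed
  then show ?thesis by (auto simp: horizontal_op_def[abs_def] intro!: ext sum.cong)
qed

lemma horizontal_op_cong:
  assumes W: "open_in (jidx M r) W" and y: "y \<in> W" and eq: "\<And>y. y \<in> W \<Longrightarrow> \<eta> y = \<zeta> y"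
  shows "horizontal_op M r \<eta> y = horizontal_op M r \<zeta> y"
proof -
  have "total_deriv M r i (\<lambda>y. \<eta> y K) y = total_deriv M r i (\<lambda>y. \<zeta> y K) y" if "i < r" for i K
    by (rule total_deriv_cong[OF W y that]) (simp add: eq)
  then show ?thesis unfolding horizontal_op_def[abs_def] eq[OF y] by (auto intro!: ext sum.cong)
qed

lemma form_on_grass_deriv:
  assumes W: "open_in (jidx M r) W" and \<eta>: "form_on M r W k \<eta>"
  shows "form_on M r W k (\<lambda>y. grass_deriv j (\<eta> y))"
proof (rule form_onI)
  show "I \<subseteq> jidx_le M r k" if "y \<in> W" "grass_deriv j (\<eta> y) I \<noteq> 0" for y I
    using that form_on_support[OF \<eta> that(1), of "insert j I"] by (auto simp: grass_deriv_def split: if_splits)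
  show "(\<lambda>y. grass_deriv j (\<eta> y) I) \<in> order_fun M r W k" for I
    by (cases "j \<in> I") (simp_all add: grass_deriv_def order_fun_const[OF W] order_fun_mult[OF W] form_on_coeff[OF \<eta>])
qed

lemma xidx_jidx: "j \<in> xidx M r \<Longrightarrow> j \<in> jidx M r"
  by (auto simp: jidx_def)

lemma form_on_horizontal_op:
  assumes W: "open_in (jidx M r) W" and \<eta>: "form_on M r W k \<eta>"
  shows "form_on M r W (Suc k) (horizontal_op M r \<eta>)"
proof (rule form_on_cong[OF W _ horizontal_op_eq[OF W \<eta>]])
  have \<eta>': "form_on M r W (Suc k) \<eta>" by (rule form_on_mono[OF _ \<eta>]) simp
  have "form_on M r W (Suc k) (hor_coeff M r k i \<eta>)" if "i < r" for i
    unfolding hor_coeff_def[abs_def] using that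
    by (intro form_on_add[OF W] form_on_sum[OF W] form_on_mult[OF W] form_on_wedge[OF W] form_on_gen[OF W]
        order_fun_coord[OF W] raise_jidx_le form_on_coeff_pd[OF W \<eta>'] form_on_grass_deriv[OF W \<eta>'])
      (auto intro: xidx_jidx)
  then show "form_on M r W (Suc k) (\<lambda>y I. \<Sum>i<r. wedge (gen (Tc i)) (hor_coeff M r k i \<eta> y) I)"
    by (intro form_on_sum[OF W] form_on_wedge[OF W] form_on_gen[OF W]) auto
qed

section \<open>The horizontal differential as an odd derivation\<close>

lemma grass_deriv_add: "grass_deriv j (\<lambda>I. \<alpha> I + \<beta> I) = (\<lambda>I. grass_deriv j \<alpha> I + grass_deriv j \<beta> I)"
  by (auto simp: grass_deriv_def algebra_simps)

lemma horizontal_op_add: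
  assumes W: "open_in (jidx M r) W" and \<alpha>: "form_on M r W k \<alpha>" and \<beta>: "form_on M r W k \<beta>" and y: "y \<in> W"
  shows "horizontal_op M r (\<lambda>y I. \<alpha> y I + \<beta> y I) y = (\<lambda>I. horizontal_op M r \<alpha> y I + horizontal_op M r \<beta> y I)"
proof -
  have "hor_coeff M r k i (\<lambda>y I. \<alpha> y I + \<beta> y I) y = (\<lambda>I. hor_coeff M r k i \<alpha> y I + hor_coeff M r k i \<beta> y I)"
    if "i < r" for i
  proof
    fix I
    have *: "coeff_pd j (\<lambda>y I. \<alpha> y I + \<beta> y I) y I = coeff_pd j \<alpha> y I + coeff_pd j \<beta> y I" if "j \<in> jidx M r" for j
      using coeff_pd_add[OF \<alpha> \<beta> y that] by simp
    have s: "(\<Sum>j\<in>jidx_le M r k \<inter> xidx M r. y (raise i j) * coeff_pd j (\<lambda>y I. \<alpha> y I + \<beta> y I) y I) =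
        (\<Sum>j\<in>jidx_le M r k \<inter> xidx M r. y (raise i j) * coeff_pd j \<alpha> y I) +
        (\<Sum>j\<in>jidx_le M r k \<inter> xidx M r. y (raise i j) * coeff_pd j \<beta> y I)"
      unfolding sum.distrib[symmetric]
      by (rule sum.cong[OF refl]) (simp add: *[OF xidx_jidx] algebra_simps)
    show "hor_coeff M r k i (\<lambda>y I. \<alpha> y I + \<beta> y I) y I = hor_coeff M r k i \<alpha> y I + hor_coeff M r k i \<beta> y I"
      unfolding hor_coeff_def s using *[of "Tc i"] that
      by (simp add: grass_deriv_add wedge_add_right sum.distrib)
  qed
  then show ?thesis
    unfolding horizontal_op_eq[OF W form_on_add[OF W \<alpha> \<beta>] y] horizontal_op_eq[OF W \<alpha> y] horizontal_op_eq[OF W \<beta> y]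
    by (simp add: wedge_add_right sum.distrib)
qed

text \<open>The structure equation of the Cartan frame: the value of D on a generator, which is
  \<open>dt^i\<close> times the Cartan form with the index \<open>i\<close> added, summed over
  \<open>i\<close>, and zero on \<open>dt\<close>.\<close>

definition frame_diff :: "'a mfd \<Rightarrow> nat \<Rightarrow> jcoord \<Rightarrow> jcoord grass" where
  "frame_diff M r j I = (if j \<in> xidx M r then \<Sum>i<r. wedge (gen (Tc i)) (gen (raise i j)) I else 0)"

lemma coeff_pd_wedge_gen:
  assumes W: "open_in (jidx M r) W" and \<alpha>: "form_on M r W k \<alpha>" and y: "y \<in> W"
    and "l \<in> jidx M r" "j \<in> jidx_le M r k"
  shows "coeff_pd l (\<lambda>y. wedge (gen j) (\<alpha> y)) y = wedge (gen j) (coeff_pd l \<alpha> y)"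
  using coeff_pd_wedge[OF form_on_gen[OF W assms(5)] \<alpha> y assms(4)] by (simp add: coeff_pd_const)

lemma wedge_diff_right: "wedge \<gamma> (\<lambda>I. \<alpha> I - \<beta> I) = (\<lambda>I. wedge \<gamma> \<alpha> I - wedge \<gamma> \<beta> I)"
  using wedge_add_right[of \<gamma> \<alpha> "\<lambda>I. -1 * \<beta> I"] wedge_cmult_right[of \<gamma> "-1" \<beta>] by simp

text \<open>For fixed \<open>i\<close> this is an even derivation that moves the index of \<Gamma>
  up by \<open>i\<close>. The sign from \<open>grass_deriv\<close> passing the generator
  \<open>j\<close> cancels against the sign from the raised generator passing it.\<close>

lemma hor_coeff_wedge_gen:
  assumes W: "open_in (jidx M r) W" and \<alpha>: "form_on M r W k \<alpha>" and y: "y \<in> W"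
    and j: "j \<in> jidx_le M r k" and i: "i < r"
  shows "hor_coeff M r k i (\<lambda>y. wedge (gen j) (\<alpha> y)) y = (\<lambda>I. wedge (gen j) (hor_coeff M r k i \<alpha> y) I
    + (if j \<in> xidx M r then wedge (gen (raise i j)) (\<alpha> y) I else 0))"
proof
  fix I
  let ?B = "jidx_le M r k \<inter> xidx M r"
  have c: "coeff_pd l (\<lambda>y. wedge (gen j) (\<alpha> y)) y I = wedge (gen j) (coeff_pd l \<alpha> y) I" if "l \<in> jidx M r" for l
    using coeff_pd_wedge_gen[OF W \<alpha> y that j] by simp
  have s1: "(\<Sum>l\<in>?B. y (raise i l) * coeff_pd l (\<lambda>y. wedge (gen j) (\<alpha> y)) y I) =
      (\<Sum>l\<in>?B. y (raise i l) * wedge (gen j) (coeff_pd l \<alpha> y) I)"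
    by (rule sum.cong[OF refl]) (simp add: c[OF xidx_jidx])
  have s2: "(\<Sum>l\<in>?B. wedge (gen (raise i l)) (grass_deriv l (wedge (gen j) (\<alpha> y))) I) =
      (\<Sum>l\<in>?B. wedge (gen j) (wedge (gen (raise i l)) (grass_deriv l (\<alpha> y))) I)
      + (if j \<in> xidx M r then wedge (gen (raise i j)) (\<alpha> y) I else 0)"
  proof -
    have "wedge (gen (raise i l)) (grass_deriv l (wedge (gen j) (\<alpha> y))) I =
        wedge (gen j) (wedge (gen (raise i l)) (grass_deriv l (\<alpha> y))) I
        + (if l = j then wedge (gen (raise i j)) (\<alpha> y) I else 0)" for l
      unfolding grass_deriv_wedge_gen[OF form_on_fin_supp[OF \<alpha> y]] wedge_diff_right
      using wedge_gen_anticommute[of "raise i l" j] by (cases "l = j") simp_all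
    then show ?thesis using j finite_jidx_le[of M r k] by (simp add: sum.distrib sum.delta')
  qed
  have "hor_coeff M r k i (\<lambda>y. wedge (gen j) (\<alpha> y)) y I =
      wedge (gen j) (coeff_pd (Tc i) \<alpha> y) I
      + (\<Sum>l\<in>?B. y (raise i l) * wedge (gen j) (coeff_pd l \<alpha> y) I)
      + (\<Sum>l\<in>?B. wedge (gen j) (wedge (gen (raise i l)) (grass_deriv l (\<alpha> y))) I)
      + (if j \<in> xidx M r then wedge (gen (raise i j)) (\<alpha> y) I else 0)"
    unfolding hor_coeff_def s1 s2 using c[of "Tc i"] i by simp
  also have "\<dots> = wedge (gen j) (hor_coeff M r k i \<alpha> y) I
      + (if j \<in> xidx M r then wedge (gen (raise i j)) (\<alpha> y) I else 0)"
    unfolding hor_coeff_def[abs_def] wedge_add_right wedge_sum_right wedge_cmult_right by simp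
  finally show "hor_coeff M r k i (\<lambda>y. wedge (gen j) (\<alpha> y)) y I = wedge (gen j) (hor_coeff M r k i \<alpha> y) I
    + (if j \<in> xidx M r then wedge (gen (raise i j)) (\<alpha> y) I else 0)" .
qed

lemma horizontal_op_wedge_gen:
  assumes W: "open_in (jidx M r) W" and \<alpha>: "form_on M r W k \<alpha>" and y: "y \<in> W" and j: "j \<in> jidx_le M r k"
  shows "horizontal_op M r (\<lambda>y. wedge (gen j) (\<alpha> y)) y =
    (\<lambda>I. wedge (frame_diff M r j) (\<alpha> y) I - wedge (gen j) (horizontal_op M r \<alpha> y) I)"
proof
  fix I
  have "(\<Sum>i<r. wedge (gen (Tc i)) (hor_coeff M r k i (\<lambda>y. wedge (gen j) (\<alpha> y)) y) I) =
      (\<Sum>i<r. (if j \<in> xidx M r then wedge (wedge (gen (Tc i)) (gen (raise i j))) (\<alpha> y) I else 0)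
        - wedge (gen j) (wedge (gen (Tc i)) (hor_coeff M r k i \<alpha> y)) I)"
  proof (rule sum.cong[OF refl])
    fix i assume "i \<in> {..<r}"
    then have i: "i < r" by simp
    show "wedge (gen (Tc i)) (hor_coeff M r k i (\<lambda>y. wedge (gen j) (\<alpha> y)) y) I =
        (if j \<in> xidx M r then wedge (wedge (gen (Tc i)) (gen (raise i j))) (\<alpha> y) I else 0)
        - wedge (gen j) (wedge (gen (Tc i)) (hor_coeff M r k i \<alpha> y)) I"
      unfolding hor_coeff_wedge_gen[OF W \<alpha> y j i] wedge_add_right
      using wedge_gen_anticommute[of "Tc i" j "hor_coeff M r k i \<alpha> y" I] by (cases "j \<in> xidx M r") (simp_all add: wedge_assoc)
  qed
  also have "\<dots> = wedge (frame_diff M r j) (\<alpha> y) I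
      - wedge (gen j) (\<lambda>I. \<Sum>i<r. wedge (gen (Tc i)) (hor_coeff M r k i \<alpha> y) I) I"
    unfolding wedge_sum_right sum_subtractf frame_diff_def[abs_def]
    by (cases "j \<in> xidx M r") (simp_all add: wedge_sum_left)
  finally show "horizontal_op M r (\<lambda>y. wedge (gen j) (\<alpha> y)) y I =
      wedge (frame_diff M r j) (\<alpha> y) I - wedge (gen j) (horizontal_op M r \<alpha> y) I"
    unfolding horizontal_op_eq[OF W form_on_wedge[OF W form_on_gen[OF W j] \<alpha>] y] horizontal_op_eq[OF W \<alpha> y] .
qed

lemma gen_diff_sum:
  assumes W: "open_in (jidx M r) W" and y: "y \<in> W" and S: "S \<subseteq> jidx M r"
    and \<alpha>: "\<And>a. a \<in> A \<Longrightarrow> form_on M r W k (\<alpha> a)"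
  shows "gen_diff S (\<lambda>y I. \<Sum>a\<in>A. \<alpha> a y I) y = (\<lambda>I. \<Sum>a\<in>A. gen_diff S (\<alpha> a) y I)"
  using \<alpha>
proof (induction A rule: infinite_finite_induct)
  case (insert a A)
  then show ?case using gen_diff_add[OF W _ form_on_sum[OF W] y S, of k "\<alpha> a" A \<alpha>] by simp
qed (use gen_diff_const[OF W y S, of "\<lambda>I. 0"] in simp_all)

text \<open>Differentiating \<open>- x_(i\<sigma>) dt^i\<close> gives
  \<open>dt^i dx_(i\<sigma>)\<close>. Replacing \<open>dx_(i\<sigma>)\<close> by its Cartan form
  changes this by \<open>x_(li\<sigma>) dt^i dt^l\<close>, which sums to zero by symmetry in
  \<open>i\<close> and \<open>l\<close>.\<close>

lemma gen_diff_from_frame: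
  assumes W: "open_in (jidx M r) W" and y: "y \<in> W" and j: "j \<in> jidx_le M r k"
  shows "gen_diff (jidx M r) (\<lambda>y. from_frame r y j) y = gsubst (from_frame r y) (frame_diff M r j)"
proof (cases j)
  case (Tc i)
  have "gen_diff (jidx M r) (\<lambda>y. gen (Tc i)) y = (\<lambda>I. 0)"
    by (rule gen_diff_const[OF W y order_refl, of _ k]) (use j Tc in \<open>auto simp: gen_def split: if_splits\<close>)
  moreover have "frame_diff M r j = (\<lambda>I. 0)" by (simp add: frame_diff_def[abs_def] Tc)
  ultimately show ?thesis by (simp add: Tc)
next
  case (Xc a \<sigma>)
  let ?S = "jidx M r" and ?k = "Suc k"
  have jx: "j \<in> xidx M r" using j Xc by simp
  have SB: "?S \<inter> jidx_le M r ?k = jidx_le M r ?k" using jidx_le_subset[of M r ?k] by auto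
  have ri: "raise i j \<in> jidx_le M r ?k" if "i < r" for i using raise_jidx_le[OF that j] .
  have j': "j \<in> jidx_le M r ?k" using jidx_le_mono[of k ?k M r] j by auto
  have T: "\<And>I. gen (Tc i) I \<noteq> 0 \<Longrightarrow> I \<subseteq> jidx_le M r ?k" if "i < r" for i
    using that by (auto simp: gen_def split: if_splits)
  have of: "(\<lambda>y. (-1) * y (raise i j)) \<in> order_fun M r W ?k" if "i < r" for i
    by (intro order_fun_mult[OF W] order_fun_const[OF W] order_fun_coord[OF W] ri that)
  have fo: "form_on M r W ?k (\<lambda>y I. ((-1) * y (raise i j)) * gen (Tc i) I)" if "i < r" for i
    using that by (intro form_on_mult[OF W of] form_on_gen[OF W]) auto
  have one: "gen_diff ?S (\<lambda>y I. ((-1) * y (raise i j)) * gen (Tc i) I) y = (\<lambda>I. - wedge (gen (raise i j)) (gen (Tc i)) I)"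
    if i: "i < r" for i
  proof
    fix I
    have pd: "pd l (\<lambda>y. (-1) * y (raise i j)) y = (if l = raise i j then -1 else 0)" for l
      using pd_cmult[OF pdiff_coord, of l "-1" "raise i j" y] by (simp add: pd_coord)
    have "gen_diff ?S (\<lambda>y I. ((-1) * y (raise i j)) * gen (Tc i) I) y I =
        (\<Sum>l\<in>jidx_le M r ?k. (if l = raise i j then -1 else 0) * wedge (gen l) (gen (Tc i)) I)"
    proof -
      have "gen_diff ?S (\<lambda>y I. ((-1) * y (raise i j)) * gen (Tc i) I) y =
          (\<lambda>I. \<Sum>l\<in>?S \<inter> jidx_le M r ?k. pd l (\<lambda>y. (-1) * y (raise i j)) y * wedge (gen l) (gen (Tc i)) I)"
        by (rule gen_diff_mult_const[OF W of[OF i] y order_refl]) (rule T[OF i])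
      then show ?thesis unfolding SB pd by simp
    qed
    also have "\<dots> = (\<Sum>l\<in>jidx_le M r ?k. if l = raise i j then - wedge (gen (raise i j)) (gen (Tc i)) I else 0)"
      by (rule sum.cong) auto
    also have "\<dots> = - wedge (gen (raise i j)) (gen (Tc i)) I"
      using ri[OF i] finite_jidx_le[of M r ?k] by (simp add: sum.delta)
    finally show "gen_diff ?S (\<lambda>y I. ((-1) * y (raise i j)) * gen (Tc i) I) y I = - wedge (gen (raise i j)) (gen (Tc i)) I" .
  qed
  have fsum: "form_on M r W ?k (\<lambda>y I. \<Sum>i<r. ((-1) * y (raise i j)) * gen (Tc i) I)"
    by (rule form_on_sum[OF W]) (rule fo, simp)
  have "(\<lambda>y. from_frame r y j) = (\<lambda>y I. gen j I + (\<Sum>i<r. ((-1) * y (raise i j)) * gen (Tc i) I))"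
    by (simp add: fun_eq_iff Xc frame_Xc sum_negf)
  then have "gen_diff ?S (\<lambda>y. from_frame r y j) y =
      (\<lambda>I. gen_diff ?S (\<lambda>y. gen j) y I + gen_diff ?S (\<lambda>y I. \<Sum>i<r. ((-1) * y (raise i j)) * gen (Tc i) I) y I)"
    using gen_diff_add[OF W form_on_gen[OF W j'] fsum y order_refl] by simp
  also have "gen_diff ?S (\<lambda>y. gen j) y = (\<lambda>I. 0)"
    by (rule gen_diff_const[OF W y order_refl, of _ k]) (use j in \<open>auto simp: gen_def split: if_splits\<close>)
  also have "gen_diff ?S (\<lambda>y I. \<Sum>i<r. ((-1) * y (raise i j)) * gen (Tc i) I) y =
      (\<lambda>I. \<Sum>i<r. gen_diff ?S (\<lambda>y I. ((-1) * y (raise i j)) * gen (Tc i) I) y I)"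
    by (rule gen_diff_sum[OF W y order_refl fo]) simp
  also have "(\<lambda>I. 0 + (\<Sum>i<r. gen_diff ?S (\<lambda>y I. ((-1) * y (raise i j)) * gen (Tc i) I) y I)) =
      (\<lambda>I. \<Sum>i<r. wedge (gen (Tc i)) (gen (raise i j)) I)"
    unfolding add_0_left
    by (rule ext, rule sum.cong[OF refl], subst wedge_gen_gen_anticommute, rule fun_cong[OF one]) simp
  finally have lhs: "gen_diff ?S (\<lambda>y. from_frame r y j) y = (\<lambda>I. \<Sum>i<r. wedge (gen (Tc i)) (gen (raise i j)) I)" .
  have "gsubst (from_frame r y) (frame_diff M r j) =
      gsubst (from_frame r y) (\<lambda>I. \<Sum>i<r. wedge (gen (Tc i)) (gen (raise i j)) I)"
    by (simp add: frame_diff_def[abs_def] jx)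
  also have "\<dots> = (\<lambda>I. \<Sum>i<r. wedge (gen (Tc i)) (from_frame r y (raise i j)) I)"
    by (simp add: gsubst_setsum fin_supp_wedge gsubst_wedge_gen gsubst_gen deg1_finite[OF deg1_frame(2)])
  also have "\<dots> = (\<lambda>I. (\<Sum>i<r. wedge (gen (Tc i)) (gen (raise i j)) I)
      - (\<Sum>i<r. \<Sum>l<r. y (raise l (raise i j)) * wedge (gen (Tc i)) (gen (Tc l)) I))"
    by (simp add: Xc frame_Xc wedge_diff_right wedge_sum_right wedge_cmult_right sum_subtractf)
  also have "\<dots> = (\<lambda>I. \<Sum>i<r. wedge (gen (Tc i)) (gen (raise i j)) I)"
  proof -
    have "(\<Sum>i<r. \<Sum>l<r. y (raise l (raise i j)) * wedge (gen (Tc i)) (gen (Tc l)) I) = 0" for I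
      by (rule antisymmetric_sum_zero[of "{..<r}" "\<lambda>i l. y (raise l (raise i j))" Tc I])
        (simp add: Xc add_mset_commute)
    then show ?thesis by simp
  qed
  finally show ?thesis using lhs by simp
qed

lemma fin_supp_frame_diff: "fin_supp (frame_diff M r j)"
  unfolding frame_diff_def[abs_def] by (cases "j \<in> xidx M r") (simp_all add: fin_supp_sum fin_supp_wedge)

lemma to_cartan_wedge:
  "fin_supp (\<alpha> y) \<Longrightarrow> fin_supp (\<beta> y) \<Longrightarrow>
    to_cartan r (\<lambda>y. wedge (\<alpha> y) (\<beta> y)) y = wedge (to_cartan r \<alpha> y) (to_cartan r \<beta> y)"
  unfolding to_cartan_frame by (simp add: gsubst_wedge)

lemma xidx_subset: "xidx M r \<subseteq> jidx M r"
  by (auto simp: jidx_def)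

text \<open>Both sides are odd derivations, so by \<open>form_on_induct\<close> functions and
  generators suffice. On a function the \<open>dt\<close>-parts of the Cartan forms cancel the terms
  by which the total derivative exceeds the partial one; on generators it is
  \<open>gen_diff_from_frame\<close>.\<close>

lemma gen_diff_from_cartan:
  assumes W: "open_in (jidx M r) W" and \<eta>: "form_on M r W k \<eta>" and "y \<in> W"
  shows "gen_diff (jidx M r) (from_cartan r \<eta>) y =
    from_cartan r (\<lambda>y I. horizontal_op M r \<eta> y I + gen_diff (xidx M r) \<eta> y I) y"
  using W \<eta> assms(3)
proof (induction arbitrary: y rule: form_on_induct)
  case (base f)
  let ?B = "jidx_le M r k \<inter> xidx M r"
  note f = base(1) and y = base(2)
  have B: "jidx M r \<inter> jidx_le M r k = tidx r \<union> ?B" "xidx M r \<inter> jidx_le M r k = ?B" "finite ?B" "tidx r \<inter> ?B = {}"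
    using finite_jidx_le[of M r k] by (auto simp: jidx_def jidx_le_def tidx_def xidx_def)
  have T: "tidx r = Tc ` {..<r}" "finite (tidx r)" by (auto simp: tidx_def)
  define D where "D i = pd (Tc i) f y + (\<Sum>j\<in>?B. y (raise i j) * pd j f y)" for i
  have "from_cartan r (\<lambda>y I. f y * gone I) = (\<lambda>y I. f y * gone I)"
    by (simp add: from_cartan_frame fun_eq_iff gsubst_cmult gsubst_gone)
  then have lhs: "gen_diff (jidx M r) (from_cartan r (\<lambda>y I. f y * gone I)) y =
      (\<lambda>I. (\<Sum>i<r. pd (Tc i) f y * gen (Tc i) I) + (\<Sum>j\<in>?B. pd j f y * gen j I))"
    using gen_diff_fun[OF W f y order_refl] B T
    by (simp add: B(1) sum.union_disjoint sum.reindex inj_on_def)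
  have "hor_coeff M r k i (\<lambda>y I. f y * gone I) y = (\<lambda>I. D i * gone I)" if "i < r" for i
  proof
    fix I
    have c: "coeff_pd j (\<lambda>y I. f y * gone I) y I = pd j f y * gone I" if "j \<in> jidx M r" for j
      using coeff_pd_mult[OF f y that] by simp
    have "grass_deriv j (\<lambda>I. f y * gone I) = (\<lambda>I. 0)" for j :: jcoord
      by (auto simp: grass_deriv_def gone_def)
    moreover have "(\<Sum>j\<in>?B. y (raise i j) * coeff_pd j (\<lambda>y I. f y * gone I) y I) =
        (\<Sum>j\<in>?B. y (raise i j) * pd j f y) * gone I"
      unfolding sum_distrib_right by (rule sum.cong[OF refl]) (simp add: c[OF xidx_jidx])
    ultimately show "hor_coeff M r k i (\<lambda>y I. f y * gone I) y I = D i * gone I"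
      unfolding hor_coeff_def D_def using c[of "Tc i"] that by (simp add: distrib_right)
  qed
  then have "horizontal_op M r (\<lambda>y I. f y * gone I) y = (\<lambda>I. \<Sum>i<r. D i * gen (Tc i) I)"
    unfolding horizontal_op_eq[OF W form_on_mult[OF W f form_on_gone[OF W]] y]
    by (simp add: wedge_gen_mult_gone)
  then have "from_cartan r (\<lambda>y I. horizontal_op M r (\<lambda>y I. f y * gone I) y I + gen_diff (xidx M r) (\<lambda>y I. f y * gone I) y I) y =
      gsubst (from_frame r y) (\<lambda>I. (\<Sum>i<r. D i * gen (Tc i) I) + (\<Sum>j\<in>?B. pd j f y * gen j I))"
    unfolding from_cartan_frame gen_diff_fun[OF W f y xidx_subset] B(2) by simp
  also have "\<dots> = (\<lambda>I. (\<Sum>i<r. D i * gen (Tc i) I) + (\<Sum>j\<in>?B. pd j f y * from_frame r y j I))"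
    by (simp add: gsubst_add gsubst_linear fin_supp_sum fin_supp_cmult)
  also have "\<dots> = (\<lambda>I. (\<Sum>i<r. pd (Tc i) f y * gen (Tc i) I) + (\<Sum>j\<in>?B. pd j f y * gen j I))"
  proof
    fix I
    have "(\<Sum>j\<in>?B. pd j f y * from_frame r y j I) =
        (\<Sum>j\<in>?B. pd j f y * gen j I - (\<Sum>i<r. y (raise i j) * pd j f y * gen (Tc i) I))"
    proof (rule sum.cong[OF refl])
      fix j assume "j \<in> ?B"
      then obtain a \<sigma> where "j = Xc a \<sigma>" by (cases j) auto
      then show "pd j f y * from_frame r y j I = pd j f y * gen j I - (\<Sum>i<r. y (raise i j) * pd j f y * gen (Tc i) I)"
        by (simp add: frame_Xc right_diff_distrib sum_distrib_left ac_simps)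
    qed
    also have "\<dots> = (\<Sum>j\<in>?B. pd j f y * gen j I) - (\<Sum>i<r. (\<Sum>j\<in>?B. y (raise i j) * pd j f y) * gen (Tc i) I)"
      unfolding sum_subtractf sum_distrib_right by (subst sum.swap) simp
    finally show "(\<Sum>i<r. D i * gen (Tc i) I) + (\<Sum>j\<in>?B. pd j f y * from_frame r y j I) =
        (\<Sum>i<r. pd (Tc i) f y * gen (Tc i) I) + (\<Sum>j\<in>?B. pd j f y * gen j I)"
      by (simp add: D_def distrib_right sum.distrib)
  qed
  finally show ?case using lhs by simp
next
  case (gen j \<alpha>)
  note j = gen(1) and \<alpha> = gen(2) and y = gen(4)
  let ?S = "jidx M r" and ?G = "\<lambda>y I. horizontal_op M r \<alpha> y I + gen_diff (xidx M r) \<alpha> y I"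
  have \<alpha>': "form_on M r W (Suc k) \<alpha>" by (rule form_on_mono[OF _ \<alpha>]) simp
  have fsG: "fin_supp (?G y)"
    by (intro fin_supp_add form_on_fin_supp[OF form_on_horizontal_op[OF W \<alpha>] y]
        form_on_fin_supp[OF form_on_gen_diff[OF W \<alpha> xidx_subset] y])
  note fs\<alpha> = form_on_fin_supp[OF \<alpha> y]
  have jk: "j \<in> jidx_le M r (Suc k)" using jidx_le_mono[of k "Suc k" M r] j by auto
  have "gen_diff ?S (from_cartan r (\<lambda>y. wedge (gen j) (\<alpha> y))) y =
      gen_diff ?S (\<lambda>y. wedge (from_frame r y j) (from_cartan r \<alpha> y)) y"
    by (rule gen_diff_cong[OF W y order_refl])
      (simp add: from_cartan_frame gsubst_wedge_gen form_on_fin_supp[OF \<alpha>])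
  also have "\<dots> = (\<lambda>I. wedge (gsubst (from_frame r y) (frame_diff M r j)) (from_cartan r \<alpha> y) I
      - wedge (from_frame r y j) (from_cartan r ?G y) I)"
    using gen_diff_wedge_deg1[OF W form_on_frame(2)[OF W j] form_on_cartan(2)[OF W \<alpha>] y order_refl deg1_frame(2)]
      gen_diff_from_frame[OF W y j] gen(3)[OF y] by simp
  also have "\<dots> = gsubst (from_frame r y) (\<lambda>I. wedge (frame_diff M r j) (\<alpha> y) I - wedge (gen j) (?G y) I)"
    unfolding from_cartan_frame using fsG fs\<alpha> fin_supp_frame_diff[of M r j]
    by (simp add: gsubst_diff fin_supp_wedge gsubst_wedge gsubst_gen deg1_finite[OF deg1_frame(2)])
  also have "(\<lambda>I. wedge (frame_diff M r j) (\<alpha> y) I - wedge (gen j) (?G y) I) =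
      (\<lambda>I. horizontal_op M r (\<lambda>y. wedge (gen j) (\<alpha> y)) y I + gen_diff (xidx M r) (\<lambda>y. wedge (gen j) (\<alpha> y)) y I)"
    unfolding horizontal_op_wedge_gen[OF W \<alpha> y j] gen_diff_wedge_gen[OF W \<alpha> y xidx_subset j] wedge_add_right
    by (simp add: diff_diff_eq)
  finally show ?case by (simp add: from_cartan_frame)
next
  case (add \<alpha> \<beta>)
  note \<alpha> = add(1) and \<beta> = add(2) and y = add(5)
  have fs: "fin_supp (\<lambda>I. horizontal_op M r \<alpha> y I + gen_diff (xidx M r) \<alpha> y I)" if "form_on M r W k \<alpha>" for \<alpha>
    by (intro fin_supp_add form_on_fin_supp[OF form_on_horizontal_op[OF W that] y]
        form_on_fin_supp[OF form_on_gen_diff[OF W that xidx_subset] y])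
  have "gen_diff (jidx M r) (from_cartan r (\<lambda>y I. \<alpha> y I + \<beta> y I)) y =
      gen_diff (jidx M r) (\<lambda>y I. from_cartan r \<alpha> y I + from_cartan r \<beta> y I) y"
    by (rule gen_diff_cong[OF W y order_refl])
      (simp add: from_cartan_frame gsubst_add form_on_fin_supp[OF \<alpha>] form_on_fin_supp[OF \<beta>])
  also have "\<dots> = (\<lambda>I. gen_diff (jidx M r) (from_cartan r \<alpha>) y I + gen_diff (jidx M r) (from_cartan r \<beta>) y I)"
    by (rule gen_diff_add[OF W form_on_cartan(2)[OF W \<alpha>] form_on_cartan(2)[OF W \<beta>] y order_refl])
  also have "\<dots> = gsubst (from_frame r y) (\<lambda>I. (horizontal_op M r \<alpha> y I + gen_diff (xidx M r) \<alpha> y I)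
      + (horizontal_op M r \<beta> y I + gen_diff (xidx M r) \<beta> y I))"
    unfolding add(3,4)[OF y] from_cartan_frame gsubst_add[OF fs[OF \<alpha>] fs[OF \<beta>]] ..
  also have "\<dots> = from_cartan r (\<lambda>y I. horizontal_op M r (\<lambda>y I. \<alpha> y I + \<beta> y I) y I
      + gen_diff (xidx M r) (\<lambda>y I. \<alpha> y I + \<beta> y I) y I) y"
    unfolding from_cartan_frame horizontal_op_add[OF W \<alpha> \<beta> y] gen_diff_add[OF W \<alpha> \<beta> y xidx_subset]
    by (simp add: ac_simps)
  finally show ?case .
next
  case (cong \<alpha> \<beta>)
  have "gen_diff (jidx M r) (from_cartan r \<beta>) y = gen_diff (jidx M r) (from_cartan r \<alpha>) y"
    by (rule gen_diff_cong[OF W cong(3) order_refl]) (simp add: from_cartan_frame cong(1))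
  also have "\<dots> = from_cartan r (\<lambda>y I. horizontal_op M r \<alpha> y I + gen_diff (xidx M r) \<alpha> y I) y"
    by (rule cong(2)[OF cong(3)])
  also have "\<dots> = from_cartan r (\<lambda>y I. horizontal_op M r \<beta> y I + gen_diff (xidx M r) \<beta> y I) y"
  proof -
    have "horizontal_op M r \<alpha> y = horizontal_op M r \<beta> y" by (rule horizontal_op_cong[OF W cong(3) cong(1)])
    moreover have "gen_diff (xidx M r) \<alpha> y = gen_diff (xidx M r) \<beta> y"
      by (rule gen_diff_cong[OF W cong(3) xidx_subset cong(1)])
    ultimately show ?thesis by (simp add: from_cartan_frame)
  qed
  finally show ?case .
qed

subsection \<open>Bidegrees\<close>

lemma coeff_pd_nonzeroD:
  assumes "open_in (jidx M r) W" "y \<in> W" "j \<in> jidx M r" "coeff_pd j \<eta> y K \<noteq> 0"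
  shows "\<exists>y'\<in>W. \<eta> y' K \<noteq> 0"
proof (rule ccontr)
  assume "\<not> (\<exists>y'\<in>W. \<eta> y' K \<noteq> 0)"
  then have "coeff_pd j \<eta> y K = pd j (\<lambda>y. 0) y"
    unfolding coeff_pd_def by (intro pd_cong[OF assms(1-3)]) auto
  then show False using assms(4) by simp
qed

text \<open>A coefficient may vanish at \<open>y\<close> while its derivative does not; hence a
  nonzero coefficient is only found at some point \<open>y'\<close> of \<open>W\<close>. This is
  enough for forms whose bidegree is the same at all points.\<close>

lemma horizontal_op_support:
  assumes W: "open_in (jidx M r) W" and \<eta>: "form_on M r W k \<eta>" and y: "y \<in> W"
    and nz: "horizontal_op M r \<eta> y I \<noteq> 0"
  shows "\<exists>K. (\<exists>y'\<in>W. \<eta> y' K \<noteq> 0) \<and> card (I \<inter> xidx M r) = card (K \<inter> xidx M r) \<and>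
    card (I \<inter> tidx r) = Suc (card (K \<inter> tidx r))"
proof -
  let ?X = "xidx M r" and ?T = "tidx r"
  have "\<exists>i\<in>{..<r}. wedge (gen (Tc i)) (hor_coeff M r k i \<eta> y) I \<noteq> 0"
  proof (rule ccontr)
    assume "\<not> ?thesis"
    then show False using nz unfolding horizontal_op_eq[OF W \<eta> y] by simp
  qed
  then obtain i where i: "i < r" "wedge (gen (Tc i)) (hor_coeff M r k i \<eta> y) I \<noteq> 0" by auto
  define K where "K = I - {Tc i}"
  have I: "finite I" "Tc i \<in> I" and K: "hor_coeff M r k i \<eta> y K \<noteq> 0"
    using i(2) by (auto simp: wedge_gen K_def split: if_splits)
  have fK: "finite K" using I by (simp add: K_def)
  have "I \<inter> ?X = K \<inter> ?X" by (auto simp: K_def)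
  moreover have "I \<inter> ?T = insert (Tc i) (K \<inter> ?T)" using I i by (auto simp: K_def)
  then have "card (I \<inter> ?T) = Suc (card (K \<inter> ?T))" using fK by (simp add: K_def)
  moreover have "\<exists>K'. (\<exists>y'\<in>W. \<eta> y' K' \<noteq> 0) \<and> card (K \<inter> ?X) = card (K' \<inter> ?X) \<and> card (K \<inter> ?T) = card (K' \<inter> ?T)"
  proof -
    let ?B = "jidx_le M r k \<inter> xidx M r"
    have "coeff_pd (Tc i) \<eta> y K \<noteq> 0 \<or> (\<exists>j\<in>?B. coeff_pd j \<eta> y K \<noteq> 0) \<or>
        (\<exists>j\<in>?B. wedge (gen (raise i j)) (grass_deriv j (\<eta> y)) K \<noteq> 0)"
    proof (rule ccontr)
      assume "\<not> ?thesis"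
      then show False using K unfolding hor_coeff_def by simp
    qed
    then consider (pd) j where "j \<in> jidx M r" "coeff_pd j \<eta> y K \<noteq> 0"
      | (shift) j where "j \<in> ?X" "wedge (gen (raise i j)) (grass_deriv j (\<eta> y)) K \<noteq> 0"
      using i(1) xidx_jidx[of _ M r] Tc_jidx(1)[of i M r] by blast
    then show ?thesis
    proof cases
      case pd
      then show ?thesis using coeff_pd_nonzeroD[OF W y] by blast
    next
      case shift
      let ?j = "raise i j"
      have j: "?j \<in> ?X" "?j \<in> K" "grass_deriv j (\<eta> y) (K - {?j}) \<noteq> 0"
        using shift raise_xidx[OF i(1)] by (auto simp: wedge_gen split: if_splits)
      \<comment> \<open>This undoes the shift: \<open>raise i j\<close> is put back to
        \<open>j\<close>, which leaves the number of \<Gamma> and of \<open>dt\<close>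
        unchanged.\<close>
      let ?K = "insert j (K - {?j})"
      have nz: "\<eta> y ?K \<noteq> 0" "j \<notin> K - {?j}" using j(3) by (auto simp: grass_deriv_def split: if_splits)
      have T: "j \<notin> ?T" "?j \<notin> ?T" using shift(1) j(1) tidx_xidx_disjoint[of r M] by auto
      have "K \<inter> ?X = insert ?j ((K - {?j}) \<inter> ?X)" using j by auto
      then have "card (K \<inter> ?X) = Suc (card ((K - {?j}) \<inter> ?X))"
        using fK by (simp add: card_insert_if)
      moreover have "?K \<inter> ?X = insert j ((K - {?j}) \<inter> ?X)" using shift(1) by auto
      then have "card (?K \<inter> ?X) = Suc (card ((K - {?j}) \<inter> ?X))"
        using fK nz(2) by (simp add: card_insert_if)
      moreover have "?K \<inter> ?T = K \<inter> ?T" using T by auto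
      ultimately show ?thesis using nz(1) y by (intro exI[of _ ?K]) auto
    qed
  qed
  ultimately show ?thesis by auto
qed

lemma vertical_support:
  assumes W: "open_in (jidx M r) W" and \<eta>: "form_on M r W k \<eta>" and y: "y \<in> W"
    and nz: "gen_diff (xidx M r) \<eta> y I \<noteq> 0"
  shows "\<exists>K. (\<exists>y'\<in>W. \<eta> y' K \<noteq> 0) \<and> card (I \<inter> xidx M r) = Suc (card (K \<inter> xidx M r)) \<and>
    card (I \<inter> tidx r) = card (K \<inter> tidx r)"
proof -
  have "\<exists>j\<in>xidx M r \<inter> jidx_le M r k. wedge (gen j) (coeff_pd j \<eta> y) I \<noteq> 0"
  proof (rule ccontr)
    assume "\<not> ?thesis"
    then show False using nz unfolding gen_diff_eq[OF W \<eta> y xidx_subset] by simp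
  qed
  then obtain j where j: "j \<in> xidx M r" "wedge (gen j) (coeff_pd j \<eta> y) I \<noteq> 0" by auto
  have I: "finite I" "j \<in> I" "coeff_pd j \<eta> y (I - {j}) \<noteq> 0"
    using j(2) by (auto simp: wedge_gen split: if_splits)
  have "I \<inter> xidx M r = insert j ((I - {j}) \<inter> xidx M r)" using I j by auto
  then have "card (I \<inter> xidx M r) = Suc (card ((I - {j}) \<inter> xidx M r))"
    using I(1) by (simp add: card_insert_if)
  moreover have "I \<inter> tidx r = (I - {j}) \<inter> tidx r" using j(1) tidx_xidx_disjoint[of r M] by auto
  moreover have "\<exists>y'\<in>W. \<eta> y' (I - {j}) \<noteq> 0" using coeff_pd_nonzeroD[OF W y xidx_jidx[OF j(1)] I(3)] .
  ultimately show ?thesis by (intro exI[of _ "I - {j}"]) simp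
qed

lemma card_jidx_split:
  assumes "finite I" "I \<subseteq> jidx M r"
  shows "card I = card (I \<inter> xidx M r) + card (I \<inter> tidx r)"
proof -
  have "I = (I \<inter> xidx M r) \<union> (I \<inter> tidx r)" using assms(2) by (auto simp: jidx_def)
  moreover have "(I \<inter> xidx M r) \<inter> (I \<inter> tidx r) = {}" using tidx_xidx_disjoint[of r M] by auto
  ultimately show ?thesis using assms(1) by (metis card_Un_disjoint finite_Int)
qed

subsection \<open>Powers of the Cartan ideal\<close>

lemma lforms_le_iff:
  "\<omega> \<in> lforms_le M r c k \<longleftrightarrow>
    form_on M r (jet_img M r c) k \<omega> \<and> (\<forall>y I. y \<notin> jet_img M r c \<longrightarrow> \<omega> y I = 0)"
proof -
  have "(\<forall>y I. \<omega> y I \<noteq> 0 \<longrightarrow> y \<in> jet_img M r c \<and> I \<subseteq> jidx_le M r k) \<longleftrightarrow>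
      (\<forall>y\<in>jet_img M r c. \<forall>I. \<omega> y I \<noteq> 0 \<longrightarrow> I \<subseteq> jidx_le M r k) \<and>
      (\<forall>y I. y \<notin> jet_img M r c \<longrightarrow> \<omega> y I = 0)" by blast
  then show ?thesis
    unfolding lforms_le_def form_on_def order_fun_def mem_Collect_eq all_conj_distrib by argo
qed

lemma lforms_iff:
  "\<omega> \<in> lforms M r c \<longleftrightarrow>
    (\<exists>k. form_on M r (jet_img M r c) k \<omega> \<and> (\<forall>y I. y \<notin> jet_img M r c \<longrightarrow> \<omega> y I = 0))"
  by (simp add: lforms_def lforms_le_iff)

lemma lformsE:
  assumes "\<omega> \<in> lforms M r c"
  obtains k where "form_on M r (jet_img M r c) k \<omega>" "\<And>y I. y \<notin> jet_img M r c \<Longrightarrow> \<omega> y I = 0"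
  using assms unfolding lforms_iff by blast

lemma lforms_restrict:
  assumes "open_in (jidx M r) (jet_img M r c)" "form_on M r (jet_img M r c) k \<omega>"
  shows "restrict_form (jet_img M r c) \<omega> \<in> lforms M r c"
proof -
  have "form_on M r (jet_img M r c) k (restrict_form (jet_img M r c) \<omega>)"
    by (rule form_on_cong[OF assms]) (simp add: restrict_form_def)
  then show ?thesis unfolding lforms_iff by (auto simp: restrict_form_def zero_fun_def)
qed

lemma lforms_fwedge:
  assumes W: "open_in (jidx M r) (jet_img M r c)" and "\<alpha> \<in> lforms M r c" "\<beta> \<in> lforms M r c"
  shows "fwedge \<alpha> \<beta> \<in> lforms M r c"
proof -
  obtain k l where k: "form_on M r (jet_img M r c) k \<alpha>" "\<And>y I. y \<notin> jet_img M r c \<Longrightarrow> \<alpha> y I = 0"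
    and l: "form_on M r (jet_img M r c) l \<beta>"
    using assms by (metis lformsE)
  have "form_on M r (jet_img M r c) (max k l) (fwedge \<alpha> \<beta>)"
    unfolding fwedge_def[abs_def]
    by (intro form_on_wedge[OF W] form_on_mono[OF _ k(1)] form_on_mono[OF _ l]) auto
  moreover have "fwedge \<alpha> \<beta> y I = 0" if "y \<notin> jet_img M r c" for y I
  proof -
    have "\<alpha> y = (\<lambda>I. 0)" using k(2)[OF that] by auto
    then show ?thesis by (simp add: fwedge_def)
  qed
  ultimately show ?thesis unfolding lforms_iff by auto
qed

lemma sum_fun_apply: "(\<Sum>a\<in>A. f a) y = (\<Sum>a\<in>A. f a y)"
  by (induction A rule: infinite_finite_induct) auto

lemma lforms_sum:
  assumes W: "open_in (jidx M r) (jet_img M r c)" and "\<And>a. a \<in> A \<Longrightarrow> f a \<in> lforms M r c"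
  shows "(\<Sum>a\<in>A. f a) \<in> lforms M r c"
  using assms(2)
proof (induction A rule: infinite_finite_induct)
  case (insert a A)
  obtain k l where k: "form_on M r (jet_img M r c) k (f a)" "\<And>y I. y \<notin> jet_img M r c \<Longrightarrow> f a y I = 0"
    and l: "form_on M r (jet_img M r c) l (\<Sum>a\<in>A. f a)" "\<And>y I. y \<notin> jet_img M r c \<Longrightarrow> (\<Sum>a\<in>A. f a) y I = 0"
    using insert lformsE[of "f a" M r c] lformsE[of "\<Sum>a\<in>A. f a" M r c] by (metis insertI1 insertI2)
  have "form_on M r (jet_img M r c) (max k l) (\<lambda>y I. f a y I + (\<Sum>a\<in>A. f a) y I)"
    by (intro form_on_add[OF W] form_on_mono[OF _ k(1)] form_on_mono[OF _ l(1)]) auto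
  moreover have "(\<Sum>a\<in>insert a A. f a) = (\<lambda>y I. f a y I + (\<Sum>a\<in>A. f a) y I)"
    using insert.hyps by (simp add: fun_eq_iff)
  ultimately show ?case unfolding lforms_iff using k(2) l(2) by auto
qed (auto simp: lforms_iff zero_fun_def intro!: form_on_zero[OF W])

lemma to_cartan_zero: "(\<And>I. \<omega> y I = 0) \<Longrightarrow> to_cartan r \<omega> y = (\<lambda>I. 0)"
proof -
  assume "\<And>I. \<omega> y I = 0"
  then have "\<omega> y = (\<lambda>I. 0)" by auto
  then show ?thesis by (simp add: to_cartan_frame)
qed

lemma lforms_fin_supp: "\<omega> \<in> lforms M r c \<Longrightarrow> fin_supp (\<omega> y)"
proof (cases "y \<in> jet_img M r c")
  case False
  moreover assume "\<omega> \<in> lforms M r c"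
  ultimately have "\<omega> y = (\<lambda>I. 0)" by (auto elim: lformsE)
  then show ?thesis by simp
qed (auto elim!: lformsE intro: form_on_fin_supp)

text \<open>The counterpart of \<open>cartan_power\<close> that counts factors instead of generating
  products. Degrees can be read off from it, and \<open>cartan_power_eq\<close> shows that the two
  agree.\<close>

definition cartan_ge :: "'a mfd \<Rightarrow> nat \<Rightarrow> 'a chart \<Rightarrow> nat \<Rightarrow> lform set" where
  "cartan_ge M r c k = {\<omega> \<in> lforms M r c. \<forall>y I. to_cartan r \<omega> y I \<noteq> 0 \<longrightarrow> k \<le> card (I \<inter> xidx M r)}"

lemma cartan_ge_fwedge:
  assumes W: "open_in (jidx M r) (jet_img M r c)" and \<alpha>: "\<alpha> \<in> cartan_ge M r c k" and \<beta>: "\<beta> \<in> cartan_ge M r c l"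
  shows "fwedge \<alpha> \<beta> \<in> cartan_ge M r c (k + l)"
proof -
  have fs: "fin_supp (\<alpha> y)" "fin_supp (\<beta> y)" for y using \<alpha> \<beta> by (auto simp: cartan_ge_def intro: lforms_fin_supp)
  have "k + l \<le> card (I \<inter> xidx M r)" if nz: "to_cartan r (fwedge \<alpha> \<beta>) y I \<noteq> 0" for y I
  proof -
    have "wedge (to_cartan r \<alpha> y) (to_cartan r \<beta> y) I \<noteq> 0"
      using nz to_cartan_wedge[OF fs] by (simp add: fwedge_def[abs_def])
    then obtain K where K: "finite I" "K \<subseteq> I" "to_cartan r \<alpha> y K \<noteq> 0" "to_cartan r \<beta> y (I - K) \<noteq> 0"
      using wedge_nonzeroD by blast
    then have "k \<le> card (K \<inter> xidx M r)" "l \<le> card ((I - K) \<inter> xidx M r)"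
      using \<alpha> \<beta> by (auto simp: cartan_ge_def)
    moreover have "card (K \<inter> xidx M r) + card ((I - K) \<inter> xidx M r) = card (I \<inter> xidx M r)"
    proof -
      have "I \<inter> xidx M r = (K \<inter> xidx M r) \<union> ((I - K) \<inter> xidx M r)" using K(2) by auto
      moreover have "finite K" using K finite_subset by blast
      ultimately show ?thesis using K(1) by (simp add: card_Un_disjoint[symmetric] Int_Diff disjoint_iff)
    qed
    ultimately show ?thesis by simp
  qed
  then show ?thesis using lforms_fwedge[OF W] \<alpha> \<beta> by (auto simp: cartan_ge_def)
qed

lemma cartan_ge_sum:
  assumes W: "open_in (jidx M r) (jet_img M r c)" and f: "\<And>a. a \<in> A \<Longrightarrow> f a \<in> cartan_ge M r c k"
  shows "(\<Sum>a\<in>A. f a) \<in> cartan_ge M r c k"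
proof -
  have "k \<le> card (I \<inter> xidx M r)" if nz: "to_cartan r (\<Sum>a\<in>A. f a) y I \<noteq> 0" for y I
  proof -
    have fs: "fin_supp (f a y)" if "a \<in> A" for a using f[OF that] by (auto simp: cartan_ge_def intro: lforms_fin_supp)
    have "(\<Sum>a\<in>A. f a) y = (\<lambda>I. \<Sum>a\<in>A. f a y I)" by (simp add: sum_fun_apply fun_eq_iff)
    then have "to_cartan r (\<Sum>a\<in>A. f a) y = (\<lambda>I. \<Sum>a\<in>A. to_cartan r (f a) y I)"
      unfolding to_cartan_frame by (simp add: gsubst_setsum fs)
    then obtain a where "a \<in> A" "to_cartan r (f a) y I \<noteq> 0"
      using nz by (metis (no_types, lifting) sum.neutral)
    then show ?thesis using f by (auto simp: cartan_ge_def)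
  qed
  then show ?thesis using lforms_sum[OF W, of A f] f by (auto simp: cartan_ge_def)
qed

lemma cartan_form_frame:
  assumes "j \<in> xidx M r"
  shows "cartan_form M r c j = restrict_form (jet_img M r c) (\<lambda>y. from_frame r y j)"
proof -
  obtain a \<sigma> where "j = Xc a \<sigma>" using assms by (cases j) auto
  then show ?thesis by (simp add: cartan_form_def frame_Xc)
qed

lemma lforms_gone:
  assumes W: "open_in (jidx M r) (jet_img M r c)"
  shows "restrict_form (jet_img M r c) (\<lambda>y. gone) \<in> lforms M r c"
  by (rule lforms_restrict[OF W form_on_gone[OF W]])

lemma cartan_form_ge:
  assumes W: "open_in (jidx M r) (jet_img M r c)" and j: "j \<in> xidx M r"
  shows "cartan_form M r c j \<in> cartan_ge M r c 1"
proof -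
  obtain k where "j \<in> jidx_le M r k" using jidx_finite_order[OF xidx_jidx[OF j]] by blast
  then have "cartan_form M r c j \<in> lforms M r c"
    unfolding cartan_form_frame[OF j] by (rule lforms_restrict[OF W form_on_frame(2)[OF W]])
  moreover have "1 \<le> card (I \<inter> xidx M r)" if nz: "to_cartan r (cartan_form M r c j) y I \<noteq> 0" for y I
  proof -
    have "y \<in> jet_img M r c"
      by (rule ccontr) (use nz to_cartan_zero[of "cartan_form M r c j" y r]
          in \<open>simp add: cartan_form_frame[OF j] restrict_form_def\<close>)
    then have "to_cartan r (cartan_form M r c j) y = gen j"
      by (simp add: to_cartan_frame cartan_form_frame[OF j] restrict_form_def to_frame_from_frame)
    then have "I = {j}" using nz by (auto simp: gen_def split: if_splits)
    then show ?thesis using j by simp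
  qed
  ultimately show ?thesis by (simp add: cartan_ge_def)
qed

lemma cartan_ideal_ge:
  assumes W: "open_in (jidx M r) (jet_img M r c)"
  shows "cartan_ideal M r c \<subseteq> cartan_ge M r c 1"
proof
  fix \<omega> assume "\<omega> \<in> cartan_ideal M r c"
  then obtain n :: nat and \<alpha> j \<beta> where \<omega>: "\<omega> = (\<Sum>l<n. fwedge (fwedge (\<alpha> l) (cartan_form M r c (j l))) (\<beta> l))"
    "\<forall>l<n. \<alpha> l \<in> lforms M r c \<and> j l \<in> xidx M r \<and> \<beta> l \<in> lforms M r c"
    unfolding cartan_ideal_def by blast
  have l0: "\<alpha> \<in> cartan_ge M r c 0" if "\<alpha> \<in> lforms M r c" for \<alpha> using that by (simp add: cartan_ge_def)
  have "fwedge (fwedge (\<alpha> l) (cartan_form M r c (j l))) (\<beta> l) \<in> cartan_ge M r c 1" if "l < n" for l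
    using cartan_ge_fwedge[OF W cartan_ge_fwedge[OF W l0 cartan_form_ge[OF W]] l0, of "\<alpha> l" "j l" "\<beta> l"] \<omega>(2) that
    by simp
  then show "\<omega> \<in> cartan_ge M r c 1" unfolding \<omega>(1) by (intro cartan_ge_sum[OF W]) auto
qed

lemma gprod_append1:
  assumes "\<And>I. \<theta> j I \<noteq> 0 \<Longrightarrow> finite I"
  shows "gprod \<theta> (l @ [j]) = wedge (gprod \<theta> l) (\<theta> j)"
  using assms by (induction l) (simp_all add: wedge_gone wedge_gone_right wedge_assoc)

lemma gsubst_gprod_hom:
  assumes "\<And>g. deg1 (\<theta> g)" "\<And>g. fin_supp (\<theta> g)" "\<And>g. fin_supp (\<eta> g)"
  shows "gsubst \<theta> (gprod \<eta> l) = gprod (\<lambda>g. gsubst \<theta> (\<eta> g)) l"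
  by (induction l) (simp_all add: gsubst_gone gsubst_wedge assms fin_supp_gprod)

text \<open>One inclusion holds because the number of factors \<Gamma> is additive under products.
  For the other, the form is expanded in products of \<open>dt\<close> and \<Gamma>; from each term
  the last factor, a Cartan form, is split off as an element of the ideal, and the rest has one
  \<Gamma> less.\<close>

lemma cartan_power_eq:
  assumes W: "open_in (jidx M r) (jet_img M r c)"
  shows "cartan_power M r c k = cartan_ge M r c k"
proof (induction k)
  case 0
  show ?case by (simp add: cartan_ge_def)
next
  case (Suc k)
  let ?W = "jet_img M r c" and ?X = "xidx M r"
  show ?case
  proof
    show "cartan_power M r c (Suc k) \<subseteq> cartan_ge M r c (Suc k)"
    proof
      fix \<omega> assume "\<omega> \<in> cartan_power M r c (Suc k)"
      then obtain n :: nat and \<alpha> \<beta> where \<omega>: "\<omega> = (\<Sum>l<n. fwedge (\<alpha> l) (\<beta> l))"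
        "\<forall>l<n. \<alpha> l \<in> cartan_ge M r c k \<and> \<beta> l \<in> cartan_ideal M r c"
        unfolding cartan_power.simps Suc ideal_prod_def by blast
      have "fwedge (\<alpha> l) (\<beta> l) \<in> cartan_ge M r c (Suc k)" if "l < n" for l
        using cartan_ge_fwedge[OF W, of "\<alpha> l" k "\<beta> l" 1] \<omega>(2) that cartan_ideal_ge[OF W] by auto
      then show "\<omega> \<in> cartan_ge M r c (Suc k)" unfolding \<omega>(1) by (intro cartan_ge_sum[OF W]) auto
    qed
    show "cartan_ge M r c (Suc k) \<subseteq> cartan_power M r c (Suc k)"
    proof
      fix \<omega> assume \<omega>: "\<omega> \<in> cartan_ge M r c (Suc k)"
      then obtain m where m: "form_on M r ?W m \<omega>" "\<And>y I. y \<notin> ?W \<Longrightarrow> \<omega> y I = 0"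
        by (auto simp: cartan_ge_def elim: lformsE)
      define \<eta> where "\<eta> = to_cartan r \<omega>"
      define A where "A = jidx_le M r (Suc m)"
      have \<eta>: "form_on M r ?W (Suc m) \<eta>" unfolding \<eta>_def by (rule form_on_cartan(1)[OF W m(1)])
      have \<eta>': "form_on M r ?W (Suc (Suc m)) \<eta>" by (rule form_on_mono[OF _ \<eta>]) simp
      have A: "finite A" by (simp add: A_def finite_jidx_le)
      define KK where "KK = {K \<in> Pow A. Suc k \<le> card (K \<inter> ?X)}"
      have KK: "finite KK" using A by (simp add: KK_def)
      have KKf: "finite K" if "K \<in> KK" for K using that A finite_subset by (auto simp: KK_def)
      \<comment> \<open>In the order on \<open>jcoord\<close> every \<open>Xc\<close> lies above
        every \<open>Tc\<close>, so the greatest generator of a term containing a \<Gamma> is itself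
        a \<Gamma>. Standing last, it splits off without a sign.\<close>
      define h where "h K = Max K" for K :: "jcoord set"
      define l where "l K = sorted_list_of_set (K - {Max K})" for K :: "jcoord set"
      define \<alpha> where "\<alpha> K = restrict_form ?W (\<lambda>y I. \<eta> y K * gprod (from_frame r y) (l K) I)" for K
      have sl: "sorted_list_of_set K = l K @ [h K]" and hX: "h K \<in> ?X" and hK: "h K \<in> K" if K: "K \<in> KK" for K
      proof -
        have ne: "K \<noteq> {}" "K \<inter> ?X \<noteq> {}" using K by (auto simp: KK_def)
        show hK: "h K \<in> K" using KKf[OF K] ne by (simp add: h_def)
        obtain x where x: "x \<in> K" "x \<in> ?X" using ne by auto
        have "x \<le> h K" using KKf[OF K] x(1) by (simp add: h_def)
        moreover have "h K \<in> jidx M r" using hK K jidx_le_subset[of M r "Suc m"] by (auto simp: KK_def A_def)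
        ultimately show "h K \<in> ?X" using x(2) by (cases x; cases "h K") auto
        have "sorted (l K @ [h K])" "distinct (l K @ [h K])" "set (l K @ [h K]) = K"
          using KKf[OF K] hK by (auto simp: l_def h_def sorted_append)
        then show "sorted_list_of_set K = l K @ [h K]"
          by (metis sorted_list_of_set.idem_if_sorted_distinct)
      qed
      have \<alpha>: "\<alpha> K \<in> cartan_power M r c k" if K: "K \<in> KK" for K
      proof -
        have lK: "set (l K) = K - {h K}" using KKf[OF K] by (simp add: l_def h_def)
        have "form_on M r ?W (Suc (Suc m)) (\<lambda>y I. \<eta> y K * gprod (from_frame r y) (l K) I)"
          using lK K by (intro form_on_mult[OF W] form_on_coeff[OF \<eta>'] form_on_gprod[OF W] form_on_frame(2)[OF W])
            (auto simp: KK_def A_def)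
        then have "\<alpha> K \<in> lforms M r c" unfolding \<alpha>_def by (rule lforms_restrict[OF W])
        moreover have "k \<le> card (I \<inter> ?X)" if nz: "to_cartan r (\<alpha> K) y I \<noteq> 0" for y I
        proof -
          have y: "y \<in> ?W"
            by (rule ccontr) (use nz to_cartan_zero[of "\<alpha> K" y r] in \<open>simp add: \<alpha>_def restrict_form_def\<close>)
          have "to_cartan r (\<alpha> K) y = (\<lambda>I. \<eta> y K * gprod gen (l K) I)"
            using y by (simp add: to_cartan_frame \<alpha>_def restrict_form_def gsubst_cmult fin_supp_gprod
                gsubst_gprod_hom to_frame_from_frame)
          then have nz': "gprod gen (l K) I \<noteq> 0" using nz by auto
          have gen_X: "h \<in> ?X \<longleftrightarrow> g \<in> ?X" if "gen g {h} \<noteq> 0" for g h :: jcoord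
            using that by (cases "h = g") (simp_all add: gen_def)
          have "card (I \<inter> ?X) = length (filter (\<lambda>g. g \<in> ?X) (l K))"
            using gprod_nonzeroD[where X = ?X and Y = ?X, OF deg1_gen nz' gen_X] by blast
          also have "\<dots> = card (set (filter (\<lambda>g. g \<in> ?X) (l K)))"
            by (rule distinct_card[symmetric]) (simp add: l_def)
          also have "set (filter (\<lambda>g. g \<in> ?X) (l K)) = (K \<inter> ?X) - {h K}" using lK by auto
          also have "card \<dots> = card (K \<inter> ?X) - 1" using hX[OF K] hK[OF K] by simp
          finally have "card (I \<inter> ?X) = card (K \<inter> ?X) - 1" .
          moreover have "Suc k \<le> card (K \<inter> ?X)" using K by (simp add: KK_def)
          ultimately show ?thesis by linarith
        qed
        ultimately show ?thesis unfolding Suc by (simp add: cartan_ge_def)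
      qed
      \<comment> \<open>The elements of \<open>cartan_ideal\<close> are sums of two-sided multiples,
        so the Cartan form is padded by the unit on both sides.\<close>
      define one where "one = restrict_form ?W (\<lambda>y. gone :: jcoord grass)"
      define \<beta> where "\<beta> K = fwedge (fwedge one (cartan_form M r c (h K))) one" for K
      have \<beta>: "\<beta> K \<in> cartan_ideal M r c" if K: "K \<in> KK" for K
      proof -
        have "\<beta> K = (\<Sum>l<(1::nat). fwedge (fwedge one (cartan_form M r c (h K))) one)"
          by (simp add: \<beta>_def)
        then show ?thesis unfolding cartan_ideal_def
          using hX[OF K] lforms_gone[OF W, folded one_def]
          by (intro CollectI exI[of _ 1] exI[of _ "\<lambda>_. one"] exI[of _ "\<lambda>_. h K"]) simp
      qed
      have sum: "\<omega> = (\<Sum>K\<in>KK. fwedge (\<alpha> K) (\<beta> K))"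
      proof (intro ext)
        fix y I
        show "\<omega> y I = (\<Sum>K\<in>KK. fwedge (\<alpha> K) (\<beta> K)) y I"
        proof (cases "y \<in> ?W")
          case False
          then show ?thesis by (simp add: sum_fun_apply m(2) \<alpha>_def fwedge_def restrict_form_def zero_fun_def)
        next
          case True
          have "\<omega> y = gsubst (from_frame r y) (\<eta> y)"
            using from_cartan_to_cartan[of \<omega> y r] form_on_fin_supp[OF m(1) True] by (simp add: \<eta>_def from_cartan_frame)
          also have "\<dots> = (\<lambda>I. \<Sum>K\<in>KK. \<eta> y K * gprod (from_frame r y) (sorted_list_of_set K) I)"
          proof (rule gsubst_sum[OF KK])
            show "{K. \<eta> y K \<noteq> 0} \<subseteq> KK"
              using form_on_support[OF \<eta> True] \<omega> by (auto simp: KK_def A_def \<eta>_def cartan_ge_def)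
          qed
          also have "\<dots> = (\<lambda>I. \<Sum>K\<in>KK. fwedge (\<alpha> K) (\<beta> K) y I)"
          proof (intro ext sum.cong refl)
            fix I K assume K: "K \<in> KK"
            have "\<beta> K y = from_frame r y (h K)"
              using True deg1_finite[OF deg1_frame(2)]
              by (simp add: \<beta>_def fwedge_def one_def restrict_form_def cartan_form_frame[OF hX[OF K]]
                  wedge_gone wedge_gone_right)
            then show "\<eta> y K * gprod (from_frame r y) (sorted_list_of_set K) I = fwedge (\<alpha> K) (\<beta> K) y I"
              using True deg1_finite[OF deg1_frame(2)]
              by (simp add: sl[OF K] gprod_append1 fwedge_def \<alpha>_def restrict_form_def wedge_cmult_left)
          qed
          finally show ?thesis by (simp add: sum_fun_apply)
        qed
      qed
      \<comment> \<open>\<open>ideal_prod\<close> sums over an initial segment of the natural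
        numbers, so the terms have to be numbered.\<close>
      obtain f where f: "bij_betw f {0..<card KK} KK" using ex_bij_betw_nat_finite[OF KK] by blast
      have "\<omega> = (\<Sum>n<card KK. fwedge (\<alpha> (f n)) (\<beta> (f n)))"
        unfolding sum lessThan_atLeast0 by (rule sum.reindex_bij_betw[OF f, symmetric])
      moreover have "\<forall>n<card KK. \<alpha> (f n) \<in> cartan_power M r c k \<and> \<beta> (f n) \<in> cartan_ideal M r c"
      proof -
        have "f n \<in> KK" if "n < card KK" for n using bij_betwE[OF f] that by simp
        then show ?thesis using \<alpha> \<beta> by simp
      qed
      ultimately show "\<omega> \<in> cartan_power M r c (Suc k)"
        unfolding cartan_power.simps ideal_prod_def
        by (intro CollectI exI[of _ "card KK"] exI[of _ "\<lambda>n. \<alpha> (f n)"] exI[of _ "\<lambda>n. \<beta> (f n)"] conjI)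
    qed
  qed
qed

section \<open>Differential forms on the jet space\<close>

lemma chartwise_apply: "c \<in> matlas M \<Longrightarrow> y \<in> jet_img M r c \<Longrightarrow> chartwise M r \<zeta> c y = \<zeta> c y"
  by (simp add: chartwise_def restrict_form_def)

lemma chartwise_zero: "c \<notin> matlas M \<or> y \<notin> jet_img M r c \<Longrightarrow> chartwise M r \<zeta> c y = (\<lambda>I. 0)"
  by (auto simp: chartwise_def restrict_form_def zero_fun_def)

lemma chartwise_eqI:
  "(\<And>c y. c \<in> matlas M \<Longrightarrow> y \<in> jet_img M r c \<Longrightarrow> \<zeta> c y = \<xi> c y) \<Longrightarrow> chartwise M r \<zeta> = chartwise M r \<xi>"
  by (auto simp: chartwise_def restrict_form_def fun_eq_iff)

locale jet_space =
  fixes M :: "'a mfd"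
  assumes sm: "smooth_manifold M"
begin

lemma open_img: "c \<in> matlas M \<Longrightarrow> open_in (jidx M r) (jet_img M r c)"
  by (rule open_in_jet_img[OF sm])

lemma jet_trans_jet_img:
  "c \<in> matlas M \<Longrightarrow> c' \<in> matlas M \<Longrightarrow> y \<in> overlap M r c c' \<Longrightarrow> jet_trans M r c c' y \<in> jet_img M r c'"
  using jet_trans_eq(1)[OF sm] overlap_subset_jet_img[OF sm] by blast

lemma formsI:
  assumes "\<And>c. c \<in> matlas M \<Longrightarrow> form_on M r (jet_img M r c) k (\<zeta> c)"
    and "\<And>c c' y. c \<in> matlas M \<Longrightarrow> c' \<in> matlas M \<Longrightarrow> y \<in> overlap M r c c' \<Longrightarrow>
      \<zeta> c y = pullback (jidx M r) (jet_trans M r c c') (\<zeta> c') y"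
  shows "chartwise M r \<zeta> \<in> forms M r"
proof -
  have le: "chartwise M r \<zeta> c \<in> lforms_le M r c k" if c: "c \<in> matlas M" for c
    unfolding lforms_le_iff
  proof (intro conjI allI impI)
    show "form_on M r (jet_img M r c) k (chartwise M r \<zeta> c)"
      by (rule form_on_cong[OF open_img[OF c] assms(1)[OF c]]) (simp add: chartwise_apply c)
  qed (simp add: chartwise_zero)
  have trans: "chartwise M r \<zeta> c y = pullback (jidx M r) (jet_trans M r c c') (chartwise M r \<zeta> c') y"
    if "c \<in> matlas M" "c' \<in> matlas M" "y \<in> overlap M r c c'" for c c' y
  proof -
    have "y \<in> jet_img M r c" using that overlap_subset_jet_img[OF sm] by blast
    then show ?thesis
      using assms(2)[OF that] jet_trans_jet_img[OF that] that by (simp add: chartwise_apply pullback_def)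
  qed
  show ?thesis unfolding forms_def mem_Collect_eq
  proof (intro conjI exI[of _ k] ballI allI impI)
    show "chartwise M r \<zeta> c = 0" if "c \<notin> matlas M" for c using that by (simp add: chartwise_def)
    show "chartwise M r \<zeta> c y = pullback (jidx M r) (jet_trans M r c c') (chartwise M r \<zeta> c') y"
      if "c \<in> matlas M" "c' \<in> matlas M" "y \<in> jet_coords M r c ` (jet_dom M r c \<inter> jet_dom M r c')" for c c' y
      using that jet_dom_Int_image[OF sm, of c c' r] by (intro trans) auto
  qed (rule le)
qed

lemma formsE:
  assumes "\<omega> \<in> forms M r"
  obtains k where "\<And>c. c \<in> matlas M \<Longrightarrow> form_on M r (jet_img M r c) k (\<omega> c)"
    "\<And>c y. c \<notin> matlas M \<or> y \<notin> jet_img M r c \<Longrightarrow> \<omega> c y = (\<lambda>I. 0)"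
    "\<And>c c' y. c \<in> matlas M \<Longrightarrow> c' \<in> matlas M \<Longrightarrow> y \<in> overlap M r c c' \<Longrightarrow>
      \<omega> c y = pullback (jidx M r) (jet_trans M r c c') (\<omega> c') y"
proof -
  obtain k where k: "\<forall>c\<in>matlas M. \<omega> c \<in> lforms_le M r c k"
    and z: "\<forall>c. c \<notin> matlas M \<longrightarrow> \<omega> c = 0"
    and t: "\<forall>c\<in>matlas M. \<forall>c'\<in>matlas M. \<forall>y \<in> jet_coords M r c ` (jet_dom M r c \<inter> jet_dom M r c').
      \<omega> c y = pullback (jidx M r) (jet_trans M r c c') (\<omega> c') y"
    using assms unfolding forms_def by blast
  show thesis
  proof (rule that)
    show "form_on M r (jet_img M r c) k (\<omega> c)" if "c \<in> matlas M" for c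
      using k that by (simp add: lforms_le_iff)
    show "\<omega> c y = (\<lambda>I. 0)" if "c \<notin> matlas M \<or> y \<notin> jet_img M r c" for c y
    proof (cases "c \<in> matlas M")
      case True
      then show ?thesis using k that by (auto simp: lforms_le_iff)
    next
      case False
      then have "\<omega> c = 0" using z by blast
      then show ?thesis by (simp add: zero_fun_def)
    qed
    show "\<omega> c y = pullback (jidx M r) (jet_trans M r c c') (\<omega> c') y"
      if "c \<in> matlas M" "c' \<in> matlas M" "y \<in> overlap M r c c'" for c c' y
      using t that by (simp add: jet_dom_Int_image[OF sm])
  qed
qed

lemma forms_fin_supp: "\<omega> \<in> forms M r \<Longrightarrow> fin_supp (\<omega> c y)"
proof (cases "c \<in> matlas M \<and> y \<in> jet_img M r c")
  case True
  moreover assume "\<omega> \<in> forms M r"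
  ultimately show ?thesis by (meson formsE form_on_fin_supp)
next
  case False
  moreover assume "\<omega> \<in> forms M r"
  ultimately have "\<omega> c y = (\<lambda>I. 0)" by (meson formsE)
  then show ?thesis by simp
qed

lemma forms_zero: "\<omega> \<in> forms M r \<Longrightarrow> c \<notin> matlas M \<or> y \<notin> jet_img M r c \<Longrightarrow> \<omega> c y = (\<lambda>I. 0)"
  by (meson formsE)

lemma forms_eqI:
  assumes "\<omega> \<in> forms M r" "\<eta> \<in> forms M r"
    and "\<And>c y. c \<in> matlas M \<Longrightarrow> y \<in> jet_img M r c \<Longrightarrow> \<omega> c y = \<eta> c y"
  shows "\<omega> = \<eta>"
proof (intro ext)
  fix c y I
  show "\<omega> c y I = \<eta> c y I"
    by (cases "c \<in> matlas M \<and> y \<in> jet_img M r c") (use assms forms_zero in auto)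
qed

lemma forms_cartan_eqI:
  assumes "\<omega> \<in> forms M r" "\<eta> \<in> forms M r"
    and "\<And>c y. c \<in> matlas M \<Longrightarrow> y \<in> jet_img M r c \<Longrightarrow> to_cartan r (\<omega> c) y = to_cartan r (\<eta> c) y"
  shows "\<omega> = \<eta>"
proof (rule forms_eqI[OF assms(1,2)])
  fix c y assume "c \<in> matlas M" "y \<in> jet_img M r c"
  then have "from_cartan r (to_cartan r (\<omega> c)) y = from_cartan r (to_cartan r (\<eta> c)) y"
    using assms(3) by (simp add: from_cartan_frame)
  then show "\<omega> c y = \<eta> c y"
    using from_cartan_to_cartan[of "\<omega> c" y r] from_cartan_to_cartan[of "\<eta> c" y r] forms_fin_supp assms(1,2) by simp
qed

lemma lincomb_apply: "lincomb u \<omega> v \<eta> c y = (\<lambda>I. u * \<omega> c y I + v * \<eta> c y I)"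
  by (simp add: lincomb_def fun_eq_iff)

lemma gsubst_lincomb:
  "fin_supp \<alpha> \<Longrightarrow> fin_supp \<beta> \<Longrightarrow>
    gsubst \<theta> (\<lambda>I. u * \<alpha> I + v * \<beta> I) = (\<lambda>I. u * gsubst \<theta> \<alpha> I + v * gsubst \<theta> \<beta> I)"
  by (simp add: gsubst_add gsubst_cmult fin_supp_cmult)

lemma forms_lincomb:
  assumes "\<omega> \<in> forms M r" "\<eta> \<in> forms M r"
  shows "lincomb u \<omega> v \<eta> \<in> forms M r"
proof -
  obtain k where k: "\<And>c. c \<in> matlas M \<Longrightarrow> form_on M r (jet_img M r c) k (\<omega> c)"
    "\<And>c y. c \<notin> matlas M \<or> y \<notin> jet_img M r c \<Longrightarrow> \<omega> c y = (\<lambda>I. 0)"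
    "\<And>c c' y. c \<in> matlas M \<Longrightarrow> c' \<in> matlas M \<Longrightarrow> y \<in> overlap M r c c' \<Longrightarrow>
      \<omega> c y = pullback (jidx M r) (jet_trans M r c c') (\<omega> c') y"
    by (rule formsE[OF assms(1)]) blast
  obtain l where l: "\<And>c. c \<in> matlas M \<Longrightarrow> form_on M r (jet_img M r c) l (\<eta> c)"
    "\<And>c y. c \<notin> matlas M \<or> y \<notin> jet_img M r c \<Longrightarrow> \<eta> c y = (\<lambda>I. 0)"
    "\<And>c c' y. c \<in> matlas M \<Longrightarrow> c' \<in> matlas M \<Longrightarrow> y \<in> overlap M r c c' \<Longrightarrow>
      \<eta> c y = pullback (jidx M r) (jet_trans M r c c') (\<eta> c') y"
    by (rule formsE[OF assms(2)]) blast
  have "chartwise M r (lincomb u \<omega> v \<eta>) \<in> forms M r"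
  proof (rule formsI)
    fix c assume c: "c \<in> matlas M"
    show "form_on M r (jet_img M r c) (max k l) (lincomb u \<omega> v \<eta> c)"
      unfolding lincomb_apply[abs_def]
      by (intro form_on_add[OF open_img[OF c]] form_on_cmult[OF open_img[OF c]]
          form_on_mono[OF _ k(1)[OF c]] form_on_mono[OF _ l(1)[OF c]]) auto
  next
    fix c c' y assume "c \<in> matlas M" "c' \<in> matlas M" "y \<in> overlap M r c c'"
    from k(3)[OF this] l(3)[OF this]
    show "lincomb u \<omega> v \<eta> c y = pullback (jidx M r) (jet_trans M r c c') (lincomb u \<omega> v \<eta> c') y"
      by (simp add: lincomb_apply pullback_def gsubst_lincomb forms_fin_supp[OF assms(1)] forms_fin_supp[OF assms(2)])
  qed
  moreover have "chartwise M r (lincomb u \<omega> v \<eta>) = lincomb u \<omega> v \<eta>"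
  proof (intro ext)
    fix c y I
    show "chartwise M r (lincomb u \<omega> v \<eta>) c y I = lincomb u \<omega> v \<eta> c y I"
      by (cases "c \<in> matlas M \<and> y \<in> jet_img M r c")
        (use k(2)[of c y] l(2)[of c y] in \<open>auto simp: chartwise_apply chartwise_zero lincomb_apply\<close>)
  qed
  ultimately show ?thesis by simp
qed

lemma diff_lincomb: "\<omega> - \<eta> = lincomb 1 \<omega> (- 1) (\<eta> :: 'a form)"
  by (simp add: fun_eq_iff lincomb_def)

lemma add_lincomb: "\<omega> + \<eta> = lincomb 1 \<omega> 1 (\<eta> :: 'a form)"
  by (simp add: fun_eq_iff lincomb_def)

lemma zero_in_forms: "0 \<in> forms M r"
proof -
  have "chartwise M r (\<lambda>c y I. 0) \<in> forms M r"
    by (rule formsI[of r 0]) (simp_all add: form_on_zero open_img pullback_def)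
  moreover have "chartwise M r (\<lambda>c y I. 0) = 0"
    by (auto simp: chartwise_def restrict_form_def fun_eq_iff)
  ultimately show ?thesis by simp
qed

lemma to_cartan_lincomb:
  assumes "\<omega> \<in> forms M r'" "\<eta> \<in> forms M r'"
  shows "to_cartan r (lincomb u \<omega> v \<eta> c) y = (\<lambda>I. u * to_cartan r (\<omega> c) y I + v * to_cartan r (\<eta> c) y I)"
  by (simp add: to_cartan_frame lincomb_apply gsubst_lincomb forms_fin_supp[OF assms(1)] forms_fin_supp[OF assms(2)])

subsection \<open>Bihomogeneous components\<close>

definition bideg :: "nat \<Rightarrow> int \<Rightarrow> int \<Rightarrow> jcoord set \<Rightarrow> bool" where
  "bideg r p q I \<longleftrightarrow> int (card (I \<inter> xidx M r)) = p \<and> int (card (I \<inter> tidx r)) = q"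

definition bipart :: "nat \<Rightarrow> int \<Rightarrow> int \<Rightarrow> jcoord grass \<Rightarrow> jcoord grass" where
  "bipart r p q \<alpha> I = (if bideg r p q I then \<alpha> I else 0)"

definition component :: "nat \<Rightarrow> int \<Rightarrow> int \<Rightarrow> 'a form \<Rightarrow> 'a form" where
  "component r p q \<omega> = chartwise M r (\<lambda>c. from_cartan r (\<lambda>y. bipart r p q (to_cartan r (\<omega> c) y)))"

lemma bipart_eq_0: "bipart r p q \<alpha> I = 0 \<longleftrightarrow> \<not> bideg r p q I \<or> \<alpha> I = 0"
  by (simp add: bipart_def)

lemma fin_supp_bipart: "fin_supp \<alpha> \<Longrightarrow> fin_supp (bipart r p q \<alpha>)"
  by (rule fin_supp_subset[of "{K. \<alpha> K \<noteq> 0}"]) (auto simp: fin_supp_def bipart_eq_0)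

lemma form_on_bipart:
  assumes W: "open_in (jidx M r) W" and \<eta>: "form_on M r W k \<eta>"
  shows "form_on M r W k (\<lambda>y. bipart r p q (\<eta> y))"
proof (rule form_onI)
  show "I \<subseteq> jidx_le M r k" if "y \<in> W" "bipart r p q (\<eta> y) I \<noteq> 0" for y I
    using form_on_support[OF \<eta> that(1)] that(2) by (auto simp: bipart_eq_0)
  show "(\<lambda>y. bipart r p q (\<eta> y) I) \<in> order_fun M r W k" for I
    using form_on_coeff[OF \<eta>] order_fun_const[OF W] by (cases "bideg r p q I") (simp_all add: bipart_def)
qed

text \<open>A substitution that sends \<Gamma> to combinations of \<Gamma> and \<open>dt\<close> to
  combinations of \<open>dt\<close> preserves both counts, by
  \<open>gsubst_nonzeroD\<close>.\<close>

lemma gsubst_bipart: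
  assumes \<theta>: "\<And>g. deg1 (\<theta> g)" and "fin_supp \<alpha>" and supp: "\<And>K. \<alpha> K \<noteq> 0 \<Longrightarrow> K \<subseteq> jidx M r"
    and X: "\<And>g h. g \<in> xidx M r \<Longrightarrow> \<theta> g {h} \<noteq> 0 \<Longrightarrow> h \<in> xidx M r"
    and T: "\<And>g h. g \<in> tidx r \<Longrightarrow> \<theta> g {h} \<noteq> 0 \<Longrightarrow> h \<in> tidx r"
  shows "gsubst \<theta> (bipart r p q \<alpha>) = bipart r p q (gsubst \<theta> \<alpha>)"
proof
  fix I
  have homog: "\<exists>K. \<beta> K \<noteq> 0 \<and> (bideg r p q K \<longleftrightarrow> bideg r p q I)"
    if \<beta>: "fin_supp \<beta>" "\<And>K. \<beta> K \<noteq> 0 \<Longrightarrow> K \<subseteq> jidx M r" "gsubst \<theta> \<beta> I \<noteq> 0" for \<beta>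
  proof -
    obtain K where K: "\<beta> K \<noteq> 0"
      "\<forall>X Y. (\<forall>g h. g \<in> K \<longrightarrow> \<theta> g {h} \<noteq> 0 \<longrightarrow> (h \<in> X \<longleftrightarrow> g \<in> Y)) \<longrightarrow> card (I \<inter> X) = card (K \<inter> Y)"
      using gsubst_nonzeroD[OF \<beta>(1) \<theta> \<beta>(3)] by blast
    have gK: "g \<in> xidx M r \<or> g \<in> tidx r" if "g \<in> K" for g
      using \<beta>(2)[OF K(1)] that by (auto simp: jidx_def)
    have "card (I \<inter> xidx M r) = card (K \<inter> xidx M r)"
      using K(2)[rule_format, of "xidx M r" "xidx M r"] gK X T tidx_xidx_disjoint[of r M] by blast
    moreover have "card (I \<inter> tidx r) = card (K \<inter> tidx r)"
      using K(2)[rule_format, of "tidx r" "tidx r"] gK X T tidx_xidx_disjoint[of r M] by blast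
    ultimately show ?thesis using K(1) by (auto simp: bideg_def)
  qed
  show "gsubst \<theta> (bipart r p q \<alpha>) I = bipart r p q (gsubst \<theta> \<alpha>) I"
  proof (cases "bideg r p q I")
    case False
    have "gsubst \<theta> (bipart r p q \<alpha>) I = 0"
    proof (rule ccontr)
      assume nz: "gsubst \<theta> (bipart r p q \<alpha>) I \<noteq> 0"
      have "\<And>K. bipart r p q \<alpha> K \<noteq> 0 \<Longrightarrow> K \<subseteq> jidx M r" using supp by (simp add: bipart_eq_0)
      from homog[OF fin_supp_bipart[OF assms(2)] this nz] False show False by (auto simp: bipart_eq_0)
    qed
    then show ?thesis using False by (simp add: bipart_def)
  next
    case True
    \<comment> \<open>What remains of \<alpha> without its part of bidegree \<open>(p, q)\<close>;
      its image has no coefficient in that bidegree.\<close>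
    let ?\<beta> = "\<lambda>K. \<alpha> K - bipart r p q \<alpha> K"
    have fs: "fin_supp ?\<beta>" by (intro fin_supp_diff fin_supp_bipart assms(2))
    have "gsubst \<theta> ?\<beta> I = 0"
    proof (rule ccontr)
      assume nz: "gsubst \<theta> ?\<beta> I \<noteq> 0"
      have "\<And>K. ?\<beta> K \<noteq> 0 \<Longrightarrow> K \<subseteq> jidx M r" using supp by (auto simp: bipart_def split: if_splits)
      from homog[OF fs this nz] True show False by (auto simp: bipart_def)
    qed
    then show ?thesis
      using gsubst_diff[OF assms(2) fin_supp_bipart[OF assms(2)], of \<theta> r p q] True by (simp add: bipart_def)
  qed
qed

lemma dfun_jet_trans_fin_supp:
  assumes c: "c \<in> matlas M" "c' \<in> matlas M" and y: "y \<in> overlap M r c c'"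
  shows "fin_supp (dfun (jidx M r) (\<lambda>y. jet_trans M r c c' y j) y)"
proof -
  note W = open_in_overlap[OF sm c, of r]
  have "\<exists>k. (\<lambda>y. jet_trans M r c c' y j) \<in> order_fun M r (overlap M r c c') k"
  proof (cases "j \<in> jidx M r")
    case True
    then show ?thesis using jidx_finite_order jet_trans_order_fun[OF sm c] by blast
  next
    case False
    then have "(\<lambda>y. jet_trans M r c c' y j) \<in> order_fun M r (overlap M r c c') 0"
      using jet_trans_eq(4)[OF sm c] by (intro order_fun_cong[OF W order_fun_const[OF W]]) auto
    then show ?thesis by blast
  qed
  then show ?thesis using form_on_fin_supp[OF form_on_dfun[OF W] y] by blast
qed

text \<open>
  \<open>\<Lambda>\<close> is the pullback of the generator \<open>j\<close> along the coordinate change, both sides being written in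
  the variables \<open>dt, \<Gamma>\<close>.  That \<open>\<Gamma>\<close> yields no \<open>dt\<close>-terms is the contact property.
\<close>

lemma jet_trans_frame:
  assumes c: "c \<in> matlas M" "c' \<in> matlas M" and y: "y \<in> overlap M r c c'" and j: "j \<in> jidx_le M r k"
  defines "\<Lambda> \<equiv> gsubst (to_frame r y) (gsubst (\<lambda>j. dfun (jidx M r) (\<lambda>y. jet_trans M r c c' y j) y)
      (from_frame r (jet_trans M r c c' y) j))"
  shows "j \<in> tidx r \<Longrightarrow> \<Lambda> = gen j"
    and "j \<in> xidx M r \<Longrightarrow> \<Lambda> = (\<lambda>I. \<Sum>l\<in>jidx_le M r k \<inter> xidx M r. pd l (\<lambda>y. jet_trans M r c c' y j) y * gen l I)"
proof -
  let ?W = "overlap M r c c'" and ?T = "jet_trans M r c c'" and ?B = "jidx_le M r k \<inter> xidx M r"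
  let ?d = "\<lambda>j. dfun (jidx M r) (\<lambda>y. ?T y j) y"
  note W = open_in_overlap[OF sm c, of r]
  have dT: "?d (Tc i) = gen (Tc i)" if i: "i < r" for i
  proof
    fix I
    have "pd l (\<lambda>y. ?T y (Tc i)) y = (if l = Tc i then 1 else 0)" if "l \<in> jidx M r" for l
      using pd_cong[OF W y that, of "\<lambda>y. ?T y (Tc i)" "\<lambda>y. y (Tc i)"] jet_trans_eq(2)[OF sm c _ i]
      by (simp add: pd_coord)
    then show "?d (Tc i) I = gen (Tc i) I"
    proof (cases "is_singleton I")
      case True
      then obtain l where "I = {l}" by (auto simp: is_singleton_def)
      then show ?thesis using i \<open>\<And>l. l \<in> jidx M r \<Longrightarrow> _\<close>[of l]
        by (cases "l = Tc i"; cases "l \<in> jidx M r") (auto simp: dfun_def gen_def)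
    qed (auto simp: dfun_def gen_def)
  qed
  show "\<Lambda> = gen j" if "j \<in> tidx r"
  proof -
    obtain i where "j = Tc i" "i < r" using \<open>j \<in> tidx r\<close> by (auto simp: tidx_def)
    then show ?thesis unfolding \<Lambda>_def by (simp add: gsubst_gen deg1_finite[OF deg1_dfun] deg1_finite[OF deg1_gen] dT deg1_finite[OF deg1_frame(1)])
  qed
  assume jx: "j \<in> xidx M r"
  then obtain a \<sigma> where a: "j = Xc a \<sigma>" by (cases j) auto
  let ?t = "\<lambda>y. ?T y j"
  have t: "?t \<in> order_fun M r ?W k" by (rule jet_trans_order_fun[OF sm c j])
  have B: "jidx M r \<inter> jidx_le M r k = tidx r \<union> ?B" "finite ?B" "tidx r \<inter> ?B = {}"
    using finite_jidx_le[of M r k] by (auto simp: jidx_def jidx_le_def tidx_def xidx_def)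
  have Ti: "tidx r = Tc ` {..<r}" "finite (tidx r)" by (auto simp: tidx_def)
  have dj: "?d j = (\<lambda>I. (\<Sum>i<r. pd (Tc i) ?t y * gen (Tc i) I) + (\<Sum>l\<in>?B. pd l ?t y * gen l I))"
    unfolding dfun_eq[OF W t y order_refl] B(1)
    using B Ti by (simp add: sum.union_disjoint sum.reindex inj_on_def)
  have "gsubst ?d (from_frame r (?T y) j) = (\<lambda>I. ?d j I - (\<Sum>i<r. ?T y (raise i j) * ?d (Tc i) I))"
    unfolding a frame_Xc(2)
    by (simp only: gsubst_diff fin_supp_gen fin_supp_sum fin_supp_cmult gsubst_linear deg1_dfun
        gsubst_gen deg1_finite[OF deg1_dfun])
  also have "\<dots> = (\<lambda>I. (\<Sum>i<r. (pd (Tc i) ?t y - ?T y (raise i j)) * gen (Tc i) I) + (\<Sum>l\<in>?B. pd l ?t y * gen l I))"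
    unfolding dj by (auto simp: dT sum_subtractf left_diff_distrib intro!: ext)
  finally have "\<Lambda> = (\<lambda>I. (\<Sum>i<r. (pd (Tc i) ?t y - ?T y (raise i j)) * gen (Tc i) I) + (\<Sum>l\<in>?B. pd l ?t y * to_frame r y l I))"
    unfolding \<Lambda>_def by (simp add: gsubst_add gsubst_linear fin_supp_sum fin_supp_cmult)
  also have "\<dots> = (\<lambda>I. \<Sum>l\<in>?B. pd l ?t y * gen l I)"
  proof
    fix I
    have "(\<Sum>l\<in>?B. pd l ?t y * to_frame r y l I) =
        (\<Sum>l\<in>?B. pd l ?t y * gen l I + (\<Sum>i<r. y (raise i l) * pd l ?t y * gen (Tc i) I))"
    proof (rule sum.cong[OF refl])
      fix l assume "l \<in> ?B"
      then obtain b \<tau> where "l = Xc b \<tau>" by (cases l) auto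
      then show "pd l ?t y * to_frame r y l I = pd l ?t y * gen l I + (\<Sum>i<r. y (raise i l) * pd l ?t y * gen (Tc i) I)"
        by (simp add: frame_Xc distrib_left sum_distrib_left ac_simps)
    qed
    also have "\<dots> = (\<Sum>l\<in>?B. pd l ?t y * gen l I) + (\<Sum>i<r. (\<Sum>l\<in>?B. y (raise i l) * pd l ?t y) * gen (Tc i) I)"
      unfolding sum.distrib sum_distrib_right by (subst sum.swap) simp
    finally have e: "(\<Sum>l\<in>?B. pd l ?t y * to_frame r y l I) = \<dots>" .
    have "(\<Sum>i<r. (pd (Tc i) ?t y - ?T y (raise i j)) * gen (Tc i) I)
        + (\<Sum>i<r. (\<Sum>l\<in>?B. y (raise i l) * pd l ?t y) * gen (Tc i) I) = 0"
      unfolding sum.distrib[symmetric]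
    proof (rule sum.neutral, rule ballI)
      fix i assume "i \<in> {..<r}"
      then have i: "i < r" by simp
      have "pd (Tc i) ?t y + (\<Sum>l\<in>?B. y (raise i l) * pd l ?t y) = ?T y (raise i j)"
        using jet_trans_contact[OF sm c y jx i] total_deriv_eq[OF W t y i] by simp
      then have z: "(pd (Tc i) ?t y - ?T y (raise i j)) + (\<Sum>l\<in>?B. y (raise i l) * pd l ?t y) = 0" by simp
      show "(pd (Tc i) ?t y - ?T y (raise i j)) * gen (Tc i) I
          + (\<Sum>l\<in>?B. y (raise i l) * pd l ?t y) * gen (Tc i) I = 0"
        unfolding distrib_right[symmetric] z by simp
    qed
    then show "(\<Sum>i<r. (pd (Tc i) ?t y - ?T y (raise i j)) * gen (Tc i) I) + (\<Sum>l\<in>?B. pd l ?t y * to_frame r y l I)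
        = (\<Sum>l\<in>?B. pd l ?t y * gen l I)"
      unfolding e by linarith
  qed
  finally show "\<Lambda> = (\<lambda>I. \<Sum>l\<in>?B. pd l ?t y * gen l I)" .
qed

text \<open>Read in the variables \<open>dt\<close> and \<Gamma> of both charts, the coordinate
  change is the substitution \<open>?\<Lambda>\<close>. By \<open>jet_trans_frame\<close> it
  preserves the type of each generator and so commutes with taking a bihomogeneous part.\<close>

lemma component_compat:
  assumes \<omega>: "\<omega> \<in> forms M r" and c: "c \<in> matlas M" "c' \<in> matlas M" and y: "y \<in> overlap M r c c'"
  shows "from_cartan r (\<lambda>y. bipart r p q (to_cartan r (\<omega> c) y)) y =
    pullback (jidx M r) (jet_trans M r c c') (from_cartan r (\<lambda>y. bipart r p q (to_cartan r (\<omega> c') y))) y"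
proof -
  let ?T = "jet_trans M r c c'"
  let ?d = "\<lambda>j. dfun (jidx M r) (\<lambda>y. ?T y j) y"
  let ?\<Lambda> = "\<lambda>j. gsubst (to_frame r y) (gsubst ?d (from_frame r (?T y) j))"
  define \<alpha> where "\<alpha> = to_cartan r (\<omega> c') (?T y)"
  obtain k where k: "\<And>c. c \<in> matlas M \<Longrightarrow> form_on M r (jet_img M r c) k (\<omega> c)"
    "\<And>c c' y. c \<in> matlas M \<Longrightarrow> c' \<in> matlas M \<Longrightarrow> y \<in> overlap M r c c' \<Longrightarrow>
      \<omega> c y = pullback (jidx M r) (jet_trans M r c c') (\<omega> c') y"
    by (rule formsE[OF \<omega>]) blast
  have Ty: "?T y \<in> jet_img M r c'" by (rule jet_trans_jet_img[OF c y])
  have \<alpha>fo: "form_on M r (jet_img M r c') (Suc k) (to_cartan r (\<omega> c'))"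
    by (rule form_on_cartan(1)[OF open_img[OF c(2)] k(1)[OF c(2)]])
  have fs\<alpha>: "fin_supp \<alpha>" unfolding \<alpha>_def by (rule form_on_fin_supp[OF \<alpha>fo Ty])
  have supp: "K \<subseteq> jidx_le M r (Suc k)" if "\<alpha> K \<noteq> 0" for K
    using form_on_support[OF \<alpha>fo Ty] that by (simp add: \<alpha>_def)
  have fsd: "fin_supp (?d j)" for j by (rule dfun_jet_trans_fin_supp[OF c y])
  have d1: "deg1 (gsubst ?d (from_frame r (?T y) j))" for j by (intro deg1_gsubst deg1_dfun deg1_frame fin_supp_frame)
  have fs1: "fin_supp (gsubst ?d (from_frame r (?T y) j))" for j by (intro fin_supp_gsubst fin_supp_frame fsd)
  have comp: "gsubst (to_frame r y) (gsubst ?d (gsubst (from_frame r (?T y)) \<beta>)) = gsubst ?\<Lambda> \<beta>" if "fin_supp \<beta>" for \<beta>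
    using that by (simp add: gsubst_gsubst deg1_dfun fsd d1 fs1)
  have "\<omega> c y = gsubst ?d (\<omega> c' (?T y))" using k(2)[OF c y] by (simp add: pullback_def)
  also have "\<omega> c' (?T y) = gsubst (from_frame r (?T y)) \<alpha>"
    using from_cartan_to_cartan[of "\<omega> c'" "?T y" r] forms_fin_supp[OF \<omega>]
    by (simp add: from_cartan_frame \<alpha>_def)
  finally have "to_cartan r (\<omega> c) y = gsubst ?\<Lambda> \<alpha>" using comp[OF fs\<alpha>] by (simp add: to_cartan_frame)
  then have "bipart r p q (to_cartan r (\<omega> c) y) = bipart r p q (gsubst ?\<Lambda> \<alpha>)" by simp
  also have "\<dots> = gsubst ?\<Lambda> (bipart r p q \<alpha>)"
  proof -
    \<comment> \<open>\<open>jet_trans_frame\<close> is used for the generators up to the order of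
      \<alpha>. The others do not occur in \<alpha> and are sent to 0, so that the hypotheses of
      \<open>gsubst_bipart\<close> hold for every generator.\<close>
    define \<Lambda>' where "\<Lambda>' j = (if j \<in> jidx_le M r (Suc k) then ?\<Lambda> j else (\<lambda>I. 0))" for j
    have c1: "gsubst ?\<Lambda> \<beta> = gsubst \<Lambda>' \<beta>" if "fin_supp \<beta>" "\<And>K. \<beta> K \<noteq> 0 \<Longrightarrow> K \<subseteq> jidx_le M r (Suc k)" for \<beta>
      by (rule gsubst_cong[OF that(1)]) (use that(2) in \<open>auto simp: \<Lambda>'_def\<close>)
    have "gsubst \<Lambda>' (bipart r p q \<alpha>) = bipart r p q (gsubst \<Lambda>' \<alpha>)"
    proof (rule gsubst_bipart[OF _ fs\<alpha>])
      show "deg1 (\<Lambda>' g)" for g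
        using deg1_gsubst[OF deg1_frame(1) d1 fs1] by (simp add: \<Lambda>'_def deg1_def)
      show "K \<subseteq> jidx M r" if "\<alpha> K \<noteq> 0" for K using supp[OF that] jidx_le_subset[of M r "Suc k"] by auto
      show "h \<in> xidx M r" if "g \<in> xidx M r" "\<Lambda>' g {h} \<noteq> 0" for g h
      proof -
        have g: "g \<in> jidx_le M r (Suc k)" using that(2) by (auto simp: \<Lambda>'_def split: if_splits)
        have "(\<Sum>l\<in>jidx_le M r (Suc k) \<inter> xidx M r. pd l (\<lambda>y. ?T y g) y * gen l {h}) \<noteq> 0"
          using that(2) jet_trans_frame(2)[OF c y g that(1)] g by (simp add: \<Lambda>'_def)
        then obtain l where "l \<in> jidx_le M r (Suc k) \<inter> xidx M r" "gen l {h} \<noteq> (0::real)"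
          by (metis (no_types, lifting) mult_zero_right sum.neutral)
        then show ?thesis by (auto simp: gen_def split: if_splits)
      qed
      show "h \<in> tidx r" if "g \<in> tidx r" "\<Lambda>' g {h} \<noteq> 0" for g h
      proof -
        have g: "g \<in> jidx_le M r (Suc k)" using that(2) by (auto simp: \<Lambda>'_def split: if_splits)
        show ?thesis using that jet_trans_frame(1)[OF c y g that(1)] g by (auto simp: \<Lambda>'_def gen_def split: if_splits)
      qed
    qed
    then show ?thesis
      using c1[OF fs\<alpha> supp] c1[OF fin_supp_bipart[OF fs\<alpha>], of r p q] supp by (auto simp: bipart_eq_0)
  qed
  also have "\<dots> = gsubst (to_frame r y) (gsubst ?d (gsubst (from_frame r (?T y)) (bipart r p q \<alpha>)))"
    by (rule comp[OF fin_supp_bipart[OF fs\<alpha>], symmetric])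
  finally have eq: "bipart r p q (to_cartan r (\<omega> c) y) =
      to_cartan r (pullback (jidx M r) ?T (from_cartan r (\<lambda>y. bipart r p q (to_cartan r (\<omega> c') y)))) y"
    by (simp add: to_cartan_frame pullback_def from_cartan_frame \<alpha>_def)
  have "fin_supp (pullback (jidx M r) ?T (from_cartan r (\<lambda>y. bipart r p q (to_cartan r (\<omega> c') y))) y)"
    unfolding pullback_def
    by (intro fin_supp_gsubst fsd fin_supp_cartan(2)) (use fin_supp_bipart[OF fs\<alpha>] in \<open>simp add: \<alpha>_def\<close>)
  from from_cartan_to_cartan[where \<eta> = "pullback (jidx M r) ?T (from_cartan r (\<lambda>y. bipart r p q (to_cartan r (\<omega> c') y)))", OF this, of r]
  show ?thesis unfolding from_cartan_frame eq .
qed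

lemma component_forms:
  assumes \<omega>: "\<omega> \<in> forms M r"
  shows "component r p q \<omega> \<in> forms M r"
proof -
  obtain k where k: "\<And>c. c \<in> matlas M \<Longrightarrow> form_on M r (jet_img M r c) k (\<omega> c)"
    by (rule formsE[OF \<omega>]) blast
  show ?thesis unfolding component_def
  proof (rule formsI)
    show "form_on M r (jet_img M r c) (Suc (Suc k)) (from_cartan r (\<lambda>y. bipart r p q (to_cartan r (\<omega> c) y)))"
      if c: "c \<in> matlas M" for c
      by (intro form_on_cartan(2)[OF open_img[OF c]] form_on_bipart[OF open_img[OF c]]
          form_on_cartan(1)[OF open_img[OF c]] k c)
  qed (rule component_compat[OF \<omega>])
qed

lemma to_cartan_component:
  assumes "\<omega> \<in> forms M r" "c \<in> matlas M" "y \<in> jet_img M r c"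
  shows "to_cartan r (component r p q \<omega> c) y = bipart r p q (to_cartan r (\<omega> c) y)"
proof -
  have "fin_supp (bipart r p q (to_cartan r (\<omega> c) y))"
    by (intro fin_supp_bipart fin_supp_cartan forms_fin_supp[OF assms(1)])
  from to_cartan_from_cartan[of "\<lambda>y. bipart r p q (to_cartan r (\<omega> c) y)", OF this, of r]
  show ?thesis by (simp add: to_cartan_frame component_def chartwise_apply[OF assms(2,3)])
qed

text \<open>Bidegree, filtration and form degree are all conditions of this kind on the index sets
  of nonzero coefficients; treating them together gives closure under linear combinations once for
  all.\<close>

definition cforms :: "nat \<Rightarrow> (jcoord set \<Rightarrow> bool) \<Rightarrow> 'a form set" where
  "cforms r Q = {\<omega> \<in> forms M r. \<forall>c\<in>matlas M. \<forall>y\<in>jet_img M r c. \<forall>I. to_cartan r (\<omega> c) y I \<noteq> 0 \<longrightarrow> Q I}"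

lemma cformsI:
  "\<omega> \<in> forms M r \<Longrightarrow>
   (\<And>c y I. c \<in> matlas M \<Longrightarrow> y \<in> jet_img M r c \<Longrightarrow> to_cartan r (\<omega> c) y I \<noteq> 0 \<Longrightarrow> Q I) \<Longrightarrow> \<omega> \<in> cforms r Q"
  by (simp add: cforms_def)

lemma cformsD:
  "\<omega> \<in> cforms r Q \<Longrightarrow> \<omega> \<in> forms M r"
  "\<omega> \<in> cforms r Q \<Longrightarrow> c \<in> matlas M \<Longrightarrow> y \<in> jet_img M r c \<Longrightarrow> to_cartan r (\<omega> c) y I \<noteq> 0 \<Longrightarrow> Q I"
  by (simp_all add: cforms_def)

lemma cforms_lincomb:
  assumes "\<omega> \<in> cforms r Q" "\<eta> \<in> cforms r Q"
  shows "lincomb u \<omega> v \<eta> \<in> cforms r Q"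
proof (rule cformsI)
  show "lincomb u \<omega> v \<eta> \<in> forms M r" using assms by (intro forms_lincomb cformsD(1))
  fix c y I assume "c \<in> matlas M" "y \<in> jet_img M r c" "to_cartan r (lincomb u \<omega> v \<eta> c) y I \<noteq> 0"
  then show "Q I"
    using cformsD(2)[OF assms(1), of c y I] cformsD(2)[OF assms(2), of c y I]
      to_cartan_lincomb[OF cformsD(1)[OF assms(1)] cformsD(1)[OF assms(2)], of r u v c y]
    by (cases "to_cartan r (\<omega> c) y I = 0") auto
qed

lemma cforms_diff: "\<omega> \<in> cforms r Q \<Longrightarrow> \<eta> \<in> cforms r Q \<Longrightarrow> \<omega> - \<eta> \<in> cforms r Q"
  unfolding diff_lincomb by (rule cforms_lincomb)

lemma cforms_zero: "0 \<in> cforms r Q"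
  using zero_in_forms by (auto intro!: cformsI simp: to_cartan_zero)

lemma to_cartan_support:
  assumes "\<omega> \<in> forms M r" "c \<in> matlas M" "y \<in> jet_img M r c" "to_cartan r (\<omega> c) y I \<noteq> 0"
  shows "finite I" and "I \<subseteq> jidx M r"
proof -
  obtain k where "form_on M r (jet_img M r c) k (\<omega> c)" by (rule formsE[OF assms(1)]) (use assms(2) in blast)
  from form_on_support[OF form_on_cartan(1)[OF open_img[OF assms(2)] this] assms(3,4)]
  have "I \<subseteq> jidx_le M r (Suc k)" .
  then show "finite I" "I \<subseteq> jidx M r"
    using finite_subset[OF _ finite_jidx_le] jidx_le_subset[of M r "Suc k"] by auto
qed

lemma bihom_eq: "bihom M r p q = cforms r (bideg r p q)"
proof -
  have "to_cartan r (\<omega> c) y = (\<lambda>I. 0)" if "\<omega> \<in> forms M r" "y \<notin> jet_img M r c" for \<omega> c y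
    using forms_zero[OF that(1), of c y] that(2) by (intro to_cartan_zero) simp
  then show ?thesis unfolding bihom_def cforms_def bideg_def by (auto; metis)
qed

lemma forms_lforms: "\<omega> \<in> forms M r \<Longrightarrow> c \<in> matlas M \<Longrightarrow> \<omega> c \<in> lforms M r c"
  unfolding lforms_iff by (meson formsE)

text \<open>This is \<open>cartan_power_eq\<close> in each chart. For negative \<open>k\<close> both
  conditions are void, \<open>nat k\<close> being 0.\<close>

lemma cartan_filt_eq: "cartan_filt M r k = cforms r (\<lambda>I. k \<le> int (card (I \<inter> xidx M r)))"
proof -
  have "\<omega> c \<in> cartan_power M r c (nat k) \<longleftrightarrow>
      (\<forall>y\<in>jet_img M r c. \<forall>I. to_cartan r (\<omega> c) y I \<noteq> 0 \<longrightarrow> k \<le> int (card (I \<inter> xidx M r)))"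
    if \<omega>: "\<omega> \<in> forms M r" and c: "c \<in> matlas M" for \<omega> c
  proof -
    have z: "to_cartan r (\<omega> c) y I = 0" if "y \<notin> jet_img M r c" for y I
      using forms_zero[OF \<omega>, of c y] that to_cartan_zero[of "\<omega> c" y r] by simp
    have k: "nat k \<le> n \<longleftrightarrow> k \<le> int n" for n by linarith
    show ?thesis
      unfolding cartan_power_eq[OF open_img[OF c]] cartan_ge_def mem_Collect_eq k using forms_lforms[OF \<omega> c] z by blast
  qed
  then show ?thesis unfolding cartan_filt_def cforms_def by auto
qed

text \<open>Passing between \<open>dx\<close> and \<Gamma> substitutes elements of degree one and so
  keeps the total degree, which may therefore be tested in either set of variables.\<close>

lemma cartan_filt_deg_eq:
  "cartan_filt_deg M r p n = cforms r (\<lambda>I. p \<le> int (card (I \<inter> xidx M r)) \<and> int (card I) = n)"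
proof -
  have "(\<forall>c y I. \<omega> c y I \<noteq> 0 \<longrightarrow> int (card I) = n) \<longleftrightarrow>
      (\<forall>c\<in>matlas M. \<forall>y\<in>jet_img M r c. \<forall>I. to_cartan r (\<omega> c) y I \<noteq> 0 \<longrightarrow> int (card I) = n)"
    if \<omega>: "\<omega> \<in> forms M r" for \<omega>
  proof (intro iffI allI ballI impI)
    fix c y I assume "\<forall>c y I. \<omega> c y I \<noteq> 0 \<longrightarrow> int (card I) = n" "to_cartan r (\<omega> c) y I \<noteq> 0"
    moreover from this(2) have "gsubst (to_frame r y) (\<omega> c y) I \<noteq> 0" by (simp add: to_cartan_frame)
    from gsubst_card[OF forms_fin_supp[OF \<omega>] deg1_frame(1) this]
    obtain K where "\<omega> c y K \<noteq> 0" "card K = card I" by blast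
    ultimately show "int (card I) = n" by metis
  next
    fix c y I assume *: "\<forall>c\<in>matlas M. \<forall>y\<in>jet_img M r c. \<forall>I. to_cartan r (\<omega> c) y I \<noteq> 0 \<longrightarrow> int (card I) = n"
      and nz: "\<omega> c y I \<noteq> 0"
    have cy: "c \<in> matlas M \<and> y \<in> jet_img M r c"
      by (rule ccontr) (use nz forms_zero[OF \<omega>, of c y] in auto)
    have "gsubst (from_frame r y) (to_cartan r (\<omega> c) y) I \<noteq> 0"
      using from_cartan_to_cartan[of "\<omega> c" y r] forms_fin_supp[OF \<omega>] nz by (simp add: from_cartan_frame)
    from gsubst_card[OF fin_supp_cartan(1)[OF forms_fin_supp[OF \<omega>]] deg1_frame(2) this]
    obtain K where K: "to_cartan r (\<omega> c) y K \<noteq> 0" "card K = card I" by blast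
    have "int (card K) = n" using * cy K(1) by blast
    then show "int (card I) = n" using K(2) by simp
  qed
  then show ?thesis
    unfolding cartan_filt_deg_def cartan_filt_eq forms_deg_def cforms_def by blast
qed

lemma bihom_filt_deg: "bihom M r p q \<subseteq> cartan_filt_deg M r p (p + q)"
proof
  fix \<omega> assume \<omega>: "\<omega> \<in> bihom M r p q"
  then have \<omega>': "\<omega> \<in> cforms r (bideg r p q)" by (simp add: bihom_eq)
  show "\<omega> \<in> cartan_filt_deg M r p (p + q)" unfolding cartan_filt_deg_eq
  proof (rule cformsI[OF cformsD(1)[OF \<omega>']])
    fix c y I assume *: "c \<in> matlas M" "y \<in> jet_img M r c" "to_cartan r (\<omega> c) y I \<noteq> 0"
    have "bideg r p q I" by (rule cformsD(2)[OF \<omega>' *])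
    moreover have "card I = card (I \<inter> xidx M r) + card (I \<inter> tidx r)"
      using to_cartan_support[OF cformsD(1)[OF \<omega>'] *] by (rule card_jidx_split)
    ultimately show "p \<le> int (card (I \<inter> xidx M r)) \<and> int (card I) = p + q" by (auto simp: bideg_def)
  qed
qed

lemma component_bihom: "\<omega> \<in> forms M r \<Longrightarrow> component r p q \<omega> \<in> bihom M r p q"
  unfolding bihom_eq
  by (rule cformsI) (auto simp: component_forms to_cartan_component bipart_eq_0)

lemma component_id:
  assumes "\<omega> \<in> bihom M r p q"
  shows "component r p q \<omega> = \<omega>"
proof -
  have \<omega>: "\<omega> \<in> cforms r (bideg r p q)" using assms by (simp add: bihom_eq)
  note f = cformsD(1)[OF \<omega>]
  show ?thesis
  proof (rule forms_cartan_eqI[OF component_forms[OF f] f], rule ext)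
    fix c y I assume *: "c \<in> matlas M" "y \<in> jet_img M r c"
    show "to_cartan r (component r p q \<omega> c) y I = to_cartan r (\<omega> c) y I"
      using cformsD(2)[OF \<omega> *] by (auto simp: to_cartan_component[OF f *] bipart_def)
  qed
qed

lemma component_other:
  assumes "\<omega> \<in> bihom M r p q" "(p, q) \<noteq> (p', q')"
  shows "component r p' q' \<omega> = 0"
proof -
  have \<omega>: "\<omega> \<in> cforms r (bideg r p q)" using assms by (simp add: bihom_eq)
  note f = cformsD(1)[OF \<omega>]
  show ?thesis
  proof (rule forms_cartan_eqI[OF component_forms[OF f] zero_in_forms], rule ext)
    fix c y I assume *: "c \<in> matlas M" "y \<in> jet_img M r c"
    show "to_cartan r (component r p' q' \<omega> c) y I = to_cartan r (0 c) y I"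
      using cformsD(2)[OF \<omega> *, of I] assms(2)
      by (auto simp: to_cartan_component[OF f *] bipart_def bideg_def to_cartan_zero)
  qed
qed

lemma component_lincomb:
  assumes "\<omega> \<in> forms M r" "\<eta> \<in> forms M r"
  shows "component r p q (lincomb u \<omega> v \<eta>) = lincomb u (component r p q \<omega>) v (component r p q \<eta>)"
proof (rule forms_cartan_eqI)
  fix c y assume *: "c \<in> matlas M" "y \<in> jet_img M r c"
  show "to_cartan r (component r p q (lincomb u \<omega> v \<eta>) c) y =
      to_cartan r (lincomb u (component r p q \<omega>) v (component r p q \<eta>) c) y"
    unfolding to_cartan_component[OF forms_lincomb[OF assms] *]
      to_cartan_lincomb[OF component_forms[OF assms(1)] component_forms[OF assms(2)]]
      to_cartan_component[OF assms(1) *] to_cartan_component[OF assms(2) *] to_cartan_lincomb[OF assms]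
    by (auto simp: bipart_def)
qed (intro component_forms forms_lincomb assms)+

lemma component_add:
  "\<omega> \<in> forms M r \<Longrightarrow> \<eta> \<in> forms M r \<Longrightarrow>
    component r p q (\<omega> + \<eta>) = component r p q \<omega> + component r p q \<eta>"
  unfolding add_lincomb by (rule component_lincomb)

text \<open>A term of total degree \<open>p + q\<close> with at least \<open>p\<close> factors
  \<Gamma> either has bidegree \<open>(p, q)\<close> or contains at least \<open>p + 1\<close> of
  them.\<close>

lemma diff_component_filt:
  assumes "\<omega> \<in> cartan_filt_deg M r p (p + q)"
  shows "\<omega> - component r p q \<omega> \<in> cartan_filt_deg M r (p + 1) (p + q)"
proof -
  have \<omega>: "\<omega> \<in> cforms r (\<lambda>I. p \<le> int (card (I \<inter> xidx M r)) \<and> int (card I) = p + q)"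
    using assms by (simp add: cartan_filt_deg_eq)
  note f = cformsD(1)[OF \<omega>]
  show ?thesis unfolding cartan_filt_deg_eq
  proof (rule cformsI)
    show "\<omega> - component r p q \<omega> \<in> forms M r"
      unfolding diff_lincomb by (intro forms_lincomb f component_forms)
    fix c y I assume *: "c \<in> matlas M" "y \<in> jet_img M r c" and nz: "to_cartan r ((\<omega> - component r p q \<omega>) c) y I \<noteq> 0"
    have "to_cartan r (\<omega> c) y I \<noteq> bipart r p q (to_cartan r (\<omega> c) y) I"
      using nz unfolding diff_lincomb to_cartan_lincomb[OF f component_forms[OF f]] to_cartan_component[OF f *] by simp
    then have nz': "to_cartan r (\<omega> c) y I \<noteq> 0" "\<not> bideg r p q I" by (auto simp: bipart_def split: if_splits)
    have "card I = card (I \<inter> xidx M r) + card (I \<inter> tidx r)"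
      using to_cartan_support[OF f * nz'(1)] by (rule card_jidx_split)
    then show "p + 1 \<le> int (card (I \<inter> xidx M r)) \<and> int (card I) = p + q"
      using cformsD(2)[OF \<omega> * nz'(1)] nz'(2) by (auto simp: bideg_def)
  qed
qed

subsection \<open>The exterior differential of a form\<close>

lemma ext_deriv_apply:
  "c \<in> matlas M \<Longrightarrow> y \<in> jet_img M r c \<Longrightarrow> ext_deriv M r \<omega> c y = gen_diff (jidx M r) (\<omega> c) y"
  unfolding ext_deriv_def by (rule chartwise_apply)

lemma ext_deriv_forms:
  assumes \<omega>: "\<omega> \<in> forms M r"
  shows "ext_deriv M r \<omega> \<in> forms M r"
proof -
  obtain k where k: "\<And>c. c \<in> matlas M \<Longrightarrow> form_on M r (jet_img M r c) k (\<omega> c)"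
    "\<And>c c' y. c \<in> matlas M \<Longrightarrow> c' \<in> matlas M \<Longrightarrow> y \<in> overlap M r c c' \<Longrightarrow>
      \<omega> c y = pullback (jidx M r) (jet_trans M r c c') (\<omega> c') y"
    by (rule formsE[OF \<omega>]) blast
  show ?thesis unfolding ext_deriv_def
  proof (rule formsI)
    show "form_on M r (jet_img M r c) k (gen_diff (jidx M r) (\<omega> c))" if c: "c \<in> matlas M" for c
      by (rule form_on_gen_diff[OF open_img[OF c] k(1)[OF c] order_refl])
    fix c c' y assume c: "c \<in> matlas M" "c' \<in> matlas M" and y: "y \<in> overlap M r c c'"
    note W = open_in_overlap[OF sm c, of r]
    have "gen_diff (jidx M r) (\<omega> c) y = gen_diff (jidx M r) (pullback (jidx M r) (jet_trans M r c c') (\<omega> c')) y"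
      by (rule gen_diff_cong[OF W y order_refl]) (rule k(2)[OF c])
    also have "\<dots> = pullback (jidx M r) (jet_trans M r c c') (gen_diff (jidx M r) (\<omega> c')) y"
      by (rule gen_diff_pullback[OF W open_img[OF c(2)] jet_trans_jet_img[OF c] jet_trans_order_fun[OF sm c] k(1)[OF c(2)] y])
    finally show "gen_diff (jidx M r) (\<omega> c) y = pullback (jidx M r) (jet_trans M r c c') (gen_diff (jidx M r) (\<omega> c')) y" .
  qed
qed

lemma to_cartan_ext_deriv:
  assumes \<omega>: "\<omega> \<in> forms M r" and c: "c \<in> matlas M" and y: "y \<in> jet_img M r c"
  shows "to_cartan r (ext_deriv M r \<omega> c) y =
    (\<lambda>I. horizontal_op M r (to_cartan r (\<omega> c)) y I + gen_diff (xidx M r) (to_cartan r (\<omega> c)) y I)"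
proof -
  obtain k where k: "form_on M r (jet_img M r c) k (\<omega> c)" by (rule formsE[OF \<omega>]) (use c in blast)
  let ?\<eta> = "to_cartan r (\<omega> c)" and ?W = "jet_img M r c"
  note W = open_img[OF c, of r]
  have \<eta>: "form_on M r ?W (Suc k) ?\<eta>" by (rule form_on_cartan(1)[OF W k])
  let ?D = "\<lambda>y I. horizontal_op M r ?\<eta> y I + gen_diff (xidx M r) ?\<eta> y I"
  have fs: "fin_supp (?D y)"
    by (intro fin_supp_add form_on_fin_supp[OF form_on_horizontal_op[OF W \<eta>] y]
        form_on_fin_supp[OF form_on_gen_diff[OF W \<eta> xidx_subset] y])
  have "ext_deriv M r \<omega> c y = gen_diff (jidx M r) (\<omega> c) y" by (rule ext_deriv_apply[OF c y])
  also have "\<dots> = gen_diff (jidx M r) (from_cartan r ?\<eta>) y"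
    by (rule gen_diff_cong[OF W y order_refl])
      (rule from_cartan_to_cartan[OF forms_fin_supp[OF \<omega>], symmetric])
  also have "\<dots> = from_cartan r ?D y" by (rule gen_diff_from_cartan[OF W \<eta> y])
  finally have "to_cartan r (ext_deriv M r \<omega> c) y = to_cartan r (from_cartan r ?D) y"
    by (simp add: to_cartan_frame)
  also have "\<dots> = ?D y" by (rule to_cartan_from_cartan[where \<eta> = ?D, OF fs])
  finally show ?thesis .
qed

text \<open>The horizontal part keeps the number of \<Gamma> and adds a \<open>dt\<close>, the
  vertical part adds a \<Gamma>; neither lowers the filtration.\<close>

lemma ext_deriv_filt_deg:
  assumes "\<omega> \<in> cartan_filt_deg M r p n"
  shows "ext_deriv M r \<omega> \<in> cartan_filt_deg M r p (n + 1)"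
proof -
  have \<omega>: "\<omega> \<in> cforms r (\<lambda>I. p \<le> int (card (I \<inter> xidx M r)) \<and> int (card I) = n)"
    using assms by (simp add: cartan_filt_deg_eq)
  note f = cformsD(1)[OF \<omega>]
  show ?thesis unfolding cartan_filt_deg_eq
  proof (rule cformsI[OF ext_deriv_forms[OF f]])
    fix c y I assume c: "c \<in> matlas M" and y: "y \<in> jet_img M r c"
      and nz: "to_cartan r (ext_deriv M r \<omega> c) y I \<noteq> 0"
    obtain k where k: "form_on M r (jet_img M r c) k (\<omega> c)" by (rule formsE[OF f]) (use c in blast)
    let ?\<eta> = "to_cartan r (\<omega> c)" and ?W = "jet_img M r c"
    note W = open_img[OF c, of r]
    have \<eta>: "form_on M r ?W (Suc k) ?\<eta>" by (rule form_on_cartan(1)[OF W k])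
    have "horizontal_op M r ?\<eta> y I \<noteq> 0 \<or> gen_diff (xidx M r) ?\<eta> y I \<noteq> 0"
      using nz unfolding to_cartan_ext_deriv[OF f c y] by auto
    then obtain K y' where K: "y' \<in> ?W" "?\<eta> y' K \<noteq> 0" "card (K \<inter> xidx M r) \<le> card (I \<inter> xidx M r)"
      "card (I \<inter> xidx M r) + card (I \<inter> tidx r) = Suc (card (K \<inter> xidx M r) + card (K \<inter> tidx r))"
      using horizontal_op_support[OF W \<eta> y, of I] vertical_support[OF W \<eta> y, of I] by fastforce
    have "card I = Suc (card K)"
      using card_jidx_split[OF to_cartan_support[OF ext_deriv_forms[OF f] c y nz]]
        card_jidx_split[OF to_cartan_support[OF f c K(1,2)]] K(4) by simp
    then show "p \<le> int (card (I \<inter> xidx M r)) \<and> int (card I) = n + 1"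
      using cformsD(2)[OF \<omega> c K(1,2)] K(3) by auto
  qed
qed

text \<open>\<open>hor_diff\<close> and \<open>vert_diff\<close> are given by chart expressions.
  Recognised as components of the global \<open>ext_deriv\<close>, they are forms without a separate
  check of coordinate changes.\<close>

lemma
  assumes "\<omega> \<in> bihom M r p q"
  shows hor_diff_eq: "hor_diff M r \<omega> = component r p (q + 1) (ext_deriv M r \<omega>)"
    and vert_diff_eq: "vert_diff M r \<omega> = component r (p + 1) q (ext_deriv M r \<omega>)"
    and ext_deriv_split: "ext_deriv M r \<omega> = hor_diff M r \<omega> + vert_diff M r \<omega>"
proof -
  have \<omega>: "\<omega> \<in> cforms r (bideg r p q)" using assms by (simp add: bihom_eq)
  note f = cformsD(1)[OF \<omega>]
  have H: "bideg r p (q + 1) I" if c: "c \<in> matlas M" and y: "y \<in> jet_img M r c"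
    and nz: "horizontal_op M r (to_cartan r (\<omega> c)) y I \<noteq> 0" for c y I
  proof -
    obtain k where k: "form_on M r (jet_img M r c) k (\<omega> c)" by (rule formsE[OF f]) (use c in blast)
    obtain K y' where K: "y' \<in> jet_img M r c" "to_cartan r (\<omega> c) y' K \<noteq> 0"
      "card (I \<inter> xidx M r) = card (K \<inter> xidx M r)" "card (I \<inter> tidx r) = Suc (card (K \<inter> tidx r))"
      using horizontal_op_support[OF open_img[OF c] form_on_cartan(1)[OF open_img[OF c] k] y nz] by blast
    show ?thesis using cformsD(2)[OF \<omega> c K(1,2)] K(3,4) by (simp add: bideg_def)
  qed
  have V: "bideg r (p + 1) q I" if c: "c \<in> matlas M" and y: "y \<in> jet_img M r c"
    and nz: "gen_diff (xidx M r) (to_cartan r (\<omega> c)) y I \<noteq> 0" for c y I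
  proof -
    obtain k where k: "form_on M r (jet_img M r c) k (\<omega> c)" by (rule formsE[OF f]) (use c in blast)
    obtain K y' where K: "y' \<in> jet_img M r c" "to_cartan r (\<omega> c) y' K \<noteq> 0"
      "card (I \<inter> xidx M r) = Suc (card (K \<inter> xidx M r))" "card (I \<inter> tidx r) = card (K \<inter> tidx r)"
      using vertical_support[OF open_img[OF c] form_on_cartan(1)[OF open_img[OF c] k] y nz] by blast
    show ?thesis using cformsD(2)[OF \<omega> c K(1,2)] K(3,4) by (simp add: bideg_def)
  qed
  have bh: "bipart r p (q + 1) (to_cartan r (ext_deriv M r \<omega> c) y) = horizontal_op M r (to_cartan r (\<omega> c)) y"
    and bv: "bipart r (p + 1) q (to_cartan r (ext_deriv M r \<omega> c) y) = gen_diff (xidx M r) (to_cartan r (\<omega> c)) y"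
    if c: "c \<in> matlas M" and y: "y \<in> jet_img M r c" for c y
  proof -
    have disj: "\<not> bideg r (p + 1) q I" if "bideg r p (q + 1) I" for I using that by (simp add: bideg_def)
    have h: "horizontal_op M r (to_cartan r (\<omega> c)) y I = 0" if "\<not> bideg r p (q + 1) I" for I
      using H[OF c y] that by blast
    have v: "gen_diff (xidx M r) (to_cartan r (\<omega> c)) y I = 0" if "\<not> bideg r (p + 1) q I" for I
      using V[OF c y] that by blast
    have e: "to_cartan r (ext_deriv M r \<omega> c) y I =
        horizontal_op M r (to_cartan r (\<omega> c)) y I + gen_diff (xidx M r) (to_cartan r (\<omega> c)) y I" for I
      unfolding to_cartan_ext_deriv[OF f c y] ..
    have "bipart r p (q + 1) (to_cartan r (ext_deriv M r \<omega> c) y) I = horizontal_op M r (to_cartan r (\<omega> c)) y I" for I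
    proof (cases "bideg r p (q + 1) I")
      case True
      then show ?thesis using v[OF disj[OF True]] by (simp add: bipart_def e)
    next
      case False
      then show ?thesis using h[OF False] by (simp add: bipart_def)
    qed
    moreover have "bipart r (p + 1) q (to_cartan r (ext_deriv M r \<omega> c) y) I = gen_diff (xidx M r) (to_cartan r (\<omega> c)) y I" for I
    proof (cases "bideg r (p + 1) q I")
      case True
      then have "\<not> bideg r p (q + 1) I" using disj by blast
      then show ?thesis using h True by (simp add: bipart_def e)
    next
      case False
      then show ?thesis using v[OF False] by (simp add: bipart_def)
    qed
    ultimately show "bipart r p (q + 1) (to_cartan r (ext_deriv M r \<omega> c) y) = horizontal_op M r (to_cartan r (\<omega> c)) y"
      "bipart r (p + 1) q (to_cartan r (ext_deriv M r \<omega> c) y) = gen_diff (xidx M r) (to_cartan r (\<omega> c)) y"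
      by blast+
  qed
  show h: "hor_diff M r \<omega> = component r p (q + 1) (ext_deriv M r \<omega>)"
    unfolding hor_diff_def component_def
    by (rule chartwise_eqI) (simp add: from_cartan_frame bh)
  show v: "vert_diff M r \<omega> = component r (p + 1) q (ext_deriv M r \<omega>)"
    unfolding vert_diff_def component_def
    by (rule chartwise_eqI) (simp add: from_cartan_frame bv)
  note e = ext_deriv_forms[OF f]
  show "ext_deriv M r \<omega> = hor_diff M r \<omega> + vert_diff M r \<omega>"
    unfolding h v add_lincomb
  proof (rule forms_cartan_eqI[OF e])
    show "lincomb 1 (component r p (q + 1) (ext_deriv M r \<omega>)) 1 (component r (p + 1) q (ext_deriv M r \<omega>)) \<in> forms M r"
      by (intro forms_lincomb component_forms e)
    fix c y assume c: "c \<in> matlas M" and y: "y \<in> jet_img M r c"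
    show "to_cartan r (ext_deriv M r \<omega> c) y = to_cartan r (lincomb 1 (component r p (q + 1) (ext_deriv M r \<omega>)) 1
        (component r (p + 1) q (ext_deriv M r \<omega>)) c) y"
      unfolding to_cartan_lincomb[OF component_forms[OF e] component_forms[OF e]]
        to_cartan_component[OF e c y] bh[OF c y] bv[OF c y]
      unfolding to_cartan_ext_deriv[OF f c y] by simp
  qed
qed

lemma
  assumes "\<omega> \<in> bihom M r p q"
  shows hor_diff_bihom: "hor_diff M r \<omega> \<in> bihom M r p (q + 1)"
    and vert_diff_bihom: "vert_diff M r \<omega> \<in> bihom M r (p + 1) q"
proof -
  have "ext_deriv M r \<omega> \<in> forms M r" using assms by (intro ext_deriv_forms) (simp add: bihom_def)
  then show "hor_diff M r \<omega> \<in> bihom M r p (q + 1)" "vert_diff M r \<omega> \<in> bihom M r (p + 1) q"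
    unfolding hor_diff_eq[OF assms] vert_diff_eq[OF assms] by (simp_all add: component_bihom)
qed

lemma ext_deriv_lincomb:
  assumes "\<omega> \<in> forms M r" "\<eta> \<in> forms M r"
  shows "ext_deriv M r (lincomb u \<omega> v \<eta>) = lincomb u (ext_deriv M r \<omega>) v (ext_deriv M r \<eta>)"
proof (rule forms_eqI)
  fix c y assume c: "c \<in> matlas M" and y: "y \<in> jet_img M r c"
  obtain k where k: "form_on M r (jet_img M r c) k (\<omega> c)" by (rule formsE[OF assms(1)]) (use c in blast)
  obtain l where l: "form_on M r (jet_img M r c) l (\<eta> c)" by (rule formsE[OF assms(2)]) (use c in blast)
  note W = open_img[OF c, of r]
  let ?m = "max k l"
  have m: "form_on M r (jet_img M r c) ?m (\<omega> c)" "form_on M r (jet_img M r c) ?m (\<eta> c)"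
    using form_on_mono[OF _ k, of ?m] form_on_mono[OF _ l, of ?m] by auto
  have cm: "gen_diff (jidx M r) (\<lambda>y I. w * \<zeta> y I) y = (\<lambda>I. w * gen_diff (jidx M r) \<zeta> y I)"
    if \<zeta>: "form_on M r (jet_img M r c) ?m \<zeta>" for \<zeta> w
  proof -
    have "coeff_pd j (\<lambda>y I. w * \<zeta> y I) y = (\<lambda>I. w * coeff_pd j \<zeta> y I)" if "j \<in> jidx M r" for j
      unfolding coeff_pd_def by (rule ext, rule pd_cmult, rule order_fun_pdiff[OF form_on_coeff[OF \<zeta>] that y])
    then show ?thesis
      unfolding gen_diff_eq[OF W \<zeta> y order_refl] gen_diff_eq[OF W form_on_cmult[OF W \<zeta>] y order_refl]
      by (simp add: wedge_cmult_right sum_distrib_left)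
  qed
  show "ext_deriv M r (lincomb u \<omega> v \<eta>) c y = lincomb u (ext_deriv M r \<omega>) v (ext_deriv M r \<eta>) c y"
    unfolding ext_deriv_apply[OF c y] lincomb_apply[abs_def]
      gen_diff_add[OF W form_on_cmult[OF W m(1)] form_on_cmult[OF W m(2)] y order_refl] cm[OF m(1)] cm[OF m(2)] ..
qed (intro ext_deriv_forms forms_lincomb assms)+

lemma ext_deriv_add:
  "\<omega> \<in> forms M r \<Longrightarrow> \<eta> \<in> forms M r \<Longrightarrow> ext_deriv M r (\<omega> + \<eta>) = ext_deriv M r \<omega> + ext_deriv M r \<eta>"
  unfolding add_lincomb by (rule ext_deriv_lincomb)

subsection \<open>Pullback along the projection\<close>

text \<open>The coordinates of the smaller jet space are coordinates of the larger one too, so their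
  differentials are sent to themselves and only the point changes.\<close>

lemma pullback_jet_proj:
  assumes "form_on M r V k \<zeta>" "jet_proj M r y \<in> V"
  shows "pullback (jidx M (r + 1)) (jet_proj M r) \<zeta> y = \<zeta> (jet_proj M r y)"
  unfolding pullback_def
proof (rule gsubst_id[OF form_on_fin_supp[OF assms]])
  fix g K assume "\<zeta> (jet_proj M r y) K \<noteq> 0" "g \<in> K"
  then have g: "g \<in> jidx M r" "g \<in> jidx M (r + 1)"
    using form_on_support[OF assms] jidx_le_subset[of M r k] jidx_Suc[of M r] by auto
  show "dfun (jidx M (r + 1)) (\<lambda>y. jet_proj M r y g) y = gen g"
  proof
    fix I
    show "dfun (jidx M (r + 1)) (\<lambda>y. jet_proj M r y g) y I = gen g I"
      using g by (cases "is_singleton I") (auto simp: dfun_def jet_proj_def pd_coord gen_def is_singleton_def)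
  qed
qed

lemma proj_pullback_apply:
  assumes "\<omega> \<in> forms M r" "c \<in> matlas M" "y \<in> jet_img M (r + 1) c"
  shows "proj_pullback M r \<omega> c y = \<omega> c (jet_proj M r y)"
proof -
  obtain k where "form_on M r (jet_img M r c) k (\<omega> c)" by (rule formsE[OF assms(1)]) (use assms(2) in blast)
  then show ?thesis unfolding proj_pullback_def chartwise_apply[OF assms(2,3)]
    by (rule pullback_jet_proj[OF _ jet_proj_jet_img[OF sm assms(2,3)]])
qed

lemma proj_pullback_forms:
  assumes \<omega>: "\<omega> \<in> forms M r"
  shows "proj_pullback M r \<omega> \<in> forms M (r + 1)"
proof -
  obtain k where k: "\<And>c. c \<in> matlas M \<Longrightarrow> form_on M r (jet_img M r c) k (\<omega> c)"
    "\<And>c c' y. c \<in> matlas M \<Longrightarrow> c' \<in> matlas M \<Longrightarrow> y \<in> overlap M r c c' \<Longrightarrow>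
      \<omega> c y = pullback (jidx M r) (jet_trans M r c c') (\<omega> c') y"
    by (rule formsE[OF \<omega>]) blast
  show ?thesis unfolding proj_pullback_def
  proof (rule formsI)
    fix c assume c: "c \<in> matlas M"
    show "form_on M (r + 1) (jet_img M (r + 1) c) k (pullback (jidx M (r + 1)) (jet_proj M r) (\<omega> c))"
      by (rule form_on_pullback[OF open_img[OF c] open_img[OF c] jet_proj_jet_img[OF sm c]
            jet_proj_order_fun[OF open_img[OF c]] k(1)[OF c]])
  next
    fix c c' y assume c: "c \<in> matlas M" "c' \<in> matlas M" and y: "y \<in> overlap M (r + 1) c c'"
    let ?p = "jet_proj M r" and ?T = "jet_trans M r c c'" and ?T' = "jet_trans M (r + 1) c c'"
    note W = open_in_overlap[OF sm c, of "r + 1"] and V = open_in_overlap[OF sm c, of r]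
    have py: "?p y \<in> overlap M r c c'" by (rule jet_proj_jet_trans(1)[OF sm c y])
    have pT: "?p (?T' y) = ?T (?p y)" by (rule jet_proj_jet_trans(2)[OF sm c y])
    have Ty: "?T (?p y) \<in> jet_img M r c'" by (rule jet_trans_jet_img[OF c py])
    have "pullback (jidx M (r + 1)) ?p (\<omega> c) y = \<omega> c (?p y)"
      by (rule pullback_jet_proj[OF k(1)[OF c(1)]]) (use py overlap_subset_jet_img[OF sm c(1)] in blast)
    also have "\<dots> = gsubst (\<lambda>j. dfun (jidx M r) (\<lambda>y. ?T y j) (?p y)) (\<omega> c' (?T (?p y)))"
      using k(2)[OF c py] by (simp add: pullback_def)
    \<comment> \<open>A component of the larger coordinate change that belongs to the smaller jet
      space depends on the projected point only, so its differential is that of the smaller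
      coordinate change.\<close>
    also have "\<dots> = gsubst (\<lambda>j. dfun (jidx M (r + 1)) (\<lambda>y. ?T' y j) y) (\<omega> c' (?T (?p y)))"
    proof (rule gsubst_cong[OF forms_fin_supp[OF \<omega>]])
      fix j K assume "\<omega> c' (?T (?p y)) K \<noteq> 0" "j \<in> K"
      then have j: "j \<in> jidx_le M r k" "j \<in> jidx M r"
        using form_on_support[OF k(1)[OF c(2)] Ty] jidx_le_subset[of M r k] by auto
      note t = jet_trans_order_fun[OF sm c j(1)]
      have pd: "pd i (\<lambda>y. ?T' y j) y = (if i \<in> jidx_le M r k then pd i (\<lambda>y. ?T y j) (?p y) else 0)"
        if i: "i \<in> jidx M (r + 1)" for i
      proof -
        have "pd i (\<lambda>y. ?T' y j) y = pd i (\<lambda>y. ?T (?p y) j) y"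
        proof (rule pd_cong[OF W y i])
          fix x assume "x \<in> overlap M (r + 1) c c'"
          from jet_proj_jet_trans(2)[OF sm c this] have "?p (?T' x) j = ?T (?p x) j" by simp
          then show "?T' x j = ?T (?p x) j" using j(2) by (simp add: jet_proj_def)
        qed
        also have "\<dots> = (if i \<in> jidx_le M r k then pd i (\<lambda>y. ?T y j) (?p y) else 0)"
          by (rule pd_jet_proj[OF W V jet_proj_jet_trans(1)[OF sm c] t i y])
        finally show ?thesis .
      qed
      show "dfun (jidx M r) (\<lambda>y. ?T y j) (?p y) = dfun (jidx M (r + 1)) (\<lambda>y. ?T' y j) y"
      proof
        fix I
        show "dfun (jidx M r) (\<lambda>y. ?T y j) (?p y) I = dfun (jidx M (r + 1)) (\<lambda>y. ?T' y j) y I"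
        proof (cases "is_singleton I")
          case True
          then obtain i where i: "I = {i}" by (auto simp: is_singleton_def)
          have "pd i (\<lambda>y. ?T y j) (?p y) = 0" if "i \<in> jidx M r" "i \<notin> jidx_le M r k"
            by (rule order_fun_pd_zero[OF V t py that])
          then show ?thesis using pd[of i] jidx_Suc[of M r] jidx_le_subset[of M r k]
            by (auto simp: dfun_def i)
        qed (simp add: dfun_def)
      qed
    qed
    also have "\<dots> = pullback (jidx M (r + 1)) ?T' (pullback (jidx M (r + 1)) ?p (\<omega> c')) y"
      unfolding pullback_def[of _ ?T'] using pullback_jet_proj[OF k(1)[OF c(2)], of "?T' y"] Ty pT by simp
    finally show "pullback (jidx M (r + 1)) ?p (\<omega> c) y =
        pullback (jidx M (r + 1)) ?T' (pullback (jidx M (r + 1)) ?p (\<omega> c')) y" .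
  qed
qed

lemma proj_pullback_lincomb:
  assumes "\<omega> \<in> forms M r" "\<eta> \<in> forms M r"
  shows "proj_pullback M r (lincomb u \<omega> v \<eta>) = lincomb u (proj_pullback M r \<omega>) v (proj_pullback M r \<eta>)"
  by (rule forms_eqI[OF proj_pullback_forms[OF forms_lincomb[OF assms]]
        forms_lincomb[OF proj_pullback_forms[OF assms(1)] proj_pullback_forms[OF assms(2)]]])
    (simp only: proj_pullback_apply forms_lincomb assms lincomb_apply)

lemma proj_pullback_add:
  "\<omega> \<in> forms M r \<Longrightarrow> \<eta> \<in> forms M r \<Longrightarrow> proj_pullback M r (\<omega> + \<eta>) = proj_pullback M r \<omega> + proj_pullback M r \<eta>"
  unfolding add_lincomb by (rule proj_pullback_lincomb)

lemma proj_pullback_ext_deriv: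
  assumes \<omega>: "\<omega> \<in> forms M r"
  shows "ext_deriv M (r + 1) (proj_pullback M r \<omega>) = proj_pullback M r (ext_deriv M r \<omega>)"
proof (rule forms_eqI[OF ext_deriv_forms[OF proj_pullback_forms[OF \<omega>]] proj_pullback_forms[OF ext_deriv_forms[OF \<omega>]]])
  fix c y assume c: "c \<in> matlas M" and y: "y \<in> jet_img M (r + 1) c"
  obtain k where k: "form_on M r (jet_img M r c) k (\<omega> c)" by (rule formsE[OF \<omega>]) (use c in blast)
  let ?p = "jet_proj M r"
  have py: "?p y \<in> jet_img M r c" by (rule jet_proj_jet_img[OF sm c y])
  have "ext_deriv M (r + 1) (proj_pullback M r \<omega>) c y =
      gen_diff (jidx M (r + 1)) (pullback (jidx M (r + 1)) ?p (\<omega> c)) y"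
    unfolding ext_deriv_apply[OF c y] proj_pullback_def
    by (rule gen_diff_cong[OF open_img[OF c] y order_refl]) (rule chartwise_apply[OF c])
  also have "\<dots> = pullback (jidx M (r + 1)) ?p (gen_diff (jidx M r) (\<omega> c)) y"
    by (rule gen_diff_pullback[OF open_img[OF c] open_img[OF c] jet_proj_jet_img[OF sm c]
          jet_proj_order_fun[OF open_img[OF c]] k y])
  also have "\<dots> = ext_deriv M r \<omega> c (?p y)"
    unfolding ext_deriv_apply[OF c py]
    by (rule pullback_jet_proj[OF form_on_gen_diff[OF open_img[OF c] k order_refl] py])
  also have "\<dots> = proj_pullback M r (ext_deriv M r \<omega>) c y"
    by (rule proj_pullback_apply[OF ext_deriv_forms[OF \<omega>] c y, symmetric])
  finally show "ext_deriv M (r + 1) (proj_pullback M r \<omega>) c y = proj_pullback M r (ext_deriv M r \<omega>) c y" .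
qed

text \<open>Every generator in \<open>I\<close> is one of \<open>K\<close> or the new
  \<open>dt\<close>. As \<open>I\<close> and \<open>K\<close> have the same size, either both counts
  agree or one \<Gamma> has been exchanged for a \<open>dt\<close>.\<close>

lemma proj_pullback_support:
  assumes \<omega>: "\<omega> \<in> forms M r" and c: "c \<in> matlas M" and y: "y \<in> jet_img M (r + 1) c"
    and nz: "to_cartan (r + 1) (proj_pullback M r \<omega> c) y I \<noteq> 0"
  shows "\<exists>K. to_cartan r (\<omega> c) (jet_proj M r y) K \<noteq> 0 \<and> card I = card K \<and>
    (card (I \<inter> xidx M (r + 1)) = card (K \<inter> xidx M r) \<and> card (I \<inter> tidx (r + 1)) = card (K \<inter> tidx r) \<or>
     Suc (card (I \<inter> xidx M (r + 1))) = card (K \<inter> xidx M r) \<and> card (I \<inter> tidx (r + 1)) = Suc (card (K \<inter> tidx r)))"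
proof -
  let ?p = "jet_proj M r"
  have py: "?p y \<in> jet_img M r c" by (rule jet_proj_jet_img[OF sm c y])
  let ?\<alpha> = "to_cartan r (\<omega> c) (?p y)"
  let ?\<Lambda> = "\<lambda>j. gsubst (to_frame (r + 1) y) (from_frame r (?p y) j)"
  have fs: "fin_supp ?\<alpha>" by (intro fin_supp_cartan forms_fin_supp[OF \<omega>])
  have "proj_pullback M r \<omega> c y = gsubst (from_frame r (?p y)) ?\<alpha>"
    unfolding proj_pullback_apply[OF \<omega> c y]
    using from_cartan_to_cartan[of "\<omega> c" "?p y" r] forms_fin_supp[OF \<omega>] by (simp add: from_cartan_frame)
  then have nz': "gsubst ?\<Lambda> ?\<alpha> I \<noteq> 0"
    using nz fs by (simp add: to_cartan_frame gsubst_gsubst)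
  have d: "deg1 (?\<Lambda> j)" for j by (intro deg1_gsubst deg1_frame fin_supp_frame)
  obtain K where K: "?\<alpha> K \<noteq> 0" "finite K" "finite I" "card I = card K" "I \<subseteq> (\<Union>g\<in>K. {h. ?\<Lambda> g {h} \<noteq> 0})"
    using gsubst_nonzeroD[OF fs d nz'] by blast
  have Kj: "K \<subseteq> jidx M r" by (rule to_cartan_support(2)[OF \<omega> c py K(1)])
  have \<Lambda>: "h = g \<or> h = Tc r" if g: "g \<in> jidx M r" and h: "?\<Lambda> g {h} \<noteq> 0" for g h
  proof (cases g)
    case (Tc i)
    then have "?\<Lambda> g = gen g" by (simp add: gsubst_gen deg1_finite[OF deg1_frame(1)])
    then show ?thesis using h by (auto simp: gen_def split: if_splits)
  next
    case (Xc a \<sigma>)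
    have "?\<Lambda> g = (\<lambda>I. to_frame (r + 1) y g I - (\<Sum>i<r. ?p y (raise i g) * to_frame (r + 1) y (Tc i) I))"
      unfolding Xc frame_Xc(2)
      by (simp only: gsubst_diff fin_supp_gen fin_supp_sum fin_supp_cmult gsubst_linear deg1_frame
          gsubst_gen deg1_finite[OF deg1_frame(1)])
    moreover have "?p y (raise i g) = y (raise i g)" if "i < r" for i
      using g Xc that by (simp add: jet_proj_def)
    ultimately have "?\<Lambda> g = (\<lambda>I. gen g I + y (raise r g) * gen (Tc r) I)"
      by (simp add: Xc frame_Xc)
    then show ?thesis using h by (auto simp: gen_def split: if_splits)
  qed
  have IK: "I \<subseteq> insert (Tc r) K" using K(5) Kj \<Lambda> by blast
  have XI: "I \<inter> xidx M (r + 1) \<subseteq> K \<inter> xidx M r"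
  proof
    fix j assume j: "j \<in> I \<inter> xidx M (r + 1)"
    then have "j \<noteq> Tc r" by auto
    then have "j \<in> K" using j IK by auto
    moreover have "j \<notin> tidx r" using j by (cases j) auto
    ultimately show "j \<in> K \<inter> xidx M r" using Kj by (auto simp: jidx_def)
  qed
  have TI: "I \<inter> tidx (r + 1) \<subseteq> insert (Tc r) (K \<inter> tidx r)"
  proof
    fix j assume j: "j \<in> I \<inter> tidx (r + 1)"
    then show "j \<in> insert (Tc r) (K \<inter> tidx r)" using IK Kj by (cases j) auto
  qed
  have cX: "card (I \<inter> xidx M (r + 1)) \<le> card (K \<inter> xidx M r)" using XI K(2) by (intro card_mono) auto
  have cT: "card (I \<inter> tidx (r + 1)) \<le> Suc (card (K \<inter> tidx r))"
    using card_mono[OF _ TI] K(2) by (auto simp: card_insert_if split: if_splits)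
  have "I \<subseteq> jidx M (r + 1)" by (rule to_cartan_support(2)[OF proj_pullback_forms[OF \<omega>] c y nz])
  then have "card (I \<inter> xidx M (r + 1)) + card (I \<inter> tidx (r + 1)) = card (K \<inter> xidx M r) + card (K \<inter> tidx r)"
    using card_jidx_split[OF K(3) \<open>I \<subseteq> jidx M (r + 1)\<close>] card_jidx_split[OF K(2) Kj] K(4) by simp
  then show ?thesis using K(1,4) cX cT by (intro exI[of _ K]) auto
qed

lemma proj_pullback_filt:
  assumes "\<omega> \<in> cartan_filt M r k"
  shows "proj_pullback M r \<omega> \<in> cartan_filt M (r + 1) (k - 1)"
proof -
  have \<omega>: "\<omega> \<in> cforms r (\<lambda>I. k \<le> int (card (I \<inter> xidx M r)))" using assms by (simp add: cartan_filt_eq)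
  note f = cformsD(1)[OF \<omega>]
  show ?thesis unfolding cartan_filt_eq
  proof (rule cformsI[OF proj_pullback_forms[OF f]])
    fix c y I assume c: "c \<in> matlas M" and y: "y \<in> jet_img M (r + 1) c"
      and nz: "to_cartan (r + 1) (proj_pullback M r \<omega> c) y I \<noteq> 0"
    from proj_pullback_support[OF f c y nz] obtain K where
      K: "to_cartan r (\<omega> c) (jet_proj M r y) K \<noteq> 0" "card (K \<inter> xidx M r) \<le> Suc (card (I \<inter> xidx M (r + 1)))"
      by fastforce
    show "k - 1 \<le> int (card (I \<inter> xidx M (r + 1)))"
      using cformsD(2)[OF \<omega> c jet_proj_jet_img[OF sm c y] K(1)] K(2) by linarith
  qed
qed

lemma proj_pullback_filt_deg:
  assumes "\<omega> \<in> cartan_filt_deg M r p n"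
  shows "proj_pullback M r \<omega> \<in> cartan_filt_deg M (r + 1) (p - 1) n"
proof -
  have \<omega>: "\<omega> \<in> cforms r (\<lambda>I. p \<le> int (card (I \<inter> xidx M r)) \<and> int (card I) = n)"
    using assms by (simp add: cartan_filt_deg_eq)
  note f = cformsD(1)[OF \<omega>]
  show ?thesis unfolding cartan_filt_deg_eq
  proof (rule cformsI[OF proj_pullback_forms[OF f]])
    fix c y I assume c: "c \<in> matlas M" and y: "y \<in> jet_img M (r + 1) c"
      and nz: "to_cartan (r + 1) (proj_pullback M r \<omega> c) y I \<noteq> 0"
    from proj_pullback_support[OF f c y nz] obtain K where
      K: "to_cartan r (\<omega> c) (jet_proj M r y) K \<noteq> 0" "card (K \<inter> xidx M r) \<le> Suc (card (I \<inter> xidx M (r + 1)))"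
        "card I = card K"
      by fastforce
    show "p - 1 \<le> int (card (I \<inter> xidx M (r + 1))) \<and> int (card I) = n"
      using cformsD(2)[OF \<omega> c jet_proj_jet_img[OF sm c y] K(1)] K(2,3) by linarith
  qed
qed

lemma proj_pullback_split:
  assumes "\<omega> \<in> bihom M r p q"
  shows "proj_pullback M r \<omega> =
    component (r + 1) p q (proj_pullback M r \<omega>) + component (r + 1) (p - 1) (q + 1) (proj_pullback M r \<omega>)"
proof -
  have \<omega>: "\<omega> \<in> cforms r (bideg r p q)" using assms by (simp add: bihom_eq)
  note f = cformsD(1)[OF \<omega>]
  note e = proj_pullback_forms[OF f]
  let ?c = "component (r + 1) p q (proj_pullback M r \<omega>)"
    and ?d = "component (r + 1) (p - 1) (q + 1) (proj_pullback M r \<omega>)"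
  show ?thesis unfolding add_lincomb
  proof (rule forms_cartan_eqI[OF e forms_lincomb[OF component_forms[OF e] component_forms[OF e]]])
    fix c y assume c: "c \<in> matlas M" and y: "y \<in> jet_img M (r + 1) c"
    let ?\<zeta> = "to_cartan (r + 1) (proj_pullback M r \<omega> c) y"
    have "?\<zeta> I = bipart (r + 1) p q ?\<zeta> I + bipart (r + 1) (p - 1) (q + 1) ?\<zeta> I" for I
    proof (cases "?\<zeta> I = 0")
      case False
      from proj_pullback_support[OF f c y this] obtain K where
        K: "to_cartan r (\<omega> c) (jet_proj M r y) K \<noteq> 0"
          "card (I \<inter> xidx M (r + 1)) = card (K \<inter> xidx M r) \<and> card (I \<inter> tidx (r + 1)) = card (K \<inter> tidx r) \<or>
           Suc (card (I \<inter> xidx M (r + 1))) = card (K \<inter> xidx M r) \<and> card (I \<inter> tidx (r + 1)) = Suc (card (K \<inter> tidx r))"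
        by blast
      have "bideg r p q K" by (rule cformsD(2)[OF \<omega> c jet_proj_jet_img[OF sm c y] K(1)])
      then show ?thesis using K(2) unfolding bipart_def bideg_def by auto
    qed (simp add: bipart_def)
    then show "?\<zeta> = to_cartan (r + 1) (lincomb 1 ?c 1 ?d c) y"
      unfolding to_cartan_lincomb[OF component_forms[OF e] component_forms[OF e]] to_cartan_component[OF e c y]
      by auto
  qed
qed

section \<open>The zeroth term and the induced maps\<close>

lemma filt_deg_forms: "\<omega> \<in> cartan_filt_deg M r p n \<Longrightarrow> \<omega> \<in> forms M r"
  unfolding cartan_filt_deg_eq by (rule cformsD(1))

lemma filt_deg_diff:
  "\<omega> \<in> cartan_filt_deg M r p n \<Longrightarrow> \<eta> \<in> cartan_filt_deg M r p n \<Longrightarrow> \<omega> - \<eta> \<in> cartan_filt_deg M r p n"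
  unfolding cartan_filt_deg_eq by (rule cforms_diff)

lemma filt_deg_zero: "0 \<in> cartan_filt_deg M r p n"
  unfolding cartan_filt_deg_eq by (rule cforms_zero)

lemma bihom_forms: "\<omega> \<in> bihom M r p q \<Longrightarrow> \<omega> \<in> forms M r"
  by (simp add: bihom_def)

lemma bihom_filt: "\<omega> \<in> bihom M r p q \<Longrightarrow> \<omega> \<in> cartan_filt_deg M r p (p + q)"
  using bihom_filt_deg by blast

lemma equiv_E0_rel: "equiv (cartan_filt_deg M r p (p + q)) (E0_rel M r p q)"
proof (rule equivI)
  let ?F = "cartan_filt_deg M r p (p + q)"
  show "E0_rel M r p q \<subseteq> ?F \<times> ?F" by (auto simp: E0_rel_def)
  show "refl_on ?F (E0_rel M r p q)" by (auto simp: refl_on_def E0_rel_def filt_deg_zero)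
  show "sym (E0_rel M r p q)"
  proof (rule symI)
    fix \<omega> \<eta> assume "(\<omega>, \<eta>) \<in> E0_rel M r p q"
    then show "(\<eta>, \<omega>) \<in> E0_rel M r p q"
      using filt_deg_diff[OF filt_deg_zero, of "\<omega> - \<eta>"] by (auto simp: E0_rel_def)
  qed
  show "trans (E0_rel M r p q)"
  proof (rule transI)
    fix \<omega> \<eta> \<zeta> assume *: "(\<omega>, \<eta>) \<in> E0_rel M r p q" "(\<eta>, \<zeta>) \<in> E0_rel M r p q"
    then have d: "\<omega> - \<eta> \<in> cartan_filt_deg M r (p + 1) (p + q)" "\<eta> - \<zeta> \<in> cartan_filt_deg M r (p + 1) (p + q)"
      by (auto simp: E0_rel_def)
    \<comment> \<open>The sum is written with differences only, to match
      \<open>filt_deg_diff\<close>.\<close>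
    have "\<omega> - \<zeta> = (\<omega> - \<eta>) - (0 - (\<eta> - \<zeta>))" by simp
    also have "\<dots> \<in> cartan_filt_deg M r (p + 1) (p + q)"
      by (rule filt_deg_diff[OF d(1) filt_deg_diff[OF filt_deg_zero d(2)]])
    finally show "(\<omega>, \<zeta>) \<in> E0_rel M r p q" using * by (auto simp: E0_rel_def)
  qed
qed

lemma E0_class_eqI:
  "\<omega> \<in> cartan_filt_deg M r p (p + q) \<Longrightarrow> \<eta> \<in> cartan_filt_deg M r p (p + q) \<Longrightarrow>
   \<omega> - \<eta> \<in> cartan_filt_deg M r (p + 1) (p + q) \<Longrightarrow> E0_class M r p q \<omega> = E0_class M r p q \<eta>"
  unfolding E0_class_def by (rule equiv_class_eq[OF equiv_E0_rel]) (simp add: E0_rel_def)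

lemma E0_class_eqD:
  "\<omega> \<in> cartan_filt_deg M r p (p + q) \<Longrightarrow> \<eta> \<in> cartan_filt_deg M r p (p + q) \<Longrightarrow>
   E0_class M r p q \<omega> = E0_class M r p q \<eta> \<Longrightarrow> \<omega> - \<eta> \<in> cartan_filt_deg M r (p + 1) (p + q)"
  unfolding E0_class_def using eq_equiv_class_iff[OF equiv_E0_rel] by (auto simp: E0_rel_def)

lemma E0_class_in_E0: "\<omega> \<in> cartan_filt_deg M r p (p + q) \<Longrightarrow> E0_class M r p q \<omega> \<in> E0 M r p q"
  unfolding E0_class_def E0_def by (rule quotientI)

lemma E0E:
  assumes "Z \<in> E0 M r p q"
  obtains \<omega> where "\<omega> \<in> cartan_filt_deg M r p (p + q)" "Z = E0_class M r p q \<omega>"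
  using assms unfolding E0_def E0_class_def by (rule quotientE)

lemma proj_pullback_filt_deg':
  "\<omega> \<in> cartan_filt_deg M r p (p + q) \<Longrightarrow> proj_pullback M r \<omega> \<in> cartan_filt_deg M (r + 1) (p - 1) ((p - 1) + (q + 1))"
  using proj_pullback_filt_deg[of \<omega> r p "p + q"] by simp

lemma ext_deriv_filt_deg':
  "\<omega> \<in> cartan_filt_deg M r p (p + q) \<Longrightarrow> ext_deriv M r \<omega> \<in> cartan_filt_deg M r p (p + (q + 1))"
  using ext_deriv_filt_deg[of \<omega> r p "p + q"] by (simp add: add.assoc)

text \<open>A difference in filtration \<open>p + 1\<close> is sent to filtration \<open>p\<close>,
  one step above the \<open>p - 1\<close> of the target, so the class does not depend on the
  representative.\<close>

lemma E0_map_class: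
  assumes \<omega>: "\<omega> \<in> cartan_filt_deg M r p (p + q)"
  shows "E0_map M r p q (E0_class M r p q \<omega>) = E0_class M (r + 1) (p - 1) (q + 1) (proj_pullback M r \<omega>)"
  unfolding E0_map_def E0_class_def[of M r]
proof (rule UN_equiv_class[OF equiv_E0_rel _ \<omega>], rule congruentI)
  fix \<eta> \<zeta> assume "(\<eta>, \<zeta>) \<in> E0_rel M r p q"
  then have *: "\<eta> \<in> cartan_filt_deg M r p (p + q)" "\<zeta> \<in> cartan_filt_deg M r p (p + q)"
    "\<eta> - \<zeta> \<in> cartan_filt_deg M r (p + 1) (p + q)" by (auto simp: E0_rel_def)
  have "proj_pullback M r \<eta> - proj_pullback M r \<zeta> = proj_pullback M r (\<eta> - \<zeta>)"
    unfolding diff_lincomb by (rule proj_pullback_lincomb[symmetric]) (intro filt_deg_forms[OF *(1)] filt_deg_forms[OF *(2)])+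
  also have "\<dots> \<in> cartan_filt_deg M (r + 1) ((p - 1) + 1) ((p - 1) + (q + 1))"
    using proj_pullback_filt_deg[OF *(3)] by simp
  finally show "E0_class M (r + 1) (p - 1) (q + 1) (proj_pullback M r \<eta>) =
      E0_class M (r + 1) (p - 1) (q + 1) (proj_pullback M r \<zeta>)"
    by (intro E0_class_eqI proj_pullback_filt_deg' *)
qed

lemma E0_diff_class:
  assumes \<omega>: "\<omega> \<in> cartan_filt_deg M r p (p + q)"
  shows "E0_diff M r p q (E0_class M r p q \<omega>) = E0_class M r p (q + 1) (ext_deriv M r \<omega>)"
  unfolding E0_diff_def E0_class_def[of M r p q]
proof (rule UN_equiv_class[OF equiv_E0_rel _ \<omega>], rule congruentI)
  fix \<eta> \<zeta> assume "(\<eta>, \<zeta>) \<in> E0_rel M r p q"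
  then have *: "\<eta> \<in> cartan_filt_deg M r p (p + q)" "\<zeta> \<in> cartan_filt_deg M r p (p + q)"
    "\<eta> - \<zeta> \<in> cartan_filt_deg M r (p + 1) (p + q)" by (auto simp: E0_rel_def)
  have "ext_deriv M r \<eta> - ext_deriv M r \<zeta> = ext_deriv M r (\<eta> - \<zeta>)"
    unfolding diff_lincomb by (rule ext_deriv_lincomb[symmetric]) (intro filt_deg_forms[OF *(1)] filt_deg_forms[OF *(2)])+
  also have "\<dots> \<in> cartan_filt_deg M r (p + 1) (p + (q + 1))"
    using ext_deriv_filt_deg[OF *(3)] by (simp add: add.assoc)
  finally show "E0_class M r p (q + 1) (ext_deriv M r \<eta>) = E0_class M r p (q + 1) (ext_deriv M r \<zeta>)"
    by (intro E0_class_eqI ext_deriv_filt_deg' *)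
qed

lemma E0_map_E0_diff:
  assumes "Z \<in> E0 M r p q"
  shows "E0_diff M (r + 1) (p - 1) (q + 1) (E0_map M r p q Z) = E0_map M r p (q + 1) (E0_diff M r p q Z)"
proof -
  from assms obtain \<omega> where \<omega>: "\<omega> \<in> cartan_filt_deg M r p (p + q)" and Z: "Z = E0_class M r p q \<omega>"
    by (rule E0E)
  show ?thesis
    unfolding Z E0_map_class[OF \<omega>] E0_diff_class[OF \<omega>] E0_diff_class[OF proj_pullback_filt_deg'[OF \<omega>]]
      E0_map_class[OF ext_deriv_filt_deg'[OF \<omega>]] proj_pullback_ext_deriv[OF filt_deg_forms[OF \<omega>]] ..
qed

text \<open>By \<open>diff_component_filt\<close> the leading component differs from the form by
  deeper filtration; thus every class has a bihomogeneous representative.\<close>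

lemma E0_class_component:
  assumes "\<omega> \<in> cartan_filt_deg M r p (p + q)"
  shows "E0_class M r p q (component r p q \<omega>) = E0_class M r p q \<omega>"
  by (rule E0_class_eqI[OF assms bihom_filt[OF component_bihom[OF filt_deg_forms[OF assms]]]
        diff_component_filt[OF assms], symmetric])

text \<open>The difference of two forms of bidegree \<open>(p, q)\<close> has exactly
  \<open>p\<close> factors \<Gamma> in each term, so it vanishes if it lies in filtration
  \<open>p + 1\<close>. With \<open>E0_class_component\<close> this gives the identification of the
  zeroth term with bihomogeneous forms.\<close>

lemma inj_on_E0_class: "inj_on (E0_class M r p q) (bihom M r p q)"
proof (rule inj_onI)
  fix \<omega> \<eta> assume *: "\<omega> \<in> bihom M r p q" "\<eta> \<in> bihom M r p q" "E0_class M r p q \<omega> = E0_class M r p q \<eta>"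
  have "\<omega> - \<eta> \<in> cartan_filt_deg M r (p + 1) (p + q)"
    by (rule E0_class_eqD[OF bihom_filt[OF *(1)] bihom_filt[OF *(2)] *(3)])
  then have F: "\<omega> - \<eta> \<in> cforms r (\<lambda>I. p + 1 \<le> int (card (I \<inter> xidx M r)) \<and> int (card I) = p + q)"
    by (simp add: cartan_filt_deg_eq)
  have B: "\<omega> - \<eta> \<in> cforms r (bideg r p q)" using * by (intro cforms_diff) (simp_all add: bihom_eq)
  have "\<omega> - \<eta> = 0"
  proof (rule forms_cartan_eqI[OF cformsD(1)[OF F] zero_in_forms], rule ext)
    fix c y I assume c: "c \<in> matlas M" "y \<in> jet_img M r c"
    have "to_cartan r ((\<omega> - \<eta>) c) y I = 0"
      using cformsD(2)[OF F c, of I] cformsD(2)[OF B c, of I] by (auto simp: bideg_def)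
    then show "to_cartan r ((\<omega> - \<eta>) c) y I = to_cartan r (0 c) y I" by (simp add: to_cartan_zero)
  qed
  then show "\<omega> = \<eta>" by simp
qed

text \<open>The component is a bihomogeneous representative of the class of
  \<open>p^* \<omega>\<close>, and such representatives are unique, so \<open>inv_into\<close>
  returns it. From here on \<kappa> is explicit.\<close>

lemma kappa_eq:
  assumes "\<omega> \<in> bihom M r p q"
  shows "kappa M r p q \<omega> = component (r + 1) (p - 1) (q + 1) (proj_pullback M r \<omega>)"
proof -
  have F: "proj_pullback M r \<omega> \<in> cartan_filt_deg M (r + 1) (p - 1) ((p - 1) + (q + 1))"
    by (rule proj_pullback_filt_deg'[OF bihom_filt[OF assms]])
  show ?thesis
    unfolding kappa_def E0_map_class[OF bihom_filt[OF assms]] E0_class_component[OF F, symmetric]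
    by (rule inv_into_f_f[OF inj_on_E0_class component_bihom[OF filt_deg_forms[OF F]]])
qed

lemma kappa_bihom: "\<omega> \<in> bihom M r p q \<Longrightarrow> kappa M r p q \<omega> \<in> bihom M (r + 1) (p - 1) (q + 1)"
  by (simp only: kappa_eq) (intro component_bihom proj_pullback_forms bihom_forms)

lemma E0_class_kappa:
  assumes "\<omega> \<in> bihom M r p q"
  shows "E0_class M (r + 1) (p - 1) (q + 1) (kappa M r p q \<omega>) = E0_map M r p q (E0_class M r p q \<omega>)"
  unfolding kappa_eq[OF assms] E0_map_class[OF bihom_filt[OF assms]]
  by (rule E0_class_component[OF proj_pullback_filt_deg'[OF bihom_filt[OF assms]]])

lemma kappa_lincomb:
  assumes "\<omega> \<in> bihom M r p q" "\<eta> \<in> bihom M r p q"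
  shows "kappa M r p q (lincomb u \<omega> v \<eta>) = lincomb u (kappa M r p q \<omega>) v (kappa M r p q \<eta>)"
proof -
  have "lincomb u \<omega> v \<eta> \<in> bihom M r p q" using assms by (simp add: bihom_eq cforms_lincomb)
  then show ?thesis
    using assms by (simp only: kappa_eq component_lincomb proj_pullback_lincomb proj_pullback_forms bihom_forms)
qed

text \<open>
  Both identities are components of \<open>d p\<^sup>* \<omega> = p\<^sup>* d \<omega>\<close>, where \<open>p\<^sup>* \<omega>\<close> is the sum of \<open>\<kappa> \<omega>\<close> and of its
  part of the same bidegree as \<open>\<omega>\<close>.
\<close>

lemma
  assumes \<omega>: "\<omega> \<in> bihom M r p q"
  defines "\<iota> \<equiv> component (r + 1) p q (proj_pullback M r \<omega>)"
  shows hor_diff_kappa: "hor_diff M (r + 1) (kappa M r p q \<omega>) = kappa M r p (q + 1) (hor_diff M r \<omega>)"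
    and vert_diff_kappa: "hor_diff M (r + 1) \<iota> + vert_diff M (r + 1) (kappa M r p q \<omega>) =
      component (r + 1) p (q + 1) (proj_pullback M r (hor_diff M r \<omega>)) + kappa M r (p + 1) q (vert_diff M r \<omega>)"
proof -
  let ?R = "r + 1" and ?p = "proj_pullback M r"
  let ?\<kappa> = "kappa M r p q \<omega>" and ?h = "hor_diff M r \<omega>" and ?v = "vert_diff M r \<omega>"
  have h: "?h \<in> bihom M r p (q + 1)" and v: "?v \<in> bihom M r (p + 1) q"
    by (rule hor_diff_bihom[OF \<omega>] vert_diff_bihom[OF \<omega>])+
  have \<iota>: "\<iota> \<in> bihom M ?R p q"
    unfolding \<iota>_def by (intro component_bihom proj_pullback_forms bihom_forms[OF \<omega>])
  have \<kappa>: "?\<kappa> \<in> bihom M ?R (p - 1) (q + 1)" by (rule kappa_bihom[OF \<omega>])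
  let ?h\<iota> = "hor_diff M ?R \<iota>" and ?v\<iota> = "vert_diff M ?R \<iota>" and ?h\<kappa> = "hor_diff M ?R ?\<kappa>" and ?v\<kappa> = "vert_diff M ?R ?\<kappa>"
  have b: "?h\<iota> \<in> bihom M ?R p (q + 1)" "?v\<iota> \<in> bihom M ?R (p + 1) q"
    "?h\<kappa> \<in> bihom M ?R (p - 1) (q + 1 + 1)" "?v\<kappa> \<in> bihom M ?R p (q + 1)"
    using hor_diff_bihom[OF \<iota>] vert_diff_bihom[OF \<iota>] hor_diff_bihom[OF \<kappa>] vert_diff_bihom[OF \<kappa>] by simp_all
  note fb = b[THEN bihom_forms]
  have ph: "?p ?h \<in> forms M ?R" and pv: "?p ?v \<in> forms M ?R"
    using h v by (simp_all only: proj_pullback_forms bihom_forms)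
  have sum_forms: "\<alpha> + \<beta> \<in> forms M ?R" if "\<alpha> \<in> forms M ?R" "\<beta> \<in> forms M ?R" for \<alpha> \<beta>
    using that unfolding add_lincomb by (rule forms_lincomb)
  have "(?h\<iota> + ?v\<iota>) + (?h\<kappa> + ?v\<kappa>) = ext_deriv M ?R (\<iota> + ?\<kappa>)"
    unfolding ext_deriv_add[OF bihom_forms[OF \<iota>] bihom_forms[OF \<kappa>]]
      ext_deriv_split[OF \<iota>] ext_deriv_split[OF \<kappa>] ..
  also have "\<dots> = ?p (ext_deriv M r \<omega>)"
    unfolding \<iota>_def kappa_eq[OF \<omega>] proj_pullback_split[OF \<omega>, symmetric]
    by (rule proj_pullback_ext_deriv[OF bihom_forms[OF \<omega>]])
  also have "\<dots> = ?p ?h + ?p ?v"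
    unfolding ext_deriv_split[OF \<omega>] by (rule proj_pullback_add[OF bihom_forms[OF h] bihom_forms[OF v]])
  finally have E: "(?h\<iota> + ?v\<iota>) + (?h\<kappa> + ?v\<kappa>) = ?p ?h + ?p ?v" .
  \<comment> \<open>One equation for each bidegree; a piece outside its own bidegree drops out by
    \<open>component_other\<close>.\<close>
  have C: "component ?R i j ?h\<iota> + component ?R i j ?v\<iota> + (component ?R i j ?h\<kappa> + component ?R i j ?v\<kappa>) =
      component ?R i j (?p ?h) + component ?R i j (?p ?v)" for i j
    using arg_cong[OF E, of "component ?R i j"]
    by (simp only: component_add fb ph pv sum_forms)
  have ph0: "component ?R i j (?p ?h) = 0" if "(i, j) \<noteq> (p, q + 1)" "(i, j) \<noteq> (p - 1, q + 1 + 1)" for i j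
    using arg_cong[OF proj_pullback_split[OF h], of "component ?R i j"] that
      component_other[OF component_bihom[OF ph]]
    by (simp only: component_add component_forms ph) (metis add_0)
  have pv0: "component ?R i j (?p ?v) = 0" if "(i, j) \<noteq> (p + 1, q)" "(i, j) \<noteq> (p + 1 - 1, q + 1)" for i j
    using arg_cong[OF proj_pullback_split[OF v], of "component ?R i j"] that
      component_other[OF component_bihom[OF pv]]
    by (simp only: component_add component_forms pv) (metis add_0)
  \<comment> \<open>In bidegree \<open>(p - 1, q + 2)\<close> only \<open>D \<kappa>\<close>
    survives on the left, and on the right only the lowered part of
    \<open>p^* D \<omega>\<close>.\<close>
  have "component ?R (p - 1) (q + 1 + 1) (?p ?v) = 0" by (rule pv0) auto
  moreover have "component ?R (p - 1) (q + 1 + 1) ?h\<iota> = 0" "component ?R (p - 1) (q + 1 + 1) ?v\<iota> = 0"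
    "component ?R (p - 1) (q + 1 + 1) ?v\<kappa> = 0"
    by (rule component_other[OF b(1)] component_other[OF b(2)] component_other[OF b(4)]; simp)+
  ultimately have "component ?R (p - 1) (q + 1 + 1) ?h\<kappa> = component ?R (p - 1) (q + 1 + 1) (?p ?h)"
    using C[of "p - 1" "q + 1 + 1"] by (simp only: add_0 add_0_right)
  then show "?h\<kappa> = kappa M r p (q + 1) ?h" unfolding component_id[OF b(3)] kappa_eq[OF h] .
  \<comment> \<open>In bidegree \<open>(p, q + 1)\<close> the left keeps \<open>D \<iota>\<close>
    and \<open>\<delta> \<kappa>\<close>, the right the unchanged part of
    \<open>p^* D \<omega>\<close> and the lowered part of
    \<open>p^* \<delta> \<omega>\<close>.\<close>
  have "component ?R p (q + 1) ?v\<iota> = 0" "component ?R p (q + 1) ?h\<kappa> = 0"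
    by (rule component_other[OF b(2)] component_other[OF b(3)]; simp)+
  then have "?h\<iota> + ?v\<kappa> = component ?R p (q + 1) (?p ?h) + component ?R p (q + 1) (?p ?v)"
    using C[of p "q + 1"] component_id[OF b(1)] component_id[OF b(4)] by (simp only: add_0 add_0_right)
  moreover have "kappa M r (p + 1) q ?v = component ?R p (q + 1) (?p ?v)"
    using kappa_eq[OF v] by simp
  ultimately show "?h\<iota> + ?v\<kappa> = component ?R p (q + 1) (?p ?h) + kappa M r (p + 1) q ?v" by simp
qed

text \<open>For D-closed \<omega> the term \<open>\<iota> D\<close> drops out of
  \<open>vert_diff_kappa\<close>, and \<theta> is the part of \<open>p^* \<omega>\<close> with
  unchanged bidegree. So on D-cohomology \<kappa> commutes with the map induced by \<delta>.\<close>

lemma kappa_vert_diff: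
  assumes \<omega>: "\<omega> \<in> bihom M r p q" and h: "hor_diff M r \<omega> = 0"
  shows "\<exists>\<theta>\<in>bihom M (r + 1) p q.
    kappa M r (p + 1) q (vert_diff M r \<omega>) - vert_diff M (r + 1) (kappa M r p q \<omega>) = hor_diff M (r + 1) \<theta>"
proof
  let ?\<theta> = "component (r + 1) p q (proj_pullback M r \<omega>)"
  show "?\<theta> \<in> bihom M (r + 1) p q" by (intro component_bihom proj_pullback_forms bihom_forms[OF \<omega>])
  have "proj_pullback M r 0 = 0"
    by (rule forms_eqI[OF proj_pullback_forms[OF zero_in_forms] zero_in_forms])
      (simp only: proj_pullback_apply zero_in_forms zero_fun_apply, simp only: zero_fun_def)
  moreover have "component (r + 1) p (q + 1) 0 = 0"
    by (rule component_other[where p = p and q = q]) (simp_all add: bihom_eq cforms_zero)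
  ultimately have "hor_diff M (r + 1) ?\<theta> + vert_diff M (r + 1) (kappa M r p q \<omega>) = kappa M r (p + 1) q (vert_diff M r \<omega>)"
    using vert_diff_kappa[OF \<omega>] by (simp add: h)
  then show "kappa M r (p + 1) q (vert_diff M r \<omega>) - vert_diff M (r + 1) (kappa M r p q \<omega>) = hor_diff M (r + 1) ?\<theta>"
    by (simp add: algebra_simps)
qed

end

theorem proposition3p2:
  fixes M :: "'a mfd" and r :: nat
  assumes "smooth_manifold M"
  shows
    "(\<forall>k. proj_pullback M r \<in> cartan_filt M r k \<rightarrow> cartan_filt M (r + 1) (k - 1)) \<and>
     (\<forall>p q.
        E0_map M r p q \<in> E0 M r p q \<rightarrow> E0 M (r + 1) (p - 1) (q + 1) \<and>
        (\<forall>\<omega> \<in> cartan_filt_deg M r p (p + q).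
           E0_map M r p q (E0_class M r p q \<omega>) =
             E0_class M (r + 1) (p - 1) (q + 1) (proj_pullback M r \<omega>)) \<and>
        (\<forall>Z \<in> E0 M r p q.
           E0_diff M (r + 1) (p - 1) (q + 1) (E0_map M r p q Z) =
             E0_map M r p (q + 1) (E0_diff M r p q Z))) \<and>
     (\<forall>p q.
        kappa M r p q \<in> bihom M r p q \<rightarrow> bihom M (r + 1) (p - 1) (q + 1) \<and>
        (\<forall>\<omega> \<in> bihom M r p q.
           E0_class M (r + 1) (p - 1) (q + 1) (kappa M r p q \<omega>) =
             E0_map M r p q (E0_class M r p q \<omega>)) \<and>
        (\<forall>\<omega> \<in> bihom M r p q. \<forall>\<eta> \<in> bihom M r p q. \<forall>u v.
           kappa M r p q (lincomb u \<omega> v \<eta>) =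
             lincomb u (kappa M r p q \<omega>) v (kappa M r p q \<eta>)) \<and>
        (\<forall>\<omega> \<in> bihom M r p q.
           hor_diff M (r + 1) (kappa M r p q \<omega>) = kappa M r p (q + 1) (hor_diff M r \<omega>)) \<and>
        (\<forall>\<omega> \<in> bihom M r p q. hor_diff M r \<omega> = 0 \<longrightarrow>
           (\<exists>\<theta> \<in> bihom M (r + 1) p q.
              kappa M r (p + 1) q (vert_diff M r \<omega>) - vert_diff M (r + 1) (kappa M r p q \<omega>) =
                hor_diff M (r + 1) \<theta>)))"
proof -
  interpret jet_space M by unfold_locales (rule assms)
  have "E0_map M r p q Z \<in> E0 M (r + 1) (p - 1) (q + 1)" if "Z \<in> E0 M r p q" for p q Z
  proof -
    from that obtain \<omega> where \<omega>: "\<omega> \<in> cartan_filt_deg M r p (p + q)" and Z: "Z = E0_class M r p q \<omega>"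
      by (rule E0E)
    show ?thesis unfolding Z E0_map_class[OF \<omega>] by (rule E0_class_in_E0[OF proj_pullback_filt_deg'[OF \<omega>]])
  qed
  then show ?thesis
    by (intro conjI allI ballI impI Pi_I proj_pullback_filt E0_map_class E0_map_E0_diff kappa_bihom
        E0_class_kappa kappa_lincomb hor_diff_kappa kappa_vert_diff)
qed

end
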